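(* For every prime $p>2$ and every integer $g\ge1$, let $P(p,g)$ be the probability that, for $f(x)$ chosen uniformly at random from $\mathcal{H}_{2g+2}$, the group of $\mathbb{F}_p$-rational points of the Jacobian of the nonsingular complete model of the curve $y^2=f(x)$ over $\mathbb{F}_p$ is cyclic. Then $\lim_{p,g \rightarrow \infty} P(p,g) = 0$.
   Context: $\mathcal{H}_{2g+2}$ denotes the set of square-free polynomials $f(x)\in\mathbb{F}_p[x]$ of degree exactly $2g+2$. The limit is taken as both the prime $p$ and the genus $g$ tend to infinity. *)

theory Defs
  imports
    "HOL-Probability.Probability"
    "HOL-Number_Theory.Residues"
    "HOL-Algebra.Algebra"
begin

text \<open>
  Polynomials over a ring \<open>R\<close> are the lists of HOL-Algebra (leading coefficient first), i.e.
  elements of \<open>poly_ring R\<close>.  The carrier-based setting is forced by the limit over the prime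
  \<open>p\<close>: the base field varies inside the statement.
\<close>

section \<open>The field of fractions of a domain\<close>

definition fraction_rel :: "('a, 'b) ring_scheme \<Rightarrow> (('a \<times> 'a) \<times> ('a \<times> 'a)) set" where
  "fraction_rel R =
     {((a, b), (c, d)) | a b c d.
        a \<in> carrier R \<and> b \<in> carrier R - {\<zero>\<^bsub>R\<^esub>} \<and> c \<in> carrier R \<and> d \<in> carrier R - {\<zero>\<^bsub>R\<^esub>} \<and>
        a \<otimes>\<^bsub>R\<^esub> d = c \<otimes>\<^bsub>R\<^esub> b}"

definition fraction :: "('a, 'b) ring_scheme \<Rightarrow> 'a \<Rightarrow> 'a \<Rightarrow> ('a \<times> 'a) set" where
  "fraction R a b = fraction_rel R `` {(a, b)}"

definition fraction_field :: "('a, 'b) ring_scheme \<Rightarrow> ('a \<times> 'a) set ring" where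
  "fraction_field R =
     \<lparr>carrier = (carrier R \<times> (carrier R - {\<zero>\<^bsub>R\<^esub>})) // fraction_rel R,
      monoid.mult = (\<lambda>A B. \<Union>(a, b)\<in>A. \<Union>(c, d)\<in>B. fraction R (a \<otimes>\<^bsub>R\<^esub> c) (b \<otimes>\<^bsub>R\<^esub> d)),
      monoid.one = fraction R \<one>\<^bsub>R\<^esub> \<one>\<^bsub>R\<^esub>,
      ring.zero = fraction R \<zero>\<^bsub>R\<^esub> \<one>\<^bsub>R\<^esub>,
      ring.add = (\<lambda>A B. \<Union>(a, b)\<in>A. \<Union>(c, d)\<in>B.
               fraction R ((a \<otimes>\<^bsub>R\<^esub> d) \<oplus>\<^bsub>R\<^esub> (c \<otimes>\<^bsub>R\<^esub> b)) (b \<otimes>\<^bsub>R\<^esub> d))\<rparr>"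


section \<open>The function field of the curve $y^2 = f(x)$\<close>

text \<open>
  Over a field \<open>k\<close> the function field is $k(x)[Y]/(Y^2 - f)$.
\<close>

type_synonym 'a ratfun = "('a list \<times> 'a list) set"
type_synonym 'a funfield = "'a ratfun list set"

abbreviation ratfun_field :: "'a ring \<Rightarrow> 'a ratfun ring" where
  "ratfun_field k \<equiv> fraction_field (poly_ring k)"

definition ratfun_of_poly :: "'a ring \<Rightarrow> 'a list \<Rightarrow> 'a ratfun" where
  "ratfun_of_poly k h = fraction (poly_ring k) h \<one>\<^bsub>poly_ring k\<^esub>"

definition curve_poly :: "'a ring \<Rightarrow> 'a list \<Rightarrow> 'a ratfun list" where
  "curve_poly k f =
     [\<one>\<^bsub>ratfun_field k\<^esub>, \<zero>\<^bsub>ratfun_field k\<^esub>, \<ominus>\<^bsub>ratfun_field k\<^esub> (ratfun_of_poly k f)]"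

definition function_field :: "'a ring \<Rightarrow> 'a list \<Rightarrow> 'a funfield ring" where
  "function_field k f =
     Rupt\<^bsub>ratfun_field k\<^esub> (carrier (ratfun_field k)) (curve_poly k f)"

definition ff_class :: "'a ring \<Rightarrow> 'a list \<Rightarrow> 'a ratfun list \<Rightarrow> 'a funfield" where
  "ff_class k f q =
     ring.rupture_surj (ratfun_field k) (carrier (ratfun_field k)) (curve_poly k f) q"

definition ff_of_poly :: "'a ring \<Rightarrow> 'a list \<Rightarrow> 'a list \<Rightarrow> 'a funfield" where
  "ff_of_poly k f h = ff_class k f (ring.poly_of_const (ratfun_field k) (ratfun_of_poly k h))"

definition ff_const :: "'a ring \<Rightarrow> 'a list \<Rightarrow> 'a \<Rightarrow> 'a funfield" where
  "ff_const k f c = ff_of_poly k f (ring.poly_of_const k c)"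

definition ff_x :: "'a ring \<Rightarrow> 'a list \<Rightarrow> 'a funfield" where
  "ff_x k f = ff_of_poly k f X\<^bsub>k\<^esub>"

definition ff_y :: "'a ring \<Rightarrow> 'a list \<Rightarrow> 'a funfield" where
  "ff_y k f = ff_class k f X\<^bsub>ratfun_field k\<^esub>"


section \<open>Points of the nonsingular complete model and the Picard group\<close>

text \<open>
  The closed points of the nonsingular complete model of a function field \<open>K\<close> over \<open>k\<close> are
  the normalized discrete valuations of \<open>K\<close> that are trivial on \<open>k\<close>; the valuation at a point
  is the order of vanishing there.  Valuations are integer-valued functions on the nonzero
  elements only (\<open>extensional\<close> makes each of them a unique HOL function).
\<close>

definition nonzero :: "('a, 'b) ring_scheme \<Rightarrow> 'a set" where
  "nonzero K = carrier K - {\<zero>\<^bsub>K\<^esub>}"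

definition discrete_valuations :: "('a, 'b) ring_scheme \<Rightarrow> 'a set \<Rightarrow> ('a \<Rightarrow> int) set" where
  "discrete_valuations K C =
     {v \<in> extensional (nonzero K).
        (\<forall>a\<in>nonzero K. \<forall>b\<in>nonzero K. v (a \<otimes>\<^bsub>K\<^esub> b) = v a + v b) \<and>
        (\<forall>a\<in>nonzero K. \<forall>b\<in>nonzero K. a \<oplus>\<^bsub>K\<^esub> b \<noteq> \<zero>\<^bsub>K\<^esub> \<longrightarrow> min (v a) (v b) \<le> v (a \<oplus>\<^bsub>K\<^esub> b)) \<and>
        (\<forall>c\<in>C - {\<zero>\<^bsub>K\<^esub>}. v c = 0) \<and>
        v ` nonzero K = UNIV}"

definition points :: "'a ring \<Rightarrow> 'a list \<Rightarrow> ('a funfield \<Rightarrow> int) set" where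
  "points k f = discrete_valuations (function_field k f) (ff_const k f ` carrier k)"

type_synonym 'a divisor = "('a funfield \<Rightarrow> int) \<Rightarrow>\<^sub>0 int"

definition divisor_group :: "'a ring \<Rightarrow> 'a list \<Rightarrow> 'a divisor monoid" where
  "divisor_group k f = free_Abelian_group (points k f)"

text \<open>
  Used only for algebraically closed \<open>k\<close>, where all points have degree one.
\<close>

definition divisor_degree :: "'a divisor \<Rightarrow> int" where
  "divisor_degree D = (\<Sum>v\<in>Poly_Mapping.keys D. Poly_Mapping.lookup D v)"

definition principal_divisors :: "'a ring \<Rightarrow> 'a list \<Rightarrow> 'a divisor set" where
  "principal_divisors k f =
     {D \<in> carrier (divisor_group k f).
        \<exists>\<phi>\<in>nonzero (function_field k f). \<forall>v\<in>points k f. Poly_Mapping.lookup D v = v \<phi>}"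

definition picard_group :: "'a ring \<Rightarrow> 'a list \<Rightarrow> 'a divisor set monoid" where
  "picard_group k f = divisor_group k f Mod principal_divisors k f"


section \<open>Rational points of the Jacobian\<close>

text \<open>
  For \<open>k\<close> algebraically closed and \<open>F\<close> a perfect subfield containing the coefficients of \<open>f\<close>,
  each element of $\mathrm{Gal}(k/F)$ extends to an automorphism of the function field over \<open>k\<close>
  fixing $x$ and $y$.
\<close>

definition galois_action :: "'a ring \<Rightarrow> 'a set \<Rightarrow> 'a list \<Rightarrow> ('a funfield \<Rightarrow> 'a funfield) set" where
  "galois_action k F f =
     {\<tau> \<in> ring_iso (function_field k f) (function_field k f).
        \<tau> (ff_x k f) = ff_x k f \<and> \<tau> (ff_y k f) = ff_y k f \<and>
        (\<exists>\<sigma>\<in>ring_iso k k. (\<forall>c\<in>F. \<sigma> c = c) \<and>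
           (\<forall>c\<in>carrier k. \<tau> (ff_const k f c) = ff_const k f (\<sigma> c)))}"

text \<open>
  This is the action of the inverse of \<open>\<tau>\<close> on divisors; as \<open>\<tau>\<close> ranges over a group, the invariant
  classes are the same.
\<close>

definition divisor_pullback ::
  "'a ring \<Rightarrow> 'a list \<Rightarrow> ('a funfield \<Rightarrow> 'a funfield) \<Rightarrow> 'a divisor \<Rightarrow> 'a divisor" where
  "divisor_pullback k f \<tau> D =
     frag_extend (\<lambda>v. frag_of (restrict (v \<circ> \<tau>) (nonzero (function_field k f)))) D"

text \<open>
  The points of the Jacobian over \<open>k\<close> are the divisor classes of degree zero, and its
  \<open>F\<close>-rational points are those fixed by $\mathrm{Gal}(k/F)$.
\<close>

definition jacobian_points :: "'a ring \<Rightarrow> 'a set \<Rightarrow> 'a list \<Rightarrow> 'a divisor set monoid" where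
  "jacobian_points k F f =
     (picard_group k f)
       \<lparr>carrier :=
          {c \<in> carrier (picard_group k f).
             (\<exists>D\<in>c. divisor_degree D = 0) \<and>
             (\<forall>\<tau>\<in>galois_action k F f. divisor_pullback k f \<tau> ` c = c)}\<rparr>"


section \<open>The random curve over a prime field\<close>

abbreviation prime_field :: "nat \<Rightarrow> int ring" where
  "prime_field p \<equiv> residue_ring (int p)"

text \<open>
  HOL-Algebra's algebraic closure contains a copy of the base field, embedded by \<open>indexed_const\<close>.
\<close>

definition jacobian_Fp :: "nat \<Rightarrow> int list \<Rightarrow> ((int list \<times> nat) multiset \<Rightarrow> int) divisor set monoid" where
  "jacobian_Fp p f =
     jacobian_points (field.alg_closure (prime_field p))
       (ring.indexed_const (prime_field p) ` carrier (prime_field p))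
       (map (ring.indexed_const (prime_field p)) f)"

definition squarefree_polys :: "nat \<Rightarrow> nat \<Rightarrow> int list set" where
  "squarefree_polys p d =
     {f \<in> carrier (poly_ring (prime_field p)).
        f \<noteq> \<zero>\<^bsub>poly_ring (prime_field p)\<^esub> \<and> Polynomials.degree f = d \<and>
        (\<forall>h\<in>carrier (poly_ring (prime_field p)).
           (h \<otimes>\<^bsub>poly_ring (prime_field p)\<^esub> h) pdivides\<^bsub>prime_field p\<^esub> f \<longrightarrow>
           h \<in> Units (poly_ring (prime_field p)))}"

definition cyclic_probability :: "nat \<Rightarrow> nat \<Rightarrow> real" where
  "cyclic_probability p g =
     measure_pmf.prob (pmf_of_set (squarefree_polys p (2 * g + 2)))
       {f. cyclic_group (jacobian_Fp p f)}"

end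

theory Submission
  imports Defs
begin

text \<open>
  Let \<open>f\<close> be squarefree of even degree. A factor \<open>h\<close> of \<open>f\<close> of even degree
  gives a divisor class of degree zero, namely half of the divisor of \<open>h(x)\<close>, which is rational and
  killed by \<open>2\<close>; it is trivial only if \<open>h\<close> or \<open>f/h\<close> is constant, and two
  factors \<open>h1\<close>, \<open>h2\<close> give the same class only if \<open>h1\<close> is, up to constants,
  \<open>h2\<close> or \<open>f/h2\<close>. Indeed, if \<open>h1(x)/h2(x)\<close> has the divisor of a square
  \<open>\<phi>^2\<close>, then \<open>\<phi>^2\<close> is a constant multiple of it and \<open>\<phi>\<close> is a
  rational function of \<open>x\<close>, or such a function times \<open>y\<close>. If \<open>f\<close> is a product
  of four nonconstant factors, then two of them have even degree, or all four have odd degree and pairwise products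
  serve as \<open>h1\<close> and \<open>h2\<close>. So there are two different elements of order two, and the rational
  points do not form a cyclic group.

  On the other hand there are at most \<open>q^n/n\<close> monic irreducible polynomials of degree \<open>n\<close>
  over the field with \<open>q\<close> elements, so the proportion of polynomials of degree \<open>d\<close> with a
  fixed number \<open>r\<close> of irreducible factors is bounded by a sequence independent of \<open>q\<close> that
  tends to zero: factoring out an irreducible factor of maximal degree, which is at least \<open>d/r\<close>, bounds
  the proportion for \<open>r\<close> by \<open>r\<close> times the Cesaro mean of the bounds for
  \<open>r - 1\<close>. As at least the proportion \<open>1/2\<close> of polynomials is squarefree, the probability in question
  tends to zero, even uniformly in \<open>p\<close>.
\<close>

section \<open>Discrete valuations of a field over a subfield\<close>

text \<open>The points of the curve are, by definition, all discrete valuations trivial on the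
  constants. So valuations must be built at prescribed points, and every other valuation must be
  shown to have order zero at the functions in question. Both rest on uniformizers:
  \<open>x - a\<close> at a point with \<open>y\<close> nonzero, \<open>y\<close> over a root of
  \<open>f\<close>, and \<open>1/x\<close> at infinity, where the coordinates \<open>1/x\<close> and
  \<open>y/x^(g+1)\<close> give a curve of the same shape. Even degree of \<open>h\<close> matters
  because \<open>h(x)\<close> has order \<open>- degree h\<close> at each of the two points at
  infinity. Three factors would not suffice: for degrees odd, odd and even, the only nontrivial
  class of this kind is that of the even factor. A divisor whose double is the divisor of
  \<open>h(x)\<close> is determined by \<open>h\<close>, so every automorphism fixing
  \<open>x\<close> and the coefficients of \<open>h\<close> fixes it; this is the rationality. That
  the roots of \<open>f\<close> in the closure are simple comes from \<open>X^(q^n) - X\<close>,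
  which has simple roots and is divisible by every irreducible polynomial of degree
  \<open>n\<close>; the same polynomial gives the bound \<open>q^n/n\<close>.\<close>

lemma (in field) nonzero_iff: "a \<in> nonzero R \<longleftrightarrow> a \<in> carrier R \<and> a \<noteq> \<zero>"
  by (auto simp: nonzero_def)

lemma (in field) nonzero_mult: "a \<in> nonzero R \<Longrightarrow> b \<in> nonzero R \<Longrightarrow> a \<otimes> b \<in> nonzero R"
  by (auto simp: nonzero_def integral_iff)

lemma (in field) nonzero_one: "\<one> \<in> nonzero R"
  by (auto simp: nonzero_def)

lemma (in field) nonzero_pow: "a \<in> nonzero R \<Longrightarrow> a [^] (n::nat) \<in> nonzero R"
  by (induction n) (auto simp: nonzero_one nonzero_mult)

lemma (in field) nonzero_inv:
  assumes "a \<in> nonzero R" shows "inv a \<in> nonzero R" "a \<otimes> inv a = \<one>" "inv a \<otimes> a = \<one>"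
proof -
  have u: "a \<in> Units R" using assms field_Units by (auto simp: nonzero_def)
  show 1: "a \<otimes> inv a = \<one>" "inv a \<otimes> a = \<one>" using u by auto
  have "inv a \<noteq> \<zero>" using 1(1) assms by (metis DiffD1 nonzero_def r_null zero_not_one)
  then show "inv a \<in> nonzero R" using u by (auto simp: nonzero_def)
qed

text \<open>The constants are a subset of \<open>K\<close> and not a separate field, so that one
  polynomial over \<open>C\<close> can be evaluated both at constants and at functions.\<close>

locale field_over = field K for K :: "('a, 'b) ring_scheme" (structure) +
  fixes C :: "'a set"
  assumes subfield_C: "subfield C K"
begin

abbreviation "\<V> \<equiv> discrete_valuations K C"

lemma C_closed: "c \<in> C \<Longrightarrow> c \<in> carrier K"
  using subfieldE(3)[OF subfield_C] by auto

lemma subring_C: "subring C K"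
  using subfieldE(1)[OF subfield_C] .

lemma C_ops:
  "\<zero> \<in> C" "\<one> \<in> C"
  "a \<in> C \<Longrightarrow> b \<in> C \<Longrightarrow> a \<oplus> b \<in> C"
  "a \<in> C \<Longrightarrow> b \<in> C \<Longrightarrow> a \<otimes> b \<in> C"
  "a \<in> C \<Longrightarrow> b \<in> C \<Longrightarrow> a \<ominus> b \<in> C"
  "a \<in> C \<Longrightarrow> \<ominus> a \<in> C"
  unfolding a_minus_def by (intro subringE(2,3,5,6,7)[OF subring_C]; assumption)+

lemma C_inv: "a \<in> C \<Longrightarrow> a \<noteq> \<zero> \<Longrightarrow> inv a \<in> C"
  using subfield_m_inv(1)[OF subfield_C, of a] by auto

text \<open>Valuations say nothing about \<open>\<zero>\<close>, whose order ought to be infinite;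
  this predicate and the next admit it explicitly. They describe the valuation ring and its maximal
  ideal.\<close>

definition regular_at :: "('a \<Rightarrow> int) \<Rightarrow> 'a \<Rightarrow> bool" where
  "regular_at v z \<longleftrightarrow> z \<in> carrier K \<and> (z \<noteq> \<zero> \<longrightarrow> 0 \<le> v z)"

definition vanishes_at :: "('a \<Rightarrow> int) \<Rightarrow> 'a \<Rightarrow> bool" where
  "vanishes_at v z \<longleftrightarrow> z \<in> carrier K \<and> (z \<noteq> \<zero> \<longrightarrow> 0 < v z)"

lemma regular_closed: "regular_at v z \<Longrightarrow> z \<in> carrier K"
  and vanishes_closed: "vanishes_at v z \<Longrightarrow> z \<in> carrier K"
  and vanishes_regular: "vanishes_at v z \<Longrightarrow> regular_at v z"
  by (simp_all add: regular_at_def vanishes_at_def order_less_imp_le)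

context
  fixes v assumes v: "v \<in> \<V>"
begin

lemma val_mult: "a \<in> nonzero K \<Longrightarrow> b \<in> nonzero K \<Longrightarrow> v (a \<otimes> b) = v a + v b"
  using v unfolding discrete_valuations_def by blast

lemma val_add: "a \<in> nonzero K \<Longrightarrow> b \<in> nonzero K \<Longrightarrow> a \<oplus> b \<noteq> \<zero> \<Longrightarrow> min (v a) (v b) \<le> v (a \<oplus> b)"
  using v unfolding discrete_valuations_def by blast

lemma val_const: "c \<in> C \<Longrightarrow> c \<noteq> \<zero> \<Longrightarrow> v c = 0"
  using v unfolding discrete_valuations_def by blast

lemma val_surj: "\<exists>z\<in>nonzero K. v z = k"
proof -
  have "v ` nonzero K = UNIV" using v unfolding discrete_valuations_def by blast
  then show ?thesis by (metis imageE UNIV_I)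
qed

lemma val_one: "v \<one> = 0"
  using val_const[of \<one>] C_ops by auto

lemma val_neg: "a \<in> nonzero K \<Longrightarrow> v (\<ominus> a) = v a"
proof -
  assume a: "a \<in> nonzero K"
  have "\<ominus> a = (\<ominus> \<one>) \<otimes> a" using a by (simp add: nonzero_iff l_minus)
  moreover have "\<ominus> \<one> \<in> nonzero K" using C_ops by (auto simp: nonzero_iff)
  moreover have "v (\<ominus> \<one>) = 0" using val_const[of "\<ominus> \<one>"] C_ops by auto
  ultimately show ?thesis using val_mult a by auto
qed

lemma val_pow: "a \<in> nonzero K \<Longrightarrow> v (a [^] (n::nat)) = int n * v a"
  by (induction n) (auto simp: val_one val_mult nonzero_pow algebra_simps)

lemma val_inv: "a \<in> nonzero K \<Longrightarrow> v (inv a) = - v a"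
  using val_mult[of a "inv a"] nonzero_inv[of a] val_one by auto

lemma regular_add:
  assumes "regular_at v a" "regular_at v b" shows "regular_at v (a \<oplus> b)"
proof (cases "a = \<zero> \<or> b = \<zero>")
  case True
  then show ?thesis
    using assms regular_closed[OF assms(1)] regular_closed[OF assms(2)] by (elim disjE) simp_all
next
  case False
  then have "a \<in> nonzero K" "b \<in> nonzero K" "0 \<le> v a" "0 \<le> v b"
    using assms by (simp_all add: regular_at_def nonzero_iff)
  then show ?thesis using val_add[of a b] unfolding regular_at_def nonzero_iff by fastforce
qed

lemma vanishes_add:
  assumes "vanishes_at v a" "vanishes_at v b" shows "vanishes_at v (a \<oplus> b)"
proof (cases "a = \<zero> \<or> b = \<zero>")
  case True
  then show ?thesis
    using assms vanishes_closed[OF assms(1)] vanishes_closed[OF assms(2)] by (elim disjE) simp_all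
next
  case False
  then have "a \<in> nonzero K" "b \<in> nonzero K" "0 < v a" "0 < v b"
    using assms by (simp_all add: vanishes_at_def nonzero_iff)
  then show ?thesis using val_add[of a b] unfolding vanishes_at_def nonzero_iff by fastforce
qed

lemma regular_mult: "regular_at v a \<Longrightarrow> regular_at v b \<Longrightarrow> regular_at v (a \<otimes> b)"
  using val_mult[of a b] by (cases "a = \<zero>"; cases "b = \<zero>") (simp_all add: regular_at_def nonzero_iff)

lemma vanishes_mult: "vanishes_at v a \<Longrightarrow> regular_at v b \<Longrightarrow> vanishes_at v (a \<otimes> b)"
  using val_mult[of a b] by (cases "a = \<zero>"; cases "b = \<zero>") (simp_all add: regular_at_def vanishes_at_def nonzero_iff)

lemma vanishes_neg: "vanishes_at v a \<Longrightarrow> vanishes_at v (\<ominus> a)"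
  using val_neg[of a] by (cases "a = \<zero>") (auto simp: vanishes_at_def nonzero_iff)

lemma regular_neg: "regular_at v a \<Longrightarrow> regular_at v (\<ominus> a)"
  using val_neg[of a] by (cases "a = \<zero>") (auto simp: regular_at_def nonzero_iff)

lemma regular_const: "c \<in> C \<Longrightarrow> regular_at v c"
  using val_const C_closed by (auto simp: regular_at_def)

lemma const_vanishes: "c \<in> C \<Longrightarrow> vanishes_at v c \<Longrightarrow> c = \<zero>"
  using val_const by (auto simp: vanishes_at_def)

text \<open>A positive sum of two integers has a positive summand, so the rule applies to factors
  with poles as well.\<close>

lemma vanishes_mult_cases:
  assumes "a \<in> carrier K" "b \<in> carrier K" "vanishes_at v (a \<otimes> b)"
  shows "vanishes_at v a \<or> vanishes_at v b"
  using assms val_mult[of a b] by (auto simp: vanishes_at_def nonzero_iff integral_iff)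

text \<open>Were \<open>c \<oplus> m\<close> to vanish, so would \<open>c\<close>, the difference of
  \<open>c \<oplus> m\<close> and \<open>m\<close>; but a nonzero constant has order zero. Orders at
  a point can thus be read off from values there.\<close>

lemma val_unit_plus_vanishing:
  assumes "c \<in> C" "c \<noteq> \<zero>" "vanishes_at v m"
  shows "c \<oplus> m \<in> nonzero K" "v (c \<oplus> m) = 0"
proof -
  have c: "c \<in> carrier K" and m: "m \<in> carrier K" using assms C_closed vanishes_closed by auto
  have e: "(c \<oplus> m) \<oplus> (\<ominus> m) = c" using c m by algebra
  have ne: "\<not> vanishes_at v (c \<oplus> m)"
    using vanishes_add[OF _ vanishes_neg[OF assms(3)], of "c \<oplus> m"] e const_vanishes assms by metis
  then show nz: "c \<oplus> m \<in> nonzero K" using c m by (auto simp: vanishes_at_def nonzero_iff)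
  have "regular_at v (c \<oplus> m)"
    using regular_add regular_const vanishes_regular assms by auto
  then show "v (c \<oplus> m) = 0" using ne nz c m unfolding regular_at_def vanishes_at_def nonzero_iff by auto
qed

end

lemma valuation_eqI:
  assumes "v \<in> \<V>" "w \<in> \<V>" "\<And>z. z \<in> nonzero K \<Longrightarrow> v z = w z"
  shows "v = w"
  using assms unfolding discrete_valuations_def by (auto intro!: extensionalityI)

end

section \<open>Construction of a valuation from a uniformizer\<close>

text \<open>
  \<open>U \<union> M\<close> is a subring of functions regular at a point and \<open>M\<close> its prime ideal of functions
  vanishing there.  If every nonzero element of the field is, up to elements of \<open>U\<close>, an integer
  power of \<open>\<pi>\<close>, then there is exactly one valuation that vanishes on \<open>U\<close> and is positive at \<open>\<pi>\<close>.
\<close>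

locale uniformized = field_over +
  fixes U M :: "'a set" and \<pi> :: 'a
  assumes U_M: "U \<inter> M = {}" "U \<union> M \<subseteq> carrier K"
    and U_mult: "\<And>a b. a \<in> U \<Longrightarrow> b \<in> U \<Longrightarrow> a \<otimes> b \<in> U"
    and M_mult: "\<And>a b. a \<in> M \<Longrightarrow> b \<in> U \<union> M \<Longrightarrow> a \<otimes> b \<in> M"
    and A_add: "\<And>a b. a \<in> U \<union> M \<Longrightarrow> b \<in> U \<union> M \<Longrightarrow> a \<oplus> b \<in> U \<union> M"
    and U_M_add: "\<And>a b. a \<in> U \<Longrightarrow> b \<in> M \<Longrightarrow> a \<oplus> b \<in> U"
    and zero_M: "\<zero> \<in> M"
    and C_U: "C - {\<zero>} \<subseteq> U"
    and pi_M: "\<pi> \<in> M" and pi_nonzero: "\<pi> \<noteq> \<zero>"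
begin

text \<open>This says that \<open>z\<close> is a unit times \<open>\<pi>^k\<close>, with
  denominators cleared: \<open>k\<close> may be negative and the inverse of an element of
  \<open>U\<close> need not lie in \<open>U\<close>, so units and powers of \<open>\<pi>\<close>
  occur on both sides.\<close>

definition has_val :: "'a \<Rightarrow> int \<Rightarrow> bool" where
  "has_val z k \<longleftrightarrow> z \<in> nonzero K \<and>
     (\<exists>m n s t. s \<in> U \<and> t \<in> U \<and> s \<otimes> z \<otimes> \<pi> [^] (m::nat) = t \<otimes> \<pi> [^] (n::nat) \<and> k = int n - int m)"

lemma U_nonzero: "u \<in> U \<Longrightarrow> u \<in> nonzero K"
  using U_M zero_M by (auto simp: nonzero_iff)

lemma pi_nz: "\<pi> \<in> nonzero K"
  using U_M pi_M pi_nonzero by (auto simp: nonzero_iff)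

lemma one_U: "\<one> \<in> U"
  using C_U C_ops(2) by auto

lemma pi_pow_M: "n > 0 \<Longrightarrow> \<pi> [^] (n::nat) \<in> M"
proof (induction n)
  case (Suc n)
  show ?case
  proof (cases "n = 0")
    case True then show ?thesis using pi_M U_M by (auto)
  next
    case False
    then show ?thesis using Suc M_mult[of "\<pi> [^] n" \<pi>] pi_M by auto
  qed
qed simp

lemma has_valE:
  assumes "has_val z k"
  obtains m n s t where "z \<in> nonzero K" "s \<in> U" "t \<in> U"
    "s \<otimes> z \<otimes> \<pi> [^] (m::nat) = t \<otimes> \<pi> [^] (n::nat)" "k = int n - int m"
  using assms unfolding has_val_def by auto

lemma has_val_U: "u \<in> U \<Longrightarrow> has_val u 0"
  unfolding has_val_def using U_nonzero[of u] one_U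
  by (intro conjI exI[of _ 0] exI[of _ \<one>] exI[of _ u]) (auto simp: nonzero_iff)

lemma has_val_pi: "has_val \<pi> 1"
  unfolding has_val_def using pi_nz one_U
  by (intro conjI exI[of _ 0] exI[of _ 1] exI[of _ \<one>] exI[of _ \<one>]) (auto simp: nonzero_iff)

lemma has_val_mult:
  assumes "has_val a k" "has_val b l"
  shows "has_val (a \<otimes> b) (k + l)"
proof -
  obtain m n s t where 1: "a \<in> nonzero K" "s \<in> U" "t \<in> U"
    "s \<otimes> a \<otimes> \<pi> [^] (m::nat) = t \<otimes> \<pi> [^] (n::nat)" "k = int n - int m"
    by (rule has_valE[OF assms(1)])
  obtain m' n' s' t' where 2: "b \<in> nonzero K" "s' \<in> U" "t' \<in> U"
    "s' \<otimes> b \<otimes> \<pi> [^] (m'::nat) = t' \<otimes> \<pi> [^] (n'::nat)" "l = int n' - int m'"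
    by (rule has_valE[OF assms(2)])
  note nz = 1(1-3) 2(1-3) pi_nz
  have cl: "a \<in> carrier K" "b \<in> carrier K" "s \<in> carrier K" "t \<in> carrier K" "s' \<in> carrier K" "t' \<in> carrier K"
    "\<pi> \<in> carrier K" using nz U_nonzero by (auto simp: nonzero_iff)
  have "(s \<otimes> s') \<otimes> (a \<otimes> b) \<otimes> \<pi> [^] (m + m') = (s \<otimes> a \<otimes> \<pi> [^] m) \<otimes> (s' \<otimes> b \<otimes> \<pi> [^] m')"
    using cl by (simp add: nat_pow_mult[symmetric] m_ac)
  also have "\<dots> = (t \<otimes> t') \<otimes> \<pi> [^] (n + n')"
    unfolding 1(4) 2(4) using cl by (simp add: nat_pow_mult[symmetric] m_ac)
  finally show ?thesis
    unfolding has_val_def using nz U_mult 1(5) 2(5)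
    by (intro conjI exI[of _ "m + m'"] exI[of _ "n + n'"] exI[of _ "s \<otimes> s'"] exI[of _ "t \<otimes> t'"])
       (auto simp: nonzero_mult)
qed

lemma has_val_pow: "has_val a k \<Longrightarrow> has_val (a [^] (n::nat)) (int n * k)"
  by (induction n) (auto simp: has_val_U one_U algebra_simps dest: has_val_mult)

lemma has_val_inv:
  assumes "has_val a k"
  shows "has_val (inv a) (- k)"
proof -
  obtain m n s t where 1: "a \<in> nonzero K" "s \<in> U" "t \<in> U"
    "s \<otimes> a \<otimes> \<pi> [^] (m::nat) = t \<otimes> \<pi> [^] (n::nat)" "k = int n - int m"
    by (rule has_valE[OF assms(1)])
  have cl: "a \<in> carrier K" "s \<in> carrier K" "t \<in> carrier K" "\<pi> \<in> carrier K" "inv a \<in> carrier K" "inv a \<otimes> a = \<one>"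
    using 1 U_nonzero pi_nz nonzero_inv[of a] by (auto simp: nonzero_iff)
  have "t \<otimes> inv a \<otimes> \<pi> [^] n = inv a \<otimes> (t \<otimes> \<pi> [^] n)" using cl by (simp add: m_ac)
  also have "\<dots> = inv a \<otimes> (s \<otimes> a \<otimes> \<pi> [^] m)" by (simp add: 1)
  also have "\<dots> = (inv a \<otimes> a) \<otimes> (s \<otimes> \<pi> [^] m)" using cl(1-5) by (simp add: m_ac)
  also have "\<dots> = s \<otimes> \<pi> [^] m" using cl by simp
  finally show ?thesis
    unfolding has_val_def using 1 nonzero_inv[of a]
    by (intro conjI exI[of _ n] exI[of _ m] exI[of _ t] exI[of _ s]) auto
qed

text \<open>If \<open>k\<close> were too small, cancelling \<open>\<pi> [^] n\<close> would express
  the element \<open>t\<close> of \<open>U\<close> as a product with a factor in \<open>M\<close>,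
  against the disjointness of \<open>U\<close> and \<open>M\<close>.\<close>

lemma has_val_regular:
  assumes "has_val a k" "a \<in> U \<union> M"
  shows "k \<ge> 0" and "a \<in> M \<Longrightarrow> k > 0"
proof -
  obtain m n s t where 1: "a \<in> nonzero K" "s \<in> U" "t \<in> U"
    "s \<otimes> a \<otimes> \<pi> [^] (m::nat) = t \<otimes> \<pi> [^] (n::nat)" "k = int n - int m"
    by (rule has_valE[OF assms(1)])
  have cl: "a \<in> carrier K" "s \<in> carrier K" "t \<in> carrier K" "\<pi> \<in> carrier K" "\<pi> [^] n \<in> nonzero K"
    using 1 U_nonzero pi_nz nonzero_pow[of \<pi> n] by (auto simp: nonzero_iff)
  have sa: "s \<otimes> a \<in> U \<union> M"
    using assms(2) 1(2) U_mult M_mult[of a s] m_comm[of a s] cl by auto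
  have *: "s \<otimes> a \<otimes> \<pi> [^] (m - n) = t" if "n \<le> m"
  proof -
    have "\<pi> [^] m = \<pi> [^] (m - n) \<otimes> \<pi> [^] n" using that cl by (simp add: nat_pow_mult)
    then have "(s \<otimes> a \<otimes> \<pi> [^] (m - n)) \<otimes> \<pi> [^] n = t \<otimes> \<pi> [^] n"
      using 1(4) cl by (simp add: m_assoc)
    then show ?thesis using cl m_rcancel[of "\<pi> [^] n"] by (auto simp: nonzero_iff)
  qed
  show "k \<ge> 0"
  proof (rule ccontr)
    assume "\<not> k \<ge> 0"
    then have "n < m" using 1 by auto
    then have "\<pi> [^] (m - n) \<otimes> (s \<otimes> a) \<in> M" using pi_pow_M[of "m - n"] M_mult sa by auto
    then have "t \<in> M" using * \<open>n < m\<close> cl by (simp add: m_ac)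
    then show False using 1 U_M by auto
  qed
  show "k > 0" if "a \<in> M"
  proof (rule ccontr)
    assume "\<not> k > 0"
    then have "n \<le> m" using 1 by auto
    have "\<pi> [^] (m - n) \<in> U \<union> M" using pi_pow_M[of "m - n"] one_U by (cases "m - n = 0") auto
    moreover have "s \<otimes> a \<in> M" using that 1(2) M_mult[of a s] m_comm[of a s] cl by auto
    ultimately have "t \<in> M" using * \<open>n \<le> m\<close> M_mult by metis
    then show False using 1 U_M by auto
  qed
qed

text \<open>The element \<open>\<one>\<close> would have the values \<open>k - l\<close> and
  \<open>l - k\<close>, and both are nonnegative because \<open>\<one>\<close> lies in
  \<open>U\<close>.\<close>

lemma has_val_unique:
  assumes "has_val a k" "has_val a l" shows "k = l"
proof -
  have e: "a \<otimes> inv a = \<one>" using assms nonzero_inv[of a] by (simp add: has_val_def)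
  have 1: "has_val \<one> (k + - l)" using has_val_mult[OF assms(1) has_val_inv[OF assms(2)]] e by simp
  have 2: "has_val \<one> (l + - k)" using has_val_mult[OF assms(2) has_val_inv[OF assms(1)]] e by simp
  show ?thesis using has_val_regular(1)[OF 1] has_val_regular(1)[OF 2] one_U by simp
qed

text \<open>The shared computation behind the two rules for sums: over a common denominator the
  smaller power of \<open>\<pi>\<close> is taken out, and what remains is regular, even a unit if
  the two orders differ.\<close>

lemma has_val_le:
  assumes a: "has_val a k" and b: "has_val b l" and kl: "k \<le> l"
  obtains s r m n where "s \<in> U" "r \<in> U \<union> M" "s \<otimes> (a \<oplus> b) \<otimes> \<pi> [^] (m::nat) = r \<otimes> \<pi> [^] (n::nat)"
    "k = int n - int m" "k < l \<Longrightarrow> r \<in> U"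
proof -
  obtain m n s t where 1: "a \<in> nonzero K" "s \<in> U" "t \<in> U"
    "s \<otimes> a \<otimes> \<pi> [^] (m::nat) = t \<otimes> \<pi> [^] (n::nat)" "k = int n - int m"
    by (rule has_valE[OF a])
  obtain m' n' s' t' where 2: "b \<in> nonzero K" "s' \<in> U" "t' \<in> U"
    "s' \<otimes> b \<otimes> \<pi> [^] (m'::nat) = t' \<otimes> \<pi> [^] (n'::nat)" "l = int n' - int m'"
    by (rule has_valE[OF b])
  have cl: "a \<in> carrier K" "b \<in> carrier K" "s \<in> carrier K" "t \<in> carrier K" "s' \<in> carrier K" "t' \<in> carrier K"
    "\<pi> \<in> carrier K" using 1(1-3) 2(1-3) pi_nz U_nonzero by (auto simp: nonzero_iff)
  \<comment> \<open>After cross-multiplication the two summands carry \<open>\<pi>\<close> to the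
    powers \<open>n + m'\<close> and \<open>n' + m\<close>, whose difference is
    \<open>j\<close>.\<close>
  define j where "j = nat (l - k)"
  have j: "n' + m = n + m' + j" using 1 2 kl unfolding j_def by auto
  define r where "r = s' \<otimes> t \<oplus> s \<otimes> t' \<otimes> \<pi> [^] j"
  have piM: "\<pi> [^] j \<in> U \<union> M" using pi_pow_M[of j] one_U by (cases "j = 0") auto
  have comm: "s \<otimes> t' \<otimes> \<pi> [^] j = \<pi> [^] j \<otimes> (s \<otimes> t')" using cl by (simp add: m_ac)
  have pM: "s \<otimes> t' \<otimes> \<pi> [^] j \<in> U \<union> M"
    using piM comm M_mult[of "\<pi> [^] j" "s \<otimes> t'"] U_mult 1 2 by (metis Un_iff)
  then have r1: "r \<in> U \<union> M" unfolding r_def using A_add U_mult 1 2 by auto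
  have r2: "r \<in> U" if "k < l"
  proof -
    have "j > 0" using that unfolding j_def by auto
    then have "s \<otimes> t' \<otimes> \<pi> [^] j \<in> M" using pi_pow_M[of j] comm M_mult U_mult 1 2 by auto
    then show ?thesis unfolding r_def using U_M_add U_mult 1 2 by auto
  qed
  have "(s \<otimes> s') \<otimes> (a \<oplus> b) \<otimes> \<pi> [^] (m + m')
    = s' \<otimes> \<pi> [^] m' \<otimes> (s \<otimes> a \<otimes> \<pi> [^] m) \<oplus> s \<otimes> \<pi> [^] m \<otimes> (s' \<otimes> b \<otimes> \<pi> [^] m')"
    using cl by (simp add: nat_pow_mult[symmetric] m_ac r_distr l_distr)
  also have "\<dots> = s' \<otimes> t \<otimes> \<pi> [^] (n + m') \<oplus> s \<otimes> t' \<otimes> \<pi> [^] (n' + m)"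
    unfolding 1(4) 2(4) using cl by (simp add: nat_pow_mult[symmetric] m_ac)
  also have "\<dots> = r \<otimes> \<pi> [^] (n + m')"
    unfolding j r_def using cl by (simp add: nat_pow_mult[symmetric] m_ac l_distr r_distr)
  finally show thesis using that[of "s \<otimes> s'" r "m + m'" "n + m'"] r1 r2 U_mult 1 2 by auto
qed

text \<open>For unequal orders no cancellation can occur. This settles \<open>q(x) + r(x) y\<close>
  over a root of \<open>f\<close>, where the two terms have orders of different parity.\<close>

lemma has_val_add_less:
  assumes a: "has_val a k" and b: "has_val b l" and kl: "k < l"
  shows "has_val (a \<oplus> b) k"
proof -
  obtain s r m n where 1: "s \<in> U" "r \<in> U \<union> M" "s \<otimes> (a \<oplus> b) \<otimes> \<pi> [^] (m::nat) = r \<otimes> \<pi> [^] (n::nat)"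
    "k = int n - int m" "r \<in> U"
    using has_val_le[OF a b] kl by (metis less_imp_le)
  have cl: "a \<in> carrier K" "b \<in> carrier K" using a b by (auto simp: has_val_def nonzero_iff)
  have "r \<otimes> \<pi> [^] n \<noteq> \<zero>"
    using U_nonzero[of r] 1 nonzero_mult nonzero_pow pi_nz nonzero_iff by blast
  then have "a \<oplus> b \<noteq> \<zero>" using 1(1,3) U_nonzero[of s] pi_nz by (auto simp: nonzero_iff)
  then show ?thesis using 1 cl unfolding has_val_def nonzero_iff by blast
qed

text \<open>That the sum has a value is assumed because it may be zero. Relative to the smaller
  power of \<open>\<pi>\<close> its order is that of a regular element, hence nonnegative.\<close>

lemma has_val_add:
  assumes a: "has_val a k" and b: "has_val b l" and ab: "has_val (a \<oplus> b) i"
  shows "min k l \<le> i"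
proof -
  have *: "k \<le> i" if h: "has_val a k" "has_val b l" "has_val (a \<oplus> b) i" "k \<le> l" for a b k l
  proof -
    obtain s r m n where 1: "s \<in> U" "r \<in> U \<union> M" "s \<otimes> (a \<oplus> b) \<otimes> \<pi> [^] (m::nat) = r \<otimes> \<pi> [^] (n::nat)"
      "k = int n - int m"
      using has_val_le[OF h(1,2,4)] by metis
    have rcl: "r \<in> carrier K" using 1 U_M by auto
    have hl: "has_val (s \<otimes> (a \<oplus> b) \<otimes> \<pi> [^] m) (i + int m)"
      using has_val_mult[OF has_val_mult[OF has_val_U[OF 1(1)] h(3)] has_val_pow[OF has_val_pi, of m]] by simp
    have "has_val (inv (\<pi> [^] n)) (- int n)"
      using has_val_inv[OF has_val_pow[OF has_val_pi, of n]] by simp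
    then have "has_val (r \<otimes> \<pi> [^] n \<otimes> inv (\<pi> [^] n)) (i + int m - int n)"
      using has_val_mult[OF hl] 1(3) by fastforce
    moreover have "r \<otimes> \<pi> [^] n \<otimes> inv (\<pi> [^] n) = r"
      using nonzero_inv[OF nonzero_pow[OF pi_nz]] nonzero_pow[OF pi_nz] rcl
      by (simp add: m_assoc nonzero_iff)
    ultimately have "i + int m - int n \<ge> 0" using has_val_regular(1) 1(2) by metis
    then show ?thesis using 1(4) by simp
  qed
  show ?thesis
  proof (cases "k \<le> l")
    case True then show ?thesis using *[OF a b ab] by simp
  next
    case False
    have "b \<oplus> a = a \<oplus> b" using a b a_comm by (auto simp: has_val_def nonzero_iff)
    then show ?thesis using *[OF b a] ab False by simp
  qed
qed

text \<open>The existence of \<open>k\<close> is left to the hypothesis \<open>total\<close> of the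
  following context, to be verified for each kind of point.\<close>

definition valuation :: "'a \<Rightarrow> int" where
  "valuation = restrict (\<lambda>z. THE k. has_val z k) (nonzero K)"

context
  assumes total: "\<And>z. z \<in> nonzero K \<Longrightarrow> \<exists>k. has_val z k"
begin

lemma has_val_valuation: "z \<in> nonzero K \<Longrightarrow> has_val z (valuation z)"
  unfolding valuation_def using total[of z] has_val_unique by (auto intro: theI2)

lemma valuation_eq: assumes "has_val z k" shows "valuation z = k"
proof -
  have "z \<in> nonzero K" using assms by (simp add: has_val_def)
  then show ?thesis using has_val_unique[OF has_val_valuation assms] by simp
qed

lemma valuation_discrete: "valuation \<in> \<V>"
proof -
  have surj: "k \<in> valuation ` nonzero K" for k
  proof (cases "k \<ge> 0")
    case True
    have "has_val (\<pi> [^] nat k) k" using has_val_pow[OF has_val_pi, of "nat k"] True by simp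
    then show ?thesis using valuation_eq unfolding has_val_def by (metis imageI)
  next
    case False
    have "has_val (inv (\<pi> [^] nat (- k))) k"
      using has_val_inv[OF has_val_pow[OF has_val_pi, of "nat (- k)"]] False by simp
    then show ?thesis using valuation_eq unfolding has_val_def by (metis imageI)
  qed
  have "valuation \<in> extensional (nonzero K)" unfolding valuation_def by simp
  moreover have "valuation (a \<otimes> b) = valuation a + valuation b" if "a \<in> nonzero K" "b \<in> nonzero K" for a b
    by (intro valuation_eq has_val_mult has_val_valuation that)
  moreover have "min (valuation a) (valuation b) \<le> valuation (a \<oplus> b)"
    if "a \<in> nonzero K" "b \<in> nonzero K" "a \<oplus> b \<noteq> \<zero>" for a b
    using has_val_add[OF has_val_valuation[OF that(1)] has_val_valuation[OF that(2)] has_val_valuation] that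
    by (simp add: nonzero_iff)
  moreover have "valuation c = 0" if "c \<in> C - {\<zero>}" for c
    by (intro valuation_eq has_val_U subsetD[OF C_U that])
  moreover have "valuation ` nonzero K = UNIV" using surj by (intro equalityI subset_UNIV subsetI)
  ultimately show ?thesis unfolding discrete_valuations_def by simp
qed

text \<open>Such a \<open>v\<close> is \<open>v \<pi>\<close> times \<open>valuation\<close>. As
  \<open>v\<close> takes the value \<open>1\<close>, the positive integer \<open>v \<pi>\<close>
  divides \<open>1\<close>.\<close>

lemma valuation_unique:
  assumes v: "v \<in> \<V>" and U0: "\<And>u. u \<in> U \<Longrightarrow> v u = 0" and pos: "v \<pi> > 0"
  shows "v = valuation"
proof -
  have *: "v z = valuation z * v \<pi>" if z: "z \<in> nonzero K" for z
  proof -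
    obtain m n s t where 1: "s \<in> U" "t \<in> U"
      "s \<otimes> z \<otimes> \<pi> [^] (m::nat) = t \<otimes> \<pi> [^] (n::nat)" "valuation z = int n - int m"
      by (rule has_valE[OF has_val_valuation[OF z]])
    have "v (s \<otimes> z \<otimes> \<pi> [^] m) = v s + v z + int m * v \<pi>"
      using val_mult[OF v nonzero_mult[OF U_nonzero[OF 1(1)] z] nonzero_pow[OF pi_nz]]
        val_mult[OF v U_nonzero[OF 1(1)] z] val_pow[OF v pi_nz] by simp
    moreover have "v (t \<otimes> \<pi> [^] n) = v t + int n * v \<pi>"
      using val_mult[OF v U_nonzero[OF 1(2)] nonzero_pow[OF pi_nz]] val_pow[OF v pi_nz] by simp
    ultimately have "v z = int n * v \<pi> - int m * v \<pi>" using 1(3) U0[OF 1(1)] U0[OF 1(2)] by simp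
    then show ?thesis unfolding 1(4) by (simp add: left_diff_distrib)
  qed
  obtain z where "z \<in> nonzero K" "v z = 1" using val_surj[OF v] by blast
  then have "valuation z * v \<pi> = 1" using * by simp
  then have "v \<pi> = 1" using pos by (auto simp: zmult_eq_1_iff)
  then show ?thesis using * valuation_eqI[OF v valuation_discrete] by simp
qed

end
end

section \<open>Polynomials over the field of constants\<close>

context field_over begin

abbreviation P :: "'a list set" where "P \<equiv> carrier (C[X])"

lemma P_domain: "domain (C[X])"
  using univ_poly_is_domain[OF subring_C] .

lemma P_set: "p \<in> P \<Longrightarrow> set p \<subseteq> C"
  by (auto simp: univ_poly_carrier[symmetric] polynomial_def)

lemma P_carrier: "p \<in> P \<Longrightarrow> set p \<subseteq> carrier K"
  using P_set C_closed by blast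

lemma P_Nil [simp]: "[] \<in> P"
  by (auto simp: univ_poly_carrier[symmetric] polynomial_def)

lemma P_lead: "p \<in> P \<Longrightarrow> p \<noteq> [] \<Longrightarrow> lead_coeff p \<in> C - {\<zero>}"
  by (auto simp: univ_poly_carrier[symmetric] polynomial_def)

lemma eval_closed: "p \<in> P \<Longrightarrow> z \<in> carrier K \<Longrightarrow> eval p z \<in> carrier K"
  using eval_in_carrier[OF P_carrier] .

lemma eval_C: assumes "set p \<subseteq> C" "a \<in> C" shows "eval p a \<in> C"
proof -
  have pw: "a [^] (n::nat) \<in> C" for n using assms(2) by (induction n) (auto simp: C_ops)
  show ?thesis using assms(1) by (induction p) (auto simp: C_ops pw)
qed

lemma eval_P_C: "p \<in> P \<Longrightarrow> a \<in> C \<Longrightarrow> eval p a \<in> C"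
  using eval_C P_set by auto

lemma eval_P_hom: "z \<in> carrier K \<Longrightarrow> ring_hom_cring (C[X]) K (\<lambda>p. eval p z)"
  using eval_cring_hom[OF subring_C] by auto

lemma eval_P_mult: "p \<in> P \<Longrightarrow> q \<in> P \<Longrightarrow> z \<in> carrier K \<Longrightarrow> eval (p \<otimes>\<^bsub>C[X]\<^esub> q) z = eval p z \<otimes> eval q z"
  by (rule ring_hom_mult[OF eval_is_hom[OF subring_C]])

lemma eval_P_add: "p \<in> P \<Longrightarrow> q \<in> P \<Longrightarrow> z \<in> carrier K \<Longrightarrow> eval (p \<oplus>\<^bsub>C[X]\<^esub> q) z = eval p z \<oplus> eval q z"
  by (rule ring_hom_add[OF eval_is_hom[OF subring_C]])

lemma eval_P_neg: "p \<in> P \<Longrightarrow> z \<in> carrier K \<Longrightarrow> eval (\<ominus>\<^bsub>C[X]\<^esub> p) z = \<ominus> (eval p z)"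
  using ring_hom_cring.hom_a_inv[OF eval_P_hom] by auto

lemma P_mult [simp]: "p \<in> P \<Longrightarrow> q \<in> P \<Longrightarrow> p \<otimes>\<^bsub>C[X]\<^esub> q \<in> P"
  and P_add [simp]: "p \<in> P \<Longrightarrow> q \<in> P \<Longrightarrow> p \<oplus>\<^bsub>C[X]\<^esub> q \<in> P"
  and P_neg [simp]: "p \<in> P \<Longrightarrow> \<ominus>\<^bsub>C[X]\<^esub> p \<in> P"
proof -
  interpret UP: domain "C[X]" by (rule P_domain)
  show "p \<in> P \<Longrightarrow> q \<in> P \<Longrightarrow> p \<otimes>\<^bsub>C[X]\<^esub> q \<in> P" "p \<in> P \<Longrightarrow> q \<in> P \<Longrightarrow> p \<oplus>\<^bsub>C[X]\<^esub> q \<in> P"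
    "p \<in> P \<Longrightarrow> \<ominus>\<^bsub>C[X]\<^esub> p \<in> P" by auto
qed

lemma P_mult_Nil: "p \<in> P \<Longrightarrow> q \<in> P \<Longrightarrow> p \<otimes>\<^bsub>C[X]\<^esub> q = [] \<longleftrightarrow> p = [] \<or> q = []"
  using domain.integral_iff[OF P_domain] by (simp add: univ_poly_zero)

lemma P_degree_mult: "p \<in> P \<Longrightarrow> q \<in> P \<Longrightarrow> p \<noteq> [] \<Longrightarrow> q \<noteq> [] \<Longrightarrow> degree (p \<otimes>\<^bsub>C[X]\<^esub> q) = degree p + degree q"
  using poly_mult_degree_eq[OF subring_C, of p q] by (auto simp: univ_poly_mult univ_poly_carrier)

lemma poly_of_const_P: "c \<in> C \<Longrightarrow> poly_of_const c \<in> P"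
  by (auto simp: univ_poly_carrier[symmetric] polynomial_def poly_of_const_def)

lemma eval_poly_of_const: "c \<in> C \<Longrightarrow> z \<in> carrier K \<Longrightarrow> eval (poly_of_const c) z = c"
  using C_closed by (auto simp: poly_of_const_def)

definition lin :: "'a \<Rightarrow> 'a list" where "lin a = [\<one>, \<ominus> a]"

lemma lin_P: "a \<in> C \<Longrightarrow> lin a \<in> P"
  using C_ops by (auto simp: lin_def univ_poly_carrier[symmetric] polynomial_def)

lemma lin_not_Nil [simp]: "lin a \<noteq> []" "length (lin a) = 2"
  by (auto simp: lin_def)

lemma eval_lin: "a \<in> C \<Longrightarrow> z \<in> carrier K \<Longrightarrow> eval (lin a) z = z \<ominus> a"
  using C_closed by (simp add: lin_def a_minus_def)

lemma poly_division:
  assumes p: "p \<in> P" and a: "a \<in> C"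
  obtains q where "q \<in> P" "p = lin a \<otimes>\<^bsub>C[X]\<^esub> q \<oplus>\<^bsub>C[X]\<^esub> poly_of_const (eval p a)"
proof -
  have "lin a \<noteq> \<zero>\<^bsub>C[X]\<^esub>" by (simp add: univ_poly_zero)
  then obtain q r where qr: "q \<in> P" "r \<in> P" "p = lin a \<otimes>\<^bsub>C[X]\<^esub> q \<oplus>\<^bsub>C[X]\<^esub> r"
    "r = \<zero>\<^bsub>C[X]\<^esub> \<or> degree r < degree (lin a)"
    using subfield_long_division_theorem_shell[OF subfield_C p lin_P[OF a]] by blast
  have "length r \<le> 1" using qr(4) by (auto simp: univ_poly_zero lin_def)
  then obtain c where c: "c \<in> C" "r = poly_of_const c"
  proof (cases r)
    case Nil
    then have "r = poly_of_const \<zero>" by (simp add: poly_of_const_def)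
    then show ?thesis using that C_ops by auto
  next
    case (Cons c l)
    then have "r = [c]" using \<open>length r \<le> 1\<close> by simp
    moreover have "c \<in> C - {\<zero>}" using P_lead[OF qr(2)] Cons by simp
    ultimately show ?thesis using that[of c] by (simp add: poly_of_const_def)
  qed
  have "eval p a = eval (lin a) a \<otimes> eval q a \<oplus> c"
    using qr c a by (simp add: eval_P_add eval_P_mult lin_P C_closed eval_poly_of_const)
  also have "\<dots> = c" using eval_lin[OF a, of a] a qr c C_closed eval_closed[of q a] by (simp add: r_neg a_minus_def)
  finally show thesis using that qr c by metis
qed

lemma eval_division:
  assumes p: "p \<in> P" and a: "a \<in> C"
  obtains q where "q \<in> P" "\<And>z. z \<in> carrier K \<Longrightarrow> eval p z = (z \<ominus> a) \<otimes> eval q z \<oplus> eval p a"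
proof -
  obtain q where q: "q \<in> P" "p = lin a \<otimes>\<^bsub>C[X]\<^esub> q \<oplus>\<^bsub>C[X]\<^esub> poly_of_const (eval p a)"
    using poly_division[OF assms] .
  have c: "eval p a \<in> C" using eval_P_C assms by auto
  have "eval p z = (z \<ominus> a) \<otimes> eval q z \<oplus> eval p a" if "z \<in> carrier K" for z
    by (subst q(2)) (use that c a q(1) in \<open>simp add: eval_P_add eval_P_mult lin_P poly_of_const_P eval_poly_of_const eval_lin\<close>)
  then show thesis using that q by blast
qed

lemma root_factor:
  assumes p: "p \<in> P" and a: "a \<in> C" and "eval p a = \<zero>"
  obtains q where "q \<in> P" "p = lin a \<otimes>\<^bsub>C[X]\<^esub> q"
    "\<And>z. z \<in> carrier K \<Longrightarrow> eval p z = (z \<ominus> a) \<otimes> eval q z"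
    "p \<noteq> [] \<Longrightarrow> q \<noteq> [] \<and> length p = Suc (length q)"
proof -
  interpret UP: domain "C[X]" by (rule P_domain)
  obtain q where q: "q \<in> P" "p = lin a \<otimes>\<^bsub>C[X]\<^esub> q \<oplus>\<^bsub>C[X]\<^esub> poly_of_const (eval p a)"
    using poly_division[OF p a] .
  have "poly_of_const (eval p a) = \<zero>\<^bsub>C[X]\<^esub>" by (simp add: assms poly_of_const_def univ_poly_zero)
  then have e: "p = lin a \<otimes>\<^bsub>C[X]\<^esub> q" using q lin_P[OF a] by simp
  have "q \<noteq> [] \<and> length p = Suc (length q)" if "p \<noteq> []"
  proof -
    have qn: "q \<noteq> []" using that e q P_mult_Nil lin_P[OF a] by auto
    have "degree p = 1 + degree q" using P_degree_mult[OF lin_P[OF a] q(1) _ qn] e by simp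
    then show ?thesis using qn that by (cases p; cases q) auto
  qed
  then show thesis using that[OF q(1) e] e q(1) a by (simp add: eval_P_mult lin_P eval_lin)
qed

lemma root_power_factor:
  assumes "p \<in> P" "p \<noteq> []" and a: "a \<in> C"
  obtains i q where "q \<in> P" "eval q a \<noteq> \<zero>" "\<And>z. z \<in> carrier K \<Longrightarrow> eval p z = (z \<ominus> a) [^] (i::nat) \<otimes> eval q z"
proof -
  have "\<exists>i q. q \<in> P \<and> eval q a \<noteq> \<zero> \<and> (\<forall>z\<in>carrier K. eval p z = (z \<ominus> a) [^] (i::nat) \<otimes> eval q z)"
    using assms(1,2)
  proof (induction "length p" arbitrary: p)
    case (Suc n)
    show ?case
    proof (cases "eval p a = \<zero>")
      case False
      then show ?thesis using Suc(3) eval_closed by (intro exI[of _ 0] exI[of _ p]) auto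
    next
      case True
      then obtain q where q: "q \<in> P" "\<And>z. z \<in> carrier K \<Longrightarrow> eval p z = (z \<ominus> a) \<otimes> eval q z"
        "q \<noteq> [] \<and> length p = Suc (length q)" using root_factor[OF Suc(3) a] Suc(4) by metis
      obtain i r where r: "r \<in> P" "eval r a \<noteq> \<zero>" "\<forall>z\<in>carrier K. eval q z = (z \<ominus> a) [^] (i::nat) \<otimes> eval r z"
        using Suc(1)[of q] Suc(2) q by auto
      have "eval p z = (z \<ominus> a) [^] (Suc i) \<otimes> eval r z" if z: "z \<in> carrier K" for z
        using q(2)[OF z] r z a C_closed eval_closed[OF r(1) z] by (simp add: m_ac)
      then show ?thesis using r by blast
    qed
  qed simp
  then show thesis using that by blast
qed

lemma P_eqI:
  assumes "p \<in> P" "q \<in> P" "p \<oplus>\<^bsub>C[X]\<^esub> (\<ominus>\<^bsub>C[X]\<^esub> q) = []"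
  shows "p = q"
proof -
  interpret UP: domain "C[X]" by (rule P_domain)
  show ?thesis using assms UP.r_neg[of q] UP.add.inv_solve_right'[of "\<zero>\<^bsub>C[X]\<^esub>" p q]
    by (metis UP.minus_equality UP.minus_minus UP.a_inv_closed univ_poly_zero)
qed

context
  fixes v and x :: 'a assumes v: "v \<in> \<V>"
begin

lemma regular_pow: "regular_at v z \<Longrightarrow> regular_at v (z [^] (n::nat))"
  by (induction n) (auto intro: regular_mult[OF v] regular_const[OF v] C_ops)

lemma regular_eval':
  assumes "regular_at v x" "set p \<subseteq> C" shows "regular_at v (eval p x)"
  using assms(2)
proof (induction p)
  case Nil
  then show ?case using regular_const[OF v C_ops(1)] by simp
next
  case (Cons c p)
  have "regular_at v (c \<otimes> x [^] length p \<oplus> eval p x)"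
    using Cons regular_const[OF v, of c] regular_pow[OF assms(1)]
    by (intro regular_add[OF v] regular_mult[OF v]) simp_all
  then show ?case by simp
qed

lemma regular_eval: "regular_at v x \<Longrightarrow> p \<in> P \<Longrightarrow> regular_at v (eval p x)"
  using regular_eval' P_set by auto

lemma regular_if_vanishes_minus:
  assumes "a \<in> C" "x \<in> carrier K" "vanishes_at v (x \<ominus> a)" shows "regular_at v x"
proof -
  have "x = (x \<ominus> a) \<oplus> a" using assms C_closed[of a] by algebra
  then show ?thesis using regular_add[OF v vanishes_regular[OF assms(3)] regular_const[OF v assms(1)]] by simp
qed

text \<open>\<open>p(x) - p(a)\<close> is divisible by \<open>x - a\<close>, and the quotient is a
  polynomial in \<open>x\<close>, hence regular.\<close>

lemma vanishes_eval_diff: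
  assumes "a \<in> C" "x \<in> carrier K" "vanishes_at v (x \<ominus> a)" "p \<in> P"
  obtains m where "vanishes_at v m" "eval p x = eval p a \<oplus> m"
proof -
  obtain q where q: "q \<in> P" "eval p x = (x \<ominus> a) \<otimes> eval q x \<oplus> eval p a"
    using eval_division[OF assms(4,1)] assms(2) by metis
  have m: "vanishes_at v ((x \<ominus> a) \<otimes> eval q x)"
    using vanishes_mult[OF v assms(3)] regular_eval regular_if_vanishes_minus assms q by blast
  have "eval p x = eval p a \<oplus> (x \<ominus> a) \<otimes> eval q x"
    using q assms vanishes_closed[OF m] eval_closed[OF assms(4)] C_closed[of a] by (simp add: a_comm)
  then show thesis using that m by blast
qed

lemma val_eval_nonroot:
  assumes "a \<in> C" "x \<in> carrier K" "vanishes_at v (x \<ominus> a)" "p \<in> P" "eval p a \<noteq> \<zero>"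
  shows "eval p x \<in> nonzero K" "v (eval p x) = 0"
  using vanishes_eval_diff[OF assms(1-4)] val_unit_plus_vanishing[OF v eval_P_C[OF assms(4,1)] assms(5)]
  by metis+

end
end

text \<open>Characteristic other than two keeps the points \<open>(a, b)\<close> and
  \<open>(a, - b)\<close> apart for nonzero \<open>b\<close>; \<open>exists_root\<close> makes the
  constants algebraically closed.\<close>

locale alg_closed_over = field_over +
  assumes exists_root: "\<And>p. p \<in> P \<Longrightarrow> degree p > 0 \<Longrightarrow> \<exists>a\<in>C. eval p a = \<zero>"
    and two_nonzero: "\<one> \<oplus> \<one> \<noteq> \<zero>"
begin

text \<open>Linear factors are split off one at a time; since the maximal ideal is prime, one of
  them must vanish.\<close>

lemma vanishing_eval_root:
  assumes v: "v \<in> \<V>" and x: "regular_at v x" and p: "p \<in> P" "p \<noteq> []" "vanishes_at v (eval p x)"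
  obtains a where "a \<in> C" "eval p a = \<zero>" "vanishes_at v (x \<ominus> a)"
proof -
  have xc: "x \<in> carrier K" using x regular_closed by auto
  have "\<exists>a\<in>C. eval p a = \<zero> \<and> vanishes_at v (x \<ominus> a)" using p
  proof (induction "length p" arbitrary: p)
    case (Suc n)
    show ?case
    proof (cases "degree p = 0")
      case True
      then obtain c where "p = [c]" using Suc(2) by (cases p) auto
      then have c: "p = [c]" "c \<in> C - {\<zero>}" using P_lead[OF Suc(3)] by auto
      then have "vanishes_at v c" using Suc(5) xc C_closed by auto
      then show ?thesis using const_vanishes[OF v] c by auto
    next
      case False
      then obtain a where a: "a \<in> C" "eval p a = \<zero>" using exists_root Suc(3) by blast
      obtain q where q: "q \<in> P" "\<And>z. z \<in> carrier K \<Longrightarrow> eval p z = (z \<ominus> a) \<otimes> eval q z"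
        "q \<noteq> [] \<and> length p = Suc (length q)" using root_factor[OF Suc(3) a] Suc(4) by metis
      have "vanishes_at v (x \<ominus> a) \<or> vanishes_at v (eval q x)"
        using vanishes_mult_cases[OF v] Suc(5) q xc a C_closed eval_closed by auto
      then show ?thesis
      proof
        assume "vanishes_at v (eval q x)"
        then obtain b where b: "b \<in> C" "eval q b = \<zero>" "vanishes_at v (x \<ominus> b)" using Suc(1)[of q] Suc(2) q by auto
        then have "eval p b = \<zero>" using q(2)[of b] C_closed a by auto
        then show ?thesis using b by auto
      qed (use a in auto)
    qed
  qed simp
  then show thesis using that by blast
qed

lemma exists_sqrt:
  assumes "c \<in> C" obtains b where "b \<in> C" "b \<otimes> b = c"
proof -
  have p: "[\<one>, \<zero>, \<ominus> c] \<in> P" using assms C_ops by (auto simp: univ_poly_carrier[symmetric] polynomial_def)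
  then obtain b where b: "b \<in> C" "eval [\<one>, \<zero>, \<ominus> c] b = \<zero>" using exists_root[OF p] by auto
  have cl: "b \<in> carrier K" "c \<in> carrier K" using b assms C_closed by auto
  have "b \<otimes> b \<oplus> (\<ominus> c) = \<zero>" using b(2) cl by (simp add: numeral_2_eq_2)
  then have "b \<otimes> b = c" using cl by (metis add.inv_closed m_closed minus_equality minus_minus)
  then show thesis using that b by blast
qed

lemma double_zero: "a \<in> carrier K \<Longrightarrow> a \<oplus> a = \<zero> \<Longrightarrow> a = \<zero>"
proof -
  assume a: "a \<in> carrier K" "a \<oplus> a = \<zero>"
  have "a \<otimes> (\<one> \<oplus> \<one>) = \<zero>" using a by (simp add: r_distr)
  then show ?thesis using a two_nonzero by (simp add: integral_iff)
qed

end

section \<open>Charts of a hyperelliptic curve and their places\<close>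

text \<open>
  The coordinates are parameters, so that all results also apply to the chart at infinity, whose
  coordinates are \<open>1/x\<close> and \<open>y/x^(g+1)\<close>.
\<close>

locale hyperelliptic_chart = alg_closed_over +
  fixes x y :: 'a and f :: "'a list"
  assumes x_closed: "x \<in> carrier K" and y_closed: "y \<in> carrier K" and f_P: "f \<in> P"
    and curve: "y \<otimes> y = eval f x"
    and indep: "\<And>q r. q \<in> P \<Longrightarrow> r \<in> P \<Longrightarrow> eval q x \<oplus> eval r x \<otimes> y = \<zero> \<Longrightarrow> q = [] \<and> r = []"
    and generate: "\<And>z. z \<in> carrier K \<Longrightarrow> \<exists>q\<in>P. \<exists>r\<in>P. \<exists>s\<in>P. s \<noteq> [] \<and> z \<otimes> eval s x = eval q x \<oplus> eval r x \<otimes> y"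
begin

text \<open>The value of the function \<open>q(x) + r(x) y\<close> at the point \<open>(a, b)\<close>.\<close>

definition gev :: "'a list \<Rightarrow> 'a list \<Rightarrow> 'a \<Rightarrow> 'a \<Rightarrow> 'a" where
  "gev q r a b = eval q a \<oplus> eval r a \<otimes> b"

lemma gev_closed: "q \<in> P \<Longrightarrow> r \<in> P \<Longrightarrow> a \<in> carrier K \<Longrightarrow> b \<in> carrier K \<Longrightarrow> gev q r a b \<in> carrier K"
  by (auto simp: gev_def eval_closed)

lemma gev_C: "q \<in> P \<Longrightarrow> r \<in> P \<Longrightarrow> a \<in> C \<Longrightarrow> b \<in> C \<Longrightarrow> gev q r a b \<in> C"
  by (auto simp: gev_def eval_P_C C_ops)

lemma gev_Nil: "q \<in> P \<Longrightarrow> a \<in> carrier K \<Longrightarrow> b \<in> carrier K \<Longrightarrow> gev q [] a b = eval q a"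
  by (auto simp: gev_def eval_closed)

lemma gev_add:
  assumes "q \<in> P" "r \<in> P" "q' \<in> P" "r' \<in> P" "a \<in> carrier K" "b \<in> carrier K"
  shows "gev q r a b \<oplus> gev q' r' a b = gev (q \<oplus>\<^bsub>C[X]\<^esub> q') (r \<oplus>\<^bsub>C[X]\<^esub> r') a b"
proof -
  have *: "(s \<oplus> t \<otimes> b) \<oplus> (s' \<oplus> t' \<otimes> b) = (s \<oplus> s') \<oplus> (t \<oplus> t') \<otimes> b"
    if "s \<in> carrier K" "t \<in> carrier K" "s' \<in> carrier K" "t' \<in> carrier K" "b \<in> carrier K" for s t s' t'
    using that by algebra
  show ?thesis using assms *[of "eval q a" "eval r a" "eval q' a" "eval r' a"] by (simp add: gev_def eval_P_add eval_closed)
qed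

text \<open>One formula serves both the generic point \<open>(x, y)\<close> and every point
  \<open>(a, b)\<close> of the curve. Hence evaluation at a point respects products of
  functions.\<close>

lemma gev_mult:
  assumes "q \<in> P" "r \<in> P" "q' \<in> P" "r' \<in> P" "a \<in> carrier K" "b \<in> carrier K" "b \<otimes> b = eval f a"
  shows "gev q r a b \<otimes> gev q' r' a b =
    gev (q \<otimes>\<^bsub>C[X]\<^esub> q' \<oplus>\<^bsub>C[X]\<^esub> r \<otimes>\<^bsub>C[X]\<^esub> r' \<otimes>\<^bsub>C[X]\<^esub> f) (q \<otimes>\<^bsub>C[X]\<^esub> r' \<oplus>\<^bsub>C[X]\<^esub> r \<otimes>\<^bsub>C[X]\<^esub> q') a b"
proof -
  have *: "(s \<oplus> t \<otimes> b) \<otimes> (s' \<oplus> t' \<otimes> b) = (s \<otimes> s' \<oplus> t \<otimes> t' \<otimes> (b \<otimes> b)) \<oplus> (s \<otimes> t' \<oplus> t \<otimes> s') \<otimes> b"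
    if "s \<in> carrier K" "t \<in> carrier K" "s' \<in> carrier K" "t' \<in> carrier K" "b \<in> carrier K" for s t s' t'
    using that by algebra
  show ?thesis using assms *[of "eval q a" "eval r a" "eval q' a" "eval r' a"]
    by (simp add: gev_def eval_P_add eval_P_mult eval_closed f_P)
qed

abbreviation ev :: "'a list \<Rightarrow> 'a list \<Rightarrow> 'a" where "ev q r \<equiv> gev q r x y"

lemma ev_zero: "q \<in> P \<Longrightarrow> r \<in> P \<Longrightarrow> ev q r = \<zero> \<longleftrightarrow> q = [] \<and> r = []"
  using indep y_closed by (auto simp: gev_def)

lemma eval_x_zero: "q \<in> P \<Longrightarrow> eval q x = \<zero> \<longleftrightarrow> q = []"
  using ev_zero[of q "[]"] gev_Nil x_closed y_closed by auto

lemma eval_x_nonzero: "q \<in> P \<Longrightarrow> q \<noteq> [] \<Longrightarrow> eval q x \<in> nonzero K"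
  using eval_x_zero eval_closed x_closed by (auto simp: nonzero_iff)

lemma x_minus_nonzero: "a \<in> C \<Longrightarrow> x \<ominus> a \<in> nonzero K"
  using eval_x_nonzero[OF lin_P] eval_lin x_closed by auto

lemma y_nonzero: "y \<in> nonzero K"
  using ev_zero[of "[]" "[\<one>]"] y_closed x_closed C_ops
  by (auto simp: nonzero_iff gev_def univ_poly_carrier[symmetric] polynomial_def)

text \<open>A function determines its pair of polynomials, so its value at a point is well
  defined.\<close>

lemma ev_inj:
  assumes "q \<in> P" "r \<in> P" "q' \<in> P" "r' \<in> P" "ev q r = ev q' r'"
  shows "q = q' \<and> r = r'"
proof -
  have "ev q r \<oplus> ev (\<ominus>\<^bsub>C[X]\<^esub> q') (\<ominus>\<^bsub>C[X]\<^esub> r') = ev q' r' \<oplus> ev (\<ominus>\<^bsub>C[X]\<^esub> q') (\<ominus>\<^bsub>C[X]\<^esub> r')"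
    using assms by simp
  also have "\<dots> = \<zero>"
  proof -
    have *: "(s \<oplus> t \<otimes> y) \<oplus> (\<ominus> s \<oplus> (\<ominus> t) \<otimes> y) = \<zero>" if "s \<in> carrier K" "t \<in> carrier K" for s t
      using that y_closed by algebra
    show ?thesis using assms *[of "eval q' x" "eval r' x"] x_closed by (simp add: gev_def eval_P_neg eval_closed)
  qed
  finally have "ev (q \<oplus>\<^bsub>C[X]\<^esub> (\<ominus>\<^bsub>C[X]\<^esub> q')) (r \<oplus>\<^bsub>C[X]\<^esub> (\<ominus>\<^bsub>C[X]\<^esub> r')) = \<zero>"
    using gev_add[OF assms(1,2) P_neg[OF assms(3)] P_neg[OF assms(4)] x_closed y_closed] by simp
  then show ?thesis using ev_zero assms P_eqI by auto
qed

text \<open>In geometric terms: the centre of \<open>v\<close> is the point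
  \<open>(a, b)\<close>.\<close>

definition place :: "'a \<Rightarrow> 'a \<Rightarrow> ('a \<Rightarrow> int) \<Rightarrow> bool" where
  "place a b v \<longleftrightarrow> v \<in> \<V> \<and> vanishes_at v (x \<ominus> a) \<and> vanishes_at v (y \<ominus> b)"

lemma place_gev:
  assumes pl: "place a b v" and ab: "a \<in> C" "b \<in> C" and qr: "q \<in> P" "r \<in> P"
  obtains m where "vanishes_at v m" "ev q r = gev q r a b \<oplus> m"
proof -
  have v: "v \<in> \<V>" and va: "vanishes_at v (x \<ominus> a)" and vb: "vanishes_at v (y \<ominus> b)"
    using pl by (auto simp: place_def)
  obtain m where m: "vanishes_at v m" "eval q x = eval q a \<oplus> m"
    using vanishes_eval_diff[OF v ab(1) x_closed va qr(1)] .
  obtain n where n: "vanishes_at v n" "eval r x = eval r a \<oplus> n"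
    using vanishes_eval_diff[OF v ab(1) x_closed va qr(2)] .
  have ry: "regular_at v y" using regular_if_vanishes_minus[OF v ab(2) y_closed vb] .
  \<comment> \<open>From \<open>r(x) y - r(a) b = (y - b) r(a) + (r(x) - r(a)) y\<close>, with
    \<open>m\<close> and \<open>n\<close> the vanishing parts of \<open>q(x)\<close> and
    \<open>r(x)\<close>.\<close>
  define k where "k = m \<oplus> ((y \<ominus> b) \<otimes> eval r a \<oplus> n \<otimes> y)"
  have vk: "vanishes_at v k" unfolding k_def
    by (intro vanishes_add[OF v] vanishes_mult[OF v] m n vb ry regular_const[OF v] eval_P_C qr ab)
  have *: "(s \<oplus> m) \<oplus> (t \<oplus> n) \<otimes> y = (s \<oplus> t \<otimes> b) \<oplus> (m \<oplus> ((y \<ominus> b) \<otimes> t \<oplus> n \<otimes> y))"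
    if "s \<in> carrier K" "t \<in> carrier K" "m \<in> carrier K" "n \<in> carrier K" "b \<in> carrier K" "y \<in> carrier K" for s t
    using that by algebra
  have "ev q r = gev q r a b \<oplus> k"
    unfolding gev_def k_def m n
    using * eval_closed qr ab C_closed vanishes_closed m(1) n(1) y_closed by auto
  then show thesis using that vk by blast
qed

lemma place_val_zero:
  assumes "place a b v" "a \<in> C" "b \<in> C" "q \<in> P" "r \<in> P" "gev q r a b \<noteq> \<zero>"
  shows "v (ev q r) = 0"
  using place_gev[OF assms(1-5)] val_unit_plus_vanishing(2)[of v "gev q r a b"] gev_C assms
  unfolding place_def by metis

lemma place_vanishes:
  assumes "place a b v" "a \<in> C" "b \<in> C" "q \<in> P" "r \<in> P" "vanishes_at v (ev q r)"
  shows "gev q r a b = \<zero>"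
  using place_val_zero[OF assms(1-5)] assms(6) unfolding vanishes_at_def
  using place_gev[OF assms(1-5)] val_unit_plus_vanishing(1)[of v "gev q r a b"] gev_C assms
  unfolding place_def nonzero_iff by (metis less_irrefl)

text \<open>Only the functions \<open>q(x) + r(x) y\<close> with polynomials \<open>q\<close> and
  \<open>r\<close> are used here and in \<open>place_ideal\<close>, not the whole local ring;
  denominators are provided by \<open>has_val\<close>.\<close>

definition place_units :: "'a \<Rightarrow> 'a \<Rightarrow> 'a set" where
  "place_units a b = {ev q r | q r. q \<in> P \<and> r \<in> P \<and> gev q r a b \<noteq> \<zero>}"

definition place_ideal :: "'a \<Rightarrow> 'a \<Rightarrow> 'a set" where
  "place_ideal a b = {ev q r | q r. q \<in> P \<and> r \<in> P \<and> gev q r a b = \<zero>}"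

lemma gev_lin: "a \<in> C \<Longrightarrow> s \<in> carrier K \<Longrightarrow> t \<in> carrier K \<Longrightarrow> gev (lin a) [] s t = s \<ominus> a"
  using gev_Nil lin_P eval_lin by auto

lemma gev_y:
  assumes "b \<in> C" "s \<in> carrier K" "t \<in> carrier K"
  shows "gev (poly_of_const (\<ominus> b)) [\<one>] s t = t \<ominus> b" "[\<one>] \<in> P"
proof -
  show "[\<one>] \<in> P" using C_ops by (auto simp: univ_poly_carrier[symmetric] polynomial_def)
  have "eval (poly_of_const (\<ominus> b)) s = \<ominus> b" using eval_poly_of_const C_ops assms by auto
  then show "gev (poly_of_const (\<ominus> b)) [\<one>] s t = t \<ominus> b"
    using assms C_closed[of b] by (simp add: gev_def a_minus_def a_comm)
qed

lemma x_minus_ideal: "a \<in> C \<Longrightarrow> b \<in> C \<Longrightarrow> x \<ominus> a \<in> place_ideal a b"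
  unfolding place_ideal_def using gev_lin[of a a b] gev_lin[of a x y] lin_P[of a] x_closed y_closed C_closed r_neg
  by (intro CollectI exI[of _ "lin a"] exI[of _ "[]"]) (auto simp: a_minus_def)

lemma y_minus_ideal: "a \<in> C \<Longrightarrow> b \<in> C \<Longrightarrow> y \<ominus> b \<in> place_ideal a b"
  unfolding place_ideal_def using gev_y[of b a b] gev_y[of b x y] x_closed y_closed C_closed r_neg poly_of_const_P C_ops
  by (intro CollectI exI[of _ "poly_of_const (\<ominus> b)"] exI[of _ "[\<one>]"]) (auto simp: a_minus_def)

text \<open>On the functions \<open>q(x) + r(x) y\<close> evaluation at \<open>(a, b)\<close> is a
  ring homomorphism to \<open>C\<close>, with \<open>place_ideal\<close> as kernel.\<close>

lemma place_uniformized: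
  assumes ab: "a \<in> C" "b \<in> C" "b \<otimes> b = eval f a" and pi: "\<pi> \<in> place_ideal a b" "\<pi> \<noteq> \<zero>"
  shows "uniformized K C (place_units a b) (place_ideal a b) \<pi>"
proof -
  have cl: "a \<in> carrier K" "b \<in> carrier K" using ab C_closed by auto
  have xy: "x \<in> carrier K" "y \<in> carrier K" "y \<otimes> y = eval f x" using x_closed y_closed curve by auto
  let ?q = "\<lambda>q r q' r'. q \<otimes>\<^bsub>C[X]\<^esub> q' \<oplus>\<^bsub>C[X]\<^esub> r \<otimes>\<^bsub>C[X]\<^esub> r' \<otimes>\<^bsub>C[X]\<^esub> f"
  let ?r = "\<lambda>q r q' r'. q \<otimes>\<^bsub>C[X]\<^esub> r' \<oplus>\<^bsub>C[X]\<^esub> r \<otimes>\<^bsub>C[X]\<^esub> q'"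
  have mult: "\<exists>q'' r''. q'' \<in> P \<and> r'' \<in> P \<and> ev q r \<otimes> ev q' r' = ev q'' r'' \<and>
       gev q'' r'' a b = gev q r a b \<otimes> gev q' r' a b"
    if "q \<in> P" "r \<in> P" "q' \<in> P" "r' \<in> P" for q r q' r'
    using gev_mult[OF that xy] gev_mult[OF that cl ab(3)] that f_P
    by (intro exI[of _ "?q q r q' r'"] exI[of _ "?r q r q' r'"]) auto
  have add: "\<exists>q'' r''. q'' \<in> P \<and> r'' \<in> P \<and> ev q r \<oplus> ev q' r' = ev q'' r'' \<and>
       gev q'' r'' a b = gev q r a b \<oplus> gev q' r' a b"
    if "q \<in> P" "r \<in> P" "q' \<in> P" "r' \<in> P" for q r q' r'
    using gev_add[OF that xy(1,2)] gev_add[OF that cl] that by (metis P_add)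
  have R: "place_units a b \<union> place_ideal a b = {ev q r | q r. q \<in> P \<and> r \<in> P}"
    unfolding place_units_def place_ideal_def by blast
  have intro_U: "ev q r \<in> place_units a b" if "q \<in> P" "r \<in> P" "gev q r a b \<noteq> \<zero>" for q r
    using that unfolding place_units_def by blast
  have intro_M: "ev q r \<in> place_ideal a b" if "q \<in> P" "r \<in> P" "gev q r a b = \<zero>" for q r
    using that unfolding place_ideal_def by blast
  show ?thesis
  proof (unfold_locales)
    show "place_units a b \<inter> place_ideal a b = {}"
    proof (rule ccontr)
      assume "place_units a b \<inter> place_ideal a b \<noteq> {}"
      then obtain z where "z \<in> place_units a b" "z \<in> place_ideal a b" by blast
      then obtain q r q' r' where "q \<in> P" "r \<in> P" "gev q r a b \<noteq> \<zero>" "z = ev q r"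
        "q' \<in> P" "r' \<in> P" "gev q' r' a b = \<zero>" "z = ev q' r'"
        unfolding place_units_def place_ideal_def by blast
      then show False using ev_inj by metis
    qed
    show "place_units a b \<union> place_ideal a b \<subseteq> carrier K"
      unfolding R using gev_closed[OF _ _ xy(1,2)] by blast
    show "u \<otimes> w \<in> place_units a b" if uw: "u \<in> place_units a b" "w \<in> place_units a b" for u w
    proof -
      obtain q r q' r' where *: "q \<in> P" "r \<in> P" "q' \<in> P" "r' \<in> P" "u = ev q r" "w = ev q' r'"
        "gev q r a b \<noteq> \<zero>" "gev q' r' a b \<noteq> \<zero>" using uw unfolding place_units_def by blast
      then show ?thesis using mult[OF *(1-4)] intro_U gev_closed cl by (metis integral)
    qed
    show "u \<otimes> w \<in> place_ideal a b" if uw: "u \<in> place_ideal a b" "w \<in> place_units a b \<union> place_ideal a b" for u w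
    proof -
      obtain q r q' r' where *: "q \<in> P" "r \<in> P" "q' \<in> P" "r' \<in> P" "u = ev q r" "w = ev q' r'"
        "gev q r a b = \<zero>" using uw unfolding R unfolding place_ideal_def by blast
      then show ?thesis using mult[OF *(1-4)] intro_M gev_closed[OF *(3,4) cl] by (metis l_null)
    qed
    show "u \<oplus> w \<in> place_units a b \<union> place_ideal a b"
      if uw: "u \<in> place_units a b \<union> place_ideal a b" "w \<in> place_units a b \<union> place_ideal a b" for u w
    proof -
      obtain q r q' r' where *: "q \<in> P" "r \<in> P" "q' \<in> P" "r' \<in> P" "u = ev q r" "w = ev q' r'"
        using uw unfolding R by blast
      then show ?thesis using add[OF *(1-4)] unfolding R by blast
    qed
    show "u \<oplus> w \<in> place_units a b" if uw: "u \<in> place_units a b" "w \<in> place_ideal a b" for u w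
    proof -
      obtain q r q' r' where *: "q \<in> P" "r \<in> P" "q' \<in> P" "r' \<in> P" "u = ev q r" "w = ev q' r'"
        "gev q r a b \<noteq> \<zero>" "gev q' r' a b = \<zero>" using uw unfolding place_ideal_def place_units_def by blast
      then show ?thesis using add[OF *(1-4)] intro_U gev_closed[OF *(1,2) cl] by (metis r_zero)
    qed
    show "\<zero> \<in> place_ideal a b"
      using intro_M[of "[]" "[]"] xy cl by (auto simp: gev_def)
    show "C - {\<zero>} \<subseteq> place_units a b"
    proof
      fix c assume c: "c \<in> C - {\<zero>}"
      then have pc: "poly_of_const c \<in> P" and c0: "c \<in> C" "c \<noteq> \<zero>" using poly_of_const_P by auto
      have "gev (poly_of_const c) [] a b = c" "ev (poly_of_const c) [] = c"
        using gev_Nil[OF pc cl] gev_Nil[OF pc xy(1,2)] eval_poly_of_const[OF c0(1)] xy(1) cl(1) by simp_all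
      then show "c \<in> place_units a b" using intro_U[OF pc P_Nil] c0(2) by simp
    qed
    show "\<pi> \<in> place_ideal a b" "\<pi> \<noteq> \<zero>" using pi by auto
  qed
qed

text \<open>By \<open>generate\<close> every function is a quotient of functions
  \<open>q(x) + r(x) y\<close>, so it is enough to give values to these. A valuation centred at
  \<open>(a, b)\<close> is zero on the units and positive at \<open>\<pi>\<close>, which determines
  it.\<close>

lemma place_exists_unique:
  assumes ab: "a \<in> C" "b \<in> C" "b \<otimes> b = eval f a" and pi: "\<pi> \<in> place_ideal a b" "\<pi> \<noteq> \<zero>"
    and total: "\<And>q r. q \<in> P \<Longrightarrow> r \<in> P \<Longrightarrow> ev q r \<noteq> \<zero> \<Longrightarrow>
       \<exists>k. uniformized.has_val K (place_units a b) \<pi> (ev q r) k"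
  shows "\<exists>!v. place a b v" "place a b v \<Longrightarrow> v \<pi> = 1"
proof -
  interpret u: uniformized K C "place_units a b" "place_ideal a b" \<pi>
    using place_uniformized[OF assms(1-5)] .
  have t: "\<exists>k. u.has_val z k" if "z \<in> nonzero K" for z
  proof -
    obtain q r s where *: "q \<in> P" "r \<in> P" "s \<in> P" "s \<noteq> []" "z \<otimes> eval s x = ev q r"
      using generate[of z] \<open>z \<in> nonzero K\<close> unfolding nonzero_iff gev_def by blast
    have s: "eval s x \<in> nonzero K" using eval_x_nonzero * by auto
    then have "ev q r \<noteq> \<zero>" using * nonzero_mult[OF that s] by (auto simp: nonzero_iff)
    then obtain k where k: "u.has_val (z \<otimes> eval s x) k" using total * by metis
    have "ev s [] = eval s x" using gev_Nil * x_closed y_closed by auto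
    then obtain l where l: "u.has_val (eval s x) l" using total[of s "[]"] * s by (auto simp: nonzero_iff)
    have "u.has_val (z \<otimes> eval s x \<otimes> inv (eval s x)) (k - l)"
      using u.has_val_mult[OF k u.has_val_inv[OF l]] by simp
    moreover have "z \<otimes> eval s x \<otimes> inv (eval s x) = z"
      using that s nonzero_inv[OF s] by (simp add: m_assoc nonzero_iff)
    ultimately show ?thesis by metis
  qed
  let ?v = "u.valuation"
  have v: "?v \<in> \<V>" using u.valuation_discrete t by blast
  have van: "vanishes_at ?v m" if "m \<in> place_ideal a b" for m
  proof (cases "m = \<zero>")
    case False
    then have "m \<in> nonzero K" using that u.U_M by (auto simp: nonzero_iff)
    then show ?thesis unfolding vanishes_at_def using u.has_val_regular(2)[OF u.has_val_valuation[OF t]] that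
      by (auto simp: nonzero_iff)
  qed (simp add: vanishes_at_def)
  have pl: "place a b ?v"
    unfolding place_def using v van x_minus_ideal y_minus_ideal ab by auto
  have uni: "w = ?v" if w: "place a b w" for w
  proof (rule u.valuation_unique[OF t])
    show "w \<in> \<V>" using w by (simp add: place_def)
    show "w u = 0" if "u \<in> place_units a b" for u
      using that place_val_zero[OF w ab(1,2)] unfolding place_units_def by auto
    obtain q r where qr: "q \<in> P" "r \<in> P" "\<pi> = ev q r" "gev q r a b = \<zero>"
      using pi unfolding place_ideal_def by blast
    obtain m where "vanishes_at w m" "\<pi> = \<zero> \<oplus> m"
      using place_gev[OF w ab(1,2) qr(1,2)] qr by metis
    then show "0 < w \<pi>" using pi vanishes_closed unfolding vanishes_at_def by auto
  qed auto
  show "\<exists>!v. place a b v" using pl uni by blast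
  show "v \<pi> = 1" if "place a b v"
    using uni[OF that] u.valuation_eq[OF t u.has_val_pi] by auto
qed

text \<open>The uniformizer is \<open>x - a\<close>. Common factors \<open>x - a\<close> of
  \<open>q\<close> and \<open>r\<close> are taken out by induction on the lengths. Once none is left
  and \<open>q(x) + r(x) y\<close> still vanishes at the point, its conjugate
  \<open>q(x) - r(x) y\<close> does not, so the function has the same order as its norm, a
  polynomial in \<open>x\<close> whose order is the multiplicity of the root
  \<open>a\<close>.\<close>

lemma unramified_place:
  assumes ab: "a \<in> C" "b \<in> C" "b \<otimes> b = eval f a" "b \<noteq> \<zero>"
  shows "\<exists>!v. place a b v" "place a b v \<Longrightarrow> v (x \<ominus> a) = 1"
proof -
  have pi: "x \<ominus> a \<in> place_ideal a b" "x \<ominus> a \<noteq> \<zero>"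
    using x_minus_ideal x_minus_nonzero ab by (auto simp: nonzero_iff)
  interpret u: uniformized K C "place_units a b" "place_ideal a b" "x \<ominus> a"
    using place_uniformized[OF ab(1-3) pi] .
  have cl: "a \<in> carrier K" "b \<in> carrier K" using ab C_closed by auto
  have xy: "x \<in> carrier K" "y \<in> carrier K" using x_closed y_closed by auto
  have intro_U: "ev q r \<in> place_units a b" if "q \<in> P" "r \<in> P" "gev q r a b \<noteq> \<zero>" for q r
    using that unfolding place_units_def by blast
  have tot: "\<exists>k. u.has_val (ev q r) k" if "q \<in> P" "r \<in> P" "ev q r \<noteq> \<zero>" for q r
    using that
  proof (induction "length q + length r" arbitrary: q r rule: less_induct)
    case less
    note qr = less(2,3)
    show ?case
    proof (cases "gev q r a b = \<zero>")
      case False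
      then show ?thesis using u.has_val_U intro_U less by blast
    next
      case g0: True
      show ?thesis
      proof (cases "eval q a = \<zero> \<and> eval r a = \<zero>")
        case True
        obtain q1 where q1: "q1 \<in> P" "\<And>z. z \<in> carrier K \<Longrightarrow> eval q z = (z \<ominus> a) \<otimes> eval q1 z"
          "q \<noteq> [] \<Longrightarrow> q1 \<noteq> [] \<and> length q = Suc (length q1)" "q = lin a \<otimes>\<^bsub>C[X]\<^esub> q1"
          using root_factor[OF qr(1) ab(1)] True by metis
        obtain r1 where r1: "r1 \<in> P" "\<And>z. z \<in> carrier K \<Longrightarrow> eval r z = (z \<ominus> a) \<otimes> eval r1 z"
          "r \<noteq> [] \<Longrightarrow> r1 \<noteq> [] \<and> length r = Suc (length r1)" "r = lin a \<otimes>\<^bsub>C[X]\<^esub> r1"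
          using root_factor[OF qr(2) ab(1)] True by metis
        have e: "ev q r = (x \<ominus> a) \<otimes> ev q1 r1"
          using q1 r1 xy cl eval_closed[OF q1(1) xy(1)] eval_closed[OF r1(1) xy(1)]
          by (simp add: gev_def r_distr m_assoc)
        have n1: "q = [] \<Longrightarrow> q1 = []" "r = [] \<Longrightarrow> r1 = []"
          using q1 r1 P_mult_Nil lin_P[OF ab(1)] by auto
        have "q \<noteq> [] \<or> r \<noteq> []" using less(4) xy by (auto simp: gev_def)
        then have l: "length q1 + length r1 < length q + length r"
          using q1(3) r1(3) n1 by (cases "q = []"; cases "r = []") auto
        have "ev q1 r1 \<noteq> \<zero>" using less(4) e xy cl by auto
        then obtain k where "u.has_val (ev q1 r1) k" using less(1)[OF l] q1 r1 by blast
        then show ?thesis unfolding e using u.has_val_mult[OF u.has_val_pi] by blast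
      next
        case False
        let ?r = "\<ominus>\<^bsub>C[X]\<^esub> r"
        \<comment> \<open>The norm \<open>q^2 - r^2 f\<close>, the product of the function and its
          conjugate.\<close>
        let ?N = "q \<otimes>\<^bsub>C[X]\<^esub> q \<oplus>\<^bsub>C[X]\<^esub> (\<ominus>\<^bsub>C[X]\<^esub> (r \<otimes>\<^bsub>C[X]\<^esub> r \<otimes>\<^bsub>C[X]\<^esub> f))"
        \<comment> \<open>If both conjugates vanished at the point, then \<open>2 q(a) = 0\<close>
          and \<open>r(a) b = 0\<close>, so \<open>a\<close> would be a common root of
          \<open>q\<close> and \<open>r\<close>.\<close>
        have cj: "gev q ?r a b \<noteq> \<zero>"
        proof
          assume c0: "gev q ?r a b = \<zero>"
          let ?s = "eval q a" and ?t = "eval r a"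
          have st: "?s \<in> carrier K" "?t \<in> carrier K" using eval_closed qr cl by auto
          have 1: "?s \<oplus> ?t \<otimes> b = \<zero>" using g0 by (simp add: gev_def)
          have 2: "?s \<oplus> (\<ominus> ?t) \<otimes> b = \<zero>" using c0 qr cl by (simp add: gev_def eval_P_neg)
          have "\<ominus> (?t \<otimes> b) = ?s" using minus_equality[OF 1] st cl(2) by simp
          then have "?s \<oplus> ?s = \<zero>" using 2 l_minus[OF st(2) cl(2)] by simp
          then have s0: "?s = \<zero>" by (rule double_zero[OF st(1)])
          then have "?t \<otimes> b = \<zero>" using 1 st cl by simp
          then have "?t = \<zero>" using ab(4) st cl by (simp add: integral_iff)
          then show False using s0 False by simp
        qed
        have N: "?N \<in> P" using qr f_P by auto
        have id: "(s \<oplus> t \<otimes> w) \<otimes> (s \<oplus> (\<ominus> t) \<otimes> w) = s \<otimes> s \<oplus> (\<ominus> (t \<otimes> t \<otimes> (w \<otimes> w)))"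
          if "s \<in> carrier K" "t \<in> carrier K" "w \<in> carrier K" for s t w
          using that by algebra
        have eN: "eval ?N x = ev q r \<otimes> ev q ?r"
          using id[of "eval q x" "eval r x" y] qr xy f_P curve
          by (simp add: gev_def eval_P_neg eval_P_mult eval_P_add eval_closed)
        have U: "ev q ?r \<in> place_units a b" using intro_U qr cj by auto
        have nz: "ev q r \<in> nonzero K" using less(4) gev_closed qr xy by (auto simp: nonzero_iff)
        have "?N \<noteq> []" using eN nonzero_mult[OF nz u.U_nonzero[OF U]] by (auto simp: nonzero_iff)
        then obtain i N1 where N1: "N1 \<in> P" "eval N1 a \<noteq> \<zero>"
          "\<And>z. z \<in> carrier K \<Longrightarrow> eval ?N z = (z \<ominus> a) [^] (i::nat) \<otimes> eval N1 z"
          using root_power_factor[OF N _ ab(1)] by metis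
        have "eval N1 x \<in> place_units a b" using intro_U[of N1 "[]"] N1 gev_Nil xy cl by auto
        then have "u.has_val (eval ?N x) (int i * 1 + 0)"
          using N1(3)[OF xy(1)] u.has_val_mult[OF u.has_val_pow[OF u.has_val_pi] u.has_val_U] by metis
        then have "u.has_val (ev q r \<otimes> ev q ?r \<otimes> inv (ev q ?r)) (int i + - 0)"
          using u.has_val_mult[OF _ u.has_val_inv[OF u.has_val_U[OF U]]] eN by fastforce
        moreover have "ev q r \<otimes> ev q ?r \<otimes> inv (ev q ?r) = ev q r"
          using nz u.U_nonzero[OF U] nonzero_inv[OF u.U_nonzero[OF U]] by (simp add: m_assoc nonzero_iff)
        ultimately show ?thesis by metis
      qed
    qed
  qed
  show "\<exists>!v. place a b v" "place a b v \<Longrightarrow> v (x \<ominus> a) = 1"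
    using place_exists_unique[OF ab(1-3) pi tot] by auto
qed

definition simple_root :: "'a \<Rightarrow> bool" where
  "simple_root a \<longleftrightarrow> a \<in> C \<and> (\<exists>g\<in>P. f = lin a \<otimes>\<^bsub>C[X]\<^esub> g \<and> eval g a \<noteq> \<zero>)"

lemma simple_root_eval: "simple_root a \<Longrightarrow> eval f a = \<zero>"
  using eval_P_mult[OF lin_P] C_closed eval_lin eval_closed by (fastforce simp: simple_root_def a_minus_def r_neg)

text \<open>Over a simple root of \<open>f\<close> the uniformizer is \<open>y\<close>, and
  \<open>x - a\<close> has order \<open>2\<close>. So polynomials in \<open>x\<close> have even
  order and their multiples by \<open>y\<close> odd order; the terms of \<open>q(x) + r(x) y\<close>
  never cancel.\<close>

lemma ramified_place:
  assumes a: "simple_root a"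
  shows "\<exists>!v. place a \<zero> v" "place a \<zero> v \<Longrightarrow> v y = 1"
proof -
  have aC: "a \<in> C" and cl: "a \<in> carrier K" using a C_closed by (auto simp: simple_root_def)
  obtain g where g: "g \<in> P" "f = lin a \<otimes>\<^bsub>C[X]\<^esub> g" "eval g a \<noteq> \<zero>"
    using a by (auto simp: simple_root_def)
  have xy: "x \<in> carrier K" "y \<in> carrier K" using x_closed y_closed by auto
  have b: "\<zero> \<in> C" "\<zero> \<otimes> \<zero> = eval f a" using C_ops simple_root_eval[OF a] by auto
  have pi: "y \<in> place_ideal a \<zero>" "y \<noteq> \<zero>"
    using y_minus_ideal[OF aC b(1)] y_nonzero xy by (auto simp: nonzero_iff a_minus_def)
  interpret u: uniformized K C "place_units a \<zero>" "place_ideal a \<zero>" y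
    using place_uniformized[OF aC b pi] .
  have U: "eval q x \<in> place_units a \<zero>" if "q \<in> P" "eval q a \<noteq> \<zero>" for q
  proof -
    have "gev q [] a \<zero> \<noteq> \<zero>" "ev q [] = eval q x"
      using gev_Nil[OF that(1) cl zero_closed] gev_Nil[OF that(1) xy] that(2) by simp_all
    then show ?thesis unfolding place_units_def using that(1) P_Nil by (metis (mono_tags, lifting) CollectI)
  qed
  \<comment> \<open>From \<open>y^2 = (x - a) g(x)\<close>, where \<open>g(x)\<close> is a unit at
    the point because the root is simple.\<close>
  have xa: "u.has_val (x \<ominus> a) 2"
  proof -
    have "u.has_val (y [^] (2::nat)) (int 2 * 1)" using u.has_val_pow[OF u.has_val_pi, of 2] by simp
    moreover have "y [^] (2::nat) = eval f x" using xy curve by (simp add: numeral_2_eq_2)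
    moreover have "eval f x = (x \<ominus> a) \<otimes> eval g x"
      using g xy aC by (simp add: eval_P_mult lin_P eval_lin)
    ultimately have 1: "u.has_val ((x \<ominus> a) \<otimes> eval g x) 2" by simp
    have gU: "eval g x \<in> place_units a \<zero>" using U g by auto
    have "u.has_val ((x \<ominus> a) \<otimes> eval g x \<otimes> inv (eval g x)) (2 + - 0)"
      using u.has_val_mult[OF 1 u.has_val_inv[OF u.has_val_U[OF gU]]] .
    moreover have "(x \<ominus> a) \<otimes> eval g x \<otimes> inv (eval g x) = x \<ominus> a"
      using nonzero_inv[OF u.U_nonzero[OF gU]] u.U_nonzero[OF gU] xy cl by (simp add: m_assoc nonzero_iff)
    ultimately show ?thesis by simp
  qed
  have even: "\<exists>i. u.has_val (eval q x) (2 * int i)" if h: "q \<in> P" "q \<noteq> []" for q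
  proof -
    obtain i q1 where q1: "q1 \<in> P" "eval q1 a \<noteq> \<zero>"
      "\<And>z. z \<in> carrier K \<Longrightarrow> eval q z = (z \<ominus> a) [^] (i::nat) \<otimes> eval q1 z"
      using root_power_factor[OF h aC] by metis
    have "u.has_val (eval q x) (int i * 2 + 0)"
      using q1(3)[OF xy(1)] u.has_val_mult[OF u.has_val_pow[OF xa] u.has_val_U[OF U[OF q1(1,2)]]] by metis
    then show ?thesis by (metis add.right_neutral mult.commute)
  qed
  have tot: "\<exists>k. u.has_val (ev q r) k" if qr: "q \<in> P" "r \<in> P" "ev q r \<noteq> \<zero>" for q r
  proof -
    have ry: "\<exists>j. u.has_val (eval r x \<otimes> y) (2 * int j + 1)" if "r \<noteq> []"
      using even[OF \<open>r \<in> P\<close> that] u.has_val_mult[OF _ u.has_val_pi] by blast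
    have cc: "eval q x \<in> carrier K" "eval r x \<otimes> y \<in> carrier K" using that eval_closed xy by auto
    consider "q = []" "r \<noteq> []" | "r = []" "q \<noteq> []" | "q \<noteq> []" "r \<noteq> []" using qr(3) xy by (cases "q = []"; cases "r = []") (auto simp: gev_def)
    then show ?thesis
    proof cases
      case 1 then show ?thesis using ry xy that eval_closed[of r x] by (auto simp: gev_def)
    next
      case 2 then show ?thesis using even[OF that(1)] xy that eval_closed[of q x] by (auto simp: gev_def)
    next
      case 3
      obtain i j where ij: "u.has_val (eval q x) (2 * int i)" "u.has_val (eval r x \<otimes> y) (2 * int j + 1)"
        using even[OF qr(1) 3(1)] ry[OF 3(2)] by blast
      have "2 * int i < 2 * int j + 1 \<or> 2 * int j + 1 < 2 * int i" by presburger
      then show ?thesis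
        using u.has_val_add_less[OF ij] u.has_val_add_less[OF ij(2,1)] a_comm[OF cc] unfolding gev_def by metis
    qed
  qed
  show "\<exists>!v. place a \<zero> v" "place a \<zero> v \<Longrightarrow> v y = 1"
    using place_exists_unique[OF aC b pi tot] by auto
qed

end

section \<open>Points over a given constant, and functions regular on the affine curve\<close>

context hyperelliptic_chart begin

lemma place_closed: "place a b v \<Longrightarrow> v \<in> \<V>"
  and place_x: "place a b v \<Longrightarrow> vanishes_at v (x \<ominus> a)"
  by (simp_all add: place_def)

lemma place_regular: "place a b v \<Longrightarrow> a \<in> C \<Longrightarrow> regular_at v x"
  using regular_if_vanishes_minus[OF place_closed _ x_closed place_x] by blast

text \<open>The product \<open>(y - b) (y + b)\<close> equals \<open>f(x) - f(a)\<close>, which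
  vanishes with \<open>x - a\<close>; hence one of its factors vanishes.\<close>

lemma place_above:
  assumes v: "v \<in> \<V>" and a: "a \<in> C" and va: "vanishes_at v (x \<ominus> a)"
    and b: "b \<in> C" "b \<otimes> b = eval f a"
  shows "place a b v \<or> place a (\<ominus> b) v"
proof -
  have cl: "b \<in> carrier K" "y \<in> carrier K" using b C_closed y_closed by auto
  obtain m where m: "vanishes_at v m" "eval f x = eval f a \<oplus> m"
    using vanishes_eval_diff[OF v a x_closed va f_P] .
  have mc: "m \<in> carrier K" using vanishes_closed[OF m(1)] .
  have e: "(y \<ominus> b) \<otimes> (y \<ominus> (\<ominus> b)) = y \<otimes> y \<ominus> b \<otimes> b" using cl by algebra
  have "y \<otimes> y = b \<otimes> b \<oplus> m" using m(2) curve b(2) by simp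
  moreover have "b \<otimes> b \<oplus> m \<ominus> b \<otimes> b = m" using cl mc by algebra
  ultimately have "(y \<ominus> b) \<otimes> (y \<ominus> (\<ominus> b)) = m" using e by simp
  then have "vanishes_at v (y \<ominus> b) \<or> vanishes_at v (y \<ominus> (\<ominus> b))"
    using vanishes_mult_cases[OF v, of "y \<ominus> b" "y \<ominus> (\<ominus> b)"] m(1) cl by simp
  then show ?thesis using v va by (auto simp: place_def)
qed

lemma ramified_val_x:
  assumes a: "simple_root a" and pl: "place a \<zero> v"
  shows "v (x \<ominus> a) = 2"
proof -
  have aC: "a \<in> C" and v: "v \<in> \<V>" using a pl by (auto simp: simple_root_def place_def)
  obtain g where g: "g \<in> P" "f = lin a \<otimes>\<^bsub>C[X]\<^esub> g" "eval g a \<noteq> \<zero>"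
    using a by (auto simp: simple_root_def)
  have "v (y \<otimes> y) = 2" using val_mult[OF v y_nonzero y_nonzero] ramified_place(2)[OF a pl] by simp
  moreover have "y \<otimes> y = (x \<ominus> a) \<otimes> eval g x"
    using curve g(2) eval_P_mult[OF lin_P[OF aC] g(1) x_closed] eval_lin[OF aC x_closed] by simp
  ultimately show ?thesis
    using val_mult[OF v x_minus_nonzero[OF aC]] val_eval_nonroot[OF v aC x_closed place_x[OF pl] g(1,3)] by simp
qed

lemma ramified_val_even:
  assumes a: "simple_root a" and pl: "place a \<zero> v" and q: "q \<in> P" "q \<noteq> []"
  shows "\<exists>i. v (eval q x) = 2 * int i"
proof -
  have aC: "a \<in> C" and v: "v \<in> \<V>" using a pl by (auto simp: simple_root_def place_def)
  obtain i r where r: "r \<in> P" "eval r a \<noteq> \<zero>"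
    "\<And>z. z \<in> carrier K \<Longrightarrow> eval q z = (z \<ominus> a) [^] (i::nat) \<otimes> eval r z"
    using root_power_factor[OF q aC] by metis
  note r0 = val_eval_nonroot[OF v aC x_closed place_x[OF pl] r(1,2)]
  have "v (eval q x) = int i * v (x \<ominus> a) + 0"
    using val_mult[OF v nonzero_pow[OF x_minus_nonzero[OF aC], of i] r0(1)] r0(2)
      val_pow[OF v x_minus_nonzero[OF aC]] r(3)[OF x_closed] by simp
  then show ?thesis using ramified_val_x[OF a pl] by (intro exI[of _ i]) simp
qed

lemma conjugate_zero:
  assumes cl: "s \<in> carrier K" "t \<in> carrier K" "b \<in> carrier K" "b \<noteq> \<zero>"
    and 1: "s \<oplus> t \<otimes> b = \<zero>" and 2: "s \<oplus> t \<otimes> (\<ominus> b) = \<zero>"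
  shows "s = \<zero>" "t = \<zero>"
proof -
  have "\<ominus> (t \<otimes> b) = s" using minus_equality[OF 1] cl by simp
  then have "s \<oplus> s = \<zero>" using 2 r_minus[OF cl(2,3)] by simp
  then show s: "s = \<zero>" by (rule double_zero[OF cl(1)])
  then have "t \<otimes> b = \<zero>" using 1 cl by simp
  then show "t = \<zero>" using integral[of t b] cl by blast
qed

lemma exists_place:
  assumes roots: "\<And>a. a \<in> C \<Longrightarrow> eval f a = \<zero> \<Longrightarrow> simple_root a"
    and a: "a \<in> C" "b \<in> C" "b \<otimes> b = eval f a"
  shows "\<exists>v. place a b v"
proof (cases "b = \<zero>")
  case True
  then have "eval f a = \<zero>" using a(3) by simp
  then show ?thesis using ramified_place(1)[OF roots[OF a(1)]] True by blast
next
  case False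
  then show ?thesis using unramified_place(1)[OF a] by blast
qed

text \<open>The affine coordinate ring is integrally closed because \<open>f\<close> has simple
  roots only. A denominator \<open>s\<close> is removed one root at a time: at each root
  \<open>a\<close> of \<open>s\<close> regularity forces \<open>q(a) = r(a) = 0\<close>, so
  \<open>x - a\<close> can be cancelled.\<close>

lemma regular_finite:
  assumes roots: "\<And>a. a \<in> C \<Longrightarrow> eval f a = \<zero> \<Longrightarrow> simple_root a"
    and z: "z \<in> carrier K" and reg: "\<And>v. v \<in> \<V> \<Longrightarrow> regular_at v x \<Longrightarrow> regular_at v z"
  shows "\<exists>q\<in>P. \<exists>r\<in>P. z = ev q r"
proof -
  have "\<exists>q\<in>P. \<exists>r\<in>P. z = ev q r"
    if "q \<in> P" "r \<in> P" "s \<in> P" "s \<noteq> []" "z \<otimes> eval s x = ev q r" for q r s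
    using that
  proof (induction "length s" arbitrary: q r s rule: less_induct)
    case less
    note qrs = less(2-6)
    have xy: "x \<in> carrier K" "y \<in> carrier K" using x_closed y_closed by auto
    show ?case
    proof (cases "degree s = 0")
      case True
      then obtain c where "s = [c]" using qrs(4) by (cases s) auto
      then have c: "s = [c]" "c \<in> C" "c \<noteq> \<zero>" using P_lead[OF qrs(3)] by auto
      then have cn: "c \<in> nonzero K" using C_closed by (auto simp: nonzero_iff)
      let ?p = "poly_of_const (inv c)"
      have ci: "inv c \<in> C" using C_inv c by auto
      have p: "?p \<in> P" "eval ?p x = inv c" using poly_of_const_P[OF ci] eval_poly_of_const[OF ci xy(1)] by auto
      have cc: "c \<in> carrier K" "inv c \<in> carrier K" using c ci C_closed by auto
      have "z \<otimes> c = ev q r" using qrs(5) c(1) xy cc by simp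
      then have "z \<otimes> (c \<otimes> inv c) = ev q r \<otimes> inv c" using m_assoc[OF z cc] by simp
      then have "z = ev q r \<otimes> ev ?p []"
        using nonzero_inv(2)[OF cn] z gev_Nil[OF p(1) xy] p(2) by simp
      then show ?thesis
        using gev_mult[OF qrs(1,2) p(1) P_Nil xy curve] qrs(1,2) p(1) f_P by (metis P_add P_mult P_Nil)
    next
      case False
      then obtain a where a: "a \<in> C" "eval s a = \<zero>" using exists_root[OF qrs(3)] by blast
      have ac: "a \<in> carrier K" using a C_closed by auto
      obtain s1 where s1: "s1 \<in> P" "\<And>z. z \<in> carrier K \<Longrightarrow> eval s z = (z \<ominus> a) \<otimes> eval s1 z"
        "s1 \<noteq> []" "length s = Suc (length s1)" using root_factor[OF qrs(3) a] qrs(4) by metis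
      obtain b where b: "b \<in> C" "b \<otimes> b = eval f a" using exists_sqrt[OF eval_P_C[OF f_P a(1)]] .
      have bc: "b \<in> carrier K" using b C_closed by auto
      \<comment> \<open>At every point over \<open>a\<close> the numerator is \<open>x - a\<close>
        times a regular function.\<close>
      have key: "gev q r a c = \<zero> \<and> regular_at v (z \<otimes> eval s1 x)" if pl: "place a c v" "c \<in> C" for c v
      proof -
        have v: "v \<in> \<V>" using place_closed[OF pl(1)] .
        have rx: "regular_at v x" using place_regular[OF pl(1) a(1)] .
        have rz: "regular_at v (z \<otimes> eval s1 x)"
          using regular_mult[OF v reg[OF v rx] regular_eval[OF v rx s1(1)]] .
        have "ev q r = (x \<ominus> a) \<otimes> (z \<otimes> eval s1 x)"
          using qrs(5) s1(2)[OF xy(1)] z xy ac eval_closed[OF s1(1) xy(1)] by (simp add: m_ac)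
        then have "vanishes_at v (ev q r)" using vanishes_mult[OF v place_x[OF pl(1)] rz] by simp
        then show ?thesis using place_vanishes[OF pl(1) a(1) pl(2) qrs(1,2)] rz by blast
      qed
      have zero: "eval q a = \<zero> \<and> eval r a = \<zero>"
      proof (cases "b = \<zero>")
        case b0: False
        have nb: "\<ominus> b \<in> C" "(\<ominus> b) \<otimes> (\<ominus> b) = eval f a" using C_ops(6)[OF b(1)] b(2) bc eval_closed[OF f_P ac] by (simp_all add: l_minus r_minus)
        obtain v w where "place a b v" "place a (\<ominus> b) w"
          using exists_place[OF roots a(1) b] exists_place[OF roots a(1) nb] by blast
        then have "gev q r a b = \<zero>" "gev q r a (\<ominus> b) = \<zero>" using key b(1) nb(1) by blast+
        then show ?thesis
          using conjugate_zero[OF eval_closed[OF qrs(1) ac] eval_closed[OF qrs(2) ac] bc b0] by (simp add: gev_def)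
      next
        case b0: True
        then have "eval f a = \<zero>" using b by simp
        then have sr: "simple_root a" using roots a(1) by blast
        obtain v where pl: "place a \<zero> v" using exists_place[OF roots a(1) b] b0 by blast
        have v: "v \<in> \<V>" using place_closed[OF pl] .
        have rx: "regular_at v x" using place_regular[OF pl a(1)] .
        have k: "gev q r a \<zero> = \<zero>" "regular_at v (z \<otimes> eval s1 x)" using key[OF pl C_ops(1)] by auto
        have q0: "eval q a = \<zero>" using k(1) eval_closed[OF qrs(1) ac] eval_closed[OF qrs(2) ac] by (simp add: gev_def)
        obtain q1 where q1: "q1 \<in> P" "\<And>z. z \<in> carrier K \<Longrightarrow> eval q z = (z \<ominus> a) \<otimes> eval q1 z"
          using root_factor[OF qrs(1) a(1) q0] by metis
        \<comment> \<open>Over a root of \<open>f\<close> there is only one point, and it yields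
          \<open>q(a) = 0\<close> alone. With \<open>q = (X - a) q1\<close> the identity becomes
          \<open>r(x) y = (x - a) w\<close> with \<open>w\<close> regular.\<close>
        define w where "w = z \<otimes> eval s1 x \<oplus> \<ominus> (eval q1 x)"
        have rw: "regular_at v w" unfolding w_def
          using regular_add[OF v k(2) regular_neg[OF v regular_eval[OF v rx q1(1)]]] .
        have r0: "eval r a = \<zero>"
        proof (cases "r = []")
          case False
          have rn: "eval r x \<in> nonzero K" using eval_x_nonzero[OF qrs(2) False] .
          have id: "t = d \<otimes> (u \<oplus> \<ominus> e)"
            if "d \<otimes> u = d \<otimes> e \<oplus> t" "d \<in> carrier K" "e \<in> carrier K" "t \<in> carrier K" "u \<in> carrier K" for d e t u
          proof -
            have "t = (d \<otimes> e \<oplus> t) \<oplus> \<ominus> (d \<otimes> e)" using that(2-4) by algebra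
            also have "\<dots> = d \<otimes> u \<oplus> \<ominus> (d \<otimes> e)" using that(1) by simp
            also have "\<dots> = d \<otimes> (u \<oplus> \<ominus> e)" using that(2-5) by (simp add: r_distr r_minus)
            finally show ?thesis .
          qed
          have "(x \<ominus> a) \<otimes> (z \<otimes> eval s1 x) = (x \<ominus> a) \<otimes> eval q1 x \<oplus> eval r x \<otimes> y"
            using qrs(5) s1(2)[OF xy(1)] q1(2)[OF xy(1)] z xy ac eval_closed[OF s1(1) xy(1)]
            by (simp add: m_ac gev_def)
          from id[OF this] have ry: "eval r x \<otimes> y = (x \<ominus> a) \<otimes> w" unfolding w_def
            using xy ac z eval_closed[OF s1(1) xy(1)] eval_closed[OF q1(1) xy(1)] eval_closed[OF qrs(2) xy(1)] by simp
          have "eval r x \<otimes> y \<in> nonzero K" using nonzero_mult[OF rn y_nonzero] .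
          then have "w \<noteq> \<zero>" using ry xy ac by (auto simp: nonzero_iff)
          then have wn: "w \<in> nonzero K" "0 \<le> v w" using rw by (simp_all add: regular_at_def nonzero_iff)
          \<comment> \<open>Here \<open>y\<close> has order \<open>1\<close> and
            \<open>x - a\<close> order \<open>2\<close>, so \<open>r(x)\<close> has positive order
            and \<open>a\<close> is a root of \<open>r\<close>.\<close>
          have "v (eval r x) + 1 = 2 + v w"
            using val_mult[OF v rn y_nonzero] val_mult[OF v x_minus_nonzero[OF a(1)] wn(1)] ry
              ramified_val_x[OF sr pl] ramified_place(2)[OF sr pl] by simp
          then have "vanishes_at v (eval r x)" using wn(2) rn by (simp add: vanishes_at_def nonzero_iff)
          then have "vanishes_at v (ev r [])" using gev_Nil[OF qrs(2) xy] by simp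
          then show ?thesis
            using place_vanishes[OF pl a(1) C_ops(1) qrs(2) P_Nil] gev_Nil[OF qrs(2) ac zero_closed] by simp
        qed simp
        show ?thesis using q0 r0 by simp
      qed
      obtain q1 where q1: "q1 \<in> P" "\<And>z. z \<in> carrier K \<Longrightarrow> eval q z = (z \<ominus> a) \<otimes> eval q1 z"
        using root_factor[OF qrs(1) a(1)] zero by metis
      obtain r1 where r1: "r1 \<in> P" "\<And>z. z \<in> carrier K \<Longrightarrow> eval r z = (z \<ominus> a) \<otimes> eval r1 z"
        using root_factor[OF qrs(2) a(1)] zero by metis
      note cl = eval_closed[OF s1(1) xy(1)] eval_closed[OF q1(1) xy(1)] eval_closed[OF r1(1) xy(1)]
      have "(x \<ominus> a) \<otimes> (z \<otimes> eval s1 x) = (x \<ominus> a) \<otimes> ev q1 r1"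
        using qrs(5) s1(2)[OF xy(1)] q1(2)[OF xy(1)] r1(2)[OF xy(1)] cl z xy ac
        by (simp add: gev_def m_ac r_distr)
      then have "z \<otimes> eval s1 x = ev q1 r1"
        using m_lcancel[of "x \<ominus> a"] x_minus_nonzero[OF a(1)] z cl(1) gev_closed[OF q1(1) r1(1) xy]
        by (simp add: nonzero_iff)
      then show ?thesis using less(1)[OF _ q1(1) r1(1) s1(1,3)] s1(4) by simp
    qed
  qed
  then show ?thesis using generate[OF z] unfolding gev_def by blast
qed

section \<open>Reciprocal polynomials and the chart at infinity\<close>

lemma x_nonzero: "x \<in> nonzero K"
  using x_minus_nonzero[OF C_ops(1)] x_closed by (simp add: a_minus_def)

text \<open>The exponent is the length, one more than the degree; this accounts for the factor
  \<open>z\<close> on the right and includes the empty list.\<close>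

lemma eval_rev:
  assumes "set p \<subseteq> C" "z \<in> nonzero K"
  shows "eval (rev p) (inv z) \<otimes> z [^] length p = z \<otimes> eval p z"
  using assms(1)
proof (induction p)
  case (Cons c p)
  have z: "z \<in> carrier K" "inv z \<in> carrier K" "inv z \<otimes> z = \<one>"
    using assms(2) nonzero_inv[OF assms(2)] by (auto simp: nonzero_iff)
  have p: "set p \<subseteq> carrier K" "set (rev p) \<subseteq> carrier K" "c \<in> carrier K" using Cons C_closed by auto
  have e: "eval (rev p) (inv z) \<in> carrier K" "eval p z \<in> carrier K"
    using eval_in_carrier[OF p(2) z(2)] eval_in_carrier[OF p(1) z(1)] by auto
  have "eval (rev (c # p)) (inv z) = eval (rev p) (inv z) \<otimes> inv z \<oplus> c"
    using eval_append_aux[OF p(2,3) z(2)] by simp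
  then have "eval (rev (c # p)) (inv z) \<otimes> z [^] length (c # p)
      = (eval (rev p) (inv z) \<otimes> inv z \<oplus> c) \<otimes> (z [^] length p \<otimes> z)" by simp
  also have "\<dots> = (inv z \<otimes> z) \<otimes> (eval (rev p) (inv z) \<otimes> z [^] length p) \<oplus> z \<otimes> (c \<otimes> z [^] length p)"
    using z(1,2) e p(3) by (simp add: m_ac l_distr r_distr)
  also have "\<dots> = z \<otimes> eval p z \<oplus> z \<otimes> (c \<otimes> z [^] length p)"
    using z Cons e by simp
  also have "\<dots> = z \<otimes> eval (c # p) z" using z e p(3) by (simp add: r_distr a_comm)
  finally show ?case .
qed (use assms in \<open>simp add: nonzero_iff\<close>)

text \<open>The polynomial \<open>t^N p(1/t)\<close>: the coefficients in reverse order, padded with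
  zeros. A vanishing constant term of \<open>p\<close> becomes a leading zero, which
  \<open>normalize\<close> removes. If \<open>N\<close> is the degree of \<open>p\<close>, the new
  constant term is the leading coefficient of \<open>p\<close>.\<close>

lemma reversal:
  assumes p: "p \<in> P" and N: "length p \<le> Suc N"
  obtains p' where "p' \<in> P" "\<And>z. z \<in> nonzero K \<Longrightarrow> eval p z \<otimes> inv z [^] N = eval p' (inv z)"
    "p \<noteq> [] \<Longrightarrow> p' \<noteq> []" "length p = Suc N \<Longrightarrow> eval p' \<zero> = lead_coeff p"
proof -
  define k where "k = Suc N - length p"
  let ?l = "rev p @ replicate k \<zero>"
  define p' where "p' = normalize ?l"
  have sC: "set ?l \<subseteq> C" using P_set[OF p] C_ops by auto
  then have sl: "set ?l \<subseteq> carrier K" using C_closed by blast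
  have p'P: "p' \<in> P" unfolding p'_def using normalize_gives_polynomial[OF sC] by (simp add: univ_poly_carrier)
  have e': "eval p' t = eval (rev p) t \<otimes> t [^] k" if "t \<in> carrier K" for t
  proof -
    have "eval p' t = eval ?l t" unfolding p'_def using eval_normalize[OF sl that] .
    also have "\<dots> = eval (rev p) t \<otimes> t [^] k \<oplus> eval (replicate k \<zero>) t"
      using eval_append[of "rev p" "replicate k \<zero>" t] sl that by simp
    also have "eval (replicate k \<zero>) t = \<zero>"
      using eval_replicate[of "[]" t k] that by simp
    finally show ?thesis using eval_in_carrier[of "rev p" t] sl that by simp
  qed
  have main: "eval p z \<otimes> inv z [^] N = eval p' (inv z)" if zn: "z \<in> nonzero K" for z
  proof -
    have z: "z \<in> carrier K" "inv z \<in> carrier K" "z \<otimes> inv z = \<one>"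
      using zn nonzero_inv[OF zn] by (auto simp: nonzero_iff)
    have e: "eval (rev p) (inv z) \<in> carrier K" "eval p z \<in> carrier K"
      using eval_in_carrier[of "rev p" "inv z"] eval_closed[OF p z(1)] sl z by auto
    have pw: "z [^] n \<otimes> inv z [^] n = \<one>" for n :: nat
    proof -
      have "(z \<otimes> inv z) [^] n = z [^] n \<otimes> inv z [^] n" using z by (intro nat_pow_distrib) auto
      then show ?thesis using z by simp
    qed
    have "eval p z \<otimes> inv z [^] N = (z \<otimes> inv z) \<otimes> (eval p z \<otimes> inv z [^] N)" using z e by simp
    also have "\<dots> = (z \<otimes> eval p z) \<otimes> inv z [^] Suc N" using z(1,2) e by (simp add: m_ac)
    also have "\<dots> = eval (rev p) (inv z) \<otimes> z [^] length p \<otimes> inv z [^] (length p + k)"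
      using eval_rev[OF P_set[OF p] zn] N by (simp add: k_def)
    also have "\<dots> = eval (rev p) (inv z) \<otimes> inv z [^] k \<otimes> (z [^] length p \<otimes> inv z [^] length p)"
      using z(1,2) e by (simp add: nat_pow_mult[symmetric] m_ac)
    also have "\<dots> = eval p' (inv z)" using pw e' e z(2) by simp
    finally show ?thesis .
  qed
  have "p' \<noteq> []" if "p \<noteq> []"
  proof
    assume "p' = []"
    then have "eval p x \<otimes> inv x [^] N = \<zero>" using main[OF x_nonzero] by simp
    then show False
      using nonzero_mult[OF eval_x_nonzero[OF p that] nonzero_pow[OF nonzero_inv(1)[OF x_nonzero]]]
      by (simp add: nonzero_iff)
  qed
  moreover have "eval p' \<zero> = lead_coeff p" if h: "length p = Suc N"
  proof -
    obtain c l where p1: "p = c # l" using h by (cases p) auto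
    have "eval p' \<zero> = eval (rev p) \<zero>" using e'[of \<zero>] that sl eval_in_carrier[of "rev p" \<zero>] by (simp add: k_def)
    also have "\<dots> = eval (rev l) \<zero> \<otimes> \<zero> \<oplus> c" unfolding p1 using eval_append_aux[of "rev l" c \<zero>] sl p1 by simp
    also have "\<dots> = lead_coeff p" using p1 sl eval_in_carrier[of "rev l" \<zero>] by simp
    finally show ?thesis .
  qed
  ultimately show thesis using that p'P main by blast
qed

text \<open>Dividing \<open>y^2 = f(x)\<close> by \<open>x^(2g+2)\<close>, where
  \<open>2g + 2\<close> is the degree of \<open>f\<close>, gives an equation of the same form in
  \<open>t = 1/x\<close> and \<open>w = y/x^(g+1)\<close>. At \<open>t = 0\<close> its right side is
  the leading coefficient of \<open>f\<close>, which is nonzero, so both points at infinity are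
  unramified.\<close>

lemma infinity_chart:
  assumes f: "length f = 2 * g + 3"
  obtains f' where "hyperelliptic_chart K C (inv x) (y \<otimes> inv x [^] Suc g) f'" "eval f' \<zero> = lead_coeff f"
proof -
  let ?t = "inv x" and ?w = "y \<otimes> inv x [^] Suc g"
  have xn: "x \<in> nonzero K" and tn: "?t \<in> nonzero K" using x_nonzero nonzero_inv by auto
  have cl: "x \<in> carrier K" "y \<in> carrier K" "?t \<in> carrier K" "x \<otimes> ?t = \<one>" "?t \<otimes> x = \<one>"
    using xn tn nonzero_inv[OF xn] y_closed by (auto simp: nonzero_iff)
  have itx: "inv ?t = x" using cl by (intro comm_inv_char) auto
  obtain f' where f': "f' \<in> P" "\<And>z. z \<in> nonzero K \<Longrightarrow> eval f z \<otimes> inv z [^] (2 * g + 2) = eval f' (inv z)"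
    "eval f' \<zero> = lead_coeff f"
    using reversal[OF f_P, of "2 * g + 2"] f by (metis Suc_eq_plus1 add_Suc_right eval_nat_numeral(3) le_refl)
  have pw: "x [^] n \<otimes> ?t [^] n = \<one>" for n :: nat
  proof -
    have "(x \<otimes> ?t) [^] n = x [^] n \<otimes> ?t [^] n" using cl(1-3) by (intro nat_pow_distrib) auto
    then show ?thesis using cl by simp
  qed
  have "hyperelliptic_chart K C ?t ?w f'"
  proof (unfold_locales)
    show "?t \<in> carrier K" "?w \<in> carrier K" "f' \<in> P" using cl f' by auto
    have "?w \<otimes> ?w = (y \<otimes> y) \<otimes> (?t [^] Suc g \<otimes> ?t [^] Suc g)" using cl(2,3) by (simp add: m_ac)
    also have "?t [^] Suc g \<otimes> ?t [^] Suc g = ?t [^] (2 * g + 2)"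
      using nat_pow_mult[OF cl(3), of "Suc g" "Suc g"] by (simp add: mult_2)
    finally show "?w \<otimes> ?w = eval f' ?t" using f'(2)[OF xn] curve by simp
  next
    fix q r assume qr: "q \<in> P" "r \<in> P" "eval q ?t \<oplus> eval r ?t \<otimes> ?w = \<zero>"
    \<comment> \<open>Large enough to clear the denominators of \<open>q\<close> and
      \<open>r\<close>. The exponent for \<open>q\<close> exceeds that for \<open>r\<close> by
      \<open>g + 1\<close> because \<open>w\<close> already contains \<open>t^(g+1)\<close>.\<close>
    define M where "M = length q + length r"
    obtain q' where q': "q' \<in> P" "\<And>z. z \<in> nonzero K \<Longrightarrow> eval q z \<otimes> inv z [^] (M + Suc g) = eval q' (inv z)"
      "q \<noteq> [] \<Longrightarrow> q' \<noteq> []" using reversal[OF qr(1), of "M + Suc g"] by (auto simp: M_def)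
    obtain r' where r': "r' \<in> P" "\<And>z. z \<in> nonzero K \<Longrightarrow> eval r z \<otimes> inv z [^] M = eval r' (inv z)"
      "r \<noteq> [] \<Longrightarrow> r' \<noteq> []" using reversal[OF qr(2), of M] by (auto simp: M_def)
    have e: "eval q ?t \<in> carrier K" "eval r ?t \<in> carrier K" using eval_closed qr cl by auto
    have "eval q' x \<oplus> eval r' x \<otimes> y = eval q ?t \<otimes> x [^] (M + Suc g) \<oplus> eval r ?t \<otimes> x [^] M \<otimes> y"
      using q'(2)[OF tn] r'(2)[OF tn] itx by simp
    also have "\<dots> = eval q ?t \<otimes> x [^] (M + Suc g) \<oplus> eval r ?t \<otimes> x [^] M \<otimes> y \<otimes> (x [^] Suc g \<otimes> ?t [^] Suc g)"
      using pw[of "Suc g"] e cl by simp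
    also have "\<dots> = (eval q ?t \<oplus> eval r ?t \<otimes> ?w) \<otimes> x [^] (M + Suc g)"
      using e cl(1-3) by (simp add: nat_pow_mult[symmetric] m_ac l_distr r_distr del: nat_pow_Suc)
    also have "\<dots> = \<zero>" using qr(3) cl by simp
    finally show "q = [] \<and> r = []" using indep[OF q'(1) r'(1)] q'(3) r'(3) by blast
  next
    fix z assume z: "z \<in> carrier K"
    obtain q r s where qrs: "q \<in> P" "r \<in> P" "s \<in> P" "s \<noteq> []" "z \<otimes> eval s x = eval q x \<oplus> eval r x \<otimes> y"
      using generate[OF z] by blast
    \<comment> \<open>As before, now clearing denominators in the opposite direction, by a
      multiplication with \<open>t^(M+g+1)\<close>.\<close>
    define M where "M = length q + length r + length s"
    obtain q' where q': "q' \<in> P" "\<And>z. z \<in> nonzero K \<Longrightarrow> eval q z \<otimes> inv z [^] (M + Suc g) = eval q' (inv z)"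
      using reversal[OF qrs(1), of "M + Suc g"] by (auto simp: M_def)
    obtain r' where r': "r' \<in> P" "\<And>z. z \<in> nonzero K \<Longrightarrow> eval r z \<otimes> inv z [^] M = eval r' (inv z)"
      using reversal[OF qrs(2), of M] by (auto simp: M_def)
    obtain s' where s': "s' \<in> P" "\<And>z. z \<in> nonzero K \<Longrightarrow> eval s z \<otimes> inv z [^] (M + Suc g) = eval s' (inv z)"
      "s' \<noteq> []" using reversal[OF qrs(3), of "M + Suc g"] qrs(4) by (auto simp: M_def)
    have e: "eval q x \<in> carrier K" "eval r x \<in> carrier K" "eval s x \<in> carrier K" using eval_closed qrs cl by auto
    have "z \<otimes> eval s' ?t = (z \<otimes> eval s x) \<otimes> ?t [^] (M + Suc g)"
      using s'(2)[OF xn, symmetric] z e cl by (simp add: m_assoc)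
    also have "\<dots> = (eval q x \<oplus> eval r x \<otimes> y) \<otimes> ?t [^] (M + Suc g)" using qrs(5) by simp
    also have "\<dots> = eval q x \<otimes> ?t [^] (M + Suc g) \<oplus> (eval r x \<otimes> ?t [^] M) \<otimes> ?w"
      using e cl(1-3) by (simp add: nat_pow_mult[symmetric] m_ac l_distr r_distr del: nat_pow_Suc)
    also have "\<dots> = eval q' ?t \<oplus> eval r' ?t \<otimes> ?w" using q'(2)[OF xn] r'(2)[OF xn] by simp
    finally show "\<exists>q\<in>P. \<exists>r\<in>P. \<exists>s\<in>P. s \<noteq> [] \<and> z \<otimes> eval s ?t = eval q ?t \<oplus> eval r ?t \<otimes> ?w"
      using q'(1) r'(1) s'(1,3) by blast
  qed
  then show thesis using that f'(3) by blast
qed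

end

section \<open>Two-torsion divisors\<close>

text \<open>The function \<open>divisor_degree\<close> with an arbitrary type of points, so that it
  applies to an abstract field.\<close>

definition frag_degree :: "('b \<Rightarrow>\<^sub>0 int) \<Rightarrow> int" where
  "frag_degree D = (\<Sum>v\<in>Poly_Mapping.keys D. Poly_Mapping.lookup D v)"

lemma frag_degree_superset:
  "finite S \<Longrightarrow> Poly_Mapping.keys D \<subseteq> S \<Longrightarrow> frag_degree D = (\<Sum>v\<in>S. Poly_Mapping.lookup D v)"
  unfolding frag_degree_def by (rule sum.mono_neutral_left) (auto simp: in_keys_iff)

lemma frag_degree_add: "frag_degree (D + E) = frag_degree D + frag_degree E"
proof -
  let ?S = "Poly_Mapping.keys D \<union> Poly_Mapping.keys E"
  have "frag_degree (D + E) = (\<Sum>v\<in>?S. Poly_Mapping.lookup (D + E) v)"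
    using keys_add[of D E] by (intro frag_degree_superset) auto
  also have "\<dots> = (\<Sum>v\<in>?S. Poly_Mapping.lookup D v) + (\<Sum>v\<in>?S. Poly_Mapping.lookup E v)"
    by (simp add: lookup_add sum.distrib)
  also have "\<dots> = frag_degree D + frag_degree E"
    using frag_degree_superset[of ?S D] frag_degree_superset[of ?S E] by simp
  finally show ?thesis .
qed

lemma frag_degree_minus: "frag_degree (- D) = - frag_degree D"
  by (simp add: frag_degree_def sum_negf)

section \<open>Functions without poles, and orders at infinity\<close>

context hyperelliptic_chart begin

text \<open>A function regular on the affine curve is \<open>q(x) + r(x) y\<close>. If it had a
  positive pole order bound \<open>n\<close>, its product with \<open>t^n\<close> would vanish at
  both points at infinity, which are conjugate; this annihilates the terms of highest weight in
  \<open>q\<close> and in \<open>r y\<close> separately.\<close>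

lemma no_poles_constant:
  assumes roots: "\<And>a. a \<in> C \<Longrightarrow> eval f a = \<zero> \<Longrightarrow> simple_root a"
    and f: "length f = 2 * g + 3"
    and z: "z \<in> carrier K" and reg: "\<And>v. v \<in> \<V> \<Longrightarrow> regular_at v z"
  shows "z \<in> C"
proof -
  obtain q r where qr: "q \<in> P" "r \<in> P" "z = ev q r"
    using regular_finite[OF roots z reg] by blast
  let ?t = "inv x" and ?w = "y \<otimes> inv x [^] Suc g"
  obtain f' where chart: "hyperelliptic_chart K C ?t ?w f'" and f'0: "eval f' \<zero> = lead_coeff f"
    using infinity_chart[OF f] .
  interpret c2: hyperelliptic_chart K C ?t ?w f' by (rule chart)
  have fn: "f \<noteq> []" using f by auto
  have c: "lead_coeff f \<in> C" "lead_coeff f \<noteq> \<zero>" using P_lead[OF f_P fn] by auto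
  obtain b where b: "b \<in> C" "b \<otimes> b = eval f' \<zero>" using exists_sqrt[OF c(1)] f'0 by metis
  have bc: "b \<in> carrier K" using b C_closed by auto
  have b0: "b \<noteq> \<zero>" using b(2) f'0 c(2) bc by auto
  have nb: "\<ominus> b \<in> C" "(\<ominus> b) \<otimes> (\<ominus> b) = eval f' \<zero>" "\<ominus> b \<noteq> \<zero>"
    using C_ops(6)[OF b(1)] b(2) bc b0 eval_closed[OF c2.f_P zero_closed] by (simp_all add: l_minus r_minus)
  obtain v1 v2 where v: "c2.place \<zero> b v1" "c2.place \<zero> (\<ominus> b) v2"
    using c2.unramified_place(1)[OF C_ops(1) b b0] c2.unramified_place(1)[OF C_ops(1) nb] by blast
  have xn: "x \<in> nonzero K" and tn: "?t \<in> nonzero K" using x_nonzero nonzero_inv by auto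
  have cl: "x \<in> carrier K" "y \<in> carrier K" "?t \<in> carrier K" "?t \<ominus> \<zero> = ?t"
    using xn tn y_closed by (auto simp: nonzero_iff a_minus_def)
  \<comment> \<open>Pole orders at infinity: \<open>x\<close> has weight \<open>1\<close> and
    \<open>y\<close> has weight \<open>g + 1\<close>. The empty \<open>r\<close> is excluded because
    its \<open>degree\<close> is \<open>0\<close> and would contribute \<open>g + 1\<close>.\<close>
  define n where "n = max (degree q) (if r = [] then 0 else degree r + Suc g)"
  have "n = 0"
  proof (rule ccontr)
    assume n0: "n \<noteq> 0"
    have lq: "length q \<le> Suc n" by (auto simp: n_def)
    obtain q' where q': "q' \<in> P" "eval q x \<otimes> ?t [^] n = eval q' ?t" "length q = Suc n \<Longrightarrow> eval q' \<zero> = lead_coeff q"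
      using reversal[OF qr(1) lq] xn by metis
    have "\<exists>r'\<in>P. (eval r x \<otimes> y) \<otimes> ?t [^] n = eval r' ?t \<otimes> ?w \<and>
        (length r + Suc g = Suc n \<longrightarrow> r \<noteq> [] \<longrightarrow> eval r' \<zero> = lead_coeff r)"
    proof (cases "r = []")
      case True
      then show ?thesis using cl by (intro bexI[of _ "[]"]) auto
    next
      case False
      define m where "m = n - Suc g"
      have m: "n = m + Suc g" "length r \<le> Suc m" using False by (auto simp: m_def n_def)
      obtain r' where r': "r' \<in> P" "eval r x \<otimes> ?t [^] m = eval r' ?t" "length r = Suc m \<Longrightarrow> eval r' \<zero> = lead_coeff r"
        using reversal[OF qr(2) m(2)] xn by metis
      have "(eval r x \<otimes> y) \<otimes> ?t [^] n = (eval r x \<otimes> ?t [^] m) \<otimes> ?w"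
        unfolding m(1) using cl(1-3) eval_closed[OF qr(2) cl(1)]
        by (simp add: nat_pow_mult[symmetric] m_ac del: nat_pow_Suc)
      then show ?thesis using r' m(1) by (intro bexI[of _ r']) auto
    qed
    then obtain r' where r': "r' \<in> P" "(eval r x \<otimes> y) \<otimes> ?t [^] n = eval r' ?t \<otimes> ?w"
      "length r + Suc g = Suc n \<Longrightarrow> r \<noteq> [] \<Longrightarrow> eval r' \<zero> = lead_coeff r" by blast
    have e: "z \<otimes> ?t [^] n = c2.ev q' r'"
      using qr(3) q'(2) r'(2) cl eval_closed[OF qr(1) cl(1)] eval_closed[OF qr(2) cl(1)]
      by (simp add: gev_def l_distr)
    have key: "c2.gev q' r' \<zero> d = \<zero>" if pl: "c2.place \<zero> d v" "d \<in> C" for d v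
    proof -
      have v: "v \<in> \<V>" "vanishes_at v ?t" using c2.place_closed[OF pl(1)] c2.place_x[OF pl(1)] cl(4) by auto
      obtain k where k: "n = Suc k" using n0 by (cases n) auto
      have "vanishes_at v (?t [^] n)"
        unfolding k using vanishes_mult[OF v(1) v(2) regular_pow[OF v(1) vanishes_regular[OF v(2)], of k]] cl
        by (simp add: m_comm)
      then have "vanishes_at v (z \<otimes> ?t [^] n)"
        using vanishes_mult[OF v(1) _ reg[OF v(1)], of "?t [^] n"] z cl by (simp add: m_comm)
      then show ?thesis using c2.place_vanishes[OF pl(1) C_ops(1) pl(2) q'(1) r'(1)] e by simp
    qed
    have "c2.gev q' r' \<zero> b = \<zero>" "c2.gev q' r' \<zero> (\<ominus> b) = \<zero>" using key v b(1) nb(1) by blast+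
    then have zero: "eval q' \<zero> = \<zero>" "eval r' \<zero> = \<zero>"
      using conjugate_zero[OF eval_closed[OF q'(1) zero_closed] eval_closed[OF r'(1) zero_closed] bc b0]
      by (simp_all add: gev_def)
    \<comment> \<open>Whichever of \<open>q\<close> and \<open>r y\<close> attains the maximum
      \<open>n\<close> has its leading coefficient as the value at \<open>t = 0\<close>.\<close>
    show False
    proof (cases "degree q = n")
      case True
      then have "q \<noteq> []" "length q = Suc n" using n0 by auto
      then show False using q'(3) zero(1) P_lead[OF qr(1)] by auto
    next
      case False
      then have "r \<noteq> []" "length r + Suc g = Suc n" using n0 by (auto simp: n_def split: if_splits)
      then show False using r'(3) zero(2) P_lead[OF qr(2)] by auto
    qed
  qed
  then have rq: "r = []" "degree q = 0" by (auto simp: n_def split: if_splits)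
  have "z = eval q x" using qr(3) rq(1) gev_Nil[OF qr(1) cl(1,2)] by simp
  moreover have "eval q x \<in> C"
  proof (cases q)
    case Nil then show ?thesis using C_ops by simp
  next
    case (Cons d l)
    then have "q = [d]" using rq(2) by simp
    then show ?thesis using P_set[OF qr(1)] C_closed cl(1) by auto
  qed
  ultimately show ?thesis by simp
qed

text \<open>The points over \<open>t = 0\<close> are \<open>(0, b)\<close> and
  \<open>(0, - b)\<close>, where \<open>b\<close> is a square root of the leading coefficient of
  \<open>f\<close>. Where \<open>x\<close> has a pole, \<open>t\<close> vanishes, so every such
  valuation is centred at one of the two.\<close>

lemma infinite_places:
  assumes f: "length f = 2 * g + 3"
  shows "\<exists>v1\<in>\<V>. \<exists>v2\<in>\<V>. v1 \<noteq> v2 \<and> v1 x = -1 \<and> v2 x = -1 \<and>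
    (\<forall>v\<in>\<V>. \<not> regular_at v x \<longrightarrow> v = v1 \<or> v = v2)"
proof -
  let ?t = "inv x" and ?w = "y \<otimes> inv x [^] Suc g"
  obtain f' where chart: "hyperelliptic_chart K C ?t ?w f'" and f'0: "eval f' \<zero> = lead_coeff f"
    using infinity_chart[OF f] .
  interpret c2: hyperelliptic_chart K C ?t ?w f' by (rule chart)
  have fn: "f \<noteq> []" using f by auto
  have c: "lead_coeff f \<in> C" "lead_coeff f \<noteq> \<zero>" using P_lead[OF f_P fn] by auto
  obtain b where b: "b \<in> C" "b \<otimes> b = eval f' \<zero>" using exists_sqrt[OF c(1)] f'0 by metis
  have bc: "b \<in> carrier K" using b C_closed by auto
  have b0: "b \<noteq> \<zero>" using b(2) f'0 c(2) bc by auto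
  have nb: "\<ominus> b \<in> C" "(\<ominus> b) \<otimes> (\<ominus> b) = eval f' \<zero>" "\<ominus> b \<noteq> \<zero>"
    using C_ops(6)[OF b(1)] b(2) bc b0 eval_closed[OF c2.f_P zero_closed] by (simp_all add: l_minus r_minus)
  obtain v1 v2 where v: "c2.place \<zero> b v1" "c2.place \<zero> (\<ominus> b) v2"
    using c2.unramified_place(1)[OF C_ops(1) b b0] c2.unramified_place(1)[OF C_ops(1) nb] by blast
  have xn: "x \<in> nonzero K" and tn: "?t \<in> nonzero K" using x_nonzero nonzero_inv by auto
  have cl: "?t \<ominus> \<zero> = ?t" "?w \<in> carrier K" using tn c2.y_closed by (auto simp: nonzero_iff a_minus_def)
  have inV: "v1 \<in> \<V>" "v2 \<in> \<V>" using v c2.place_closed by auto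
  have "v1 ?t = 1" "v2 ?t = 1"
    using c2.unramified_place(2)[OF C_ops(1) b b0 v(1)] c2.unramified_place(2)[OF C_ops(1) nb v(2)] cl(1) by auto
  then have vx: "v1 x = -1" "v2 x = -1" using val_inv[OF inV(1) xn] val_inv[OF inV(2) xn] by auto
  have "v1 \<noteq> v2"
  proof
    assume "v1 = v2"
    then have van: "vanishes_at v1 (?w \<ominus> b)" "vanishes_at v1 (?w \<ominus> (\<ominus> b))"
      using v unfolding c2.place_def by blast+
    have "(?w \<ominus> (\<ominus> b)) \<oplus> \<ominus> (?w \<ominus> b) = b \<oplus> b"
    proof -
      have "(d \<ominus> (\<ominus> b)) \<oplus> \<ominus> (d \<ominus> b) = b \<oplus> b" if "d \<in> carrier K" for d using that bc by algebra
      from this[OF cl(2)] show ?thesis .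
    qed
    then have "vanishes_at v1 (b \<oplus> b)" using vanishes_add[OF inV(1) van(2) vanishes_neg[OF inV(1) van(1)]] by simp
    then have "b \<oplus> b = \<zero>" using const_vanishes[OF inV(1)] C_ops(3)[OF b(1) b(1)] by blast
    then show False using double_zero[OF bc] b0 by blast
  qed
  moreover have "u = v1 \<or> u = v2" if u: "u \<in> \<V>" "\<not> regular_at u x" for u
  proof -
    have "u x < 0" using u(2) xn by (auto simp: regular_at_def nonzero_iff)
    then have "vanishes_at u (?t \<ominus> \<zero>)"
      using val_inv[OF u(1) xn] tn unfolding cl(1) by (simp add: vanishes_at_def nonzero_iff)
    then have "c2.place \<zero> b u \<or> c2.place \<zero> (\<ominus> b) u" using c2.place_above[OF u(1) C_ops(1) _ b] by blast
    then show ?thesis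
      using c2.unramified_place(1)[OF C_ops(1) b b0] c2.unramified_place(1)[OF C_ops(1) nb] v by blast
  qed
  ultimately show ?thesis using inV vx by blast
qed

text \<open>\<open>h(x)/x^(degree h)\<close> is a polynomial in \<open>1/x\<close> whose value at
  \<open>0\<close> is the leading coefficient of \<open>h\<close>, hence of order zero.\<close>

lemma val_at_infinity:
  assumes v: "v \<in> \<V>" and vx: "v x < 0" and h: "h \<in> P" "h \<noteq> []"
  shows "v (eval h x) = int (degree h) * v x"
proof -
  let ?t = "inv x"
  have xn: "x \<in> nonzero K" and tn: "?t \<in> nonzero K" using x_nonzero nonzero_inv by auto
  have vt: "v ?t = - v x" using val_inv[OF v xn] .
  have cl: "?t \<ominus> \<zero> = ?t" "?t \<in> carrier K" using tn by (auto simp: nonzero_iff a_minus_def)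
  have van: "vanishes_at v (?t \<ominus> \<zero>)" unfolding cl(1) using vt vx tn by (simp add: vanishes_at_def nonzero_iff)
  have len: "length h = Suc (degree h)" using h(2) by (cases h) auto
  obtain h' where h': "h' \<in> P" "eval h x \<otimes> ?t [^] degree h = eval h' ?t" "eval h' \<zero> = lead_coeff h"
    using reversal[OF h(1), of "degree h"] xn len by (metis order_refl)
  have "eval h' \<zero> \<noteq> \<zero>" using h'(3) P_lead[OF h] by auto
  then have "v (eval h' ?t) = 0" using val_eval_nonroot(2)[OF v C_ops(1) cl(2) van h'(1)] by blast
  then have "v (eval h x) + int (degree h) * v ?t = 0"
    using val_mult[OF v eval_x_nonzero[OF h] nonzero_pow[OF tn], of "degree h"] val_pow[OF v tn] h'(2) by simp
  then show ?thesis using vt by simp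
qed

section \<open>Divisors of the factors of \<open>f\<close> and their halves\<close>

definition root_set :: "'a list \<Rightarrow> 'a set" where
  "root_set h = {a \<in> C. eval h a = \<zero>}"

text \<open>Cancelling \<open>X - a\<close> in \<open>f\<close> shows that \<open>h1 h'\<close> does
  not vanish at \<open>a\<close>: a simple root of \<open>f\<close> belongs to only one of the two
  factors, and only once.\<close>

lemma simple_root_cancel:
  assumes "simple_root a" and h: "h \<in> P" "h' \<in> P" "f = h \<otimes>\<^bsub>C[X]\<^esub> h'" and h0: "eval h a = \<zero>"
  obtains h1 where "h1 \<in> P" "h = lin a \<otimes>\<^bsub>C[X]\<^esub> h1" "eval h1 a \<noteq> \<zero>" "eval h' a \<noteq> \<zero>"
    "\<And>z. z \<in> carrier K \<Longrightarrow> eval h z = (z \<ominus> a) \<otimes> eval h1 z" "h \<noteq> [] \<Longrightarrow> length h = Suc (length h1) \<and> h1 \<noteq> []"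
proof -
  interpret UP: domain "C[X]" by (rule P_domain)
  obtain g where g: "g \<in> P" "f = lin a \<otimes>\<^bsub>C[X]\<^esub> g" "eval g a \<noteq> \<zero>" and a: "a \<in> C"
    using assms(1) by (auto simp: simple_root_def)
  have ac: "a \<in> carrier K" using a C_closed by auto
  obtain h1 where h1: "h1 \<in> P" "h = lin a \<otimes>\<^bsub>C[X]\<^esub> h1"
    "\<And>z. z \<in> carrier K \<Longrightarrow> eval h z = (z \<ominus> a) \<otimes> eval h1 z"
    "h \<noteq> [] \<Longrightarrow> h1 \<noteq> [] \<and> length h = Suc (length h1)" using root_factor[OF h(1) a h0] by metis
  have "lin a \<otimes>\<^bsub>C[X]\<^esub> g = lin a \<otimes>\<^bsub>C[X]\<^esub> (h1 \<otimes>\<^bsub>C[X]\<^esub> h')"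
    using g(2) h(3) h1(2) UP.m_assoc[OF lin_P[OF a] h1(1) h(2)] by simp
  then have "g = h1 \<otimes>\<^bsub>C[X]\<^esub> h'"
    using UP.m_lcancel[OF _ lin_P[OF a] g(1) P_mult[OF h1(1) h(2)]] by (simp add: univ_poly_zero)
  then have "eval h1 a \<otimes> eval h' a \<noteq> \<zero>" using g(3) eval_P_mult[OF h1(1) h(2) ac] by simp
  then have "eval h1 a \<noteq> \<zero>" "eval h' a \<noteq> \<zero>" using eval_closed[OF h1(1) ac] eval_closed[OF h(2) ac] by auto
  then show thesis using that h1 by blast
qed

lemma card_root_set:
  assumes roots: "\<And>a. a \<in> C \<Longrightarrow> eval f a = \<zero> \<Longrightarrow> simple_root a" and fn: "f \<noteq> []"
    and h: "h \<in> P" "h' \<in> P" "f = h \<otimes>\<^bsub>C[X]\<^esub> h'"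
  shows "finite (root_set h) \<and> card (root_set h) = degree h"
  using h
proof (induction "length h" arbitrary: h h' rule: less_induct)
  case less
  interpret UP: domain "C[X]" by (rule P_domain)
  note h = less(2-4)
  have hn: "h \<noteq> []" using fn h P_mult_Nil by auto
  show ?case
  proof (cases "degree h = 0")
    case True
    then obtain c where "h = [c]" using hn by (cases h) auto
    then have c: "h = [c]" "c \<noteq> \<zero>" "c \<in> C" using P_lead[OF h(1)] by auto
    have "eval h a \<noteq> \<zero>" if "a \<in> C" for a using c that C_closed by auto
    then have "root_set h = {}" by (auto simp: root_set_def)
    then show ?thesis using True by simp
  next
    case False
    then obtain a where a: "a \<in> C" "eval h a = \<zero>" using exists_root[OF h(1)] by blast
    have ac: "a \<in> carrier K" using a C_closed by auto
    have "eval f a = \<zero>" using h(3) eval_P_mult[OF h(1,2) ac] a(2) eval_closed[OF h(2) ac] by simp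
    then have sr: "simple_root a" using roots a(1) by blast
    obtain h1 where h1: "h1 \<in> P" "h = lin a \<otimes>\<^bsub>C[X]\<^esub> h1" "eval h1 a \<noteq> \<zero>"
      "\<And>z. z \<in> carrier K \<Longrightarrow> eval h z = (z \<ominus> a) \<otimes> eval h1 z" "length h = Suc (length h1)" "h1 \<noteq> []"
      using simple_root_cancel[OF sr h a(2)] hn by metis
    \<comment> \<open>The linear factor moves to the complementary factor, so the product is still
      \<open>f\<close> and the induction applies to \<open>h1\<close>.\<close>
    have "f = h1 \<otimes>\<^bsub>C[X]\<^esub> (lin a \<otimes>\<^bsub>C[X]\<^esub> h')"
      using h(3) h1(2) UP.m_ac lin_P[OF a(1)] h1(1) h(2) by simp
    then have IH: "finite (root_set h1)" "card (root_set h1) = degree h1"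
      using less(1)[of h1 "lin a \<otimes>\<^bsub>C[X]\<^esub> h'"] h1(1,5) P_mult[OF lin_P[OF a(1)] h(2)] by auto
    have iff: "eval h b = \<zero> \<longleftrightarrow> b = a \<or> eval h1 b = \<zero>" if "b \<in> C" for b
    proof -
      have bc: "b \<in> carrier K" using that C_closed by auto
      have "b \<ominus> a = \<zero> \<longleftrightarrow> b = a" using bc ac by simp
      then show ?thesis
        unfolding h1(4)[OF bc] using integral_iff[OF minus_closed[OF bc ac] eval_closed[OF h1(1) bc]] by blast
    qed
    have "root_set h = insert a (root_set h1)" using iff a by (auto simp: root_set_def)
    moreover have "a \<notin> root_set h1" using h1(3) by (simp add: root_set_def)
    moreover have "degree h = Suc (degree h1)" using h1(5,6) by (cases h1) auto
    ultimately show ?thesis using IH by simp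
  qed
qed

lemma divisor_val:
  assumes sr: "simple_root a" and pl: "place a \<zero> v" and h: "h \<in> P" "h' \<in> P" "f = h \<otimes>\<^bsub>C[X]\<^esub> h'"
  shows "v (eval h x) = (if eval h a = \<zero> then 2 else 0)"
proof -
  have a: "a \<in> C" using sr by (simp add: simple_root_def)
  have v: "v \<in> \<V>" using place_closed[OF pl] .
  show ?thesis
  proof (cases "eval h a = \<zero>")
    case True
    obtain h1 where h1: "h1 \<in> P" "eval h1 a \<noteq> \<zero>" "\<And>z. z \<in> carrier K \<Longrightarrow> eval h z = (z \<ominus> a) \<otimes> eval h1 z"
      using simple_root_cancel[OF sr h True] by metis
    note n1 = val_eval_nonroot[OF v a x_closed place_x[OF pl] h1(1,2)]
    show ?thesis using True val_mult[OF v x_minus_nonzero[OF a] n1(1)] n1(2) h1(3)[OF x_closed]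
        ramified_val_x[OF sr pl] by simp
  next
    case False
    then show ?thesis using val_eval_nonroot(2)[OF v a x_closed place_x[OF pl] h(1)] by simp
  qed
qed

text \<open>The divisor of \<open>h(x)\<close> consists of the ramified points over the roots of
  \<open>h\<close>, each with coefficient \<open>2\<close>, and of the two points at infinity, each
  with coefficient \<open>- degree h\<close>. All coefficients are even, and their halves add up to
  zero because \<open>h\<close> has \<open>degree h\<close> distinct roots.\<close>

lemma half_divisor:
  assumes roots: "\<And>a. a \<in> C \<Longrightarrow> eval f a = \<zero> \<Longrightarrow> simple_root a" and f: "length f = 2 * g + 3"
    and h: "h \<in> P" "h' \<in> P" "f = h \<otimes>\<^bsub>C[X]\<^esub> h'" and even: "even (degree h)"
  shows "\<exists>D. Poly_Mapping.keys D \<subseteq> \<V> \<and> frag_degree D = 0 \<and>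
    (\<forall>v\<in>\<V>. 2 * Poly_Mapping.lookup D v = v (eval h x))"
proof -
  have fn: "f \<noteq> []" using f by auto
  have hn: "h \<noteq> []" using fn h P_mult_Nil by auto
  obtain v1 v2 where inf: "v1 \<in> \<V>" "v2 \<in> \<V>" "v1 \<noteq> v2" "v1 x = -1" "v2 x = -1"
    "\<And>v. v \<in> \<V> \<Longrightarrow> \<not> regular_at v x \<Longrightarrow> v = v1 \<or> v = v2" using infinite_places[OF f] by blast
  define p where "p a = (THE v. place a \<zero> v)" for a
  define e where "e = int (degree h) div 2"
  have e: "2 * e = int (degree h)" using even by (simp add: e_def)
  note card = card_root_set[OF roots fn h]
  have sr: "simple_root a" if "a \<in> root_set h" for a
  proof -
    have a: "a \<in> C" "a \<in> carrier K" "eval h a = \<zero>" using that C_closed by (auto simp: root_set_def)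
    have "eval f a = \<zero>" using h(3) eval_P_mult[OF h(1,2) a(2)] a(3) eval_closed[OF h(2) a(2)] by simp
    then show ?thesis using roots a(1) by blast
  qed
  have pl: "place a \<zero> (p a)" if "a \<in> root_set h" for a
    unfolding p_def using theI'[OF ramified_place(1)[OF sr[OF that]]] .
  have xn: "x \<noteq> \<zero>" using x_nonzero by (simp add: nonzero_iff)
  have nreg: "\<not> regular_at v1 x" "\<not> regular_at v2 x" using inf(4,5) xn by (auto simp: regular_at_def)
  have preg: "regular_at (p a) x" if "a \<in> root_set h" for a
    using place_regular[OF pl[OF that]] that by (simp add: root_set_def)
  have p_inf: "p a \<noteq> v1" "p a \<noteq> v2" if "a \<in> root_set h" for a using preg[OF that] nreg by auto
  \<comment> \<open>At a common point \<open>x - a\<close> and \<open>x - b\<close> vanish, hence so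
    does the constant \<open>b - a\<close>.\<close>
  have p_inj: "a = b" if pa: "a \<in> root_set h" and pb: "b \<in> root_set h" and eq: "p a = p b" for a b
  proof -
    have v: "p a \<in> \<V>" using place_closed[OF pl[OF pa]] .
    have ab: "a \<in> C" "b \<in> C" using pa pb by (auto simp: root_set_def)
    then have cl: "a \<in> carrier K" "b \<in> carrier K" using C_closed by auto
    have "(x \<ominus> a) \<oplus> \<ominus> (x \<ominus> b) = b \<ominus> a" using x_closed cl by algebra
    then have "vanishes_at (p a) (b \<ominus> a)"
      using vanishes_add[OF v place_x[OF pl[OF pa]] vanishes_neg[OF v]] place_x[OF pl[OF pb]] eq by metis
    then have "b \<ominus> a = \<zero>" using const_vanishes[OF v] C_ops(5)[OF ab(2,1)] by blast
    then show ?thesis using cl by simp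
  qed
  define D where "D = (\<Sum>a\<in>root_set h. frag_of (p a)) - frag_cmul e (frag_of v1 + frag_of v2)"
  have lk: "Poly_Mapping.lookup D v = (\<Sum>a\<in>root_set h. if v = p a then 1 else 0)
      - e * ((if v = v1 then 1 else 0) + (if v = v2 then 1 else 0))" for v
    by (simp add: D_def lookup_minus lookup_sum lookup_add)
  have lk_p: "Poly_Mapping.lookup D (p a) = 1" if "a \<in> root_set h" for a
  proof -
    have "(\<Sum>b\<in>root_set h. if p a = p b then 1 else 0) = (\<Sum>b\<in>root_set h. if b = a then 1 else (0::int))"
      using p_inj[OF that] by (intro sum.cong) auto
    also have "\<dots> = 1" using card that by simp
    finally show ?thesis using lk p_inf[OF that] by simp
  qed
  have lk_inf: "Poly_Mapping.lookup D v = - e" if "v = v1 \<or> v = v2" for v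
  proof -
    have "(\<Sum>a\<in>root_set h. if v = p a then 1 else (0::int)) = 0" using p_inf that by (intro sum.neutral) auto
    then show ?thesis using lk[of v] that inf(3) by auto
  qed
  have lk_other: "Poly_Mapping.lookup D v = 0" if "v \<noteq> v1" "v \<noteq> v2" "v \<notin> p ` root_set h" for v
  proof -
    have "(\<Sum>a\<in>root_set h. if v = p a then 1 else (0::int)) = 0" using that by (intro sum.neutral) auto
    then show ?thesis using lk[of v] that by auto
  qed
  have keys: "Poly_Mapping.keys D \<subseteq> p ` root_set h \<union> {v1, v2}"
    using lk_other by (auto simp: in_keys_iff)
  have sub: "p ` root_set h \<union> {v1, v2} \<subseteq> \<V>" using inf(1,2) place_closed[OF pl] by auto
  have fin: "finite (p ` root_set h)" using card by simp
  have "frag_degree D = (\<Sum>v\<in>p ` root_set h \<union> {v1, v2}. Poly_Mapping.lookup D v)"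
    using frag_degree_superset[OF _ keys] fin by simp
  also have "\<dots> = (\<Sum>v\<in>p ` root_set h. Poly_Mapping.lookup D v) + (\<Sum>v\<in>{v1, v2}. Poly_Mapping.lookup D v)"
    using fin p_inf by (intro sum.union_disjoint) auto
  also have "(\<Sum>v\<in>p ` root_set h. Poly_Mapping.lookup D v) = int (degree h)"
    using card p_inj lk_p by (subst sum.reindex) (auto simp: inj_on_def)
  also have "(\<Sum>v\<in>{v1, v2}. Poly_Mapping.lookup D v) = - 2 * e" using inf(3) lk_inf by simp
  finally have deg: "frag_degree D = 0" using e by simp
  \<comment> \<open>Three kinds of valuations: those with a pole of \<open>x\<close>, those at which
    \<open>h(x)\<close> vanishes, and those at which \<open>h(x)\<close> has order zero. One of the
    second kind lies over a root of \<open>f\<close>, hence is a \<open>p a\<close>.\<close>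
  have "2 * Poly_Mapping.lookup D v = v (eval h x)" if v: "v \<in> \<V>" for v
  proof (cases "regular_at v x")
    case False
    then have v12: "v = v1 \<or> v = v2" using inf(6) v by blast
    then have "v x = -1" using inf(4,5) by blast
    then have "v (eval h x) = - int (degree h)" using val_at_infinity[OF v _ h(1) hn] by simp
    then show ?thesis using lk_inf[OF v12] e by simp
  next
    case True
    have nv: "v \<noteq> v1" "v \<noteq> v2" using True nreg by auto
    show ?thesis
    proof (cases "vanishes_at v (eval h x)")
      case van: True
      obtain a where a: "a \<in> C" "eval h a = \<zero>" "vanishes_at v (x \<ominus> a)"
        using vanishing_eval_root[OF v True h(1) hn van] .
      have ar: "a \<in> root_set h" using a by (simp add: root_set_def)
      have "place a \<zero> v"
        using place_above[OF v a(1,3) C_ops(1)] simple_root_eval[OF sr[OF ar]] by simp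
      then have "v = p a" using ramified_place(1)[OF sr[OF ar]] pl[OF ar] by blast
      then show ?thesis using lk_p[OF ar] divisor_val[OF sr[OF ar] pl[OF ar] h] a(2) by simp
    next
      case nvan: False
      have "v \<notin> p ` root_set h"
      proof
        assume "v \<in> p ` root_set h"
        then obtain a where a: "a \<in> root_set h" "v = p a" by blast
        then have "v (eval h x) = 2" using divisor_val[OF sr[OF a(1)] pl[OF a(1)] h] by (simp add: root_set_def)
        then show False using nvan eval_closed[OF h(1) x_closed] by (simp add: vanishes_at_def)
      qed
      then have "Poly_Mapping.lookup D v = 0" using lk_other nv by blast
      moreover have "v (eval h x) = 0"
        using nvan regular_eval[OF v True h(1)] eval_x_nonzero[OF h(1) hn]
        by (auto simp: vanishes_at_def regular_at_def nonzero_iff)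
      ultimately show ?thesis by simp
    qed
  qed
  then show ?thesis using deg keys sub by blast
qed

text \<open>The condition on \<open>a\<close> says that \<open>h1\<close> and \<open>h2\<close> have
  different roots, the one on \<open>b\<close> that \<open>h1\<close> and \<open>f/h2\<close> do.
  Modulo squares, \<open>\<phi>\<close> would give a function with a square equal to a constant
  times \<open>h1(x)/h2(x)\<close>; such a function is a rational function of \<open>x\<close>,
  excluded by orders at the point over \<open>a\<close>, or such a function times \<open>y\<close>,
  excluded at the point over \<open>b\<close>.\<close>

lemma half_divisors_inequivalent:
  assumes roots: "\<And>a. a \<in> C \<Longrightarrow> eval f a = \<zero> \<Longrightarrow> simple_root a" and f: "length f = 2 * g + 3"
    and h1: "h1 \<in> P" "h1' \<in> P" "f = h1 \<otimes>\<^bsub>C[X]\<^esub> h1'"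
    and h2: "h2 \<in> P" "h2' \<in> P" "f = h2 \<otimes>\<^bsub>C[X]\<^esub> h2'"
    and a: "a \<in> C" "eval f a = \<zero>" "eval h1 a = \<zero> \<longleftrightarrow> eval h2 a \<noteq> \<zero>"
    and b: "b \<in> C" "eval f b = \<zero>" "eval h1 b = \<zero> \<longleftrightarrow> eval h2 b = \<zero>"
    and \<phi>: "\<phi> \<in> nonzero K" "\<And>v. v \<in> \<V> \<Longrightarrow> v (eval h1 x) = v (eval h2 x) + 2 * v \<phi>"
  shows False
proof -
  interpret UP: domain "C[X]" by (rule P_domain)
  have fn: "f \<noteq> []" using f by auto
  have "h1 \<noteq> []" using fn h1(3) P_mult_Nil[OF h1(1,2)] by metis
  moreover have "h2 \<noteq> []" using fn h2(3) P_mult_Nil[OF h2(1,2)] by metis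
  ultimately have hn: "h1 \<noteq> []" "h2 \<noteq> []" by auto
  note nz = eval_x_nonzero[OF h1(1) hn(1)] eval_x_nonzero[OF h2(1) hn(2)] \<phi>(1)
  note nzi = nonzero_inv(1)[OF nz(1)]
  have cl: "eval h1 x \<in> carrier K" "eval h2 x \<in> carrier K" "\<phi> \<in> carrier K" "inv (eval h1 x) \<in> carrier K"
    using nz nzi by (auto simp: nonzero_iff)
  \<comment> \<open>It has order zero everywhere, hence is a nonzero constant.\<close>
  define u where "u = \<phi> \<otimes> \<phi> \<otimes> eval h2 x \<otimes> inv (eval h1 x)"
  have un: "u \<in> nonzero K" unfolding u_def using nonzero_mult nz nzi by blast
  have "regular_at v u" if v: "v \<in> \<V>" for v
  proof -
    have "v u = v \<phi> + v \<phi> + v (eval h2 x) - v (eval h1 x)"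
      unfolding u_def using nz nzi nonzero_mult by (simp add: val_mult[OF v] val_inv[OF v])
    then have "v u = 0" using \<phi>(2)[OF v] by simp
    then show ?thesis using un by (simp add: regular_at_def nonzero_iff)
  qed
  then have uC: "u \<in> C" using no_poles_constant[OF roots f] un by (simp add: nonzero_iff)
  have u0: "u \<noteq> \<zero>" using un by (simp add: nonzero_iff)
  have eq: "\<phi> \<otimes> \<phi> \<otimes> eval h2 x = u \<otimes> eval h1 x"
    unfolding u_def using cl nonzero_inv(3)[OF nz(1)] by (simp add: m_assoc)
  obtain q r s where qrs: "q \<in> P" "r \<in> P" "s \<in> P" "s \<noteq> []" "\<phi> \<otimes> eval s x = ev q r"
    using generate[OF cl(3)] unfolding gev_def by blast
  have xy: "x \<in> carrier K" "y \<in> carrier K" using x_closed y_closed by auto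
  have sn: "eval s x \<in> nonzero K" using eval_x_nonzero[OF qrs(3,4)] .
  have scl: "eval s x \<in> carrier K" using sn by (simp add: nonzero_iff)
  have zn: "ev q r \<in> nonzero K" using nonzero_mult[OF nz(3) sn] qrs(5) by simp
  have eq2: "ev q r \<otimes> ev q r \<otimes> eval h2 x = u \<otimes> eval h1 x \<otimes> (eval s x \<otimes> eval s x)"
  proof -
    have "ev q r \<otimes> ev q r \<otimes> eval h2 x = (\<phi> \<otimes> \<phi> \<otimes> eval h2 x) \<otimes> (eval s x \<otimes> eval s x)"
      unfolding qrs(5)[symmetric] using cl scl by (simp add: m_ac)
    then show ?thesis using eq by simp
  qed
  \<comment> \<open>With \<open>\<phi> = (q(x) + r(x) y)/s(x)\<close> the equation
    \<open>\<phi>^2 h2(x) = u h1(x)\<close> becomes \<open>A(x) + B(x) y = R(x)\<close>. Hence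
    \<open>B = 2 q r h2\<close> is zero, and one of \<open>q\<close> and \<open>r\<close>
    is.\<close>
  let ?A = "(q \<otimes>\<^bsub>C[X]\<^esub> q \<oplus>\<^bsub>C[X]\<^esub> r \<otimes>\<^bsub>C[X]\<^esub> r \<otimes>\<^bsub>C[X]\<^esub> f) \<otimes>\<^bsub>C[X]\<^esub> h2"
  let ?B = "(q \<otimes>\<^bsub>C[X]\<^esub> r \<oplus>\<^bsub>C[X]\<^esub> r \<otimes>\<^bsub>C[X]\<^esub> q) \<otimes>\<^bsub>C[X]\<^esub> h2"
  let ?R = "poly_of_const u \<otimes>\<^bsub>C[X]\<^esub> h1 \<otimes>\<^bsub>C[X]\<^esub> (s \<otimes>\<^bsub>C[X]\<^esub> s)"
  have inP: "?A \<in> P" "?B \<in> P" "?R \<in> P" using qrs h1(1) h2(1) f_P poly_of_const_P[OF uC] by simp_all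
  have "ev q r \<otimes> ev q r \<otimes> eval h2 x = ev ?A ?B"
  proof -
    have d: "(i \<oplus> j \<otimes> y) \<otimes> k = i \<otimes> k \<oplus> (j \<otimes> k) \<otimes> y"
      if "i \<in> carrier K" "j \<in> carrier K" "k \<in> carrier K" for i j k
      using that xy by (simp add: l_distr r_distr m_ac)
    show ?thesis unfolding gev_mult[OF qrs(1,2,1,2) xy curve]
      unfolding gev_def using qrs h2(1) f_P xy cl d by (simp add: eval_P_mult eval_closed)
  qed
  moreover have "u \<otimes> eval h1 x \<otimes> (eval s x \<otimes> eval s x) = ev ?R []"
    using qrs h1(1) uC poly_of_const_P[OF uC] xy eval_poly_of_const[OF uC xy(1)]
    by (simp add: gev_Nil eval_P_mult)
  ultimately have "ev ?A ?B = ev ?R []" using eq2 by simp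
  then have "?B = []" using ev_inj[OF inP(1,2,3) P_Nil] by blast
  then have B0: "q \<otimes>\<^bsub>C[X]\<^esub> r \<oplus>\<^bsub>C[X]\<^esub> r \<otimes>\<^bsub>C[X]\<^esub> q = []"
    using P_mult_Nil[OF _ h2(1)] hn(2) qrs(1,2) by simp
  have "eval q x \<otimes> eval r x \<oplus> eval q x \<otimes> eval r x = \<zero>"
  proof -
    have "eval (q \<otimes>\<^bsub>C[X]\<^esub> r \<oplus>\<^bsub>C[X]\<^esub> r \<otimes>\<^bsub>C[X]\<^esub> q) x = eval q x \<otimes> eval r x \<oplus> eval r x \<otimes> eval q x"
      using qrs(1,2) xy(1) by (simp add: eval_P_add eval_P_mult)
    then show ?thesis using B0 m_comm[OF eval_closed[OF qrs(1) xy(1)] eval_closed[OF qrs(2) xy(1)]] by simp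
  qed
  then have "eval q x \<otimes> eval r x = \<zero>" by (rule double_zero[OF m_closed[OF eval_closed[OF qrs(1) xy(1)] eval_closed[OF qrs(2) xy(1)]]])
  then have qr0: "q = [] \<or> r = []"
    using integral[OF _ eval_closed[OF qrs(1) xy(1)] eval_closed[OF qrs(2) xy(1)]]
      eval_x_zero[OF qrs(1)] eval_x_zero[OF qrs(2)] by blast
  have vals: "2 * v (ev q r) + v (eval h2 x) = v (eval h1 x) + 2 * v (eval s x)" if v: "v \<in> \<V>" for v
  proof -
    have un': "u \<otimes> eval h1 x \<in> nonzero K" "v u = 0" using nonzero_mult[OF un nz(1)] val_const[OF v uC u0] by auto
    have "v (ev q r \<otimes> ev q r \<otimes> eval h2 x) = 2 * v (ev q r) + v (eval h2 x)"
      using val_mult[OF v nonzero_mult[OF zn zn] nz(2)] val_mult[OF v zn zn] by simp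
    moreover have "v (u \<otimes> eval h1 x \<otimes> (eval s x \<otimes> eval s x)) = v (eval h1 x) + 2 * v (eval s x)"
      using val_mult[OF v un'(1) nonzero_mult[OF sn sn]] val_mult[OF v un nz(1)] val_mult[OF v sn sn] un'(2) by simp
    ultimately show ?thesis using eq2 by simp
  qed
  \<comment> \<open>At a ramified point polynomials in \<open>x\<close> have even order, so their
    squares have order divisible by \<open>4\<close>, while \<open>h1(x)\<close> and
    \<open>h2(x)\<close> have order \<open>0\<close> or \<open>2\<close>. Over \<open>a\<close>
    these orders differ by \<open>2\<close>. Over \<open>b\<close> they agree, but
    \<open>y^2\<close> contributes \<open>2\<close>.\<close>
  show False
  proof (cases "r = []")
    case True
    have sr: "simple_root a" using roots a by blast
    obtain v where pl: "place a \<zero> v" using ramified_place(1)[OF sr] by blast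
    have v: "v \<in> \<V>" using place_closed[OF pl] .
    have z: "ev q r = eval q x" using True gev_Nil[OF qrs(1) xy] by simp
    then have "q \<noteq> []" using zn by (auto simp: nonzero_iff)
    then obtain i j where "v (eval q x) = 2 * int i" "v (eval s x) = 2 * int j"
      using ramified_val_even[OF sr pl qrs(1)] ramified_val_even[OF sr pl qrs(3,4)] by blast
    then have *: "4 * int i + v (eval h2 x) = v (eval h1 x) + 4 * int j" using vals[OF v] z by simp
    then show False using divisor_val[OF sr pl h1] divisor_val[OF sr pl h2] a(3) by (auto split: if_splits) presburger+
  next
    case False
    then have q0: "q = []" using qr0 by blast
    have sr: "simple_root b" using roots b by blast
    obtain v where pl: "place b \<zero> v" using ramified_place(1)[OF sr] by blast
    have v: "v \<in> \<V>" using place_closed[OF pl] .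
    have rn: "eval r x \<in> nonzero K" using eval_x_nonzero[OF qrs(2) False] .
    have z: "ev q r = eval r x \<otimes> y" using q0 rn xy by (simp add: gev_def nonzero_iff)
    have "v (ev q r) = v (eval r x) + 1"
      unfolding z using val_mult[OF v rn y_nonzero] ramified_place(2)[OF sr pl] by simp
    moreover obtain i j where "v (eval r x) = 2 * int i" "v (eval s x) = 2 * int j"
      using ramified_val_even[OF sr pl qrs(2) False] ramified_val_even[OF sr pl qrs(3,4)] by blast
    ultimately have *: "4 * int i + 2 + v (eval h2 x) = v (eval h1 x) + 4 * int j" using vals[OF v] by simp
    moreover have "v (eval h2 x) = v (eval h1 x)"
      using divisor_val[OF sr pl h1] divisor_val[OF sr pl h2] b(3) by simp
    ultimately show False by presburger
  qed
qed

end

section \<open>The divisor class group and its invariants\<close>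

text \<open>With \<open>n\<close> the order of a generator, \<open>n\<close> divides
  \<open>2 i\<close> but not \<open>i\<close>, so \<open>2 i\<close> is an odd multiple of
  \<open>n\<close>; the same holds for \<open>2 j\<close>. Their difference is an even multiple, so
  \<open>n\<close> divides \<open>j - i\<close>. For infinite order \<open>n = 0\<close>, and the
  same divisibilities apply.\<close>

lemma (in group) cyclic_group_involution_unique:
  assumes "cyclic_group G" and a: "a \<in> carrier G" "a \<otimes> a = \<one>" "a \<noteq> \<one>"
    and b: "b \<in> carrier G" "b \<otimes> b = \<one>" "b \<noteq> \<one>"
  shows "a = b"
proof -
  obtain x where x: "x \<in> carrier G" "carrier G = range (\<lambda>n::int. x [^] n)"
    using assms(1) cyclic_group by blast
  then obtain i j :: int where ij: "a = x [^] i" "b = x [^] j" using a(1) b(1) by auto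
  define n where "n = int (ord x)"
  have "x [^] (i + i) = \<one>" "x [^] (j + j) = \<one>" using a(2) b(2) ij int_pow_mult[OF x(1), of i i] int_pow_mult[OF x(1), of j j] by metis+
  then have d: "n dvd i + i" "n dvd j + j" using int_pow_eq_id[OF x(1)] by (simp_all add: n_def)
  have nd: "\<not> n dvd i" "\<not> n dvd j" using a(3) b(3) ij int_pow_eq_id[OF x(1)] by (simp_all add: n_def)
  obtain k l where kl: "i + i = n * k" "j + j = n * l" using d by (auto simp: dvd_def)
  have "odd k"
  proof
    assume "even k"
    then obtain m where "k = 2 * m" by (auto simp: dvd_def)
    then have "i = n * m" using kl(1) by simp
    then show False using nd by simp
  qed
  moreover have "odd l"
  proof
    assume "even l"
    then obtain m where "l = 2 * m" by (auto simp: dvd_def)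
    then have "j = n * m" using kl(2) by simp
    then show False using nd by simp
  qed
  ultimately have "even (l - k)" by simp
  then obtain m where "l - k = 2 * m" by (auto simp: dvd_def)
  then have "l = k + 2 * m" by simp
  then have "j + j = i + i + 2 * (n * m)" using kl by (simp add: distrib_left)
  then have "j - i = n * m" by simp
  then have "n dvd j - i" by simp
  then show ?thesis using int_pow_eq[OF x(1)] ij by (simp add: n_def)
qed

context field_over begin

text \<open>This and the next three definitions are the divisor group, the principal divisors, the
  pull-back and the Jacobian points over an abstract field; \<open>jacobian_points_eq\<close>
  identifies the two versions.\<close>

definition div_group :: "(('a \<Rightarrow> int) \<Rightarrow>\<^sub>0 int) monoid" where
  "div_group = free_Abelian_group \<V>"

definition principals :: "(('a \<Rightarrow> int) \<Rightarrow>\<^sub>0 int) set" where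
  "principals = {D \<in> carrier div_group. \<exists>\<phi>\<in>nonzero K. \<forall>v\<in>\<V>. Poly_Mapping.lookup D v = v \<phi>}"

definition pullback :: "('a \<Rightarrow> 'a) \<Rightarrow> (('a \<Rightarrow> int) \<Rightarrow>\<^sub>0 int) \<Rightarrow> (('a \<Rightarrow> int) \<Rightarrow>\<^sub>0 int)" where
  "pullback \<tau> D = frag_extend (\<lambda>v. frag_of (restrict (v \<circ> \<tau>) (nonzero K))) D"

definition invariant_classes :: "('a \<Rightarrow> 'a) set \<Rightarrow> (('a \<Rightarrow> int) \<Rightarrow>\<^sub>0 int) set monoid" where
  "invariant_classes \<Gamma> = (div_group Mod principals)
     \<lparr>carrier := {c \<in> carrier (div_group Mod principals).
        (\<exists>D\<in>c. frag_degree D = 0) \<and> (\<forall>\<tau>\<in>\<Gamma>. pullback \<tau> ` c = c)}\<rparr>"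

text \<open>The constants are preserved only as a set, because an element of the Galois group moves
  them.\<close>

definition constant_auts :: "('a \<Rightarrow> 'a) set" where
  "constant_auts = {\<tau> \<in> ring_iso K K. \<tau> ` C = C}"

lemma div_group_carrier: "D \<in> carrier div_group \<longleftrightarrow> Poly_Mapping.keys D \<subseteq> \<V>"
  by (simp add: div_group_def)

lemma div_group_mult: "D \<otimes>\<^bsub>div_group\<^esub> E = D + E"
  by (simp add: div_group_def)

lemma div_group_comm_group: "comm_group div_group"
  unfolding div_group_def by (rule abelian_free_Abelian_group)

lemma principals_subgroup: "subgroup principals div_group"
proof -
  interpret D: comm_group div_group by (rule div_group_comm_group)
  show ?thesis
  proof (rule D.subgroupI)
    show "principals \<subseteq> carrier div_group" by (auto simp: principals_def)
    have "0 \<in> principals"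
      unfolding principals_def div_group_carrier using nonzero_one val_one by (intro CollectI conjI bexI[of _ \<one>]) auto
    then show "principals \<noteq> {}" by blast
  next
    fix D assume D: "D \<in> principals"
    then obtain \<phi> where \<phi>: "\<phi> \<in> nonzero K" "\<forall>v\<in>\<V>. Poly_Mapping.lookup D v = v \<phi>" and k: "Poly_Mapping.keys D \<subseteq> \<V>"
      unfolding principals_def div_group_carrier by blast
    have "Poly_Mapping.lookup (- D) v = v (inv \<phi>)" if "v \<in> \<V>" for v
      using \<phi> val_inv[OF that \<phi>(1)] that by simp
    then have "- D \<in> principals"
      unfolding principals_def div_group_carrier using nonzero_inv(1)[OF \<phi>(1)] k by auto
    then show "inv\<^bsub>div_group\<^esub> D \<in> principals" using k by (simp add: div_group_def)
  next
    fix D E assume D: "D \<in> principals" and E: "E \<in> principals"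
    obtain \<phi> where \<phi>: "\<phi> \<in> nonzero K" "\<forall>v\<in>\<V>. Poly_Mapping.lookup D v = v \<phi>" and k: "Poly_Mapping.keys D \<subseteq> \<V>"
      using D unfolding principals_def div_group_carrier by blast
    obtain \<psi> where \<psi>: "\<psi> \<in> nonzero K" "\<forall>v\<in>\<V>. Poly_Mapping.lookup E v = v \<psi>" and l: "Poly_Mapping.keys E \<subseteq> \<V>"
      using E unfolding principals_def div_group_carrier by blast
    have "Poly_Mapping.lookup (D + E) v = v (\<phi> \<otimes> \<psi>)" if "v \<in> \<V>" for v
      using \<phi> \<psi> val_mult[OF that \<phi>(1) \<psi>(1)] that by (simp add: lookup_add)
    moreover have "Poly_Mapping.keys (D + E) \<subseteq> \<V>" using keys_add[of D E] k l by blast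
    ultimately show "D \<otimes>\<^bsub>div_group\<^esub> E \<in> principals"
      unfolding div_group_mult principals_def div_group_carrier using nonzero_mult[OF \<phi>(1) \<psi>(1)] by blast
  qed
qed

section \<open>Automorphisms acting on points and divisors\<close>

lemma aut_nonzero:
  assumes "\<tau> \<in> constant_auts" "z \<in> nonzero K" shows "\<tau> z \<in> nonzero K"
proof -
  have i: "\<tau> \<in> ring_iso K K" using assms(1) by (simp add: constant_auts_def)
  have z: "z \<in> carrier K" "z \<noteq> \<zero>" using assms(2) by (auto simp: nonzero_iff)
  have "\<tau> \<zero> = \<zero>" using ring_hom_zero[of \<tau> K K] i is_ring by (auto simp: ring_iso_def)
  then have "\<tau> z \<noteq> \<zero>" using ring_iso_memE(5)[OF i] z by (auto simp: bij_betw_def inj_on_def)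
  then show ?thesis using ring_iso_memE(1)[OF i z(1)] by (simp add: nonzero_iff)
qed

lemma aut_inverse:
  assumes "\<tau> \<in> constant_auts"
  obtains \<rho> where "\<rho> \<in> constant_auts" "\<And>z. z \<in> carrier K \<Longrightarrow> \<rho> (\<tau> z) = z" "\<And>z. z \<in> carrier K \<Longrightarrow> \<tau> (\<rho> z) = z"
proof -
  have i: "\<tau> \<in> ring_iso K K" and tC: "\<tau> ` C = C" using assms by (auto simp: constant_auts_def)
  note h = ring_iso_memE[OF i]
  define \<rho> where "\<rho> = inv_into (carrier K) \<tau>"
  have inj: "inj_on \<tau> (carrier K)" and surj: "\<tau> ` carrier K = carrier K" using h(5) by (auto simp: bij_betw_def)
  have 1: "\<rho> (\<tau> z) = z" if "z \<in> carrier K" for z unfolding \<rho>_def using inv_into_f_f[OF inj that] .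
  have 2: "\<tau> (\<rho> z) = z" if "z \<in> carrier K" for z unfolding \<rho>_def using f_inv_into_f[of z \<tau> "carrier K"] that surj by simp
  have 3: "\<rho> z \<in> carrier K" if "z \<in> carrier K" for z unfolding \<rho>_def using inv_into_into[of z \<tau> "carrier K"] that surj by simp
  have "\<rho> \<in> ring_iso K K"
  proof (rule ring_iso_memI)
    show "\<rho> (a \<otimes> b) = \<rho> a \<otimes> \<rho> b" if "a \<in> carrier K" "b \<in> carrier K" for a b
      using h(2)[OF 3[OF that(1)] 3[OF that(2)]] 1[of "\<rho> a \<otimes> \<rho> b"] 2 3 that by simp
    show "\<rho> (a \<oplus> b) = \<rho> a \<oplus> \<rho> b" if "a \<in> carrier K" "b \<in> carrier K" for a b
      using h(3)[OF 3[OF that(1)] 3[OF that(2)]] 1[of "\<rho> a \<oplus> \<rho> b"] 2 3 that by simp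
    show "\<rho> \<one> = \<one>" using h(4) 1[of \<one>] by simp
    show "bij_betw \<rho> (carrier K) (carrier K)" unfolding \<rho>_def using bij_betw_inv_into[OF h(5)] .
  qed (use 3 in blast)
  moreover have "\<rho> ` C = C"
  proof -
    have "\<rho> ` \<tau> ` C = C" using 1 C_closed by force
    then show ?thesis using tC by simp
  qed
  ultimately show thesis using that 1 2 by (auto simp: constant_auts_def)
qed

definition transport :: "('a \<Rightarrow> 'a) \<Rightarrow> ('a \<Rightarrow> int) \<Rightarrow> 'a \<Rightarrow> int" where
  "transport \<tau> v = restrict (v \<circ> \<tau>) (nonzero K)"

lemma transport_val: "z \<in> nonzero K \<Longrightarrow> transport \<tau> v z = v (\<tau> z)"
  by (simp add: transport_def)

lemma transport_closed:
  assumes t: "\<tau> \<in> constant_auts" and v: "v \<in> \<V>" shows "transport \<tau> v \<in> \<V>"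
proof -
  have i: "\<tau> \<in> ring_iso K K" and tC: "\<tau> ` C = C" using t by (auto simp: constant_auts_def)
  note h = ring_iso_memE[OF i]
  have cl: "z \<in> carrier K" if "z \<in> nonzero K" for z using that by (simp add: nonzero_iff)
  have t0: "\<tau> \<zero> = \<zero>" using ring_hom_zero[of \<tau> K K] i is_ring by (auto simp: ring_iso_def)
  obtain \<rho> where s: "\<rho> \<in> constant_auts" "\<And>z. z \<in> carrier K \<Longrightarrow> \<tau> (\<rho> z) = z" using aut_inverse[OF t] by metis
  have "transport \<tau> v (a \<otimes> b) = transport \<tau> v a + transport \<tau> v b" if "a \<in> nonzero K" "b \<in> nonzero K" for a b
    using that val_mult[OF v aut_nonzero[OF t that(1)] aut_nonzero[OF t that(2)]] h(2)[OF cl[OF that(1)] cl[OF that(2)]]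
    by (simp add: transport_val nonzero_mult)
  moreover have "min (transport \<tau> v a) (transport \<tau> v b) \<le> transport \<tau> v (a \<oplus> b)"
    if "a \<in> nonzero K" "b \<in> nonzero K" "a \<oplus> b \<noteq> \<zero>" for a b
  proof -
    have ab: "a \<oplus> b \<in> nonzero K" using that by (simp add: nonzero_iff)
    have "\<tau> a \<oplus> \<tau> b \<noteq> \<zero>" using aut_nonzero[OF t ab] h(3)[OF cl[OF that(1)] cl[OF that(2)]] by (simp add: nonzero_iff)
    then show ?thesis
      using that ab val_add[OF v aut_nonzero[OF t that(1)] aut_nonzero[OF t that(2)]] h(3)[OF cl[OF that(1)] cl[OF that(2)]]
      by (simp add: transport_val)
  qed
  moreover have "transport \<tau> v c = 0" if "c \<in> C - {\<zero>}" for c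
  proof -
    have c: "c \<in> nonzero K" "c \<in> C" using that C_closed by (auto simp: nonzero_iff)
    have "\<tau> c \<in> C" using tC c(2) by blast
    moreover have "\<tau> c \<noteq> \<zero>" using aut_nonzero[OF t c(1)] by (simp add: nonzero_iff)
    ultimately show ?thesis using val_const[OF v] transport_val[OF c(1)] by simp
  qed
  moreover have "transport \<tau> v ` nonzero K = UNIV"
  proof (intro equalityI subset_UNIV subsetI)
    fix k
    obtain z where z: "z \<in> nonzero K" "v z = k" using val_surj[OF v] by blast
    have "transport \<tau> v (\<rho> z) = k" using transport_val[OF aut_nonzero[OF s(1) z(1)]] s(2)[OF cl[OF z(1)]] z(2) by simp
    then show "k \<in> transport \<tau> v ` nonzero K" using aut_nonzero[OF s(1) z(1)] by blast
  qed
  moreover have "transport \<tau> v \<in> extensional (nonzero K)" by (simp add: transport_def)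
  ultimately show ?thesis unfolding discrete_valuations_def by simp
qed

lemma transport_inverse:
  assumes t: "\<tau> \<in> constant_auts" "\<rho> \<in> constant_auts" "\<And>z. z \<in> carrier K \<Longrightarrow> \<rho> (\<tau> z) = z" and v: "v \<in> \<V>"
  shows "transport \<tau> (transport \<rho> v) = v"
proof (rule valuation_eqI[OF transport_closed[OF t(1) transport_closed[OF t(2) v]] v])
  fix z assume z: "z \<in> nonzero K"
  then show "transport \<tau> (transport \<rho> v) z = v z"
    using transport_val[OF z] transport_val[OF aut_nonzero[OF t(1) z]] t(3) by (simp add: nonzero_iff)
qed

lemma pullback_keys:
  assumes t: "\<tau> \<in> constant_auts" and D: "Poly_Mapping.keys D \<subseteq> \<V>"
  shows "Poly_Mapping.keys (pullback \<tau> D) \<subseteq> \<V>"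
proof -
  have "Poly_Mapping.keys (pullback \<tau> D) \<subseteq> (\<Union>v\<in>Poly_Mapping.keys D. {transport \<tau> v})"
    using keys_frag_extend[of "\<lambda>v. frag_of (transport \<tau> v)" D] by (simp add: pullback_def transport_def)
  then show ?thesis using D transport_closed[OF t] by blast
qed

text \<open>\<open>transport \<tau>\<close> permutes the points with inverse
  \<open>transport \<rho>\<close>, so only one summand contributes to the coefficient at
  \<open>w\<close>.\<close>

lemma lookup_pullback:
  assumes t: "\<tau> \<in> constant_auts" "\<rho> \<in> constant_auts" "\<And>z. z \<in> carrier K \<Longrightarrow> \<rho> (\<tau> z) = z"
    "\<And>z. z \<in> carrier K \<Longrightarrow> \<tau> (\<rho> z) = z"
    and D: "Poly_Mapping.keys D \<subseteq> \<V>" and w: "w \<in> \<V>"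
  shows "Poly_Mapping.lookup (pullback \<tau> D) w = Poly_Mapping.lookup D (transport \<rho> w)"
proof -
  have "Poly_Mapping.lookup (pullback \<tau> D) w
      = (\<Sum>v\<in>Poly_Mapping.keys D. Poly_Mapping.lookup D v * (if w = transport \<tau> v then 1 else 0))"
    by (simp add: pullback_def frag_extend_def lookup_sum transport_def[symmetric])
  also have "\<dots> = (\<Sum>v\<in>Poly_Mapping.keys D. if v = transport \<rho> w then Poly_Mapping.lookup D v else 0)"
  proof (rule sum.cong[OF refl])
    fix v assume "v \<in> Poly_Mapping.keys D"
    then have v: "v \<in> \<V>" using D by blast
    have "w = transport \<tau> v \<longleftrightarrow> v = transport \<rho> w"
      using transport_inverse[OF t(1-3) w] transport_inverse[OF t(2,1,4) v] by metis
    then show "Poly_Mapping.lookup D v * (if w = transport \<tau> v then 1 else 0) = (if v = transport \<rho> w then Poly_Mapping.lookup D v else 0)"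
      by simp
  qed
  also have "\<dots> = Poly_Mapping.lookup D (transport \<rho> w)" by (simp add: in_keys_iff)
  finally show ?thesis .
qed

lemma divisor_eqI:
  assumes "Poly_Mapping.keys D \<subseteq> \<V>" "Poly_Mapping.keys E \<subseteq> \<V>"
    and "\<And>v. v \<in> \<V> \<Longrightarrow> Poly_Mapping.lookup D v = Poly_Mapping.lookup E v"
  shows "D = E"
proof (rule poly_mapping_eqI)
  fix v show "Poly_Mapping.lookup D v = Poly_Mapping.lookup E v"
  proof (cases "v \<in> \<V>")
    case False
    then have "v \<notin> Poly_Mapping.keys D" "v \<notin> Poly_Mapping.keys E" using assms(1,2) by blast+
    then show ?thesis by (simp add: in_keys_iff)
  qed (rule assms(3))
qed

text \<open>The pull-back of the divisor of \<open>\<phi>\<close> is the divisor of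
  \<open>\<rho> \<phi>\<close>, where \<open>\<rho>\<close> is the inverse of \<open>\<tau>\<close>.
  Equality of the two sets follows by pulling back along \<open>\<rho>\<close> as well.\<close>

lemma pullback_principals:
  assumes t: "\<tau> \<in> constant_auts" shows "pullback \<tau> ` principals = principals"
proof -
  have *: "pullback \<tau> D \<in> principals" if t: "\<tau> \<in> constant_auts" and D: "D \<in> principals" for \<tau> D
  proof -
    obtain \<rho> where s: "\<rho> \<in> constant_auts" "\<And>z. z \<in> carrier K \<Longrightarrow> \<rho> (\<tau> z) = z" "\<And>z. z \<in> carrier K \<Longrightarrow> \<tau> (\<rho> z) = z"
      using aut_inverse[OF t] by metis
    obtain \<phi> where \<phi>: "\<phi> \<in> nonzero K" "\<forall>v\<in>\<V>. Poly_Mapping.lookup D v = v \<phi>" and k: "Poly_Mapping.keys D \<subseteq> \<V>"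
      using D unfolding principals_def div_group_carrier by blast
    have "Poly_Mapping.lookup (pullback \<tau> D) w = w (\<rho> \<phi>)" if w: "w \<in> \<V>" for w
      using lookup_pullback[OF t s k w] \<phi>(2) transport_closed[OF s(1) w] transport_val[OF \<phi>(1)] by simp
    then show ?thesis unfolding principals_def div_group_carrier
      using pullback_keys[OF t k] aut_nonzero[OF s(1) \<phi>(1)] by blast
  qed
  have "D \<in> pullback \<tau> ` principals" if D: "D \<in> principals" for D
  proof -
    obtain \<rho> where s: "\<rho> \<in> constant_auts" "\<And>z. z \<in> carrier K \<Longrightarrow> \<rho> (\<tau> z) = z" "\<And>z. z \<in> carrier K \<Longrightarrow> \<tau> (\<rho> z) = z"
      using aut_inverse[OF t] by metis
    have k: "Poly_Mapping.keys D \<subseteq> \<V>" using D unfolding principals_def div_group_carrier by blast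
    have "pullback \<tau> (pullback \<rho> D) = D"
    proof (rule divisor_eqI[OF pullback_keys[OF t pullback_keys[OF s(1) k]] k])
      fix w assume w: "w \<in> \<V>"
      show "Poly_Mapping.lookup (pullback \<tau> (pullback \<rho> D)) w = Poly_Mapping.lookup D w"
        using lookup_pullback[OF t s pullback_keys[OF s(1) k] w]
          lookup_pullback[OF s(1) t s(3,2) k transport_closed[OF s(1) w]] transport_inverse[OF t s(1,2) w] by simp
    qed
    then show ?thesis using *[OF s(1) D] by (metis imageI)
  qed
  then show ?thesis using *[OF t] by blast
qed

lemma pullback_add: "pullback \<tau> (D + E) = pullback \<tau> D + pullback \<tau> E"
  by (simp add: pullback_def frag_extend_add)

lemma pullback_minus: "pullback \<tau> (- D) = - pullback \<tau> D"
  by (simp add: pullback_def frag_extend_minus)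

section \<open>Invariant divisor classes of degree zero\<close>

abbreviation div_class :: "(('a \<Rightarrow> int) \<Rightarrow>\<^sub>0 int) \<Rightarrow> (('a \<Rightarrow> int) \<Rightarrow>\<^sub>0 int) set" where
  "div_class D \<equiv> principals #>\<^bsub>div_group\<^esub> D"

lemma div_class_eq: "div_class D = (\<lambda>E. E + D) ` principals"
  by (auto simp: r_coset_def div_group_mult)

lemma pullback_class: "\<tau> \<in> constant_auts \<Longrightarrow> pullback \<tau> ` div_class D = div_class (pullback \<tau> D)"
proof -
  assume t: "\<tau> \<in> constant_auts"
  have "pullback \<tau> ` div_class D = (\<lambda>E. E + pullback \<tau> D) ` pullback \<tau> ` principals"
    unfolding div_class_eq image_image pullback_add ..
  then show ?thesis unfolding pullback_principals[OF t] div_class_eq .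
qed

text \<open>The definition asks for some member of degree zero; choosing it as representative turns
  membership into conditions on one divisor.\<close>

lemma invariant_classes_carrier:
  assumes "\<Gamma> \<subseteq> constant_auts"
  shows "carrier (invariant_classes \<Gamma>) = {div_class D | D. Poly_Mapping.keys D \<subseteq> \<V> \<and> frag_degree D = 0 \<and>
     (\<forall>\<tau>\<in>\<Gamma>. div_class (pullback \<tau> D) = div_class D)}" (is "?L = ?R")
proof
  interpret D: comm_group div_group by (rule div_group_comm_group)
  show "?L \<subseteq> ?R"
  proof
    fix c assume "c \<in> ?L"
    then have c: "c \<in> carrier (div_group Mod principals)" "\<exists>D\<in>c. frag_degree D = 0" "\<forall>\<tau>\<in>\<Gamma>. pullback \<tau> ` c = c"
      by (simp_all add: invariant_classes_def)
    obtain D0 where D0: "D0 \<in> carrier div_group" "c = div_class D0" using c(1) unfolding carrier_FactGroup by blast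
    obtain D where D: "D \<in> c" "frag_degree D = 0" using c(2) by blast
    have cD: "c = div_class D" using D.repr_independence[OF _ D0(1) principals_subgroup] D(1) D0(2) by blast
    have "c \<subseteq> carrier div_group"
      unfolding D0(2) using D.r_coset_subset_G[OF subgroup.subset[OF principals_subgroup] D0(1)] .
    then have k: "Poly_Mapping.keys D \<subseteq> \<V>" using D(1) by (simp add: subset_iff div_group_carrier)
    have "div_class (pullback \<tau> D) = div_class D" if "\<tau> \<in> \<Gamma>" for \<tau>
      using pullback_class[OF subsetD[OF assms that], of D] c(3) that cD by simp
    then show "c \<in> ?R" using cD D(2) k by (intro CollectI exI[of _ D]) simp
  qed
  show "?R \<subseteq> ?L"
  proof
    fix c assume "c \<in> ?R"
    then obtain D where D: "c = div_class D" "Poly_Mapping.keys D \<subseteq> \<V>" "frag_degree D = 0"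
      "\<forall>\<tau>\<in>\<Gamma>. div_class (pullback \<tau> D) = div_class D" by blast
    have Dc: "D \<in> carrier div_group" using D(2) by (simp add: div_group_carrier)
    then have "D \<in> c" using D.rcos_self[OF Dc principals_subgroup] D(1) by simp
    moreover have "c \<in> carrier (div_group Mod principals)" unfolding carrier_FactGroup D(1) using Dc by blast
    moreover have "\<forall>\<tau>\<in>\<Gamma>. pullback \<tau> ` c = c"
      using D(4) pullback_class[OF subsetD[OF assms]] unfolding D(1) by simp
    ultimately show "c \<in> ?L" using D(3) by (auto simp: invariant_classes_def)
  qed
qed

lemma div_class_mult:
  assumes "Poly_Mapping.keys D \<subseteq> \<V>" "Poly_Mapping.keys E \<subseteq> \<V>"
  shows "div_class D <#>\<^bsub>div_group\<^esub> div_class E = div_class (D + E)"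
proof -
  interpret D: comm_group div_group by (rule div_group_comm_group)
  interpret N: normal principals div_group using D.subgroup_imp_normal[OF principals_subgroup] .
  show ?thesis using N.rcos_sum assms by (simp add: div_group_carrier div_group_mult)
qed

text \<open>Sums and negatives of representatives of degree zero again have degree zero, and
  pull-backs commute with both.\<close>

lemma invariant_classes_group:
  assumes G: "\<Gamma> \<subseteq> constant_auts" shows "group (invariant_classes \<Gamma>)"
proof -
  interpret D: comm_group div_group by (rule div_group_comm_group)
  interpret N: normal principals div_group using D.subgroup_imp_normal[OF principals_subgroup] .
  interpret Q: group "div_group Mod principals" by (rule N.factorgroup_is_group)
  let ?S = "carrier (invariant_classes \<Gamma>)"
  note car = invariant_classes_carrier[OF G]
  have one: "div_class 0 = principals" by (simp add: div_class_eq)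
  have zero: "div_class 0 \<in> ?S"
    unfolding car using pullback_def frag_degree_def by (intro CollectI exI[of _ 0]) (auto simp: pullback_def frag_degree_def)
  have "subgroup ?S (div_group Mod principals)"
  proof (rule Q.subgroupI)
    show "?S \<subseteq> carrier (div_group Mod principals)" by (auto simp: invariant_classes_def)
    show "?S \<noteq> {}" using zero by blast
  next
    fix c assume "c \<in> ?S"
    then obtain D where D: "c = div_class D" "Poly_Mapping.keys D \<subseteq> \<V>" "frag_degree D = 0"
      "\<forall>\<tau>\<in>\<Gamma>. div_class (pullback \<tau> D) = div_class D" unfolding car by blast
    have kD: "Poly_Mapping.keys (- D) \<subseteq> \<V>" using D(2) by simp
    have inv: "inv\<^bsub>div_group Mod principals\<^esub> (div_class E) = div_class (- E)" if "Poly_Mapping.keys E \<subseteq> \<V>" for E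
    proof (rule Q.inv_equality)
      show "div_class (- E) \<otimes>\<^bsub>div_group Mod principals\<^esub> div_class E = \<one>\<^bsub>div_group Mod principals\<^esub>"
        using div_class_mult[of "- E" E] that one by simp
      show "div_class E \<in> carrier (div_group Mod principals)" "div_class (- E) \<in> carrier (div_group Mod principals)"
        using that unfolding carrier_FactGroup by (simp_all add: div_group_carrier)
    qed
    have "div_class (pullback \<tau> (- D)) = div_class (- D)" if "\<tau> \<in> \<Gamma>" for \<tau>
    proof -
      have "\<tau> \<in> constant_auts" using that G by blast
      then show ?thesis unfolding pullback_minus using inv[OF D(2)] inv[OF pullback_keys[OF _ D(2)]] D(4) that by metis
    qed
    then show "inv\<^bsub>div_group Mod principals\<^esub> c \<in> ?S"
      unfolding D(1) inv[OF D(2)] car using kD D(3) frag_degree_minus[of D]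
      by (intro CollectI exI[of _ "- D"] conjI ballI) simp_all
  next
    fix c d assume "c \<in> ?S" "d \<in> ?S"
    then obtain D E where D: "c = div_class D" "Poly_Mapping.keys D \<subseteq> \<V>" "frag_degree D = 0"
      "\<forall>\<tau>\<in>\<Gamma>. div_class (pullback \<tau> D) = div_class D"
      and E: "d = div_class E" "Poly_Mapping.keys E \<subseteq> \<V>" "frag_degree E = 0"
      "\<forall>\<tau>\<in>\<Gamma>. div_class (pullback \<tau> E) = div_class E" unfolding car by blast
    have k: "Poly_Mapping.keys (D + E) \<subseteq> \<V>" using keys_add[of D E] D(2) E(2) by blast
    have "div_class (pullback \<tau> (D + E)) = div_class (D + E)" if "\<tau> \<in> \<Gamma>" for \<tau>
    proof -
      have t: "\<tau> \<in> constant_auts" using that G by blast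
      show ?thesis unfolding pullback_add
        using div_class_mult[OF pullback_keys[OF t D(2)] pullback_keys[OF t E(2)]] div_class_mult[OF D(2) E(2)] D(4) E(4) that
        by simp
    qed
    then show "c \<otimes>\<^bsub>div_group Mod principals\<^esub> d \<in> ?S"
      unfolding D(1) E(1) mult_FactGroup div_class_mult[OF D(2) E(2)] car
      using k D(3) E(3) frag_degree_add[of D E] by (intro CollectI exI[of _ "D + E"] conjI ballI) simp_all
  qed
  then have "group ((div_group Mod principals)\<lparr>carrier := ?S\<rparr>)" by (rule Q.subgroup_imp_group)
  then show ?thesis by (simp add: invariant_classes_def)
qed

end

context hyperelliptic_chart begin

lemma aut_eval:
  assumes t: "\<tau> \<in> constant_auts" "\<tau> x = x" and p: "p \<in> P" "\<And>c. c \<in> set p \<Longrightarrow> \<tau> c = c"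
  shows "\<tau> (eval p x) = eval p x"
proof -
  have i: "\<tau> \<in> ring_hom K K" using t(1) by (simp add: constant_auts_def ring_iso_def)
  interpret h: ring_hom_ring K K \<tau> using ring_hom_ringI2[OF is_ring is_ring i] .
  have "\<tau> (eval p x) = eval (map \<tau> p) (\<tau> x)" using h.eval_hom[OF subring_C x_closed p(1)] .
  moreover have "map \<tau> p = p" using p(2) by (simp add: map_idI)
  ultimately show ?thesis using t(2) by simp
qed

text \<open>
  The half divisors of \<open>1\<close>, \<open>h1\<close> and \<open>h2\<close> are three distinct classes killed by \<open>2\<close>.
\<close>

theorem invariant_classes_not_cyclic:
  assumes roots: "\<And>a. a \<in> C \<Longrightarrow> eval f a = \<zero> \<Longrightarrow> simple_root a" and f: "length f = 2 * g + 3"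
    and G: "\<Gamma> \<subseteq> constant_auts" "\<And>\<tau>. \<tau> \<in> \<Gamma> \<Longrightarrow> \<tau> x = x"
    and h1: "h1 \<in> P" "h1' \<in> P" "f = h1 \<otimes>\<^bsub>C[X]\<^esub> h1'" "even (degree h1)" "\<And>\<tau> c. \<tau> \<in> \<Gamma> \<Longrightarrow> c \<in> set h1 \<Longrightarrow> \<tau> c = c"
    and h2: "h2 \<in> P" "h2' \<in> P" "f = h2 \<otimes>\<^bsub>C[X]\<^esub> h2'" "even (degree h2)" "\<And>\<tau> c. \<tau> \<in> \<Gamma> \<Longrightarrow> c \<in> set h2 \<Longrightarrow> \<tau> c = c"
    and a1: "\<exists>a\<in>C. eval f a = \<zero> \<and> eval h1 a = \<zero>" "\<exists>a\<in>C. eval f a = \<zero> \<and> eval h1 a \<noteq> \<zero>"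
    and a2: "\<exists>a\<in>C. eval f a = \<zero> \<and> eval h2 a = \<zero>" "\<exists>a\<in>C. eval f a = \<zero> \<and> eval h2 a \<noteq> \<zero>"
    and a12: "\<exists>a\<in>C. eval f a = \<zero> \<and> (eval h1 a = \<zero> \<longleftrightarrow> eval h2 a \<noteq> \<zero>)"
      "\<exists>a\<in>C. eval f a = \<zero> \<and> (eval h1 a = \<zero> \<longleftrightarrow> eval h2 a = \<zero>)"
  shows "\<not> cyclic_group (invariant_classes \<Gamma>)"
proof
  assume cyc: "cyclic_group (invariant_classes \<Gamma>)"
  interpret D: comm_group div_group by (rule div_group_comm_group)
  interpret UP: domain "C[X]" by (rule P_domain)
  interpret J: group "invariant_classes \<Gamma>" using invariant_classes_group[OF G(1)] .
  obtain D1 where D1': "Poly_Mapping.keys D1 \<subseteq> \<V>" "frag_degree D1 = 0"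
    "\<forall>v\<in>\<V>. 2 * Poly_Mapping.lookup D1 v = v (eval h1 x)" using half_divisor[OF roots f h1(1-4)] by blast
  note D1 = D1'(1,2) D1'(3)[rule_format]
  obtain D2 where D2': "Poly_Mapping.keys D2 \<subseteq> \<V>" "frag_degree D2 = 0"
    "\<forall>v\<in>\<V>. 2 * Poly_Mapping.lookup D2 v = v (eval h2 x)" using half_divisor[OF roots f h2(1-4)] by blast
  note D2 = D2'(1,2) D2'(3)[rule_format]
  have fn: "f \<noteq> []" using f by auto
  have hn: "h1 \<noteq> []" "h2 \<noteq> []"
    using fn h1(3) h2(3) P_mult_Nil[OF h1(1,2)] P_mult_Nil[OF h2(1,2)] by metis+
  \<comment> \<open>The orders of \<open>z\<close> determine \<open>D\<close>, being its doubled
    coefficients. An automorphism that fixes \<open>z\<close> permutes the points without changing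
    these orders.\<close>
  have inv: "pullback \<tau> D = D"
    if t: "\<tau> \<in> \<Gamma>" and k: "Poly_Mapping.keys D \<subseteq> \<V>" and z: "z \<in> nonzero K" "\<tau> z = z"
      and d: "\<And>v. v \<in> \<V> \<Longrightarrow> 2 * Poly_Mapping.lookup D v = v z" for \<tau> D z
  proof -
    have tc: "\<tau> \<in> constant_auts" using t G by blast
    obtain \<rho> where s: "\<rho> \<in> constant_auts" "\<And>z. z \<in> carrier K \<Longrightarrow> \<rho> (\<tau> z) = z" "\<And>z. z \<in> carrier K \<Longrightarrow> \<tau> (\<rho> z) = z"
      using aut_inverse[OF tc] by metis
    have zc: "z \<in> carrier K" using z by (simp add: nonzero_iff)
    have sz: "\<rho> z = z" using s(2)[OF zc] z(2) by simp
    show ?thesis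
    proof (rule divisor_eqI[OF pullback_keys[OF tc k] k])
      fix w assume w: "w \<in> \<V>"
      have "2 * Poly_Mapping.lookup (pullback \<tau> D) w = 2 * Poly_Mapping.lookup D w"
        using lookup_pullback[OF tc s k w] d[OF transport_closed[OF s(1) w]] d[OF w] transport_val[OF z(1), of \<rho> w] sz
        by simp
      then show "Poly_Mapping.lookup (pullback \<tau> D) w = Poly_Mapping.lookup D w" by simp
    qed
  qed
  have inv1: "pullback \<tau> D1 = D1" if "\<tau> \<in> \<Gamma>" for \<tau>
  proof (rule inv[OF that D1(1) eval_x_nonzero[OF h1(1) hn(1)] _ D1(3)])
    show "\<tau> (eval h1 x) = eval h1 x" using aut_eval that G h1(1) h1(5)[OF that] by blast
  qed
  have inv2: "pullback \<tau> D2 = D2" if "\<tau> \<in> \<Gamma>" for \<tau>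
  proof (rule inv[OF that D2(1) eval_x_nonzero[OF h2(1) hn(2)] _ D2(3)])
    show "\<tau> (eval h2 x) = eval h2 x" using aut_eval that G h2(1) h2(5)[OF that] by blast
  qed
  have car: "div_class D1 \<in> carrier (invariant_classes \<Gamma>)" "div_class D2 \<in> carrier (invariant_classes \<Gamma>)"
    unfolding invariant_classes_carrier[OF G(1)] using D1 D2 inv1 inv2 by auto
  have one: "\<one>\<^bsub>invariant_classes \<Gamma>\<^esub> = principals" by (simp add: invariant_classes_def FactGroup_def)
  have mult: "c \<otimes>\<^bsub>invariant_classes \<Gamma>\<^esub> d = c <#>\<^bsub>div_group\<^esub> d" for c d by (simp add: invariant_classes_def FactGroup_def)
  have tors: "div_class D \<otimes>\<^bsub>invariant_classes \<Gamma>\<^esub> div_class D = \<one>\<^bsub>invariant_classes \<Gamma>\<^esub>"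
    if k: "Poly_Mapping.keys D \<subseteq> \<V>" and z: "z \<in> nonzero K" and d: "\<And>v. v \<in> \<V> \<Longrightarrow> 2 * Poly_Mapping.lookup D v = v z" for D z
  proof -
    have kk: "Poly_Mapping.keys (D + D) \<subseteq> \<V>" using keys_add[of D D] k by blast
    have "Poly_Mapping.lookup (D + D) v = v z" if "v \<in> \<V>" for v using d[OF that] by (simp add: lookup_add)
    then have p: "D + D \<in> principals" unfolding principals_def div_group_carrier using kk z by blast
    then have "div_class (D + D) = principals"
      using D.coset_join2[OF _ principals_subgroup p] kk by (simp add: div_group_carrier)
    then show ?thesis using div_class_mult[OF k k] mult one by simp
  qed
  have sep: "div_class D \<noteq> div_class E"
    if h: "h \<in> P" "h' \<in> P" "f = h \<otimes>\<^bsub>C[X]\<^esub> h'" and hh: "k \<in> P" "k' \<in> P" "f = k \<otimes>\<^bsub>C[X]\<^esub> k'"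
      and D: "Poly_Mapping.keys D \<subseteq> \<V>" "\<And>v. v \<in> \<V> \<Longrightarrow> 2 * Poly_Mapping.lookup D v = v (eval h x)"
      and E: "Poly_Mapping.keys E \<subseteq> \<V>" "\<And>v. v \<in> \<V> \<Longrightarrow> 2 * Poly_Mapping.lookup E v = v (eval k x)"
      and a: "\<exists>a\<in>C. eval f a = \<zero> \<and> (eval h a = \<zero> \<longleftrightarrow> eval k a \<noteq> \<zero>)"
      and b: "\<exists>a\<in>C. eval f a = \<zero> \<and> (eval h a = \<zero> \<longleftrightarrow> eval k a = \<zero>)" for D E h h' k k'
  proof
    assume eq: "div_class D = div_class E"
    have "D \<in> carrier div_group" using D(1) by (simp add: div_group_carrier)
    then have "D \<in> div_class E" using D.rcos_self[OF _ principals_subgroup] eq by blast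
    then obtain F where F: "F \<in> principals" "D = F + E" unfolding div_class_eq by blast
    obtain \<phi> where \<phi>: "\<phi> \<in> nonzero K" "\<forall>v\<in>\<V>. Poly_Mapping.lookup F v = v \<phi>"
      using F(1) unfolding principals_def by blast
    have val: "v (eval h x) = v (eval k x) + 2 * v \<phi>" if "v \<in> \<V>" for v
      using D(2)[OF that] E(2)[OF that] \<phi>(2) that F(2) by (simp add: lookup_add)
    obtain a where a': "a \<in> C" "eval f a = \<zero>" "eval h a = \<zero> \<longleftrightarrow> eval k a \<noteq> \<zero>" using a by blast
    obtain b where b': "b \<in> C" "eval f b = \<zero>" "eval h b = \<zero> \<longleftrightarrow> eval k b = \<zero>" using b by blast
    show False using half_divisors_inequivalent[OF roots f h hh a' b' \<phi>(1) val] .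
  qed
  have one_P: "[\<one>] \<in> P" using UP.one_closed by (simp add: univ_poly_one)
  have f1: "f = [\<one>] \<otimes>\<^bsub>C[X]\<^esub> f" using UP.l_one[OF f_P] by (simp add: univ_poly_one)
  have ev1: "eval [\<one>] z = \<one>" if "z \<in> carrier K" for z using that by simp
  have z0: "Poly_Mapping.keys (0 :: ('a \<Rightarrow> int) \<Rightarrow>\<^sub>0 int) \<subseteq> \<V>"
    "\<And>v. v \<in> \<V> \<Longrightarrow> 2 * Poly_Mapping.lookup (0 :: ('a \<Rightarrow> int) \<Rightarrow>\<^sub>0 int) v = v (eval [\<one>] x)"
    using val_one ev1[OF x_closed] by simp_all
  have c0: "div_class 0 = principals" by (simp add: div_class_eq)
  have "div_class D1 \<noteq> div_class 0"
    by (rule sep[OF h1(1-3) one_P f_P f1 D1(1,3) z0]) (use a1 ev1 C_closed in force)+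
  then have ne1: "div_class D1 \<noteq> \<one>\<^bsub>invariant_classes \<Gamma>\<^esub>" using one c0 by metis
  have "div_class D2 \<noteq> div_class 0"
    by (rule sep[OF h2(1-3) one_P f_P f1 D2(1,3) z0]) (use a2 ev1 C_closed in force)+
  then have ne2: "div_class D2 \<noteq> \<one>\<^bsub>invariant_classes \<Gamma>\<^esub>" using one c0 by metis
  have "div_class D1 = div_class D2"
    using J.cyclic_group_involution_unique[OF cyc car(1) tors[OF D1(1) eval_x_nonzero[OF h1(1) hn(1)] D1(3)] ne1
        car(2) tors[OF D2(1) eval_x_nonzero[OF h2(1) hn(2)] D2(3)] ne2] .
  then show False using sep[OF h1(1-3) h2(1-3) D1(1,3) D2(1,3) a12] by blast
qed

end

section \<open>The field of fractions\<close>

context domain begin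

abbreviation fractions :: "('a \<times> 'a) set" where
  "fractions \<equiv> carrier R \<times> (carrier R - {\<zero>})"

lemma fraction_rel_iff:
  "((a, b), (c, d)) \<in> fraction_rel R \<longleftrightarrow> (a, b) \<in> fractions \<and> (c, d) \<in> fractions \<and> a \<otimes> d = c \<otimes> b"
  by (auto simp: fraction_rel_def)

text \<open>Transitivity is the point where a domain is required: the middle denominator has to be
  cancelled.\<close>

lemma equiv_fraction_rel: "equiv fractions (fraction_rel R)"
proof (rule equivI)
  show "fraction_rel R \<subseteq> fractions \<times> fractions" by (auto simp: fraction_rel_def)
  show "refl_on fractions (fraction_rel R)"
    by (rule refl_onI) (auto simp: fraction_rel_iff)
  show "sym (fraction_rel R)"
    by (rule symI) (auto simp: fraction_rel_iff)
  show "trans (fraction_rel R)"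
  proof (rule transI)
    fix u v w assume uv: "(u, v) \<in> fraction_rel R" and vw: "(v, w) \<in> fraction_rel R"
    obtain a b c d e g where p: "u = (a, b)" "v = (c, d)" "w = (e, g)" by (metis surj_pair)
    have cl: "a \<in> carrier R" "b \<in> carrier R" "c \<in> carrier R" "d \<in> carrier R" "e \<in> carrier R" "g \<in> carrier R"
      "b \<noteq> \<zero>" "d \<noteq> \<zero>" "g \<noteq> \<zero>" and 1: "a \<otimes> d = c \<otimes> b" and 2: "c \<otimes> g = e \<otimes> d"
      using uv vw unfolding p fraction_rel_iff by auto
    have "d \<otimes> (a \<otimes> g) = (a \<otimes> d) \<otimes> g" using cl by (simp add: m_ac)
    also have "\<dots> = (c \<otimes> g) \<otimes> b" unfolding 1 using cl by (simp add: m_ac)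
    also have "\<dots> = d \<otimes> (e \<otimes> b)" unfolding 2 using cl by (simp add: m_ac)
    finally have "a \<otimes> g = e \<otimes> b" using m_lcancel[of d] cl by simp
    then show "(u, w) \<in> fraction_rel R" unfolding p fraction_rel_iff using cl by simp
  qed
qed

lemma fraction_eq_iff:
  assumes "a \<in> carrier R" "b \<in> carrier R - {\<zero>}" "c \<in> carrier R" "d \<in> carrier R - {\<zero>}"
  shows "fraction R a b = fraction R c d \<longleftrightarrow> a \<otimes> d = c \<otimes> b"
  unfolding fraction_def
  using eq_equiv_class_iff[OF equiv_fraction_rel, of "(a, b)" "(c, d)"] assms by (simp add: fraction_rel_iff)

lemma mem_fraction:
  "(c, d) \<in> fraction R a b \<Longrightarrow> (a, b) \<in> fractions \<and> (c, d) \<in> fractions \<and> a \<otimes> d = c \<otimes> b"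
  by (simp add: fraction_def fraction_rel_iff)

lemma self_fraction: "(a, b) \<in> fractions \<Longrightarrow> (a, b) \<in> fraction R a b"
  by (simp add: fraction_def fraction_rel_iff)

lemma fraction_field_carrier:
  "z \<in> carrier (fraction_field R) \<longleftrightarrow> (\<exists>a\<in>carrier R. \<exists>b\<in>carrier R - {\<zero>}. z = fraction R a b)"
  by (auto simp: fraction_field_def quotient_def fraction_def)

lemma fractionE:
  assumes "z \<in> carrier (fraction_field R)"
  obtains a b where "a \<in> carrier R" "b \<in> carrier R - {\<zero>}" "z = fraction R a b"
  using assms unfolding fraction_field_carrier by (elim bexE) (rule that)

lemma fraction_closed: "a \<in> carrier R \<Longrightarrow> b \<in> carrier R - {\<zero>} \<Longrightarrow> fraction R a b \<in> carrier (fraction_field R)"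
  using fraction_field_carrier by blast

text \<open>The operations of \<open>fraction_field\<close> are unions over all representatives. If
  every pair of representatives gives the same class, the union is that class; the members
  \<open>p\<close> and \<open>q\<close> ensure that it is not empty.\<close>

lemma UN_const2:
  assumes "p \<in> A" "q \<in> B" "\<And>a b c d. (a, b) \<in> A \<Longrightarrow> (c, d) \<in> B \<Longrightarrow> G a b c d = Z"
  shows "(\<Union>(a, b)\<in>A. \<Union>(c, d)\<in>B. G a b c d) = Z"
proof -
  have UN: "(\<Union>i\<in>I. H i) = W" if "j \<in> I" "\<And>i. i \<in> I \<Longrightarrow> H i = W" for I :: "('k \<times> 'l) set" and H and W :: "'m set" and j
    using that by (simp cong: SUP_cong) blast
  have "(\<Union>(c, d)\<in>B. G a b c d) = Z" if "(a, b) \<in> A" for a b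
  proof (rule UN[OF assms(2)])
    fix i assume "i \<in> B"
    then show "(case i of (c, d) \<Rightarrow> G a b c d) = Z" using assms(3)[OF that] by (cases i) simp
  qed
  note inner = this
  show ?thesis
  proof (rule UN[OF assms(1)])
    fix i assume "i \<in> A"
    then show "(case i of (a, b) \<Rightarrow> \<Union>(c, d)\<in>B. G a b c d) = Z" using inner by (cases i) simp
  qed
qed

lemma den_mult: "b \<in> carrier R - {\<zero>} \<Longrightarrow> d \<in> carrier R - {\<zero>} \<Longrightarrow> b \<otimes> d \<in> carrier R - {\<zero>}"
  by (simp add: integral_iff)

lemma fraction_mult:
  assumes "a \<in> carrier R" "b \<in> carrier R - {\<zero>}" "c \<in> carrier R" "d \<in> carrier R - {\<zero>}"
  shows "fraction R a b \<otimes>\<^bsub>fraction_field R\<^esub> fraction R c d = fraction R (a \<otimes> c) (b \<otimes> d)"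
proof -
  have "fraction R (a' \<otimes> c') (b' \<otimes> d') = fraction R (a \<otimes> c) (b \<otimes> d)"
    if "(a', b') \<in> fraction R a b" "(c', d') \<in> fraction R c d" for a' b' c' d'
  proof -
    note 1 = mem_fraction[OF that(1)] and 2 = mem_fraction[OF that(2)]
    have cl: "a' \<in> carrier R" "b' \<in> carrier R - {\<zero>}" "c' \<in> carrier R" "d' \<in> carrier R - {\<zero>}"
      using 1 2 by auto
    have "a' \<otimes> c' \<otimes> (b \<otimes> d) = (a' \<otimes> b) \<otimes> (c' \<otimes> d)" using cl assms by (simp add: m_ac)
    also have "\<dots> = (a \<otimes> b') \<otimes> (c \<otimes> d')" using 1 2 by simp
    also have "\<dots> = a \<otimes> c \<otimes> (b' \<otimes> d')" using cl assms by (simp add: m_ac)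
    finally show ?thesis
      using fraction_eq_iff[OF m_closed[OF cl(1,3)] den_mult[OF cl(2,4)] m_closed[OF assms(1,3)] den_mult[OF assms(2,4)]]
      by simp
  qed
  from UN_const2[OF self_fraction self_fraction this, of a b c d] show ?thesis
    using assms by (simp add: fraction_field_def)
qed

lemma fraction_add:
  assumes "a \<in> carrier R" "b \<in> carrier R - {\<zero>}" "c \<in> carrier R" "d \<in> carrier R - {\<zero>}"
  shows "fraction R a b \<oplus>\<^bsub>fraction_field R\<^esub> fraction R c d = fraction R (a \<otimes> d \<oplus> c \<otimes> b) (b \<otimes> d)"
proof -
  have "fraction R (a' \<otimes> d' \<oplus> c' \<otimes> b') (b' \<otimes> d') = fraction R (a \<otimes> d \<oplus> c \<otimes> b) (b \<otimes> d)"
    if "(a', b') \<in> fraction R a b" "(c', d') \<in> fraction R c d" for a' b' c' d'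
  proof -
    note 1 = mem_fraction[OF that(1)] and 2 = mem_fraction[OF that(2)]
    have cl: "a' \<in> carrier R" "b' \<in> carrier R - {\<zero>}" "c' \<in> carrier R" "d' \<in> carrier R - {\<zero>}"
      using 1 2 by auto
    have "(a' \<otimes> d' \<oplus> c' \<otimes> b') \<otimes> (b \<otimes> d) = (a' \<otimes> b) \<otimes> (d \<otimes> d') \<oplus> (c' \<otimes> d) \<otimes> (b \<otimes> b')"
      using cl assms by (simp add: m_ac l_distr r_distr)
    also have "\<dots> = (a \<otimes> b') \<otimes> (d \<otimes> d') \<oplus> (c \<otimes> d') \<otimes> (b \<otimes> b')" using 1 2 by simp
    also have "\<dots> = (a \<otimes> d \<oplus> c \<otimes> b) \<otimes> (b' \<otimes> d')" using cl assms by (simp add: m_ac l_distr r_distr)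
    moreover have "a' \<otimes> d' \<oplus> c' \<otimes> b' \<in> carrier R" "a \<otimes> d \<oplus> c \<otimes> b \<in> carrier R" using cl assms by simp_all
    ultimately show ?thesis
      using fraction_eq_iff[OF _ den_mult[OF cl(2,4)] _ den_mult[OF assms(2,4)]] by simp
  qed
  from UN_const2[OF self_fraction self_fraction this, of a b c d] show ?thesis
    using assms by (simp add: fraction_field_def)
qed

lemma fraction_field_zero: "\<zero>\<^bsub>fraction_field R\<^esub> = fraction R \<zero> \<one>"
  and fraction_field_one: "\<one>\<^bsub>fraction_field R\<^esub> = fraction R \<one> \<one>"
  by (simp_all add: fraction_field_def)

lemma one_den: "\<one> \<in> carrier R - {\<zero>}"
  by simp

lemma fraction_zero_iff:
  "a \<in> carrier R \<Longrightarrow> b \<in> carrier R - {\<zero>} \<Longrightarrow> fraction R a b = \<zero>\<^bsub>fraction_field R\<^esub> \<longleftrightarrow> a = \<zero>"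
  unfolding fraction_field_zero using fraction_eq_iff[of a b \<zero> \<one>] by simp

lemma fraction_field_is_field: "field (fraction_field R)"
proof -
  let ?F = "fraction_field R"
  have "cring ?F"
  proof (rule cringI)
    show "abelian_group ?F"
    proof (rule abelian_groupI)
      show "u \<oplus>\<^bsub>?F\<^esub> v \<in> carrier ?F" if h: "u \<in> carrier ?F" "v \<in> carrier ?F" for u v
      proof -
        obtain a b where p1: "a \<in> carrier R" "b \<in> carrier R - {\<zero>}" "u = fraction R a b" using fractionE[OF h(1)] .
        obtain c d where p2: "c \<in> carrier R" "d \<in> carrier R - {\<zero>}" "v = fraction R c d" using fractionE[OF h(2)] .
        note p = p1(1,2) p2(1,2) p1(3) p2(3)
        have "a \<otimes> d \<oplus> c \<otimes> b \<in> carrier R" using p(1-4) by simp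
        then show ?thesis unfolding p(5,6) fraction_add[OF p(1-4)] by (rule fraction_closed[OF _ den_mult[OF p(2,4)]])
      qed
      show "\<zero>\<^bsub>?F\<^esub> \<in> carrier ?F" unfolding fraction_field_zero by (rule fraction_closed[OF zero_closed one_den])
      show "u \<oplus>\<^bsub>?F\<^esub> v \<oplus>\<^bsub>?F\<^esub> w = u \<oplus>\<^bsub>?F\<^esub> (v \<oplus>\<^bsub>?F\<^esub> w)"
        if h: "u \<in> carrier ?F" "v \<in> carrier ?F" "w \<in> carrier ?F" for u v w
      proof -
        obtain a b where p1: "a \<in> carrier R" "b \<in> carrier R - {\<zero>}" "u = fraction R a b" using fractionE[OF h(1)] .
        obtain c d where p2: "c \<in> carrier R" "d \<in> carrier R - {\<zero>}" "v = fraction R c d" using fractionE[OF h(2)] .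
        obtain e g where p3: "e \<in> carrier R" "g \<in> carrier R - {\<zero>}" "w = fraction R e g" using fractionE[OF h(3)] .
        note p = p1(1,2) p2(1,2) p3(1,2) p1(3) p2(3) p3(3)
        have "fraction R ((a \<otimes> d \<oplus> c \<otimes> b) \<otimes> g \<oplus> e \<otimes> (b \<otimes> d)) (b \<otimes> d \<otimes> g)
          = fraction R (a \<otimes> (d \<otimes> g) \<oplus> (c \<otimes> g \<oplus> e \<otimes> d) \<otimes> b) (b \<otimes> (d \<otimes> g))"
          using p by (simp add: l_distr r_distr m_ac a_ac)
        moreover have "a \<otimes> d \<oplus> c \<otimes> b \<in> carrier R" "c \<otimes> g \<oplus> e \<otimes> d \<in> carrier R" using p(1-6) by simp_all
        ultimately show ?thesis
          unfolding p(7-9) fraction_add[OF p(1-4)] fraction_add[OF p(3-6)]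
          using fraction_add[OF _ den_mult[OF p(2,4)] p(5,6)] fraction_add[OF p(1,2) _ den_mult[OF p(4,6)]] by simp
      qed
      show "u \<oplus>\<^bsub>?F\<^esub> v = v \<oplus>\<^bsub>?F\<^esub> u" if h: "u \<in> carrier ?F" "v \<in> carrier ?F" for u v
      proof -
        obtain a b where p1: "a \<in> carrier R" "b \<in> carrier R - {\<zero>}" "u = fraction R a b" using fractionE[OF h(1)] .
        obtain c d where p2: "c \<in> carrier R" "d \<in> carrier R - {\<zero>}" "v = fraction R c d" using fractionE[OF h(2)] .
        note p = p1(1,2) p2(1,2) p1(3) p2(3)
        have cl: "b \<in> carrier R" "d \<in> carrier R" using p by auto
        show ?thesis unfolding p(5,6) fraction_add[OF p(1-4)] fraction_add[OF p(3,4,1,2)]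
          using p(1,3) cl by (simp add: a_comm m_comm)
      qed
      show "\<zero>\<^bsub>?F\<^esub> \<oplus>\<^bsub>?F\<^esub> u = u" if h: "u \<in> carrier ?F" for u
      proof -
        obtain a b where p: "a \<in> carrier R" "b \<in> carrier R - {\<zero>}" "u = fraction R a b" using fractionE[OF h] .
        show ?thesis unfolding p(3) fraction_field_zero fraction_add[OF zero_closed one_den p(1,2)] using p(1,2) by simp
      qed
      show "\<exists>v\<in>carrier ?F. v \<oplus>\<^bsub>?F\<^esub> u = \<zero>\<^bsub>?F\<^esub>" if h: "u \<in> carrier ?F" for u
      proof -
        obtain a b where p: "a \<in> carrier R" "b \<in> carrier R - {\<zero>}" "u = fraction R a b" using fractionE[OF h] .
        have "fraction R (\<ominus> a) b \<oplus>\<^bsub>?F\<^esub> u = fraction R (\<ominus> a \<otimes> b \<oplus> a \<otimes> b) (b \<otimes> b)"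
          unfolding p(3) by (rule fraction_add[OF a_inv_closed[OF p(1)] p(2,1,2)])
        also have "\<ominus> a \<otimes> b \<oplus> a \<otimes> b = \<zero>" using p by (simp add: l_minus l_neg)
        also have "fraction R \<zero> (b \<otimes> b) = \<zero>\<^bsub>?F\<^esub>" using fraction_zero_iff[OF zero_closed den_mult[OF p(2,2)]] by simp
        finally show ?thesis using fraction_closed[OF a_inv_closed[OF p(1)] p(2)] by blast
      qed
    qed
    show "comm_monoid ?F"
    proof (rule comm_monoidI)
      show "u \<otimes>\<^bsub>?F\<^esub> v \<in> carrier ?F" if h: "u \<in> carrier ?F" "v \<in> carrier ?F" for u v
      proof -
        obtain a b where p1: "a \<in> carrier R" "b \<in> carrier R - {\<zero>}" "u = fraction R a b" using fractionE[OF h(1)] .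
        obtain c d where p2: "c \<in> carrier R" "d \<in> carrier R - {\<zero>}" "v = fraction R c d" using fractionE[OF h(2)] .
        note p = p1(1,2) p2(1,2) p1(3) p2(3)
        show ?thesis unfolding p(5,6) fraction_mult[OF p(1-4)]
          by (rule fraction_closed[OF m_closed[OF p(1,3)] den_mult[OF p(2,4)]])
      qed
      show "\<one>\<^bsub>?F\<^esub> \<in> carrier ?F" unfolding fraction_field_one by (rule fraction_closed[OF one_closed one_den])
      show "u \<otimes>\<^bsub>?F\<^esub> v \<otimes>\<^bsub>?F\<^esub> w = u \<otimes>\<^bsub>?F\<^esub> (v \<otimes>\<^bsub>?F\<^esub> w)"
        if h: "u \<in> carrier ?F" "v \<in> carrier ?F" "w \<in> carrier ?F" for u v w
      proof -
        obtain a b where p1: "a \<in> carrier R" "b \<in> carrier R - {\<zero>}" "u = fraction R a b" using fractionE[OF h(1)] .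
        obtain c d where p2: "c \<in> carrier R" "d \<in> carrier R - {\<zero>}" "v = fraction R c d" using fractionE[OF h(2)] .
        obtain e g where p3: "e \<in> carrier R" "g \<in> carrier R - {\<zero>}" "w = fraction R e g" using fractionE[OF h(3)] .
        note p = p1(1,2) p2(1,2) p3(1,2) p1(3) p2(3) p3(3)
        have cl: "b \<in> carrier R" "d \<in> carrier R" "g \<in> carrier R" using p by auto
        show ?thesis
          unfolding p(7-9) fraction_mult[OF p(1-4)] fraction_mult[OF p(3-6)]
            fraction_mult[OF m_closed[OF p(1,3)] den_mult[OF p(2,4)] p(5,6)]
            fraction_mult[OF p(1,2) m_closed[OF p(3,5)] den_mult[OF p(4,6)]]
          using p(1,3,5) cl by (simp add: m_assoc)
      qed
      show "\<one>\<^bsub>?F\<^esub> \<otimes>\<^bsub>?F\<^esub> u = u" if h: "u \<in> carrier ?F" for u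
      proof -
        obtain a b where p: "a \<in> carrier R" "b \<in> carrier R - {\<zero>}" "u = fraction R a b" using fractionE[OF h] .
        show ?thesis unfolding p(3) fraction_field_one fraction_mult[OF one_closed one_den p(1,2)] using p(1,2) by simp
      qed
      show "u \<otimes>\<^bsub>?F\<^esub> v = v \<otimes>\<^bsub>?F\<^esub> u" if h: "u \<in> carrier ?F" "v \<in> carrier ?F" for u v
      proof -
        obtain a b where p1: "a \<in> carrier R" "b \<in> carrier R - {\<zero>}" "u = fraction R a b" using fractionE[OF h(1)] .
        obtain c d where p2: "c \<in> carrier R" "d \<in> carrier R - {\<zero>}" "v = fraction R c d" using fractionE[OF h(2)] .
        note p = p1(1,2) p2(1,2) p1(3) p2(3)
        have cl: "b \<in> carrier R" "d \<in> carrier R" using p by auto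
        show ?thesis unfolding p(5,6) fraction_mult[OF p(1-4)] fraction_mult[OF p(3,4,1,2)]
          using p(1,3) cl by (simp add: m_comm)
      qed
    qed
    show "(u \<oplus>\<^bsub>?F\<^esub> v) \<otimes>\<^bsub>?F\<^esub> w = u \<otimes>\<^bsub>?F\<^esub> w \<oplus>\<^bsub>?F\<^esub> v \<otimes>\<^bsub>?F\<^esub> w"
      if h: "u \<in> carrier ?F" "v \<in> carrier ?F" "w \<in> carrier ?F" for u v w
    proof -
      obtain a b where p1: "a \<in> carrier R" "b \<in> carrier R - {\<zero>}" "u = fraction R a b" using fractionE[OF h(1)] .
      obtain c d where p2: "c \<in> carrier R" "d \<in> carrier R - {\<zero>}" "v = fraction R c d" using fractionE[OF h(2)] .
      obtain e g where p3: "e \<in> carrier R" "g \<in> carrier R - {\<zero>}" "w = fraction R e g" using fractionE[OF h(3)] .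
      note p = p1(1,2) p2(1,2) p3(1,2) p1(3) p2(3) p3(3)
      have cl: "b \<in> carrier R" "d \<in> carrier R" "g \<in> carrier R" using p by auto
      note dn = den_mult[OF p(2,4)] den_mult[OF p(2,6)] den_mult[OF p(4,6)]
      have "fraction R ((a \<otimes> d \<oplus> c \<otimes> b) \<otimes> e) (b \<otimes> d \<otimes> g)
        = fraction R ((a \<otimes> e) \<otimes> (d \<otimes> g) \<oplus> (c \<otimes> e) \<otimes> (b \<otimes> g)) (b \<otimes> g \<otimes> (d \<otimes> g))"
        unfolding fraction_eq_iff[OF m_closed[OF a_closed[OF m_closed[OF p(1) cl(2)] m_closed[OF p(3) cl(1)]] p(5)]
            den_mult[OF dn(1) p(6)]
            a_closed[OF m_closed[OF m_closed[OF p(1,5)] m_closed[OF cl(2,3)]] m_closed[OF m_closed[OF p(3,5)] m_closed[OF cl(1,3)]]]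
            den_mult[OF dn(2,3)]]
        using p(1,3,5) cl by (simp add: l_distr r_distr m_ac)
      then show ?thesis
        unfolding p(7-9) fraction_add[OF p(1-4)] fraction_mult[OF p(1,2,5,6)] fraction_mult[OF p(3-6)]
          fraction_add[OF m_closed[OF p(1,5)] dn(2) m_closed[OF p(3,5)] dn(3)]
          fraction_mult[OF a_closed[OF m_closed[OF p(1) cl(2)] m_closed[OF p(3) cl(1)]] dn(1) p(5,6)] .
    qed
  qed
  then interpret F: cring ?F .
  have "\<zero>\<^bsub>?F\<^esub> \<noteq> \<one>\<^bsub>?F\<^esub>" unfolding fraction_field_one using fraction_zero_iff[OF one_closed one_den] by (metis one_not_zero)
  moreover have "\<exists>v\<in>carrier ?F. u \<otimes>\<^bsub>?F\<^esub> v = \<one>\<^bsub>?F\<^esub>" if h: "u \<in> carrier ?F" "u \<noteq> \<zero>\<^bsub>?F\<^esub>" for u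
  proof -
    obtain a b where p: "a \<in> carrier R" "b \<in> carrier R - {\<zero>}" "u = fraction R a b" using fractionE[OF h(1)] .
    have a: "a \<in> carrier R - {\<zero>}" using h(2) fraction_zero_iff[OF p(1,2)] p by auto
    have b: "b \<in> carrier R" using p by auto
    have "u \<otimes>\<^bsub>?F\<^esub> fraction R b a = fraction R (a \<otimes> b) (b \<otimes> a)" unfolding p(3) using fraction_mult[OF p(1,2) b a] .
    also have "\<dots> = \<one>\<^bsub>?F\<^esub>" unfolding fraction_field_one
      using fraction_eq_iff[OF m_closed[OF p(1) b] den_mult[OF p(2) a] one_closed one_den] p(1) b by (simp add: m_comm)
    finally show ?thesis using fraction_closed[OF b a] by blast
  qed
  ultimately show ?thesis by (intro F.cring_fieldI2) auto
qed

lemma fraction_hom: "(\<lambda>a. fraction R a \<one>) \<in> ring_hom R (fraction_field R)"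
proof (rule ring_hom_memI)
  show "fraction R a \<one> \<in> carrier (fraction_field R)" if "a \<in> carrier R" for a
    using fraction_closed[OF that one_den] .
  show "fraction R (a \<otimes> b) \<one> = fraction R a \<one> \<otimes>\<^bsub>fraction_field R\<^esub> fraction R b \<one>"
    if "a \<in> carrier R" "b \<in> carrier R" for a b using fraction_mult[OF that(1) one_den that(2) one_den] by simp
  show "fraction R (a \<oplus> b) \<one> = fraction R a \<one> \<oplus>\<^bsub>fraction_field R\<^esub> fraction R b \<one>"
    if "a \<in> carrier R" "b \<in> carrier R" for a b using fraction_add[OF that(1) one_den that(2) one_den] that by simp
qed (simp add: fraction_field_one)

lemma fraction_numerator:
  assumes "a \<in> carrier R" "b \<in> carrier R - {\<zero>}"
  shows "fraction R a b \<otimes>\<^bsub>fraction_field R\<^esub> fraction R b \<one> = fraction R a \<one>"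
proof -
  have b: "b \<in> carrier R" using assms by auto
  have "fraction R a b \<otimes>\<^bsub>fraction_field R\<^esub> fraction R b \<one> = fraction R (a \<otimes> b) (b \<otimes> \<one>)"
    using fraction_mult[OF assms b one_den] .
  also have "\<dots> = fraction R a \<one>"
    using fraction_eq_iff[OF m_closed[OF assms(1) b] den_mult[OF assms(2) one_den] assms(1) one_den] assms(1) b by simp
  finally show ?thesis .
qed

end

section \<open>Quadratic extensions as rupture fields\<close>

locale quadratic_rupture = field L for L (structure) +
  fixes F :: 'a
  assumes F_closed: "F \<in> carrier L" and nonsquare: "\<And>z. z \<in> carrier L \<Longrightarrow> z \<otimes> z \<noteq> F"
begin

abbreviation quad :: "'a list" where "quad \<equiv> [\<one>, \<zero>, \<ominus> F]"
abbreviation quad_field :: "'a list set ring" where "quad_field \<equiv> Rupt (carrier L) quad"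
abbreviation surj :: "'a list \<Rightarrow> 'a list set" where "surj \<equiv> rupture_surj (carrier L) quad"

definition incl :: "'a \<Rightarrow> 'a list set" where "incl a = surj (poly_of_const a)"
definition root :: "'a list set" where "root = surj X"

lemma poly_domain: "domain (poly_ring L)"
  using univ_poly_is_domain[OF carrier_is_subring] .

lemma quad_closed: "quad \<in> carrier (poly_ring L)"
  using F_closed by (auto simp: univ_poly_carrier[symmetric] polynomial_def)

text \<open>Two nonunit factors would both be linear, and the root of one of them would be a square
  root of \<open>F\<close>.\<close>

lemma quad_irreducible: "pirreducible (carrier L) quad"
proof (rule pirreducibleI[OF carrier_is_subring quad_closed])
  show "quad \<noteq> []" by simp
  show "quad \<notin> Units (poly_ring L)" using univ_poly_units'[OF carrier_is_subfield, of quad] by simp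
next
  fix q r assume qr: "q \<in> carrier (poly_ring L)" "r \<in> carrier (poly_ring L)" "quad = q \<otimes>\<^bsub>poly_ring L\<^esub> r"
  interpret UP: domain "poly_ring L" by (rule poly_domain)
  show "q \<in> Units (poly_ring L) \<or> r \<in> Units (poly_ring L)"
  proof (rule ccontr)
    assume nu: "\<not> ?thesis"
    have q0: "q \<noteq> []" "r \<noteq> []" using qr UP.integral_iff[OF qr(1,2)] by (auto simp: univ_poly_zero)
    have "degree quad = degree q + degree r"
      using poly_mult_degree_eq[OF carrier_is_subring, of q r] qr q0 by (simp add: univ_poly_mult univ_poly_carrier)
    moreover have "degree q \<noteq> 0" "degree r \<noteq> 0"
      using nu q0 univ_poly_units'[OF carrier_is_subfield, of q] univ_poly_units'[OF carrier_is_subfield, of r] qr by auto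
    ultimately have "degree q = 1" by simp
    then have dq: "length q = 2" using q0 by (cases q) auto
    have lq: "lead_coeff q \<in> carrier L" "lead_coeff q \<noteq> \<zero>"
      using qr(1) q0 by (auto simp: univ_poly_carrier[symmetric] polynomial_def)
    define z where "z = \<ominus> (inv (lead_coeff q) \<otimes> const_term q)"
    have "eval q z = \<zero>" and "inv (lead_coeff q) \<otimes> const_term q \<in> carrier L"
      unfolding z_def using degree_one_root[OF carrier_is_subfield qr(1)] dq by auto
    then have z: "z \<in> carrier L" "eval q z = \<zero>" unfolding z_def by auto
    have hom: "(\<lambda>p. eval p z) \<in> ring_hom (poly_ring L) L" using eval_is_hom[OF carrier_is_subring z(1)] .
    have "eval r z \<in> carrier L" using ring_hom_closed[OF hom qr(2)] .
    then have "eval quad z = \<zero>" using ring_hom_mult[OF hom qr(1,2)] qr(3) z(2) by simp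
    then have "z \<otimes> z \<oplus> \<ominus> F = \<zero>" using z(1) F_closed by (simp add: numeral_2_eq_2)
    then have "z \<otimes> z = F" using z(1) F_closed by (metis a_minus_def m_closed r_right_minus_eq)
    then show False using nonsquare z(1) by blast
  qed
qed

lemma quad_field_field: "field quad_field"
  using rupture_is_field_iff_pirreducible[OF carrier_is_subfield quad_closed] quad_irreducible by blast

lemma surj_hom: "surj \<in> ring_hom (poly_ring L) quad_field"
  using rupture_surj_hom(1)[OF carrier_is_subring quad_closed] .

lemma incl_hom: "incl \<in> ring_hom L quad_field"
  using rupture_surj_norm_is_hom[OF carrier_is_subring quad_closed] by (simp add: incl_def[abs_def] comp_def)

lemma const_poly: "a \<in> carrier L \<Longrightarrow> poly_of_const a \<in> carrier (poly_ring L)"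
  by (auto simp: poly_of_const_def univ_poly_carrier[symmetric] polynomial_def)

lemma X_poly: "X \<in> carrier (poly_ring L)"
  using var_closed(1)[OF carrier_is_subring] .

lemma linear_poly:
  assumes "a \<in> carrier L" "b \<in> carrier L"
  shows "poly_of_const a \<oplus>\<^bsub>poly_ring L\<^esub> (poly_of_const b \<otimes>\<^bsub>poly_ring L\<^esub> X) = normalize [b, a]"
proof -
  have "poly_of_const b \<otimes>\<^bsub>poly_ring L\<^esub> X = (if b = \<zero> then [] else [b, \<zero>])"
    using poly_mult_var[OF carrier_is_subring const_poly[OF assms(2)]] by (simp add: poly_of_const_def)
  then show ?thesis using assms by (simp add: univ_poly_add poly_of_const_def)
qed

lemma surj_linear:
  assumes "a \<in> carrier L" "b \<in> carrier L"
  shows "surj (normalize [b, a]) = incl a \<oplus>\<^bsub>quad_field\<^esub> incl b \<otimes>\<^bsub>quad_field\<^esub> root"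
proof -
  interpret UP: domain "poly_ring L" by (rule poly_domain)
  show ?thesis
    unfolding linear_poly[OF assms, symmetric] incl_def root_def
    using ring_hom_add[OF surj_hom] ring_hom_mult[OF surj_hom] const_poly[OF assms(1)] const_poly[OF assms(2)] X_poly
    by simp
qed

lemma low_degree_image: "(\<lambda>q. pmod q quad) ` carrier (poly_ring L) = {q \<in> carrier (poly_ring L). length q \<le> 2}"
  using pmod_image_characterization[OF carrier_is_subfield quad_closed] by (simp add: numeral_2_eq_2)

lemma quad_field_elem:
  assumes "z \<in> carrier quad_field"
  shows "\<exists>a\<in>carrier L. \<exists>b\<in>carrier L. z = incl a \<oplus>\<^bsub>quad_field\<^esub> incl b \<otimes>\<^bsub>quad_field\<^esub> root"
proof -
  have "z \<in> surj ` {q \<in> carrier (poly_ring L). length q \<le> 2}"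
    using assms rupture_carrier_as_pmod_image[OF carrier_is_subfield quad_closed] low_degree_image by simp
  then obtain q where q: "z = surj q" "q \<in> carrier (poly_ring L)" "length q \<le> 2" by blast
  have p: "polynomial (carrier L) q" using q(2) by (simp add: univ_poly_carrier)
  have "\<exists>a\<in>carrier L. \<exists>b\<in>carrier L. q = normalize [b, a]"
  proof (cases q)
    case Nil
    then show ?thesis by (intro bexI[of _ \<zero>]) auto
  next
    case (Cons c l)
    show ?thesis
    proof (cases l)
      case Nil
      then show ?thesis using Cons p by (intro bexI[of _ c] bexI[of _ \<zero>]) (auto simp: polynomial_def)
    next
      case (Cons d m)
      then have "q = [c, d]" using \<open>q = c # l\<close> q(3) by simp
      then show ?thesis using p by (intro bexI[of _ d] bexI[of _ c]) (auto simp: polynomial_def)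
    qed
  qed
  then show ?thesis using surj_linear q(1) by metis
qed

text \<open>A polynomial of degree at most one is its own remainder modulo \<open>quad\<close>, and
  distinct remainders have distinct classes.\<close>

lemma quad_field_indep:
  assumes "a \<in> carrier L" "b \<in> carrier L"
    and z: "incl a \<oplus>\<^bsub>quad_field\<^esub> incl b \<otimes>\<^bsub>quad_field\<^esub> root = \<zero>\<^bsub>quad_field\<^esub>"
  shows "a = \<zero> \<and> b = \<zero>"
proof -
  interpret UP: domain "poly_ring L" by (rule poly_domain)
  interpret Q: field quad_field by (rule quad_field_field)
  have "surj (normalize [b, a]) = \<zero>\<^bsub>quad_field\<^esub>" using surj_linear[OF assms(1,2)] z by simp
  also have "\<dots> = surj []" using ring_hom_zero[OF surj_hom UP.ring_axioms Q.ring_axioms] by (simp add: univ_poly_zero)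
  finally have e: "surj (normalize [b, a]) = surj []" .
  have "normalize [b, a] \<in> carrier (poly_ring L)"
    using normalize_gives_polynomial[of "[b, a]" "carrier L"] assms by (simp add: univ_poly_carrier)
  moreover have "length (normalize [b, a]) \<le> 2" using normalize_length_le[of "[b, a]"] by simp
  ultimately have "normalize [b, a] \<in> (\<lambda>q. pmod q quad) ` carrier (poly_ring L)" "[] \<in> (\<lambda>q. pmod q quad) ` carrier (poly_ring L)"
    unfolding low_degree_image using univ_poly_zero_closed by simp_all
  then have "normalize [b, a] = []"
    using inj_onD[OF rupture_surj_inj_on[OF carrier_is_subfield quad_closed] e] by blast
  then show ?thesis by (simp split: if_splits)
qed

lemma root_closed: "root \<in> carrier quad_field"
  unfolding root_def using ring_hom_closed[OF surj_hom X_poly] .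

lemma root_square: "root \<otimes>\<^bsub>quad_field\<^esub> root = incl F"
proof -
  interpret UP: domain "poly_ring L" by (rule poly_domain)
  interpret Q: field quad_field by (rule quad_field_field)
  let ?c = "poly_of_const (\<ominus> F)"
  have XX: "X \<otimes>\<^bsub>poly_ring L\<^esub> X = [\<one>, \<zero>, \<zero>]"
    using poly_mult_var[OF carrier_is_subring X_poly] by (simp add: var_def)
  have c: "?c \<in> carrier (poly_ring L)" using const_poly F_closed by simp
  have "(X \<otimes>\<^bsub>poly_ring L\<^esub> X) \<oplus>\<^bsub>poly_ring L\<^esub> ?c = quad"
    unfolding XX using F_closed by (simp add: univ_poly_add poly_of_const_def numeral_2_eq_2)
  then have "root \<otimes>\<^bsub>quad_field\<^esub> root \<oplus>\<^bsub>quad_field\<^esub> incl (\<ominus> F) = surj quad"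
    unfolding root_def incl_def
    using ring_hom_add[OF surj_hom UP.m_closed[OF X_poly X_poly] c] ring_hom_mult[OF surj_hom X_poly X_poly] by simp
  also have "surj quad = \<zero>\<^bsub>quad_field\<^esub>"
  proof -
    have "pmod quad quad = []"
      using pmod_zero_iff_pdivides[OF carrier_is_subfield quad_closed quad_closed]
        UP.divides_refl[OF quad_closed] by (simp add: pdivides_def)
    then have "surj quad = surj []"
      using rupture_surj_composed_with_pmod[OF carrier_is_subfield quad_closed quad_closed] by simp
    also have "\<dots> = \<zero>\<^bsub>quad_field\<^esub>" using ring_hom_zero[OF surj_hom UP.ring_axioms Q.ring_axioms] by (simp add: univ_poly_zero)
    finally show ?thesis .
  qed
  finally have s: "root \<otimes>\<^bsub>quad_field\<^esub> root \<oplus>\<^bsub>quad_field\<^esub> incl (\<ominus> F) = \<zero>\<^bsub>quad_field\<^esub>" .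
  have "incl (\<ominus> F) \<oplus>\<^bsub>quad_field\<^esub> incl F = incl (\<ominus> F \<oplus> F)"
    using ring_hom_add[OF incl_hom, of "\<ominus> F" F] F_closed by simp
  also have "\<dots> = \<zero>\<^bsub>quad_field\<^esub>"
    using ring_hom_zero[OF incl_hom ring_axioms Q.ring_axioms] F_closed by (simp add: l_neg)
  finally have "incl F = \<ominus>\<^bsub>quad_field\<^esub> incl (\<ominus> F)"
    using Q.minus_equality[of "incl F" "incl (\<ominus> F)"] Q.a_comm ring_hom_closed[OF incl_hom] F_closed by simp
  moreover have "root \<otimes>\<^bsub>quad_field\<^esub> root = \<ominus>\<^bsub>quad_field\<^esub> incl (\<ominus> F)"
    using Q.minus_equality[OF s] ring_hom_closed[OF incl_hom] F_closed root_closed by simp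
  ultimately show ?thesis by simp
qed

end

section \<open>The function field of a hyperelliptic curve\<close>

text \<open>The simple root \<open>b\<close> ensures that \<open>f\<close> is not a square in the field of rational functions.\<close>

locale hyperelliptic_field = field k for k :: "'a ring" (structure) +
  fixes f :: "'a list" and b :: 'a and g :: "'a list"
  assumes exists_root: "\<And>p. p \<in> carrier (poly_ring k) \<Longrightarrow> degree p > 0 \<Longrightarrow> \<exists>a\<in>carrier k. eval p a = \<zero>"
    and two_nonzero: "\<one> \<oplus> \<one> \<noteq> \<zero>"
    and g_poly: "g \<in> carrier (poly_ring k)" and b_closed: "b \<in> carrier k"
    and f_factor: "f = [\<one>, \<ominus> b] \<otimes>\<^bsub>poly_ring k\<^esub> g" and g_b: "eval g b \<noteq> \<zero>"
begin

abbreviation "kx \<equiv> ratfun_field k"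
abbreviation "KK \<equiv> function_field k f"
abbreviation "CC \<equiv> ff_const k f ` carrier k"

lemma kX_domain: "domain (poly_ring k)"
  using univ_poly_is_domain[OF carrier_is_subring] .

lemma linear_poly_closed: "[\<one>, \<ominus> b] \<in> carrier (poly_ring k)"
  using b_closed by (auto simp: univ_poly_carrier[symmetric] polynomial_def)

lemma f_poly: "f \<in> carrier (poly_ring k)"
proof -
  interpret UP: domain "poly_ring k" by (rule kX_domain)
  show ?thesis unfolding f_factor using linear_poly_closed g_poly by simp
qed

lemma g_not_Nil: "g \<noteq> []"
  using g_b by auto

lemma f_not_Nil: "f \<noteq> []"
proof -
  interpret UP: domain "poly_ring k" by (rule kX_domain)
  show ?thesis unfolding f_factor using UP.integral_iff[OF linear_poly_closed g_poly] g_not_Nil by (simp add: univ_poly_zero)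
qed

lemma kx_field: "field kx"
  using domain.fraction_field_is_field[OF kX_domain] .

lemma ratfun_hom: "ratfun_of_poly k \<in> ring_hom (poly_ring k) kx"
  using domain.fraction_hom[OF kX_domain] by (simp add: ratfun_of_poly_def[abs_def])

lemma ratfun_zero: "p \<in> carrier (poly_ring k) \<Longrightarrow> ratfun_of_poly k p = \<zero>\<^bsub>kx\<^esub> \<longleftrightarrow> p = []"
  using domain.fraction_zero_iff[OF kX_domain _ domain.one_den[OF kX_domain], of p]
  by (simp add: ratfun_of_poly_def univ_poly_zero)

text \<open>In \<open>n^2 = f d^2\<close> the multiplicity of the root \<open>b\<close> is even on
  the left. On the right it is odd, since \<open>b\<close> is a simple root of
  \<open>f\<close>.\<close>

lemma ratfun_nonsquare:
  assumes z: "z \<in> carrier kx" shows "z \<otimes>\<^bsub>kx\<^esub> z \<noteq> ratfun_of_poly k f"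
proof
  interpret UP: domain "poly_ring k" by (rule kX_domain)
  assume sq: "z \<otimes>\<^bsub>kx\<^esub> z = ratfun_of_poly k f"
  obtain n d where nd: "n \<in> carrier (poly_ring k)" "d \<in> carrier (poly_ring k) - {\<zero>\<^bsub>poly_ring k\<^esub>}"
    "z = fraction (poly_ring k) n d" using UP.fractionE[OF z] .
  have d: "d \<in> carrier (poly_ring k)" "d \<noteq> []" using nd(2) by (auto simp: univ_poly_zero)
  have "fraction (poly_ring k) (n \<otimes>\<^bsub>poly_ring k\<^esub> n) (d \<otimes>\<^bsub>poly_ring k\<^esub> d) = fraction (poly_ring k) f \<one>\<^bsub>poly_ring k\<^esub>"
    using sq UP.fraction_mult[OF nd(1,2,1,2)] nd(3) by (simp add: ratfun_of_poly_def)
  then have "(n \<otimes>\<^bsub>poly_ring k\<^esub> n) \<otimes>\<^bsub>poly_ring k\<^esub> \<one>\<^bsub>poly_ring k\<^esub> = f \<otimes>\<^bsub>poly_ring k\<^esub> (d \<otimes>\<^bsub>poly_ring k\<^esub> d)"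
    using UP.fraction_eq_iff[OF UP.m_closed[OF nd(1,1)] UP.den_mult[OF nd(2,2)] f_poly UP.one_den] by simp
  then have e: "n \<otimes>\<^bsub>poly_ring k\<^esub> n = f \<otimes>\<^bsub>poly_ring k\<^esub> (d \<otimes>\<^bsub>poly_ring k\<^esub> d)" using nd(1) by simp
  have dd: "d \<otimes>\<^bsub>poly_ring k\<^esub> d \<noteq> []" using UP.integral_iff[OF d(1,1)] d(2) by (simp add: univ_poly_zero)
  have "f \<otimes>\<^bsub>poly_ring k\<^esub> (d \<otimes>\<^bsub>poly_ring k\<^esub> d) \<noteq> []"
    using UP.integral_iff[OF f_poly UP.m_closed[OF d(1,1)]] f_not_Nil dd by (simp add: univ_poly_zero)
  then have n: "n \<noteq> []" using e UP.integral_iff[OF nd(1,1)] by (auto simp: univ_poly_zero)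
  note rm = field.associated_polynomials_imp_same_roots[OF field_axioms]
  have "roots n + roots n = roots f + (roots d + roots d)"
    using rm[OF nd(1) n nd(1) n] rm[OF f_poly f_not_Nil UP.m_closed[OF d(1,1)] dd] rm[OF d d] e by simp
  moreover have "roots f = add_mset b (roots g)"
    unfolding f_factor using poly_mult_degree_one_monic_imp_same_roots[OF b_closed g_poly g_not_Nil] .
  moreover have "count (roots g) b = 0"
    using roots_mem_iff_is_root[OF g_poly, of b] g_b by (simp add: is_root_def not_in_iff)
  ultimately have "count (roots n) b + count (roots n) b = Suc (count (roots d) b + count (roots d) b)"
    by (metis add.commute add_0_right add_Suc_right count_add_mset count_union)
  then show False by presburger
qed

lemma quadratic: "quadratic_rupture kx (ratfun_of_poly k f)"
  unfolding quadratic_rupture_def quadratic_rupture_axioms_def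
  using kx_field ring_hom_closed[OF ratfun_hom f_poly] ratfun_nonsquare by blast

lemma KK_eq: "KK = Rupt\<^bsub>kx\<^esub> (carrier kx) [\<one>\<^bsub>kx\<^esub>, \<zero>\<^bsub>kx\<^esub>, \<ominus>\<^bsub>kx\<^esub> ratfun_of_poly k f]"
  by (simp add: function_field_def curve_poly_def)

lemma KK_field: "field KK"
  unfolding KK_eq using quadratic_rupture.quad_field_field[OF quadratic] .

lemma ff_of_poly_eq: "ff_of_poly k f p = quadratic_rupture.incl kx (ratfun_of_poly k f) (ratfun_of_poly k p)"
  by (simp add: ff_of_poly_def ff_class_def quadratic_rupture.incl_def[OF quadratic] curve_poly_def)

lemma ff_y_eq: "ff_y k f = quadratic_rupture.root kx (ratfun_of_poly k f)"
  by (simp add: ff_y_def ff_class_def quadratic_rupture.root_def[OF quadratic] curve_poly_def)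

lemma ff_poly_hom: "ff_of_poly k f \<in> ring_hom (poly_ring k) KK"
  using ring_hom_trans[OF ratfun_hom quadratic_rupture.incl_hom[OF quadratic]]
  unfolding KK_eq by (simp add: ff_of_poly_eq[abs_def] comp_def)

lemma ff_const_hom: "ff_const k f \<in> ring_hom k KK"
  using ring_hom_trans[OF canonical_embedding_is_hom[OF carrier_is_subring] ff_poly_hom]
  by (simp add: ff_const_def[abs_def] comp_def)

lemma ff_y_closed: "ff_y k f \<in> carrier KK"
  unfolding KK_eq ff_y_eq using quadratic_rupture.root_closed[OF quadratic] .

lemma ff_x_closed: "ff_x k f \<in> carrier KK"
  unfolding ff_x_def using ring_hom_closed[OF ff_poly_hom var_closed(1)[OF carrier_is_subring]] .

lemma ff_y_square: "ff_y k f \<otimes>\<^bsub>KK\<^esub> ff_y k f = ff_of_poly k f f"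
  unfolding KK_eq ff_y_eq ff_of_poly_eq using quadratic_rupture.root_square[OF quadratic] .

lemma ff_poly_indep:
  assumes "q \<in> carrier (poly_ring k)" "r \<in> carrier (poly_ring k)"
    and "ff_of_poly k f q \<oplus>\<^bsub>KK\<^esub> ff_of_poly k f r \<otimes>\<^bsub>KK\<^esub> ff_y k f = \<zero>\<^bsub>KK\<^esub>"
  shows "q = [] \<and> r = []"
  using quadratic_rupture.quad_field_indep[OF quadratic ring_hom_closed[OF ratfun_hom assms(1)] ring_hom_closed[OF ratfun_hom assms(2)]]
    assms(3) ratfun_zero[OF assms(1)] ratfun_zero[OF assms(2)]
  unfolding KK_eq ff_y_eq ff_of_poly_eq by blast

lemma ff_poly_generate:
  assumes z: "z \<in> carrier KK"
  obtains q r s where "q \<in> carrier (poly_ring k)" "r \<in> carrier (poly_ring k)" "s \<in> carrier (poly_ring k)" "s \<noteq> []"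
    "z \<otimes>\<^bsub>KK\<^esub> ff_of_poly k f s = ff_of_poly k f q \<oplus>\<^bsub>KK\<^esub> ff_of_poly k f r \<otimes>\<^bsub>KK\<^esub> ff_y k f"
proof -
  interpret UP: domain "poly_ring k" by (rule kX_domain)
  interpret Q: quadratic_rupture kx "ratfun_of_poly k f" by (rule quadratic)
  interpret KK: field KK by (rule KK_field)
  obtain u v where uv: "u \<in> carrier kx" "v \<in> carrier kx"
    "z = Q.incl u \<oplus>\<^bsub>KK\<^esub> Q.incl v \<otimes>\<^bsub>KK\<^esub> ff_y k f"
    using Q.quad_field_elem z unfolding KK_eq ff_y_eq by blast
  obtain a b' where a: "a \<in> carrier (poly_ring k)" "b' \<in> carrier (poly_ring k) - {\<zero>\<^bsub>poly_ring k\<^esub>}"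
    "u = fraction (poly_ring k) a b'" using UP.fractionE[OF uv(1)] .
  obtain c d where c: "c \<in> carrier (poly_ring k)" "d \<in> carrier (poly_ring k) - {\<zero>\<^bsub>poly_ring k\<^esub>}"
    "v = fraction (poly_ring k) c d" using UP.fractionE[OF uv(2)] .
  have bd: "b' \<in> carrier (poly_ring k)" "d \<in> carrier (poly_ring k)" using a(2) c(2) by auto
  have ih: "Q.incl \<in> ring_hom kx KK" unfolding KK_eq by (rule Q.incl_hom)
  have u: "u \<otimes>\<^bsub>kx\<^esub> ratfun_of_poly k b' = ratfun_of_poly k a"
    unfolding a(3) ratfun_of_poly_def by (rule UP.fraction_numerator[OF a(1,2)])
  have v: "v \<otimes>\<^bsub>kx\<^esub> ratfun_of_poly k d = ratfun_of_poly k c"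
    unfolding c(3) ratfun_of_poly_def by (rule UP.fraction_numerator[OF c(1,2)])
  note rc = ring_hom_closed[OF ratfun_hom bd(1)] ring_hom_closed[OF ratfun_hom bd(2)]
  have u': "Q.incl u \<otimes>\<^bsub>KK\<^esub> ff_of_poly k f b' = ff_of_poly k f a"
    using ring_hom_mult[OF ih uv(1) rc(1)] u by (simp add: ff_of_poly_eq)
  have v': "Q.incl v \<otimes>\<^bsub>KK\<^esub> ff_of_poly k f d = ff_of_poly k f c"
    using ring_hom_mult[OF ih uv(2) rc(2)] v by (simp add: ff_of_poly_eq)
  have cl: "Q.incl u \<in> carrier KK" "Q.incl v \<in> carrier KK" "ff_of_poly k f b' \<in> carrier KK" "ff_of_poly k f d \<in> carrier KK"
    "ff_y k f \<in> carrier KK"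
    using ring_hom_closed[OF ih] uv(1,2) ring_hom_closed[OF ff_poly_hom] bd ff_y_closed by auto
  have id: "(s \<oplus>\<^bsub>KK\<^esub> t \<otimes>\<^bsub>KK\<^esub> w) \<otimes>\<^bsub>KK\<^esub> (m \<otimes>\<^bsub>KK\<^esub> n) =
      (s \<otimes>\<^bsub>KK\<^esub> m) \<otimes>\<^bsub>KK\<^esub> n \<oplus>\<^bsub>KK\<^esub> ((t \<otimes>\<^bsub>KK\<^esub> n) \<otimes>\<^bsub>KK\<^esub> m) \<otimes>\<^bsub>KK\<^esub> w"
    if "s \<in> carrier KK" "t \<in> carrier KK" "w \<in> carrier KK" "m \<in> carrier KK" "n \<in> carrier KK" for s t w m n
    using that by (simp add: KK.l_distr KK.r_distr KK.m_ac)
  have "z \<otimes>\<^bsub>KK\<^esub> ff_of_poly k f (b' \<otimes>\<^bsub>poly_ring k\<^esub> d) =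
     ff_of_poly k f (a \<otimes>\<^bsub>poly_ring k\<^esub> d) \<oplus>\<^bsub>KK\<^esub> ff_of_poly k f (c \<otimes>\<^bsub>poly_ring k\<^esub> b') \<otimes>\<^bsub>KK\<^esub> ff_y k f"
    unfolding uv(3) ring_hom_mult[OF ff_poly_hom bd] ring_hom_mult[OF ff_poly_hom a(1) bd(2)]
      ring_hom_mult[OF ff_poly_hom c(1) bd(1)] id[OF cl(1,2,5,3,4)] u' v' ..
  moreover have "b' \<otimes>\<^bsub>poly_ring k\<^esub> d \<noteq> []"
    using UP.integral_iff[OF bd] a(2) c(2) by (simp add: univ_poly_zero)
  ultimately show thesis using that[of "a \<otimes>\<^bsub>poly_ring k\<^esub> d" "c \<otimes>\<^bsub>poly_ring k\<^esub> b'" "b' \<otimes>\<^bsub>poly_ring k\<^esub> d"] a(1) c(1) bd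
    by simp
qed

lemma ff_const_hom_ring: "ring_hom_ring k KK (ff_const k f)"
  using ring_hom_ringI2[OF ring_axioms field.is_ring[OF KK_field] ff_const_hom] .

lemma ff_const_zero:
  assumes "a \<in> carrier k" shows "ff_const k f a = \<zero>\<^bsub>KK\<^esub> \<longleftrightarrow> a = \<zero>"
proof
  interpret KK: field KK by (rule KK_field)
  interpret UP: domain "poly_ring k" by (rule kX_domain)
  interpret h: ring_hom_ring k KK "ff_const k f" by (rule ff_const_hom_ring)
  show "a = \<zero> \<Longrightarrow> ff_const k f a = \<zero>\<^bsub>KK\<^esub>" using ring_hom_zero[OF ff_const_hom ring_axioms KK.ring_axioms] by simp
  have p: "poly_of_const a \<in> carrier (poly_ring k)"
    using assms by (auto simp: poly_of_const_def univ_poly_carrier[symmetric] polynomial_def)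
  assume "ff_const k f a = \<zero>\<^bsub>KK\<^esub>"
  then have "ff_of_poly k f (poly_of_const a) = \<zero>\<^bsub>KK\<^esub>" by (simp add: ff_const_def)
  moreover have "ff_of_poly k f [] = \<zero>\<^bsub>KK\<^esub>"
    using ring_hom_zero[OF ff_poly_hom UP.ring_axioms KK.ring_axioms] by (simp add: univ_poly_zero)
  ultimately have "poly_of_const a = []"
    using ff_poly_indep[OF p univ_poly_zero_closed] ring_hom_closed[OF ff_poly_hom p] ff_y_closed by simp
  then show "a = \<zero>" by (simp add: poly_of_const_def split: if_splits)
qed

lemma CC_subfield: "subfield CC KK"
proof -
  interpret KK: field KK by (rule KK_field)
  interpret h: ring_hom_ring k KK "ff_const k f" by (rule ff_const_hom_ring)
  show ?thesis using h.img_is_subfield(2)[OF carrier_is_subfield KK.one_not_zero] .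
qed

lemma map_ff_const_poly:
  assumes "p \<in> carrier (poly_ring k)" shows "map (ff_const k f) p \<in> carrier (CC[X]\<^bsub>KK\<^esub>)"
proof (cases p)
  case (Cons c l)
  have "set p \<subseteq> carrier k" "c \<noteq> \<zero>" using assms Cons by (auto simp: univ_poly_carrier[symmetric] polynomial_def)
  then show ?thesis using Cons ff_const_zero by (auto simp: univ_poly_carrier[symmetric] polynomial_def)
qed (simp add: univ_poly_zero_closed)

lemma poly_lift:
  assumes p: "p' \<in> carrier (CC[X]\<^bsub>KK\<^esub>)"
  obtains p where "p \<in> carrier (poly_ring k)" "p' = map (ff_const k f) p"
proof -
  have s: "set p' \<subseteq> CC" "p' \<noteq> [] \<longrightarrow> lead_coeff p' \<noteq> \<zero>\<^bsub>KK\<^esub>"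
    using p by (auto simp: univ_poly_carrier[symmetric] polynomial_def)
  define p where "p = map (inv_into (carrier k) (ff_const k f)) p'"
  have 1: "p' = map (ff_const k f) p"
    unfolding p_def map_map using f_inv_into_f[OF subsetD[OF s(1)]] by (intro map_idI[symmetric]) simp
  have 2: "set p \<subseteq> carrier k" unfolding p_def using s(1) by (auto intro: inv_into_into)
  have "p \<noteq> [] \<longrightarrow> lead_coeff p \<noteq> \<zero>"
  proof
    assume ne: "p \<noteq> []"
    then have "lead_coeff p' = ff_const k f (lead_coeff p)" "p' \<noteq> []" using 1 by (auto simp: hd_map)
    moreover have "lead_coeff p \<in> carrier k" using 2 ne by auto
    ultimately show "lead_coeff p \<noteq> \<zero>" using s(2) ff_const_zero by auto
  qed
  then have "p \<in> carrier (poly_ring k)" using 2 by (auto simp: univ_poly_carrier[symmetric] polynomial_def)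
  then show thesis using that 1 by blast
qed

text \<open>A polynomial is its own value at \<open>X\<close>; applying the homomorphism to the
  function field to this identity turns \<open>X\<close> into \<open>ff_x\<close> and coefficients
  into constants.\<close>

lemma ff_of_poly_eval:
  assumes p: "p \<in> carrier (poly_ring k)"
  shows "ff_of_poly k f p = ring.eval KK (map (ff_const k f) p) (ff_x k f)"
proof -
  interpret UP: domain "poly_ring k" by (rule kX_domain)
  interpret KK: field KK by (rule KK_field)
  interpret h: ring_hom_ring "poly_ring k" KK "ff_of_poly k f"
    using ring_hom_ringI2[OF UP.ring_axioms KK.ring_axioms ff_poly_hom] .
  have s: "set p \<subseteq> carrier k" using p by (auto simp: univ_poly_carrier[symmetric] polynomial_def)
  then have "set (map poly_of_const p) \<subseteq> carrier (poly_ring k)"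
    by (auto simp: poly_of_const_def univ_poly_carrier[symmetric] polynomial_def)
  then have "ff_of_poly k f (UP.eval (map poly_of_const p) X) =
      KK.eval (map (ff_of_poly k f) (map poly_of_const p)) (ff_of_poly k f X)"
    using h.eval_hom'[OF var_closed(1)[OF carrier_is_subring]] by blast
  moreover have "UP.eval (map poly_of_const p) X = p"
    using eval_rewrite[OF carrier_is_subring p] by simp
  ultimately show ?thesis by (simp add: ff_x_def ff_const_def[abs_def] comp_def)
qed

lemma ff_const_eval:
  assumes "p \<in> carrier (poly_ring k)" "a \<in> carrier k"
  shows "ring.eval KK (map (ff_const k f) p) (ff_const k f a) = ff_const k f (eval p a)"
proof -
  interpret h: ring_hom_ring k KK "ff_const k f" by (rule ff_const_hom_ring)
  show ?thesis using h.eval_hom[OF carrier_is_subring assms(2,1)] by simp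
qed

text \<open>The bridge by which all results on abstract charts apply to the function field of the
  definitions.\<close>

theorem function_field_chart:
  "hyperelliptic_chart KK CC (ff_x k f) (ff_y k f) (map (ff_const k f) f)"
proof -
  interpret KK: field KK by (rule KK_field)
  interpret h: ring_hom_ring k KK "ff_const k f" by (rule ff_const_hom_ring)
  show ?thesis
  proof (intro hyperelliptic_chart.intro hyperelliptic_chart_axioms.intro alg_closed_over.intro alg_closed_over_axioms.intro
      field_over.intro field_over_axioms.intro KK_field CC_subfield ff_x_closed ff_y_closed map_ff_const_poly f_poly)
    fix p' assume p': "p' \<in> carrier (CC[X]\<^bsub>KK\<^esub>)" "degree p' > 0"
    obtain p where p: "p \<in> carrier (poly_ring k)" "p' = map (ff_const k f) p" using poly_lift[OF p'(1)] .
    obtain a where a: "a \<in> carrier k" "eval p a = \<zero>" using exists_root[OF p(1)] p p'(2) by auto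
    have "KK.eval p' (ff_const k f a) = \<zero>\<^bsub>KK\<^esub>"
      unfolding p(2) ff_const_eval[OF p(1) a(1)] a(2) using ff_const_zero[OF zero_closed] by simp
    then show "\<exists>a\<in>CC. KK.eval p' a = \<zero>\<^bsub>KK\<^esub>" using a(1) by blast
  next
    have "ff_const k f (\<one> \<oplus> \<one>) = \<one>\<^bsub>KK\<^esub> \<oplus>\<^bsub>KK\<^esub> \<one>\<^bsub>KK\<^esub>" by simp
    then show "\<one>\<^bsub>KK\<^esub> \<oplus>\<^bsub>KK\<^esub> \<one>\<^bsub>KK\<^esub> \<noteq> \<zero>\<^bsub>KK\<^esub>"
      using ff_const_zero[of "\<one> \<oplus> \<one>"] two_nonzero by simp
  next
    show "ff_y k f \<otimes>\<^bsub>KK\<^esub> ff_y k f = KK.eval (map (ff_const k f) f) (ff_x k f)"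
      using ff_y_square ff_of_poly_eval[OF f_poly] by simp
  next
    fix q' r' assume qr: "q' \<in> carrier (CC[X]\<^bsub>KK\<^esub>)" "r' \<in> carrier (CC[X]\<^bsub>KK\<^esub>)"
      "KK.eval q' (ff_x k f) \<oplus>\<^bsub>KK\<^esub> KK.eval r' (ff_x k f) \<otimes>\<^bsub>KK\<^esub> ff_y k f = \<zero>\<^bsub>KK\<^esub>"
    obtain q where q: "q \<in> carrier (poly_ring k)" "q' = map (ff_const k f) q" using poly_lift[OF qr(1)] .
    obtain r where r: "r \<in> carrier (poly_ring k)" "r' = map (ff_const k f) r" using poly_lift[OF qr(2)] .
    show "q' = [] \<and> r' = []"
      using ff_poly_indep[OF q(1) r(1)] qr(3) ff_of_poly_eval[OF q(1)] ff_of_poly_eval[OF r(1)] q(2) r(2) by simp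
  next
    fix z assume z: "z \<in> carrier KK"
    obtain q r s where *: "q \<in> carrier (poly_ring k)" "r \<in> carrier (poly_ring k)" "s \<in> carrier (poly_ring k)" "s \<noteq> []"
      "z \<otimes>\<^bsub>KK\<^esub> ff_of_poly k f s = ff_of_poly k f q \<oplus>\<^bsub>KK\<^esub> ff_of_poly k f r \<otimes>\<^bsub>KK\<^esub> ff_y k f"
      using ff_poly_generate[OF z] .
    show "\<exists>q\<in>carrier (CC[X]\<^bsub>KK\<^esub>). \<exists>r\<in>carrier (CC[X]\<^bsub>KK\<^esub>). \<exists>s\<in>carrier (CC[X]\<^bsub>KK\<^esub>). s \<noteq> [] \<and>
        z \<otimes>\<^bsub>KK\<^esub> KK.eval s (ff_x k f) = KK.eval q (ff_x k f) \<oplus>\<^bsub>KK\<^esub> KK.eval r (ff_x k f) \<otimes>\<^bsub>KK\<^esub> ff_y k f"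
      using * map_ff_const_poly[OF *(1)] map_ff_const_poly[OF *(2)] map_ff_const_poly[OF *(3)]
        ff_of_poly_eval[OF *(1)] ff_of_poly_eval[OF *(2)] ff_of_poly_eval[OF *(3)]
      by (intro bexI[of _ "map (ff_const k f) q"] bexI[of _ "map (ff_const k f) r"] bexI[of _ "map (ff_const k f) s"]) simp_all
  qed
qed

lemma jacobian_points_eq:
  "jacobian_points k F f = field_over.invariant_classes KK CC (galois_action k F f)"
proof -
  interpret c: hyperelliptic_chart KK CC "ff_x k f" "ff_y k f" "map (ff_const k f) f" by (rule function_field_chart)
  have 1: "divisor_group k f = c.div_group" by (simp add: divisor_group_def c.div_group_def points_def)
  have 2: "principal_divisors k f = c.principals" by (simp add: principal_divisors_def c.principals_def 1 points_def)
  have 3: "divisor_pullback k f \<tau> = c.pullback \<tau>" for \<tau> by (simp add: divisor_pullback_def[abs_def] c.pullback_def[abs_def])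
  have 4: "divisor_degree D = frag_degree D" for D :: "'a divisor" by (simp add: divisor_degree_def frag_degree_def)
  show ?thesis by (simp add: jacobian_points_def c.invariant_classes_def picard_group_def 1 2 3 4)
qed

lemma galois_constant_auts:
  assumes "\<tau> \<in> galois_action k F f"
  shows "\<tau> \<in> field_over.constant_auts KK CC" "\<tau> (ff_x k f) = ff_x k f"
    "\<And>c. c \<in> F \<Longrightarrow> c \<in> carrier k \<Longrightarrow> \<tau> (ff_const k f c) = ff_const k f c"
proof -
  interpret c: hyperelliptic_chart KK CC "ff_x k f" "ff_y k f" "map (ff_const k f) f" by (rule function_field_chart)
  obtain s where s: "s \<in> ring_iso k k" "\<forall>c\<in>F. s c = c" "\<forall>c\<in>carrier k. \<tau> (ff_const k f c) = ff_const k f (s c)"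
    and t: "\<tau> \<in> ring_iso KK KK" "\<tau> (ff_x k f) = ff_x k f"
    using assms by (auto simp: galois_action_def)
  have "s ` carrier k = carrier k" using ring_iso_memE(5)[OF s(1)] by (simp add: bij_betw_def)
  then have "\<tau> ` CC = CC" using s(3) by (simp add: image_image cong: image_cong) (metis image_image)
  then show "\<tau> \<in> c.constant_auts" using t(1) by (simp add: c.constant_auts_def)
  show "\<tau> (ff_x k f) = ff_x k f" by (rule t(2))
  show "\<tau> (ff_const k f c) = ff_const k f c" if "c \<in> F" "c \<in> carrier k" for c using s(2,3) that by simp
qed

end

section \<open>Polynomials over a finite field and over its algebraic closure\<close>

text \<open>A homomorphism of fields is injective, so leading coefficients stay nonzero and the
  mapped coefficient list is already normalized.\<close>

lemma map_poly_hom: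
  assumes "field R" "field S" and h: "h \<in> ring_hom R S"
  shows "\<And>a. a \<in> carrier R \<Longrightarrow> h a = \<zero>\<^bsub>S\<^esub> \<longleftrightarrow> a = \<zero>\<^bsub>R\<^esub>"
    and "map h \<in> ring_hom (poly_ring R) (poly_ring S)"
proof -
  interpret R: field R by fact
  interpret S: field S by fact
  interpret h: ring_hom_ring R S h using ring_hom_ringI2[OF R.ring_axioms S.ring_axioms h] .
  show zero: "h a = \<zero>\<^bsub>S\<^esub> \<longleftrightarrow> a = \<zero>\<^bsub>R\<^esub>" if a: "a \<in> carrier R" for a
  proof
    assume h0: "h a = \<zero>\<^bsub>S\<^esub>"
    show "a = \<zero>\<^bsub>R\<^esub>"
    proof (rule ccontr)
      assume "a \<noteq> \<zero>\<^bsub>R\<^esub>"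
      then have "a \<in> nonzero R" using a by (simp add: nonzero_def)
      note u = R.nonzero_inv[OF this]
      have ic: "inv\<^bsub>R\<^esub> a \<in> carrier R" using u(1) by (simp add: nonzero_def)
      have "\<one>\<^bsub>S\<^esub> = h a \<otimes>\<^bsub>S\<^esub> h (inv\<^bsub>R\<^esub> a)" using h.hom_mult[OF a ic] u(2) by simp
      then show False using h0 h.hom_closed[OF ic] by simp
    qed
  qed simp
  have poly: "map h p \<in> carrier (poly_ring S)" if "p \<in> carrier (poly_ring R)" for p
  proof (cases p)
    case (Cons c l)
    have "set p \<subseteq> carrier R" "c \<noteq> \<zero>\<^bsub>R\<^esub>" using that Cons by (auto simp: univ_poly_carrier[symmetric] polynomial_def)
    then show ?thesis using Cons zero by (auto simp: univ_poly_carrier[symmetric] polynomial_def)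
  qed (simp add: univ_poly_zero_closed)
  interpret RX: domain "poly_ring R" using R.univ_poly_is_domain[OF R.carrier_is_subring] .
  have st: "set p \<subseteq> carrier R" if "p \<in> carrier (poly_ring R)" for p
    using that by (auto simp: univ_poly_carrier[symmetric] polynomial_def)
  have norm: "S.normalize (map h p) = map h p" if "p \<in> carrier (poly_ring R)" for p
    using S.normalize_polynomial[of "carrier S"] poly[OF that] by (simp add: univ_poly_carrier)
  show "map h \<in> ring_hom (poly_ring R) (poly_ring S)"
  proof (rule ring_hom_memI)
    show "map h p \<in> carrier (poly_ring S)" if "p \<in> carrier (poly_ring R)" for p using poly[OF that] .
    show "map h (p \<otimes>\<^bsub>poly_ring R\<^esub> q) = map h p \<otimes>\<^bsub>poly_ring S\<^esub> map h q"
      if "p \<in> carrier (poly_ring R)" "q \<in> carrier (poly_ring R)" for p q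
      using h.poly_mult_hom'[OF st[OF that(1)] st[OF that(2)]] norm[OF RX.m_closed[OF that]] by (simp add: univ_poly_mult)
    show "map h (p \<oplus>\<^bsub>poly_ring R\<^esub> q) = map h p \<oplus>\<^bsub>poly_ring S\<^esub> map h q"
      if "p \<in> carrier (poly_ring R)" "q \<in> carrier (poly_ring R)" for p q
      using h.poly_add_hom'[OF st[OF that(1)] st[OF that(2)]] norm[OF RX.a_closed[OF that]] by (simp add: univ_poly_add)
    show "map h \<one>\<^bsub>poly_ring R\<^esub> = \<one>\<^bsub>poly_ring S\<^esub>" by (simp add: univ_poly_one)
  qed
qed

section \<open>Polynomials over a finite field: their number, and their roots in an algebraically
  closed field\<close>

lemma inj_on_Cons_pair: "inj_on (\<lambda>(c, l). c # l) A"
  by (auto simp: inj_on_def)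

lemma (in field) card_polys:
  assumes "finite (carrier R)"
  shows "card {p \<in> carrier (poly_ring R). length p = Suc n} = (card (carrier R) - 1) * card (carrier R) ^ n"
    and "card {p \<in> carrier (poly_ring R). length p \<le> n} = card (carrier R) ^ n"
    and "finite {p \<in> carrier (poly_ring R). length p \<le> n}"
proof -
  let ?Q = "card (carrier R)"
  let ?S = "\<lambda>n. {p \<in> carrier (poly_ring R). length p = Suc n}"
  let ?L = "\<lambda>n. {l. set l \<subseteq> carrier R \<and> length l = n}"
  have finL: "finite (?L n)" for n using finite_lists_length_eq[OF assms] .
  have S: "?S n = (\<lambda>(c, l). c # l) ` ((carrier R - {\<zero>}) \<times> ?L n)" for n
  proof (intro equalityI subsetI)
    fix p assume "p \<in> ?S n"
    then obtain c l where "p = c # l" "c \<in> carrier R - {\<zero>}" "l \<in> ?L n"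
      by (cases p) (auto simp: univ_poly_carrier[symmetric] polynomial_def)
    then show "p \<in> (\<lambda>(c, l). c # l) ` ((carrier R - {\<zero>}) \<times> ?L n)" by (intro image_eqI[of _ _ "(c, l)"]) simp_all
  qed (auto simp: univ_poly_carrier[symmetric] polynomial_def)
  show 1: "card (?S n) = (?Q - 1) * ?Q ^ n" for n
  proof -
    have "card (?S n) = card ((carrier R - {\<zero>}) \<times> ?L n)" unfolding S by (rule card_image[OF inj_on_Cons_pair])
    then show ?thesis
      by (simp only: card_cartesian_product card_lists_length_eq[OF assms] card_Diff_singleton[OF zero_closed])
  qed
  have finS: "finite (?S n)" for n
    unfolding S by (rule finite_imageI[OF finite_cartesian_product[OF finite_Diff[OF assms] finL]])
  have Q: "?Q \<ge> 1" using card_gt_0_iff[of "carrier R"] assms zero_closed by (metis One_nat_def Suc_leI empty_iff)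
  have "card {p \<in> carrier (poly_ring R). length p \<le> n} = ?Q ^ n \<and> finite {p \<in> carrier (poly_ring R). length p \<le> n}"
  proof (induction n)
    case 0
    have "{p \<in> carrier (poly_ring R). length p \<le> 0} = {[]}" using univ_poly_zero_closed by auto
    then show ?case by simp
  next
    case (Suc n)
    have e: "{p \<in> carrier (poly_ring R). length p \<le> Suc n} = {p \<in> carrier (poly_ring R). length p \<le> n} \<union> ?S n" by auto
    have disj: "{p \<in> carrier (poly_ring R). length p \<le> n} \<inter> ?S n = {}" by auto
    have "card {p \<in> carrier (poly_ring R). length p \<le> Suc n} = ?Q ^ n + (?Q - 1) * ?Q ^ n"
      unfolding e using card_Un_disjoint[OF conjunct2[OF Suc] finS disj] conjunct1[OF Suc] 1[of n] by (simp only:)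
    also have "\<dots> = ?Q ^ Suc n" using Q by (cases ?Q) simp_all
    finally show ?case unfolding e using finite_UnI[OF conjunct2[OF Suc] finS] by (intro conjI)
  qed
  then show "card {p \<in> carrier (poly_ring R). length p \<le> n} = ?Q ^ n"
    "finite {p \<in> carrier (poly_ring R). length p \<le> n}" by auto
qed

lemma (in field) finite_field_pow_card:
  assumes "finite (carrier R)" "z \<in> carrier R"
  shows "z [^] card (carrier R) = z"
proof (cases "z = \<zero>")
  case True
  have "card (carrier R) > 0" using assms by (auto simp: card_gt_0_iff)
  then show ?thesis using True nat_pow_zero[of "card (carrier R)"] by simp
next
  case False
  interpret M: group "Multiplicative_Group.mult_of R" by (rule field_mult_group)
  have "z [^]\<^bsub>Multiplicative_Group.mult_of R\<^esub> order (Multiplicative_Group.mult_of R) = \<one>\<^bsub>Multiplicative_Group.mult_of R\<^esub>"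
    using M.pow_order_eq_1[of z] assms(2) False by simp
  then have 1: "z [^] (card (carrier R) - 1) = \<one>"
    using order_mult_of[OF assms(1)] by (simp add: Multiplicative_Group.nat_pow_mult_of order_def)
  have "card (carrier R) > 0" using assms by (auto simp: card_gt_0_iff)
  then have "card (carrier R) = Suc (card (carrier R) - 1)" by simp
  then have "z [^] card (carrier R) = z [^] (card (carrier R) - 1) \<otimes> z" by (metis nat_pow_Suc)
  then show ?thesis using 1 assms(2) by simp
qed

locale finite_field_closure = R: field R + k: algebraically_closed k
  for R :: "'r ring" and k :: "'a ring" and i :: "'r \<Rightarrow> 'a" +
  assumes i_hom: "i \<in> ring_hom R k" and R_finite: "finite (carrier R)"
begin

abbreviation "Q \<equiv> card (carrier R)"
abbreviation "RX \<equiv> poly_ring R"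
abbreviation "kX \<equiv> poly_ring k"
abbreviation V :: "'r list \<Rightarrow> 'a \<Rightarrow> 'a" where "V P a \<equiv> k.eval (map i P) a"

sublocale RX: domain RX
  using R.univ_poly_is_domain[OF R.carrier_is_subring] .

sublocale kX: domain kX
  using k.univ_poly_is_domain[OF k.carrier_is_subring] .

lemma map_i_hom: "map i \<in> ring_hom RX kX"
  using map_poly_hom(2)[OF R.field_axioms k.field_axioms i_hom] .

lemma i_zero: "a \<in> carrier R \<Longrightarrow> i a = \<zero>\<^bsub>k\<^esub> \<longleftrightarrow> a = \<zero>\<^bsub>R\<^esub>"
  using map_poly_hom(1)[OF R.field_axioms k.field_axioms i_hom] .

lemma map_i_closed: "P \<in> carrier RX \<Longrightarrow> map i P \<in> carrier kX"
  using ring_hom_closed[OF map_i_hom] .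

lemma eval_k_hom: "a \<in> carrier k \<Longrightarrow> (\<lambda>p. k.eval p a) \<in> ring_hom kX k"
  using k.eval_is_hom[OF k.carrier_is_subring] .

lemma V_hom: "a \<in> carrier k \<Longrightarrow> (\<lambda>P. V P a) \<in> ring_hom RX k"
  using ring_hom_trans[OF map_i_hom eval_k_hom] by (simp add: comp_def)

lemma V_closed: "P \<in> carrier RX \<Longrightarrow> a \<in> carrier k \<Longrightarrow> V P a \<in> carrier k"
  using ring_hom_closed[OF V_hom] by auto

lemma V_mult: "P \<in> carrier RX \<Longrightarrow> S \<in> carrier RX \<Longrightarrow> a \<in> carrier k \<Longrightarrow> V (P \<otimes>\<^bsub>RX\<^esub> S) a = V P a \<otimes>\<^bsub>k\<^esub> V S a"
  using ring_hom_mult[OF V_hom] by auto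

lemma V_add: "P \<in> carrier RX \<Longrightarrow> S \<in> carrier RX \<Longrightarrow> a \<in> carrier k \<Longrightarrow> V (P \<oplus>\<^bsub>RX\<^esub> S) a = V P a \<oplus>\<^bsub>k\<^esub> V S a"
  using ring_hom_add[OF V_hom] by auto

lemma RX_degree_mult:
  "p \<in> carrier RX \<Longrightarrow> q \<in> carrier RX \<Longrightarrow> p \<noteq> [] \<Longrightarrow> q \<noteq> [] \<Longrightarrow> degree (p \<otimes>\<^bsub>RX\<^esub> q) = degree p + degree q"
  using R.poly_mult_degree_eq[OF R.carrier_is_subring, of p q] by (simp add: univ_poly_mult univ_poly_carrier)

lemma RX_mult_Nil: "p \<in> carrier RX \<Longrightarrow> q \<in> carrier RX \<Longrightarrow> p \<otimes>\<^bsub>RX\<^esub> q = [] \<longleftrightarrow> p = [] \<or> q = []"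
  using RX.integral_iff by (simp add: univ_poly_zero)

lemma RX_units: "p \<in> Units RX \<longleftrightarrow> p \<in> carrier RX \<and> p \<noteq> [] \<and> degree p = 0"
  using R.univ_poly_units'[OF R.carrier_is_subfield] .

lemma V_unit:
  assumes "p \<in> Units RX" "a \<in> carrier k" shows "V p a \<noteq> \<zero>\<^bsub>k\<^esub>"
proof -
  obtain c where "p = [c]" using assms(1) RX_units by (cases p) auto
  moreover have "c \<in> carrier R" "c \<noteq> \<zero>\<^bsub>R\<^esub>"
    using assms(1) RX_units calculation by (auto simp: univ_poly_carrier[symmetric] polynomial_def)
  moreover have "i c \<in> carrier k" using ring_hom_closed[OF i_hom] calculation by blast
  ultimately show ?thesis using i_zero by simp
qed

lemma exists_root_k:
  assumes "p \<in> carrier kX" "degree p > 0" shows "\<exists>a\<in>carrier k. k.eval p a = \<zero>\<^bsub>k\<^esub>"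
proof -
  have "size (k.roots p) > 0" using k.roots_over_carrier[OF assms(1)] assms(2) by (simp add: k.splitted_def)
  then obtain a where "a \<in># k.roots p" by (metis nonempty_has_size multiset_nonemptyE)
  then show ?thesis using k.roots_mem_iff_is_root[OF assms(1)] by (auto simp: k.is_root_def)
qed

text \<open>Take a nonzero polynomial of least degree vanishing at \<open>a\<close>. Division with
  remainder shows that it divides all others, and a proper factorization would contain a smaller one
  vanishing at \<open>a\<close>.\<close>

lemma minimal_polynomial:
  assumes a: "a \<in> carrier k" and h: "h \<in> carrier RX" "h \<noteq> []" "V h a = \<zero>\<^bsub>k\<^esub>"
  shows "\<exists>m\<in>carrier RX. ring_irreducible\<^bsub>RX\<^esub> m \<and> V m a = \<zero>\<^bsub>k\<^esub> \<and>
    (\<forall>g\<in>carrier RX. V g a = \<zero>\<^bsub>k\<^esub> \<longrightarrow> (\<exists>u\<in>carrier RX. g = m \<otimes>\<^bsub>RX\<^esub> u))"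
proof -
  define A where "A = {g \<in> carrier RX. g \<noteq> [] \<and> V g a = \<zero>\<^bsub>k\<^esub>}"
  have "h \<in> A" using h by (simp add: A_def)
  then obtain m where m: "m \<in> A" "\<And>g. g \<in> A \<Longrightarrow> degree m \<le> degree g"
    using arg_min_natI[of "\<lambda>g. g \<in> A" h degree] arg_min_nat_le[of "\<lambda>g. g \<in> A" _ degree] by metis
  have mA: "m \<in> carrier RX" "m \<noteq> []" "V m a = \<zero>\<^bsub>k\<^esub>" using m(1) by (simp_all add: A_def)
  have div: "\<exists>u\<in>carrier RX. g = m \<otimes>\<^bsub>RX\<^esub> u" if g: "g \<in> carrier RX" "V g a = \<zero>\<^bsub>k\<^esub>" for g
  proof -
    have "m \<noteq> \<zero>\<^bsub>RX\<^esub>" using mA(2) by (simp add: univ_poly_zero)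
    then obtain u r where ur: "u \<in> carrier RX" "r \<in> carrier RX" "g = m \<otimes>\<^bsub>RX\<^esub> u \<oplus>\<^bsub>RX\<^esub> r" "r = [] \<or> degree r < degree m"
      using R.subfield_long_division_theorem_shell[OF R.carrier_is_subfield g(1) mA(1)] by (metis univ_poly_zero)
    have "V r a = \<zero>\<^bsub>k\<^esub>"
      using g(2) ur V_add[OF RX.m_closed[OF mA(1) ur(1)] ur(2) a] V_mult[OF mA(1) ur(1) a] mA(3) V_closed[OF ur(1) a] V_closed[OF ur(2) a]
      by simp
    then have "r = []" using ur(2,4) m(2)[of r] by (auto simp: A_def)
    then have "g = m \<otimes>\<^bsub>RX\<^esub> u" using ur(3) RX.m_closed[OF mA(1) ur(1)] RX.r_zero by (simp add: univ_poly_zero)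
    then show ?thesis using ur(1) by blast
  qed
  have "ring_irreducible\<^bsub>RX\<^esub> m"
  proof (rule R.pirreducibleI[OF R.carrier_is_subring mA(1,2)])
    show "m \<notin> Units RX" using V_unit[OF _ a] mA(3) by blast
    fix q r assume qr: "q \<in> carrier RX" "r \<in> carrier RX" "m = q \<otimes>\<^bsub>RX\<^esub> r"
    have ne: "q \<noteq> []" "r \<noteq> []" using mA(2) qr RX_mult_Nil[OF qr(1,2)] by auto
    have deg: "degree m = degree q + degree r" using RX_degree_mult[OF qr(1,2) ne] qr(3) by simp
    have "V q a \<otimes>\<^bsub>k\<^esub> V r a = \<zero>\<^bsub>k\<^esub>" using V_mult[OF qr(1,2) a] mA(3) qr(3) by simp
    then have "V q a = \<zero>\<^bsub>k\<^esub> \<or> V r a = \<zero>\<^bsub>k\<^esub>" using k.integral V_closed[OF qr(1) a] V_closed[OF qr(2) a] by blast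
    then show "q \<in> Units RX \<or> r \<in> Units RX"
    proof
      assume "V q a = \<zero>\<^bsub>k\<^esub>"
      then have "degree r = 0" using m(2)[of q] qr(1) ne(1) deg by (simp add: A_def)
      then show ?thesis using RX_units qr(2) ne(2) by blast
    next
      assume "V r a = \<zero>\<^bsub>k\<^esub>"
      then have "degree q = 0" using m(2)[of r] qr(2) ne(2) deg by (simp add: A_def)
      then show ?thesis using RX_units qr(1) ne(1) by blast
    qed
  qed
  then show ?thesis using mA(1,3) div by blast
qed

lemma XR: "X\<^bsub>R\<^esub> \<in> carrier RX" and Xk: "X\<^bsub>k\<^esub> \<in> carrier kX"
  using R.var_closed(1)[OF R.carrier_is_subring] k.var_closed(1)[OF k.carrier_is_subring] by auto

text \<open>The residue field modulo \<open>P\<close> has \<open>Q^n\<close> elements,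
  \<open>n\<close> being the degree of \<open>P\<close>. There every element equals its
  \<open>Q^n\<close>-th power, in particular the class of \<open>X\<close>.\<close>

lemma irreducible_divides_Frobenius:
  assumes P: "P \<in> carrier RX" "ring_irreducible\<^bsub>RX\<^esub> P"
  shows "\<exists>u\<in>carrier RX. X\<^bsub>R\<^esub> [^]\<^bsub>RX\<^esub> (Q ^ degree P) \<ominus>\<^bsub>RX\<^esub> X\<^bsub>R\<^esub> = P \<otimes>\<^bsub>RX\<^esub> u"
proof -
  let ?E = "Rupt\<^bsub>R\<^esub> (carrier R) P" and ?s = "R.rupture_surj (carrier R) P"
  let ?T = "X\<^bsub>R\<^esub> [^]\<^bsub>RX\<^esub> (Q ^ degree P) \<ominus>\<^bsub>RX\<^esub> X\<^bsub>R\<^esub>"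
  interpret E: field ?E using R.rupture_is_field_iff_pirreducible[OF R.carrier_is_subfield P(1)] P(2) by blast
  have sh: "?s \<in> ring_hom RX ?E" using R.rupture_surj_hom(1)[OF R.carrier_is_subring P(1)] .
  interpret s: ring_hom_ring RX ?E ?s using ring_hom_ringI2[OF RX.ring_axioms E.ring_axioms sh] .
  have Pn: "P \<noteq> []" using R.pirreducibleE(1)[OF R.carrier_is_subring P] .
  have img: "(\<lambda>q. R.pmod q P) ` carrier RX = {q \<in> carrier RX. length q \<le> degree P}"
    using R.pmod_image_characterization[OF R.carrier_is_subfield P(1) Pn] .
  have car: "carrier ?E = ?s ` {q \<in> carrier RX. length q \<le> degree P}"
    using R.rupture_carrier_as_pmod_image[OF R.carrier_is_subfield P(1)] img by simp
  have inj: "inj_on ?s {q \<in> carrier RX. length q \<le> degree P}"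
    using R.rupture_surj_inj_on[OF R.carrier_is_subfield P(1)] img by simp
  have fin: "finite (carrier ?E)" unfolding car using R.card_polys(3)[OF R_finite] by blast
  have cardE: "card (carrier ?E) = Q ^ degree P"
    unfolding car card_image[OF inj] using R.card_polys(2)[OF R_finite] .
  have Tc: "?T \<in> carrier RX" using XR by simp
  have "?s ?T = ?s (X\<^bsub>R\<^esub>) [^]\<^bsub>?E\<^esub> (Q ^ degree P) \<ominus>\<^bsub>?E\<^esub> ?s (X\<^bsub>R\<^esub>)"
    using XR by (simp add: a_minus_def s.hom_nat_pow)
  also have "\<dots> = \<zero>\<^bsub>?E\<^esub>"
    using E.finite_field_pow_card[OF fin s.hom_closed[OF XR]] cardE s.hom_closed[OF XR] by simp
  also have "\<dots> = ?s []" using s.hom_zero by (simp add: univ_poly_zero)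
  finally have e: "?s ?T = ?s []" .
  have "?s (R.pmod ?T P) = ?s []"
    using R.rupture_surj_composed_with_pmod[OF R.carrier_is_subfield P(1) Tc] e by simp
  moreover have "R.pmod ?T P \<in> {q \<in> carrier RX. length q \<le> degree P}" using img Tc by blast
  moreover have "[] \<in> {q \<in> carrier RX. length q \<le> degree P}" using univ_poly_zero_closed by simp
  ultimately have "R.pmod ?T P = []" using inj_onD[OF inj] by blast
  then have "P pdivides\<^bsub>R\<^esub> ?T" using R.pmod_zero_iff_pdivides[OF R.carrier_is_subfield Tc P(1)] by simp
  then show ?thesis unfolding pdivides_def by (auto simp: factor_def)
qed

lemma irreducible_degree_pos: "P \<in> carrier RX \<Longrightarrow> ring_irreducible\<^bsub>RX\<^esub> P \<Longrightarrow> degree P \<ge> 1"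
  using R.pirreducible_degree[OF R.carrier_is_subfield] .

text \<open>By Lagrange in the additive group of \<open>R\<close>, the \<open>Q\<close>-fold sum of
  \<open>\<one>\<close> is zero, and \<open>i\<close> carries this over to \<open>k\<close>.\<close>

lemma card_multiple_zero:
  assumes "y \<in> carrier k" "n \<ge> 1" shows "[(Q ^ n)] \<cdot>\<^bsub>k\<^esub> y = \<zero>\<^bsub>k\<^esub>"
proof -
  interpret i: ring_hom_ring R k i using ring_hom_ringI2[OF R.ring_axioms k.ring_axioms i_hom] .
  have "[Q] \<cdot>\<^bsub>R\<^esub> \<one>\<^bsub>R\<^esub> = \<zero>\<^bsub>R\<^esub>"
    using group.pow_order_eq_1[OF R.a_group, of "\<one>\<^bsub>R\<^esub>"] by (simp add: add_pow_def order_def)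
  moreover have "i ([m] \<cdot>\<^bsub>R\<^esub> \<one>\<^bsub>R\<^esub>) = [m] \<cdot>\<^bsub>k\<^esub> \<one>\<^bsub>k\<^esub>" for m :: nat
    by (induction m) (simp_all add: R.add.nat_pow_Suc k.add.nat_pow_Suc)
  ultimately have 1: "[Q] \<cdot>\<^bsub>k\<^esub> \<one>\<^bsub>k\<^esub> = \<zero>\<^bsub>k\<^esub>" by (metis i.hom_zero)
  have Qz: "[Q] \<cdot>\<^bsub>k\<^esub> z = \<zero>\<^bsub>k\<^esub>" if "z \<in> carrier k" for z
    using k.add_pow_ldistr[of "\<one>\<^bsub>k\<^esub>" z Q] 1 that by simp
  obtain m where m: "n = Suc m" using assms(2) by (cases n) auto
  have "[(Q ^ n)] \<cdot>\<^bsub>k\<^esub> y = [Q] \<cdot>\<^bsub>k\<^esub> ([(Q ^ m)] \<cdot>\<^bsub>k\<^esub> y)"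
    using k.add.nat_pow_pow[OF assms(1), of Q "Q ^ m"] by (simp add: m mult.commute)
  then show ?thesis using Qz assms(1) by simp
qed

text \<open>
  A substitute for the derivative: the quotient of \<open>X^n - a^n\<close> by \<open>X - a\<close>, evaluated at \<open>a\<close>.
\<close>

lemma power_quotient:
  assumes a: "a \<in> carrier k"
  shows "\<exists>q\<in>carrier kX. X\<^bsub>k\<^esub> [^]\<^bsub>kX\<^esub> (Suc n) = [\<one>\<^bsub>k\<^esub>, \<ominus>\<^bsub>k\<^esub> a] \<otimes>\<^bsub>kX\<^esub> q \<oplus>\<^bsub>kX\<^esub> k.poly_of_const (a [^]\<^bsub>k\<^esub> Suc n) \<and>
     k.eval q a = [Suc n] \<cdot>\<^bsub>k\<^esub> (a [^]\<^bsub>k\<^esub> n)"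
proof (induction n)
  case 0
  have "[\<one>\<^bsub>k\<^esub>, \<ominus>\<^bsub>k\<^esub> a] \<oplus>\<^bsub>kX\<^esub> k.poly_of_const a = X\<^bsub>k\<^esub>"
    using a by (simp add: univ_poly_add k.poly_of_const_def var_def k.l_neg)
  moreover have "[\<one>\<^bsub>k\<^esub>, \<ominus>\<^bsub>k\<^esub> a] \<in> carrier kX" using a by (auto simp: univ_poly_carrier[symmetric] polynomial_def)
  moreover have "k.eval [\<one>\<^bsub>k\<^esub>] a = [Suc 0] \<cdot>\<^bsub>k\<^esub> (a [^]\<^bsub>k\<^esub> (0::nat))" using a by (simp add: k.add.nat_pow_Suc)
  moreover have "[\<one>\<^bsub>k\<^esub>] \<in> carrier kX" "[\<one>\<^bsub>k\<^esub>, \<ominus>\<^bsub>k\<^esub> a] \<otimes>\<^bsub>kX\<^esub> [\<one>\<^bsub>k\<^esub>] = [\<one>\<^bsub>k\<^esub>, \<ominus>\<^bsub>k\<^esub> a]"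
    using kX.one_closed kX.r_one calculation(2) by (simp_all add: univ_poly_one)
  ultimately show ?case using a Xk by (intro bexI[of _ "[\<one>\<^bsub>k\<^esub>]"]) simp_all
next
  case (Suc n)
  let ?l = "[\<one>\<^bsub>k\<^esub>, \<ominus>\<^bsub>k\<^esub> a]" and ?c = "k.poly_of_const"
  obtain q where q: "q \<in> carrier kX" "X\<^bsub>k\<^esub> [^]\<^bsub>kX\<^esub> (Suc n) = ?l \<otimes>\<^bsub>kX\<^esub> q \<oplus>\<^bsub>kX\<^esub> ?c (a [^]\<^bsub>k\<^esub> Suc n)"
    "k.eval q a = [Suc n] \<cdot>\<^bsub>k\<^esub> (a [^]\<^bsub>k\<^esub> n)" using Suc by blast
  have l: "?l \<in> carrier kX" using a by (auto simp: univ_poly_carrier[symmetric] polynomial_def)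
  have ch: "?c \<in> ring_hom k kX" using k.canonical_embedding_is_hom[OF k.carrier_is_subring] by simp
  define y where "y = a [^]\<^bsub>k\<^esub> Suc n"
  have y: "y \<in> carrier k" using a by (simp add: y_def)
  have cc: "?c a \<in> carrier kX" "?c y \<in> carrier kX" using ring_hom_closed[OF ch] a y by auto
  have X1: "?l \<oplus>\<^bsub>kX\<^esub> ?c a = X\<^bsub>k\<^esub>"
    using a by (simp add: univ_poly_add k.poly_of_const_def var_def k.l_neg)
  have cm: "?c a \<otimes>\<^bsub>kX\<^esub> ?c y = ?c (a [^]\<^bsub>k\<^esub> Suc (Suc n))"
    using ring_hom_mult[OF ch a y] a by (simp add: y_def k.m_ac)
  have id: "(l \<otimes>\<^bsub>kX\<^esub> q \<oplus>\<^bsub>kX\<^esub> w) \<otimes>\<^bsub>kX\<^esub> (l \<oplus>\<^bsub>kX\<^esub> u) = l \<otimes>\<^bsub>kX\<^esub> (q \<otimes>\<^bsub>kX\<^esub> (l \<oplus>\<^bsub>kX\<^esub> u) \<oplus>\<^bsub>kX\<^esub> w) \<oplus>\<^bsub>kX\<^esub> u \<otimes>\<^bsub>kX\<^esub> w"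
    if "l \<in> carrier kX" "u \<in> carrier kX" "w \<in> carrier kX" for l u w
    using that q(1) by (simp add: kX.l_distr kX.r_distr kX.m_ac kX.a_ac)
  have "X\<^bsub>k\<^esub> [^]\<^bsub>kX\<^esub> (Suc (Suc n)) = (?l \<otimes>\<^bsub>kX\<^esub> q \<oplus>\<^bsub>kX\<^esub> ?c y) \<otimes>\<^bsub>kX\<^esub> (?l \<oplus>\<^bsub>kX\<^esub> ?c a)"
    using q(2) X1 unfolding y_def by (metis kX.nat_pow_Suc)
  also have "\<dots> = ?l \<otimes>\<^bsub>kX\<^esub> (q \<otimes>\<^bsub>kX\<^esub> X\<^bsub>k\<^esub> \<oplus>\<^bsub>kX\<^esub> ?c y) \<oplus>\<^bsub>kX\<^esub> ?c (a [^]\<^bsub>k\<^esub> Suc (Suc n))"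
    using id[OF l cc] unfolding X1 cm .
  finally have 1: "X\<^bsub>k\<^esub> [^]\<^bsub>kX\<^esub> (Suc (Suc n)) = ?l \<otimes>\<^bsub>kX\<^esub> (q \<otimes>\<^bsub>kX\<^esub> X\<^bsub>k\<^esub> \<oplus>\<^bsub>kX\<^esub> ?c y) \<oplus>\<^bsub>kX\<^esub> ?c (a [^]\<^bsub>k\<^esub> Suc (Suc n))" .
  have "k.eval (q \<otimes>\<^bsub>kX\<^esub> X\<^bsub>k\<^esub> \<oplus>\<^bsub>kX\<^esub> ?c y) a = k.eval q a \<otimes>\<^bsub>k\<^esub> a \<oplus>\<^bsub>k\<^esub> y"
    using ring_hom_add[OF eval_k_hom[OF a] kX.m_closed[OF q(1) Xk] cc(2)] ring_hom_mult[OF eval_k_hom[OF a] q(1) Xk]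
      k.eval_var[OF a] y a by (simp add: k.poly_of_const_def)
  also have "\<dots> = [Suc (Suc n)] \<cdot>\<^bsub>k\<^esub> y"
    unfolding q(3) using k.add_pow_ldistr[of "a [^]\<^bsub>k\<^esub> n" a "Suc n"] a y by (simp add: y_def k.add.nat_pow_Suc)
  finally show ?case using 1 q(1) Xk cc(2) unfolding y_def by (intro bexI[of _ "q \<otimes>\<^bsub>kX\<^esub> X\<^bsub>k\<^esub> \<oplus>\<^bsub>kX\<^esub> ?c y"]) (simp_all add: y_def)
qed

section \<open>The polynomial \<open>X^(Q^n) - X\<close> and the number of irreducible
  polynomials\<close>

definition frob :: "nat \<Rightarrow> 'a list" where
  "frob n = X\<^bsub>k\<^esub> [^]\<^bsub>kX\<^esub> (Q ^ n) \<ominus>\<^bsub>kX\<^esub> X\<^bsub>k\<^esub>"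

lemma frob_closed: "frob n \<in> carrier kX"
  unfolding frob_def using Xk by simp

lemma Q_ge_2: "Q \<ge> 2"
proof -
  have "{\<zero>\<^bsub>R\<^esub>, \<one>\<^bsub>R\<^esub>} \<subseteq> carrier R" by simp
  then have "card {\<zero>\<^bsub>R\<^esub>, \<one>\<^bsub>R\<^esub>} \<le> Q" by (rule card_mono[OF R_finite])
  then show ?thesis by simp
qed

lemma frob_degree:
  assumes "n \<ge> 1" shows "degree (frob n) = Q ^ n"
proof -
  have "Q ^ n > 1" using Q_ge_2 assms by (intro one_less_power) auto
  have 1: "degree (X\<^bsub>k\<^esub> [^]\<^bsub>kX\<^esub> (Q ^ n)) = Q ^ n"
    using k.polynomial_pow_degree[OF Xk] by (simp add: var_def)
  have 2: "degree (\<ominus>\<^bsub>kX\<^esub> X\<^bsub>k\<^esub>) = 1"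
    using k.univ_poly_a_inv_degree[OF k.carrier_is_subring Xk] by (simp add: var_def)
  have p: "polynomial\<^bsub>k\<^esub> (carrier k) (X\<^bsub>k\<^esub> [^]\<^bsub>kX\<^esub> (Q ^ n))" "polynomial\<^bsub>k\<^esub> (carrier k) (\<ominus>\<^bsub>kX\<^esub> X\<^bsub>k\<^esub>)"
    unfolding univ_poly_carrier using kX.nat_pow_closed[OF Xk] kX.a_inv_closed[OF Xk] by blast+
  have ne: "degree (X\<^bsub>k\<^esub> [^]\<^bsub>kX\<^esub> (Q ^ n)) \<noteq> degree (\<ominus>\<^bsub>kX\<^esub> X\<^bsub>k\<^esub>)"
    unfolding 1 2 using \<open>Q ^ n > 1\<close> by linarith
  have "degree (k.poly_add (X\<^bsub>k\<^esub> [^]\<^bsub>kX\<^esub> (Q ^ n)) (\<ominus>\<^bsub>kX\<^esub> X\<^bsub>k\<^esub>)) = max (Q ^ n) 1"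
    using k.poly_add_degree_eq[OF k.carrier_is_subring p ne] unfolding 1 2 .
  also have "max (Q ^ n) 1 = Q ^ n" using \<open>Q ^ n > 1\<close> by simp
  finally show ?thesis unfolding frob_def a_minus_def univ_poly_add .
qed

text \<open>At a root \<open>a\<close>, the quotient of \<open>X^(Q^n) - X\<close> by
  \<open>X - a\<close> is \<open>q - 1\<close>, with \<open>q\<close> from
  \<open>power_quotient\<close>. Since \<open>q(a)\<close> is a \<open>Q^n\<close>-fold sum it is
  zero, so the quotient has the value \<open>- 1\<close> at \<open>a\<close>.\<close>

lemma frob_simple_roots:
  assumes n: "n \<ge> 1" and a: "a \<in> carrier k" shows "count (k.roots (frob n)) a \<le> 1"
proof (cases "a \<in># k.roots (frob n)")
  case True
  let ?l = "[\<one>\<^bsub>k\<^esub>, \<ominus>\<^bsub>k\<^esub> a]" and ?c = "k.poly_of_const"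
  obtain M where M: "Q ^ n = Suc M" using Q_ge_2 gr0_implies_Suc[of "Q ^ n"] by auto
  have l: "?l \<in> carrier kX" using a by (auto simp: univ_poly_carrier[symmetric] polynomial_def)
  have "k.eval (frob n) a = \<zero>\<^bsub>k\<^esub>"
    using True k.roots_mem_iff_is_root[OF frob_closed] by (simp add: k.is_root_def)
  moreover have "k.eval (frob n) a = a [^]\<^bsub>k\<^esub> (Q ^ n) \<ominus>\<^bsub>k\<^esub> a"
  proof -
    interpret e: ring_hom_ring kX k "\<lambda>p. k.eval p a" using ring_hom_ringI2[OF kX.ring_axioms k.ring_axioms eval_k_hom[OF a]] .
    show ?thesis unfolding frob_def a_minus_def using Xk k.eval_var[OF a] by (simp add: e.hom_nat_pow)
  qed
  ultimately have aM: "a [^]\<^bsub>k\<^esub> Suc M = a" using a M by simp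
  obtain q where q: "q \<in> carrier kX" "X\<^bsub>k\<^esub> [^]\<^bsub>kX\<^esub> (Suc M) = ?l \<otimes>\<^bsub>kX\<^esub> q \<oplus>\<^bsub>kX\<^esub> ?c (a [^]\<^bsub>k\<^esub> Suc M)"
    "k.eval q a = [Suc M] \<cdot>\<^bsub>k\<^esub> (a [^]\<^bsub>k\<^esub> M)" using power_quotient[OF a] by blast
  have q0: "k.eval q a = \<zero>\<^bsub>k\<^esub>" using q(3) card_multiple_zero[OF _ n, of "a [^]\<^bsub>k\<^esub> M"] a M by simp
  have X1: "X\<^bsub>k\<^esub> = ?l \<oplus>\<^bsub>kX\<^esub> ?c a"
    using a by (simp add: univ_poly_add k.poly_of_const_def var_def k.l_neg)
  have ca: "?c a \<in> carrier kX" using ring_hom_closed[OF k.canonical_embedding_is_hom[OF k.carrier_is_subring]] a by simp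
  define s where "s = q \<ominus>\<^bsub>kX\<^esub> \<one>\<^bsub>kX\<^esub>"
  have s: "s \<in> carrier kX" using q(1) by (simp add: s_def)
  have id: "(l \<otimes>\<^bsub>kX\<^esub> q \<oplus>\<^bsub>kX\<^esub> u) \<ominus>\<^bsub>kX\<^esub> (l \<oplus>\<^bsub>kX\<^esub> u) = l \<otimes>\<^bsub>kX\<^esub> (q \<ominus>\<^bsub>kX\<^esub> \<one>\<^bsub>kX\<^esub>)"
    if "l \<in> carrier kX" "u \<in> carrier kX" for l u
    using that q(1) by algebra
  have fr: "frob n = ?l \<otimes>\<^bsub>kX\<^esub> s"
    unfolding frob_def M q(2) aM s_def using id[OF l ca] X1 by simp
  have "k.eval s a = \<ominus>\<^bsub>k\<^esub> \<one>\<^bsub>k\<^esub>"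
  proof -
    interpret e: ring_hom_ring kX k "\<lambda>p. k.eval p a" using ring_hom_ringI2[OF kX.ring_axioms k.ring_axioms eval_k_hom[OF a]] .
    show ?thesis unfolding s_def a_minus_def using q(1) q0 e.hom_one by simp
  qed
  then have s0: "k.eval s a \<noteq> \<zero>\<^bsub>k\<^esub>" by (metis k.add.inv_eq_1_iff k.one_closed k.one_not_zero)
  then have sn: "s \<noteq> []" by auto
  have "k.roots (frob n) = add_mset a (k.roots s)"
    unfolding fr using k.poly_mult_degree_one_monic_imp_same_roots[OF a s sn] .
  moreover have "count (k.roots s) a = 0"
    using k.roots_mem_iff_is_root[OF s, of a] s0 by (simp add: k.is_root_def not_in_iff)
  ultimately show ?thesis by simp
qed (simp add: not_in_iff)

lemma irreducible_divides_frob: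
  assumes P: "P \<in> carrier RX" "ring_irreducible\<^bsub>RX\<^esub> P"
  shows "map i P pdivides\<^bsub>k\<^esub> frob (degree P)"
proof -
  interpret m: ring_hom_ring RX kX "map i" using ring_hom_ringI2[OF RX.ring_axioms kX.ring_axioms map_i_hom] .
  interpret i: ring_hom_ring R k i using ring_hom_ringI2[OF R.ring_axioms k.ring_axioms i_hom] .
  obtain u where u: "u \<in> carrier RX" "X\<^bsub>R\<^esub> [^]\<^bsub>RX\<^esub> (Q ^ degree P) \<ominus>\<^bsub>RX\<^esub> X\<^bsub>R\<^esub> = P \<otimes>\<^bsub>RX\<^esub> u"
    using irreducible_divides_Frobenius[OF P] by blast
  have "map i (X\<^bsub>R\<^esub>) = X\<^bsub>k\<^esub>" by (simp add: var_def)
  then have "map i (X\<^bsub>R\<^esub> [^]\<^bsub>RX\<^esub> (Q ^ degree P) \<ominus>\<^bsub>RX\<^esub> X\<^bsub>R\<^esub>) = frob (degree P)"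
    unfolding frob_def a_minus_def using m.hom_add[of "X\<^bsub>R\<^esub> [^]\<^bsub>RX\<^esub> (Q ^ degree P)" "\<ominus>\<^bsub>RX\<^esub> X\<^bsub>R\<^esub>"] XR
      m.hom_nat_pow[OF XR] m.hom_a_inv[OF XR] by simp
  then have "frob (degree P) = map i P \<otimes>\<^bsub>kX\<^esub> map i u" using u(2) m.hom_mult[OF P(1) u(1)] by simp
  then show ?thesis unfolding pdivides_def factor_def using m.hom_closed[OF u(1)] by blast
qed

lemma irreducible_roots_incl:
  assumes P: "P \<in> carrier RX" "ring_irreducible\<^bsub>RX\<^esub> P"
  shows "k.roots (map i P) \<subseteq># k.roots (frob (degree P))"
proof -
  have "frob (degree P) \<noteq> []"
    using frob_degree[OF irreducible_degree_pos[OF P]] Q_ge_2 by (intro notI) simp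
  then show ?thesis using k.pdivides_imp_roots_incl[OF map_i_closed[OF P(1)] frob_closed] irreducible_divides_frob[OF P] by blast
qed

text \<open>Irreducible polynomials over a finite field are separable, as divisors of a polynomial
  with simple roots.\<close>

lemma irreducible_simple_roots:
  assumes P: "P \<in> carrier RX" "ring_irreducible\<^bsub>RX\<^esub> P" and a: "a \<in> carrier k"
  shows "count (k.roots (map i P)) a \<le> 1"
  using frob_simple_roots[OF irreducible_degree_pos[OF P] a] mset_subset_eq_count[OF irreducible_roots_incl[OF P], of a] by simp

abbreviation zeros :: "'r list \<Rightarrow> 'a set" where "zeros P \<equiv> {a \<in> carrier k. V P a = \<zero>\<^bsub>k\<^esub>}"

lemma card_zeros_irreducible:
  assumes P: "P \<in> carrier RX" "ring_irreducible\<^bsub>RX\<^esub> P"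
  shows "finite (zeros P)" "card (zeros P) = degree P"
proof -
  have iP: "map i P \<in> carrier kX" using map_i_closed[OF P(1)] .
  have Pn: "P \<noteq> []" using R.pirreducibleE(1)[OF R.carrier_is_subring P] .
  have z: "zeros P = set_mset (k.roots (map i P))"
    using k.roots_mem_iff_is_root[OF iP] Pn by (auto simp: k.is_root_def)
  have "count (k.roots (map i P)) a = 1" if "a \<in># k.roots (map i P)" for a
  proof -
    have "a \<in> carrier k" using that z by blast
    then show ?thesis using irreducible_simple_roots[OF P] that by (metis One_nat_def Suc_leI count_greater_zero_iff le_antisym)
  qed
  then have "size (k.roots (map i P)) = (\<Sum>a\<in>set_mset (k.roots (map i P)). 1)"
    unfolding size_multiset_overloaded_eq by (intro sum.cong) auto
  also have "\<dots> = card (zeros P)" using z by simp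
  finally show "card (zeros P) = degree P" using k.roots_over_carrier[OF iP] by (simp add: k.splitted_def)
  show "finite (zeros P)" unfolding z by simp
qed

definition irreducibles :: "nat \<Rightarrow> 'r list set" where
  "irreducibles n = {P \<in> carrier RX. ring_irreducible\<^bsub>RX\<^esub> P \<and> lead_coeff P = \<one>\<^bsub>R\<^esub> \<and> degree P = n}"

lemma finite_irreducibles: "finite (irreducibles n)"
proof -
  have "irreducibles n \<subseteq> {p \<in> carrier RX. length p \<le> Suc n}" by (auto simp: irreducibles_def)
  then show ?thesis using R.card_polys(3)[OF R_finite] finite_subset by blast
qed

text \<open>Both are multiples of the minimal polynomial of \<open>a\<close> by a unit, and being
  monic determines the unit.\<close>

lemma irreducible_unique:
  assumes P: "P \<in> irreducibles n" and S: "S \<in> irreducibles m" and a: "a \<in> zeros P" "a \<in> zeros S"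
  shows "P = S"
proof -
  have ac: "a \<in> carrier k" "V P a = \<zero>\<^bsub>k\<^esub>" "V S a = \<zero>\<^bsub>k\<^esub>" using a by auto
  have p: "P \<in> carrier RX" "ring_irreducible\<^bsub>RX\<^esub> P" "lead_coeff P = \<one>\<^bsub>R\<^esub>"
    and s: "S \<in> carrier RX" "ring_irreducible\<^bsub>RX\<^esub> S" "lead_coeff S = \<one>\<^bsub>R\<^esub>" using P S by (auto simp: irreducibles_def)
  have Pn: "P \<noteq> []" "S \<noteq> []" using R.pirreducibleE(1)[OF R.carrier_is_subring] p s by auto
  obtain w where w: "w \<in> carrier RX" "ring_irreducible\<^bsub>RX\<^esub> w"
    "\<forall>g\<in>carrier RX. V g a = \<zero>\<^bsub>k\<^esub> \<longrightarrow> (\<exists>u\<in>carrier RX. g = w \<otimes>\<^bsub>RX\<^esub> u)"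
    using minimal_polynomial[OF ac(1) p(1) Pn(1) ac(2)] by blast
  note m = w(1,2) w(3)[rule_format]
  have wn: "w \<noteq> []" "w \<notin> Units RX" using R.pirreducibleE(1,2)[OF R.carrier_is_subring m(1,2)] by auto
  have *: "\<exists>c\<in>carrier R. T = w \<otimes>\<^bsub>RX\<^esub> [c] \<and> c \<noteq> \<zero>\<^bsub>R\<^esub> \<and> lead_coeff T = lead_coeff w \<otimes>\<^bsub>R\<^esub> c"
    if T: "T \<in> carrier RX" "ring_irreducible\<^bsub>RX\<^esub> T" "V T a = \<zero>\<^bsub>k\<^esub>" for T
  proof -
    obtain u where u: "u \<in> carrier RX" "T = w \<otimes>\<^bsub>RX\<^esub> u" using m(3)[OF T(1,3)] by blast
    have "u \<in> Units RX" using R.pirreducibleE(3)[OF R.carrier_is_subring T(1,2) m(1) u] wn by blast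
    then obtain c where c: "u = [c]" using RX_units by (cases u) auto
    have cc: "c \<in> carrier R" "c \<noteq> \<zero>\<^bsub>R\<^esub>" using u(1) c by (auto simp: univ_poly_carrier[symmetric] polynomial_def)
    have "lead_coeff T = lead_coeff w \<otimes>\<^bsub>R\<^esub> c"
      using R.poly_mult_lead_coeff[OF R.carrier_is_subring, of w u] m(1) u wn(1) c by (simp add: univ_poly_carrier univ_poly_mult)
    then show ?thesis using u c cc by blast
  qed
  obtain c where c: "c \<in> carrier R" "P = w \<otimes>\<^bsub>RX\<^esub> [c]" "\<one>\<^bsub>R\<^esub> = lead_coeff w \<otimes>\<^bsub>R\<^esub> c" using *[OF p(1,2) ac(2)] p(3) by auto
  obtain d where d: "d \<in> carrier R" "S = w \<otimes>\<^bsub>RX\<^esub> [d]" "\<one>\<^bsub>R\<^esub> = lead_coeff w \<otimes>\<^bsub>R\<^esub> d" using *[OF s(1,2) ac(3)] s(3) by auto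
  have lw: "lead_coeff w \<in> carrier R" "lead_coeff w \<noteq> \<zero>\<^bsub>R\<^esub>"
    using m(1) wn(1) by (auto simp: univ_poly_carrier[symmetric] polynomial_def)
  have "c = d" using R.m_lcancel[OF lw(2,1) c(1) d(1)] c(3) d(3) by simp
  then show ?thesis using c(2) d(2) by simp
qed

text \<open>The zero sets of the irreducible polynomials of degree \<open>n\<close> are pairwise
  disjoint, have \<open>n\<close> elements each, and consist of roots of
  \<open>X^(Q^n) - X\<close>.\<close>

lemma card_irreducibles: "n * card (irreducibles n) \<le> Q ^ n"
proof (cases "irreducibles n = {}")
  case False
  then have n: "n \<ge> 1" using irreducible_degree_pos by (auto simp: irreducibles_def)
  have P: "P \<in> carrier RX" "ring_irreducible\<^bsub>RX\<^esub> P" "degree P = n" if "P \<in> irreducibles n" for P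
    using that by (auto simp: irreducibles_def)
  have "n * card (irreducibles n) = (\<Sum>P\<in>irreducibles n. card (zeros P))"
    using card_zeros_irreducible(2)[OF P(1,2)] P(3) by simp
  also have "\<dots> = card (\<Union>P\<in>irreducibles n. zeros P)"
  proof (rule card_UN_disjoint[symmetric, OF finite_irreducibles])
    show "\<forall>P\<in>irreducibles n. finite (zeros P)" using card_zeros_irreducible(1)[OF P(1,2)] by blast
    show "\<forall>P\<in>irreducibles n. \<forall>S\<in>irreducibles n. P \<noteq> S \<longrightarrow> zeros P \<inter> zeros S = {}"
      using irreducible_unique by blast
  qed
  also have "\<dots> \<le> card (set_mset (k.roots (frob n)))"
  proof (rule card_mono)
    show "(\<Union>P\<in>irreducibles n. zeros P) \<subseteq> set_mset (k.roots (frob n))"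
    proof
      fix a assume "a \<in> (\<Union>P\<in>irreducibles n. zeros P)"
      then obtain S where S: "S \<in> irreducibles n" "a \<in> carrier k" "V S a = \<zero>\<^bsub>k\<^esub>" by blast
      have "S \<noteq> []" using R.pirreducibleE(1)[OF R.carrier_is_subring P(1,2)[OF S(1)]] .
      then have "a \<in># k.roots (map i S)"
        using k.roots_mem_iff_is_root[OF map_i_closed[OF P(1)[OF S(1)]]] S by (simp add: k.is_root_def)
      then show "a \<in># k.roots (frob n)"
        using mset_subset_eqD[OF irreducible_roots_incl[OF P(1,2)[OF S(1)]]] P(3)[OF S(1)] by simp
    qed
  qed simp
  also have "\<dots> \<le> size (k.roots (frob n))"
    unfolding size_multiset_overloaded_eq card_eq_sum by (intro sum_mono) (simp add: Suc_le_eq)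
  also have "\<dots> \<le> Q ^ n" using k.size_roots_le_degree[OF frob_closed, of n] unfolding frob_degree[OF n] .
  finally show ?thesis .
qed simp

definition square_free :: "'r list \<Rightarrow> bool" where
  "square_free f \<longleftrightarrow> f \<in> carrier RX \<and> f \<noteq> [] \<and>
     (\<forall>h\<in>carrier RX. (h \<otimes>\<^bsub>RX\<^esub> h) pdivides\<^bsub>R\<^esub> f \<longrightarrow> h \<in> Units RX)"

text \<open>The minimal polynomial \<open>m\<close> of \<open>a\<close> divides \<open>f\<close>,
  and has \<open>a\<close> as a simple root. The cofactor does not vanish at \<open>a\<close>, since
  otherwise \<open>m\<close> would divide it and \<open>m^2\<close> would divide
  \<open>f\<close>.\<close>

lemma square_free_simple_root:
  assumes f: "square_free f" and a: "a \<in> carrier k" "V f a = \<zero>\<^bsub>k\<^esub>"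
  obtains g where "g \<in> carrier kX" "map i f = [\<one>\<^bsub>k\<^esub>, \<ominus>\<^bsub>k\<^esub> a] \<otimes>\<^bsub>kX\<^esub> g" "k.eval g a \<noteq> \<zero>\<^bsub>k\<^esub>"
proof -
  have fc: "f \<in> carrier RX" "f \<noteq> []" using f by (auto simp: square_free_def)
  obtain m where m': "m \<in> carrier RX" "ring_irreducible\<^bsub>RX\<^esub> m" "V m a = \<zero>\<^bsub>k\<^esub>"
    "\<forall>g\<in>carrier RX. V g a = \<zero>\<^bsub>k\<^esub> \<longrightarrow> (\<exists>u\<in>carrier RX. g = m \<otimes>\<^bsub>RX\<^esub> u)"
    using minimal_polynomial[OF a(1) fc a(2)] by blast
  note m = m'(1-3) m'(4)[rule_format]
  have mn: "m \<noteq> []" "m \<notin> Units RX" using R.pirreducibleE(1,2)[OF R.carrier_is_subring m(1,2)] by auto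
  obtain g where g: "g \<in> carrier RX" "f = m \<otimes>\<^bsub>RX\<^esub> g" using m(4)[OF fc(1) a(2)] by blast
  have g0: "V g a \<noteq> \<zero>\<^bsub>k\<^esub>"
  proof
    assume "V g a = \<zero>\<^bsub>k\<^esub>"
    then obtain u where u: "u \<in> carrier RX" "g = m \<otimes>\<^bsub>RX\<^esub> u" using m(4)[OF g(1)] by blast
    have "f = (m \<otimes>\<^bsub>RX\<^esub> m) \<otimes>\<^bsub>RX\<^esub> u" using g(2) u m(1) by (simp add: RX.m_assoc)
    then have "(m \<otimes>\<^bsub>RX\<^esub> m) pdivides\<^bsub>R\<^esub> f" unfolding pdivides_def factor_def using u(1) by blast
    then show False using f m(1) mn(2) by (simp add: square_free_def)
  qed
  have im: "map i m \<in> carrier kX" "map i m \<noteq> []" using map_i_closed[OF m(1)] mn by auto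
  have "[\<one>\<^bsub>k\<^esub>, \<ominus>\<^bsub>k\<^esub> a] pdivides\<^bsub>k\<^esub> map i m"
    using k.is_root_imp_pdivides[OF im(1)] a(1) m(3) im(2) by (simp add: k.is_root_def)
  then obtain s where s: "s \<in> carrier kX" "map i m = [\<one>\<^bsub>k\<^esub>, \<ominus>\<^bsub>k\<^esub> a] \<otimes>\<^bsub>kX\<^esub> s"
    unfolding pdivides_def factor_def by blast
  have l: "[\<one>\<^bsub>k\<^esub>, \<ominus>\<^bsub>k\<^esub> a] \<in> carrier kX" using a by (auto simp: univ_poly_carrier[symmetric] polynomial_def)
  have sn: "s \<noteq> []" using im(2) s(2) kX.r_null[OF l] by (auto simp: univ_poly_zero)
  have "k.roots (map i m) = add_mset a (k.roots s)"
    unfolding s(2) using k.poly_mult_degree_one_monic_imp_same_roots[OF a(1) s(1) sn] .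
  then have "count (k.roots s) a = 0" using irreducible_simple_roots[OF m(1,2) a(1)] by simp
  then have s0: "k.eval s a \<noteq> \<zero>\<^bsub>k\<^esub>"
    using k.roots_mem_iff_is_root[OF s(1), of a] a(1) sn not_in_iff[of a "k.roots s"] by (simp add: k.is_root_def)
  have ig: "map i g \<in> carrier kX" using map_i_closed[OF g(1)] .
  have "map i f = [\<one>\<^bsub>k\<^esub>, \<ominus>\<^bsub>k\<^esub> a] \<otimes>\<^bsub>kX\<^esub> (s \<otimes>\<^bsub>kX\<^esub> map i g)"
    unfolding g(2) ring_hom_mult[OF map_i_hom m(1) g(1)] s(2) using kX.m_assoc[OF l s(1) ig] .
  moreover have "k.eval (s \<otimes>\<^bsub>kX\<^esub> map i g) a \<noteq> \<zero>\<^bsub>k\<^esub>"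
    using ring_hom_mult[OF eval_k_hom[OF a(1)] s(1) ig] s0 g0 k.integral
      ring_hom_closed[OF eval_k_hom[OF a(1)] s(1)] ring_hom_closed[OF eval_k_hom[OF a(1)] ig] by metis
  ultimately show thesis using that[OF kX.m_closed[OF s(1) ig]] by blast
qed

section \<open>Curves with noncyclic Jacobian\<close>

text \<open>Transfers \<open>invariant_classes_not_cyclic\<close> to the curve over
  \<open>k\<close>, with all conditions expressed by zero sets in \<open>k\<close>. Later lemmas
  only have to exhibit suitable factors.\<close>

lemma jacobian_not_cyclic:
  assumes two: "\<one>\<^bsub>k\<^esub> \<oplus>\<^bsub>k\<^esub> \<one>\<^bsub>k\<^esub> \<noteq> \<zero>\<^bsub>k\<^esub>"
    and f: "square_free f" "length f = 2 * g + 3"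
    and h1: "h1 \<in> carrier RX" "h1' \<in> carrier RX" "f = h1 \<otimes>\<^bsub>RX\<^esub> h1'" "even (degree h1)"
    and h2: "h2 \<in> carrier RX" "h2' \<in> carrier RX" "f = h2 \<otimes>\<^bsub>RX\<^esub> h2'" "even (degree h2)"
    and a1: "zeros f \<inter> zeros h1 \<noteq> {}" "zeros f - zeros h1 \<noteq> {}"
    and a2: "zeros f \<inter> zeros h2 \<noteq> {}" "zeros f - zeros h2 \<noteq> {}"
    and a12: "\<exists>a\<in>zeros f. a \<in> zeros h1 \<longleftrightarrow> a \<notin> zeros h2" "\<exists>a\<in>zeros f. a \<in> zeros h1 \<longleftrightarrow> a \<in> zeros h2"
  shows "\<not> cyclic_group (jacobian_points k (i ` carrier R) (map i f))"
proof -
  let ?F = "map i f"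
  obtain b where b: "b \<in> carrier k" "V f b = \<zero>\<^bsub>k\<^esub>" using a1(1) by blast
  obtain gb where gb: "gb \<in> carrier kX" "?F = [\<one>\<^bsub>k\<^esub>, \<ominus>\<^bsub>k\<^esub> b] \<otimes>\<^bsub>kX\<^esub> gb" "k.eval gb b \<noteq> \<zero>\<^bsub>k\<^esub>"
    using square_free_simple_root[OF f(1) b] .
  interpret hf: hyperelliptic_field k ?F b gb
    by (intro hyperelliptic_field.intro hyperelliptic_field_axioms.intro k.field_axioms)
       (use exists_root_k two gb b in auto)
  let ?K = "function_field k ?F" and ?c = "ff_const k ?F"
  let ?C = "?c ` carrier k" and ?m = "\<lambda>h. map ?c (map i h)"
  interpret ch: hyperelliptic_chart ?K ?C "ff_x k ?F" "ff_y k ?F" "map ?c ?F" by (rule hf.function_field_chart)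
  have mh: "map ?c \<in> ring_hom kX (poly_ring ?K)"
    using map_poly_hom(2)[OF k.field_axioms hf.KK_field hf.ff_const_hom] .
  have mult: "?m (h \<otimes>\<^bsub>RX\<^esub> h') = ?m h \<otimes>\<^bsub>?C[X]\<^bsub>?K\<^esub>\<^esub> ?m h'" if "h \<in> carrier RX" "h' \<in> carrier RX" for h h'
    using ring_hom_mult[OF mh map_i_closed[OF that(1)] map_i_closed[OF that(2)]] ring_hom_mult[OF map_i_hom that]
    by (simp add: univ_poly_mult)
  have inP: "?m h \<in> ch.P" if "h \<in> carrier RX" for h using hf.map_ff_const_poly[OF map_i_closed[OF that]] .
  have ev: "ch.eval (?m h) (?c a) = \<zero>\<^bsub>?K\<^esub> \<longleftrightarrow> a \<in> zeros h" if "h \<in> carrier RX" "a \<in> carrier k" for h a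
    using hf.ff_const_eval[OF map_i_closed[OF that(1)] that(2)] hf.ff_const_zero[OF V_closed[OF that]] that(2) by simp
  have fc: "f \<in> carrier RX" using f(1) by (simp add: square_free_def)
  have roots: "ch.simple_root a" if a: "a \<in> ?C" "ch.eval (map ?c ?F) a = \<zero>\<^bsub>?K\<^esub>" for a
  proof -
    obtain a0 where a0: "a0 \<in> carrier k" "a = ?c a0" using a(1) by blast
    have "V f a0 = \<zero>\<^bsub>k\<^esub>" using ev[OF fc a0(1)] a(2) a0(2) by simp
    then obtain g0 where g0: "g0 \<in> carrier kX" "?F = [\<one>\<^bsub>k\<^esub>, \<ominus>\<^bsub>k\<^esub> a0] \<otimes>\<^bsub>kX\<^esub> g0" "k.eval g0 a0 \<noteq> \<zero>\<^bsub>k\<^esub>"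
      using square_free_simple_root[OF f(1) a0(1)] by blast
    interpret c: ring_hom_ring k ?K ?c by (rule hf.ff_const_hom_ring)
    have l: "[\<one>\<^bsub>k\<^esub>, \<ominus>\<^bsub>k\<^esub> a0] \<in> carrier kX" using a0(1) by (auto simp: univ_poly_carrier[symmetric] polynomial_def)
    have "map ?c ?F = map ?c [\<one>\<^bsub>k\<^esub>, \<ominus>\<^bsub>k\<^esub> a0] \<otimes>\<^bsub>poly_ring ?K\<^esub> map ?c g0"
      using ring_hom_mult[OF mh l g0(1)] g0(2) by simp
    also have "map ?c [\<one>\<^bsub>k\<^esub>, \<ominus>\<^bsub>k\<^esub> a0] = ch.lin a" using a0 by (simp add: ch.lin_def)
    finally have e: "map ?c ?F = ch.lin a \<otimes>\<^bsub>?C[X]\<^bsub>?K\<^esub>\<^esub> map ?c g0" by (simp add: univ_poly_mult)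
    have "ch.eval (map ?c g0) a \<noteq> \<zero>\<^bsub>?K\<^esub>"
      using hf.ff_const_eval[OF g0(1) a0(1)] hf.ff_const_zero[of "k.eval g0 a0"] g0(3) a0(2)
        ring_hom_closed[OF eval_k_hom[OF a0(1)] g0(1)] by simp
    then show ?thesis unfolding ch.simple_root_def using a(1) e hf.map_ff_const_poly[OF g0(1)] by blast
  qed
  let ?G = "galois_action k (i ` carrier R) ?F"
  \<comment> \<open>The coefficients of \<open>h\<close> come from \<open>R\<close>, whose image the
    Galois group fixes.\<close>
  have fixed: "\<tau> c = c" if t: "\<tau> \<in> ?G" "c \<in> set (?m h)" "h \<in> carrier RX" for \<tau> c h
  proof -
    have "set h \<subseteq> carrier R" using t(3) by (auto simp: univ_poly_carrier[symmetric] polynomial_def)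
    then obtain d where "d \<in> carrier R" "c = ?c (i d)" using t(2) by auto
    then show ?thesis using hf.galois_constant_auts(3)[OF t(1)] ring_hom_closed[OF i_hom] by blast
  qed
  have pts: "(\<exists>a\<in>?C. ch.eval (map ?c ?F) a = \<zero>\<^bsub>?K\<^esub> \<and> Pr a) \<longleftrightarrow> (\<exists>a\<in>zeros f. Pr (?c a))" for Pr
    using ev[OF fc] by auto
  note ev1 = ev[OF h1(1)] and ev2 = ev[OF h2(1)]
  have "\<exists>a\<in>zeros f. ch.eval (?m h1) (?c a) = \<zero>\<^bsub>?K\<^esub>" "\<exists>a\<in>zeros f. ch.eval (?m h1) (?c a) \<noteq> \<zero>\<^bsub>?K\<^esub>"
  proof -
    obtain a where a: "a \<in> carrier k" "a \<in> zeros f" "a \<in> zeros h1" using a1(1) by blast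
    show "\<exists>a\<in>zeros f. ch.eval (?m h1) (?c a) = \<zero>\<^bsub>?K\<^esub>" using ev1[OF a(1)] a(2,3) by blast
    obtain a where a: "a \<in> carrier k" "a \<in> zeros f" "a \<notin> zeros h1" using a1(2) by blast
    show "\<exists>a\<in>zeros f. ch.eval (?m h1) (?c a) \<noteq> \<zero>\<^bsub>?K\<^esub>" using ev1[OF a(1)] a(2,3) by blast
  qed
  moreover have "\<exists>a\<in>zeros f. ch.eval (?m h2) (?c a) = \<zero>\<^bsub>?K\<^esub>" "\<exists>a\<in>zeros f. ch.eval (?m h2) (?c a) \<noteq> \<zero>\<^bsub>?K\<^esub>"
  proof -
    obtain a where a: "a \<in> carrier k" "a \<in> zeros f" "a \<in> zeros h2" using a2(1) by blast
    show "\<exists>a\<in>zeros f. ch.eval (?m h2) (?c a) = \<zero>\<^bsub>?K\<^esub>" using ev2[OF a(1)] a(2,3) by blast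
    obtain a where a: "a \<in> carrier k" "a \<in> zeros f" "a \<notin> zeros h2" using a2(2) by blast
    show "\<exists>a\<in>zeros f. ch.eval (?m h2) (?c a) \<noteq> \<zero>\<^bsub>?K\<^esub>" using ev2[OF a(1)] a(2,3) by blast
  qed
  moreover have "\<exists>a\<in>zeros f. ch.eval (?m h1) (?c a) = \<zero>\<^bsub>?K\<^esub> \<longleftrightarrow> ch.eval (?m h2) (?c a) \<noteq> \<zero>\<^bsub>?K\<^esub>"
    "\<exists>a\<in>zeros f. ch.eval (?m h1) (?c a) = \<zero>\<^bsub>?K\<^esub> \<longleftrightarrow> ch.eval (?m h2) (?c a) = \<zero>\<^bsub>?K\<^esub>"
  proof -
    obtain a where a: "a \<in> carrier k" "a \<in> zeros f" "a \<in> zeros h1 \<longleftrightarrow> a \<notin> zeros h2" using a12(1) by blast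
    show "\<exists>a\<in>zeros f. ch.eval (?m h1) (?c a) = \<zero>\<^bsub>?K\<^esub> \<longleftrightarrow> ch.eval (?m h2) (?c a) \<noteq> \<zero>\<^bsub>?K\<^esub>"
      using ev1[OF a(1)] ev2[OF a(1)] a(2,3) by blast
    obtain a where a: "a \<in> carrier k" "a \<in> zeros f" "a \<in> zeros h1 \<longleftrightarrow> a \<in> zeros h2" using a12(2) by blast
    show "\<exists>a\<in>zeros f. ch.eval (?m h1) (?c a) = \<zero>\<^bsub>?K\<^esub> \<longleftrightarrow> ch.eval (?m h2) (?c a) = \<zero>\<^bsub>?K\<^esub>"
      using ev1[OF a(1)] ev2[OF a(1)] a(2,3) by blast
  qed
  ultimately have sep: "\<exists>a\<in>zeros f. ch.eval (?m h1) (?c a) = \<zero>\<^bsub>?K\<^esub>" "\<exists>a\<in>zeros f. ch.eval (?m h1) (?c a) \<noteq> \<zero>\<^bsub>?K\<^esub>"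
    "\<exists>a\<in>zeros f. ch.eval (?m h2) (?c a) = \<zero>\<^bsub>?K\<^esub>" "\<exists>a\<in>zeros f. ch.eval (?m h2) (?c a) \<noteq> \<zero>\<^bsub>?K\<^esub>"
    "\<exists>a\<in>zeros f. ch.eval (?m h1) (?c a) = \<zero>\<^bsub>?K\<^esub> \<longleftrightarrow> ch.eval (?m h2) (?c a) \<noteq> \<zero>\<^bsub>?K\<^esub>"
    "\<exists>a\<in>zeros f. ch.eval (?m h1) (?c a) = \<zero>\<^bsub>?K\<^esub> \<longleftrightarrow> ch.eval (?m h2) (?c a) = \<zero>\<^bsub>?K\<^esub>"
    by blast+
  have "\<not> cyclic_group (ch.invariant_classes ?G)"
  proof (rule ch.invariant_classes_not_cyclic[OF roots _ _ _ inP[OF h1(1)] inP[OF h1(2)] _ _ _ inP[OF h2(1)] inP[OF h2(2)]])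
    show "length (map ?c ?F) = 2 * g + 3" using f(2) by simp
    show "?G \<subseteq> ch.constant_auts" using hf.galois_constant_auts(1) by blast
    show "\<tau> (ff_x k ?F) = ff_x k ?F" if "\<tau> \<in> ?G" for \<tau> using hf.galois_constant_auts(2)[OF that] .
    show "map ?c ?F = ?m h1 \<otimes>\<^bsub>?C[X]\<^bsub>?K\<^esub>\<^esub> ?m h1'" using mult[OF h1(1,2)] h1(3) by simp
    show "map ?c ?F = ?m h2 \<otimes>\<^bsub>?C[X]\<^bsub>?K\<^esub>\<^esub> ?m h2'" using mult[OF h2(1,2)] h2(3) by simp
    show "even (degree (?m h1))" "even (degree (?m h2))" using h1(4) h2(4) by simp_all
    show "\<tau> c = c" if "\<tau> \<in> ?G" "c \<in> set (?m h1)" for \<tau> c using fixed[OF that h1(1)] .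
    show "\<tau> c = c" if "\<tau> \<in> ?G" "c \<in> set (?m h2)" for \<tau> c using fixed[OF that h2(1)] .
  qed (assumption | (rule iffD2[OF pts], rule sep))+
  then show ?thesis unfolding hf.jacobian_points_eq .
qed

end

lemma notin_disjoint: "Y \<inter> Z = {} \<Longrightarrow> x \<in> Z \<Longrightarrow> x \<notin> Y" by blast

lemma ne_emptyI: "x \<in> Y \<Longrightarrow> Y \<noteq> {}" by blast

section \<open>Factorizations that exclude a cyclic Jacobian\<close>

context finite_field_closure begin

lemma zeros_nonempty:
  assumes "P \<in> carrier RX" "degree P > 0" shows "\<exists>a. a \<in> zeros P"
  using exists_root_k[OF map_i_closed[OF assms(1)]] assms(2) by auto

lemma zeros_mult:
  assumes "P \<in> carrier RX" "S \<in> carrier RX" shows "zeros (P \<otimes>\<^bsub>RX\<^esub> S) = zeros P \<union> zeros S"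
proof -
  have "V (P \<otimes>\<^bsub>RX\<^esub> S) a = \<zero>\<^bsub>k\<^esub> \<longleftrightarrow> V P a = \<zero>\<^bsub>k\<^esub> \<or> V S a = \<zero>\<^bsub>k\<^esub>" if a: "a \<in> carrier k" for a
    unfolding V_mult[OF assms a] using k.integral_iff[OF V_closed[OF assms(1) a] V_closed[OF assms(2) a]] .
  then show ?thesis by blast
qed

text \<open>A common zero would have multiplicity at least two in \<open>f\<close>, whereas all
  roots of \<open>f\<close> in \<open>k\<close> are simple.\<close>

lemma zeros_disjoint:
  assumes f: "square_free f" and PS: "P \<in> carrier RX" "S \<in> carrier RX" "f = P \<otimes>\<^bsub>RX\<^esub> S"
  shows "zeros P \<inter> zeros S = {}"
proof (rule ccontr)
  assume "zeros P \<inter> zeros S \<noteq> {}"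
  then obtain a where a: "a \<in> carrier k" "V P a = \<zero>\<^bsub>k\<^esub>" "V S a = \<zero>\<^bsub>k\<^esub>" by blast
  have "f \<noteq> []" using f by (simp add: square_free_def)
  then have ne: "P \<noteq> []" "S \<noteq> []" using PS RX_mult_Nil[OF PS(1,2)] by auto
  have "V f a = \<zero>\<^bsub>k\<^esub>" using V_mult[OF PS(1,2) a(1)] PS(3) a(2,3) by simp
  then obtain g where g: "g \<in> carrier kX" "map i f = [\<one>\<^bsub>k\<^esub>, \<ominus>\<^bsub>k\<^esub> a] \<otimes>\<^bsub>kX\<^esub> g" "k.eval g a \<noteq> \<zero>\<^bsub>k\<^esub>"
    using square_free_simple_root[OF f a(1)] by metis
  have gn: "g \<noteq> []" using g(3) by auto
  have "k.roots (map i f) = add_mset a (k.roots g)"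
    unfolding g(2) using k.poly_mult_degree_one_monic_imp_same_roots[OF a(1) g(1) gn] .
  moreover have "count (k.roots g) a = 0"
    using k.roots_mem_iff_is_root[OF g(1), of a] g(3) not_in_iff[of a "k.roots g"] by (simp add: k.is_root_def)
  ultimately have 1: "count (k.roots (map i f)) a = 1" by simp
  note c = map_i_closed[OF PS(1)] map_i_closed[OF PS(2)]
  have e: "k.roots (map i f) = k.roots (map i P) + k.roots (map i S)"
    using field.associated_polynomials_imp_same_roots[OF k.field_axioms c(1) _ c(2)] ne
    unfolding PS(3) ring_hom_mult[OF map_i_hom PS(1,2)] by simp
  have "a \<in># k.roots (map i P)" "a \<in># k.roots (map i S)"
    using k.roots_mem_iff_is_root[OF c(1), of a] k.roots_mem_iff_is_root[OF c(2), of a] a ne by (simp_all add: k.is_root_def)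
  then have "count (k.roots (map i P)) a \<ge> 1" "count (k.roots (map i S)) a \<ge> 1" by (simp_all add: Suc_le_eq)
  then show False using 1 unfolding e count_union by linarith
qed

text \<open>The factors are \<open>h1 = A\<close> and \<open>h2 = B\<close>. Zeros of
  \<open>A\<close> and of \<open>B\<close> tell them apart; a zero of \<open>D\<close>, which lies
  in neither, shows that \<open>B\<close> is not the complement of \<open>A\<close>.\<close>

lemma two_even_factors_not_cyclic:
  assumes two: "\<one>\<^bsub>k\<^esub> \<oplus>\<^bsub>k\<^esub> \<one>\<^bsub>k\<^esub> \<noteq> \<zero>\<^bsub>k\<^esub>"
    and f: "square_free f" "length f = 2 * g + 3"
    and ABD: "A \<in> carrier RX" "B \<in> carrier RX" "D \<in> carrier RX" "f = A \<otimes>\<^bsub>RX\<^esub> (B \<otimes>\<^bsub>RX\<^esub> D)"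
    and deg: "degree A > 0" "degree B > 0" "degree D > 0" "even (degree A)" "even (degree B)"
  shows "\<not> cyclic_group (jacobian_points k (i ` carrier R) (map i f))"
proof -
  have f2: "f = B \<otimes>\<^bsub>RX\<^esub> (A \<otimes>\<^bsub>RX\<^esub> D)" using ABD by (simp add: RX.m_ac)
  note m = RX.m_closed[OF ABD(2,3)] RX.m_closed[OF ABD(1,3)]
  have zf: "zeros f = zeros A \<union> zeros B \<union> zeros D"
    unfolding ABD(4) zeros_mult[OF ABD(1) m(1)] zeros_mult[OF ABD(2,3)] by blast
  have d: "zeros A \<inter> (zeros B \<union> zeros D) = {}" "zeros B \<inter> (zeros A \<union> zeros D) = {}"
    using zeros_disjoint[OF f(1) ABD(1) m(1) ABD(4)] zeros_disjoint[OF f(1) ABD(2) m(2) f2]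
    unfolding zeros_mult[OF ABD(2,3)] zeros_mult[OF ABD(1,3)] by blast+
  obtain a b c where p: "a \<in> zeros A" "b \<in> zeros B" "c \<in> zeros D"
    using zeros_nonempty[OF ABD(1) deg(1)] zeros_nonempty[OF ABD(2) deg(2)] zeros_nonempty[OF ABD(3) deg(3)] by blast
  show ?thesis
    by (rule jacobian_not_cyclic[OF two f ABD(1) m(1) ABD(4) deg(4) ABD(2) m(2) f2 deg(5)]; unfold zf; use p d in blast)
qed

text \<open>The factors are \<open>h1 = A B\<close> and \<open>h2 = A D\<close>, of even degree. A
  zero of \<open>A\<close> is common to both, one of \<open>B\<close> belongs only to the first and
  one of \<open>D\<close> only to the second.\<close>

lemma four_odd_factors_not_cyclic:
  assumes two: "\<one>\<^bsub>k\<^esub> \<oplus>\<^bsub>k\<^esub> \<one>\<^bsub>k\<^esub> \<noteq> \<zero>\<^bsub>k\<^esub>"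
    and f: "square_free f" "length f = 2 * g + 3"
    and q: "A \<in> carrier RX" "B \<in> carrier RX" "D \<in> carrier RX" "E \<in> carrier RX"
      "f = A \<otimes>\<^bsub>RX\<^esub> (B \<otimes>\<^bsub>RX\<^esub> (D \<otimes>\<^bsub>RX\<^esub> E))"
    and deg: "odd (degree A)" "odd (degree B)" "odd (degree D)" "odd (degree E)"
  shows "\<not> cyclic_group (jacobian_points k (i ` carrier R) (map i f))"
proof -
  note m = RX.m_closed[OF q(1,2)] RX.m_closed[OF q(1,3)] RX.m_closed[OF q(3,4)] RX.m_closed[OF q(2,4)]
  have f1: "f = (A \<otimes>\<^bsub>RX\<^esub> B) \<otimes>\<^bsub>RX\<^esub> (D \<otimes>\<^bsub>RX\<^esub> E)" using q by (simp add: RX.m_ac)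
  have f2: "f = (A \<otimes>\<^bsub>RX\<^esub> D) \<otimes>\<^bsub>RX\<^esub> (B \<otimes>\<^bsub>RX\<^esub> E)" using q by (simp add: RX.m_ac)
  have zf: "zeros f = zeros A \<union> zeros B \<union> zeros D \<union> zeros E"
    unfolding f1 zeros_mult[OF m(1,3)] zeros_mult[OF q(1,2)] zeros_mult[OF q(3,4)] by blast
  note z1 = zeros_mult[OF q(1,2)] and z2 = zeros_mult[OF q(1,3)]
  have d: "(zeros A \<union> zeros B) \<inter> (zeros D \<union> zeros E) = {}" "(zeros A \<union> zeros D) \<inter> (zeros B \<union> zeros E) = {}"
    using zeros_disjoint[OF f(1) m(1,3) f1] zeros_disjoint[OF f(1) m(2,4) f2]
    unfolding zeros_mult[OF q(1,2)] zeros_mult[OF q(3,4)] zeros_mult[OF q(1,3)] zeros_mult[OF q(2,4)] by blast+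
  have ne: "A \<noteq> []" "B \<noteq> []" "D \<noteq> []" using deg by auto
  have ev: "even (degree (A \<otimes>\<^bsub>RX\<^esub> B))" "even (degree (A \<otimes>\<^bsub>RX\<^esub> D))"
    using RX_degree_mult[OF q(1,2) ne(1,2)] RX_degree_mult[OF q(1,3) ne(1,3)] deg by simp_all
  obtain a b c where p: "a \<in> zeros A" "b \<in> zeros B" "c \<in> zeros D"
    using zeros_nonempty[OF q(1) odd_pos[OF deg(1)]] zeros_nonempty[OF q(2) odd_pos[OF deg(2)]]
      zeros_nonempty[OF q(3) odd_pos[OF deg(3)]] by blast
  have z: "a \<in> zeros f" "b \<in> zeros f" "c \<in> zeros f" unfolding zf using p by (simp_all only: Un_iff simp_thms)
  have n: "b \<notin> zeros (A \<otimes>\<^bsub>RX\<^esub> D)" "c \<notin> zeros (A \<otimes>\<^bsub>RX\<^esub> B)"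
    unfolding z1 z2 by (rule notin_disjoint[OF d(2) UnI1[OF p(2)]], rule notin_disjoint[OF d(1) UnI1[OF p(3)]])
  have "a \<in> zeros (A \<otimes>\<^bsub>RX\<^esub> B)" "b \<in> zeros (A \<otimes>\<^bsub>RX\<^esub> B)" "a \<in> zeros (A \<otimes>\<^bsub>RX\<^esub> D)"
    unfolding z1 z2 using p by (simp_all only: Un_iff simp_thms)
  note y = this
  note not_cyclic = jacobian_not_cyclic[OF two f m(1,3) f1 ev(1) m(2,4) f2 ev(2)]
  show ?thesis
  proof (rule not_cyclic)
    show "zeros f \<inter> zeros (A \<otimes>\<^bsub>RX\<^esub> B) \<noteq> {}" using IntI[OF z(1) y(1)] by (rule ne_emptyI)
    show "zeros f - zeros (A \<otimes>\<^bsub>RX\<^esub> B) \<noteq> {}" using DiffI[OF z(3) n(2)] by (rule ne_emptyI)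
    show "zeros f \<inter> zeros (A \<otimes>\<^bsub>RX\<^esub> D) \<noteq> {}" using IntI[OF z(1) y(3)] by (rule ne_emptyI)
    show "zeros f - zeros (A \<otimes>\<^bsub>RX\<^esub> D) \<noteq> {}" using DiffI[OF z(2) n(1)] by (rule ne_emptyI)
    show "\<exists>x\<in>zeros f. x \<in> zeros (A \<otimes>\<^bsub>RX\<^esub> B) \<longleftrightarrow> x \<notin> zeros (A \<otimes>\<^bsub>RX\<^esub> D)"
      using z(2) y(2) n(1) by (intro bexI[of _ b]) (simp_all only: not_False_eq_True simp_thms)
    show "\<exists>x\<in>zeros f. x \<in> zeros (A \<otimes>\<^bsub>RX\<^esub> B) \<longleftrightarrow> x \<in> zeros (A \<otimes>\<^bsub>RX\<^esub> D)"
      using z(1) y(1,3) by (intro bexI[of _ a]) (simp_all only: simp_thms)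
  qed
qed

theorem four_factors_not_cyclic:
  assumes two: "\<one>\<^bsub>k\<^esub> \<oplus>\<^bsub>k\<^esub> \<one>\<^bsub>k\<^esub> \<noteq> \<zero>\<^bsub>k\<^esub>"
    and f: "square_free f" "length f = 2 * g + 3"
    and q: "A \<in> carrier RX" "B \<in> carrier RX" "D \<in> carrier RX" "E \<in> carrier RX"
      "f = A \<otimes>\<^bsub>RX\<^esub> (B \<otimes>\<^bsub>RX\<^esub> (D \<otimes>\<^bsub>RX\<^esub> E))"
    and deg: "degree A > 0" "degree B > 0" "degree D > 0" "degree E > 0"
  shows "\<not> cyclic_group (jacobian_points k (i ` carrier R) (map i f))"
proof -
  have ne: "A \<noteq> []" "B \<noteq> []" "D \<noteq> []" "E \<noteq> []" using deg by auto
  note DE = RX.m_closed[OF q(3,4)] and BDE = RX.m_closed[OF q(2) RX.m_closed[OF q(3,4)]]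
  have n2: "D \<otimes>\<^bsub>RX\<^esub> E \<noteq> []" using RX_mult_Nil[OF q(3,4)] ne by simp
  have n3: "B \<otimes>\<^bsub>RX\<^esub> (D \<otimes>\<^bsub>RX\<^esub> E) \<noteq> []" using RX_mult_Nil[OF q(2) DE] ne n2 by simp
  have "degree f = degree A + (degree B + (degree D + degree E))"
    using RX_degree_mult[OF q(1) BDE ne(1) n3] RX_degree_mult[OF q(2) DE ne(2) n2] RX_degree_mult[OF q(3,4) ne(3,4)] q(5) by simp
  then have ev: "even (degree A + (degree B + (degree D + degree E)))" using f(2) by (metis add_diff_cancel_right' diff_Suc_1 dvd_triv_left even_add numeral_3_eq_3 add_Suc_right even_Suc add.right_neutral even_zero)
  have key: "\<not> cyclic_group (jacobian_points k (i ` carrier R) (map i f))"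
    if h: "A' \<in> carrier RX" "B' \<in> carrier RX" "D' \<in> carrier RX" "E' \<in> carrier RX"
      "f = A' \<otimes>\<^bsub>RX\<^esub> (B' \<otimes>\<^bsub>RX\<^esub> (D' \<otimes>\<^bsub>RX\<^esub> E'))" "degree A' > 0" "degree B' > 0" "degree D' > 0" "degree E' > 0"
      "even (degree A')" "even (degree B')" for A' B' D' E'
  proof -
    have "D' \<noteq> []" "E' \<noteq> []" using h by auto
    then have "degree (D' \<otimes>\<^bsub>RX\<^esub> E') > 0" using RX_degree_mult[OF h(3,4)] h(8) by simp
    then show ?thesis using two_even_factors_not_cyclic[OF two f h(1,2) RX.m_closed[OF h(3,4)] h(5-7) _ h(10,11)] by blast
  qed
  \<comment> \<open>The degrees add up to the even degree of \<open>f\<close>, so zero, two or four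
    of them are odd. In the first six cases the two factors not named are merged into one.\<close>
  consider "even (degree A)" "even (degree B)" | "even (degree A)" "even (degree D)" | "even (degree A)" "even (degree E)"
    | "even (degree B)" "even (degree D)" | "even (degree B)" "even (degree E)" | "even (degree D)" "even (degree E)"
    | "odd (degree A)" "odd (degree B)" "odd (degree D)" "odd (degree E)"
    using ev by (metis even_add)
  then show ?thesis
  proof cases
    case 1 show ?thesis by (rule key[OF q deg 1])
  next
    case 2
    have "f = A \<otimes>\<^bsub>RX\<^esub> (D \<otimes>\<^bsub>RX\<^esub> (B \<otimes>\<^bsub>RX\<^esub> E))" using q by (simp add: RX.m_ac)
    from key[OF q(1,3,2,4) this deg(1,3,2,4) 2] show ?thesis .
  next
    case 3
    have "f = A \<otimes>\<^bsub>RX\<^esub> (E \<otimes>\<^bsub>RX\<^esub> (B \<otimes>\<^bsub>RX\<^esub> D))" using q by (simp add: RX.m_ac)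
    from key[OF q(1,4,2,3) this deg(1,4,2,3) 3] show ?thesis .
  next
    case 4
    have "f = B \<otimes>\<^bsub>RX\<^esub> (D \<otimes>\<^bsub>RX\<^esub> (A \<otimes>\<^bsub>RX\<^esub> E))" using q by (simp add: RX.m_ac)
    from key[OF q(2,3,1,4) this deg(2,3,1,4) 4] show ?thesis .
  next
    case 5
    have "f = B \<otimes>\<^bsub>RX\<^esub> (E \<otimes>\<^bsub>RX\<^esub> (A \<otimes>\<^bsub>RX\<^esub> D))" using q by (simp add: RX.m_ac)
    from key[OF q(2,4,1,3) this deg(2,4,1,3) 5] show ?thesis .
  next
    case 6
    have "f = D \<otimes>\<^bsub>RX\<^esub> (E \<otimes>\<^bsub>RX\<^esub> (A \<otimes>\<^bsub>RX\<^esub> B))" using q by (simp add: RX.m_ac)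
    from key[OF q(3,4,1,2) this deg(3,4,1,2) 6] show ?thesis .
  next
    case 7 show ?thesis by (rule four_odd_factors_not_cyclic[OF two f q 7])
  qed
qed

section \<open>Counting polynomials with few irreducible factors\<close>

abbreviation monic_irreducibles :: "'r list set" where
  "monic_irreducibles \<equiv> (\<Union>n. irreducibles n)"

definition poly_prod :: "'r list list \<Rightarrow> 'r list" where
  "poly_prod Ps = foldr (\<otimes>\<^bsub>RX\<^esub>) Ps \<one>\<^bsub>RX\<^esub>"

lemma irreduciblesD:
  assumes "P \<in> monic_irreducibles"
  shows "P \<in> carrier RX" "ring_irreducible\<^bsub>RX\<^esub> P" "P \<in> irreducibles (degree P)" "P \<noteq> []" "degree P \<ge> 1"
proof -
  show 1: "P \<in> carrier RX" "ring_irreducible\<^bsub>RX\<^esub> P" "P \<in> irreducibles (degree P)" using assms by (auto simp: irreducibles_def)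
  show "P \<noteq> []" using R.pirreducibleE(1)[OF R.carrier_is_subring 1(1,2)] .
  show "degree P \<ge> 1" using irreducible_degree_pos[OF 1(1,2)] .
qed

lemma poly_prod_simps: "poly_prod [] = \<one>\<^bsub>RX\<^esub>" "poly_prod (P # Ps) = P \<otimes>\<^bsub>RX\<^esub> poly_prod Ps"
  by (simp_all add: poly_prod_def)

lemma poly_prod_closed: "set Ps \<subseteq> monic_irreducibles \<Longrightarrow> poly_prod Ps \<in> carrier RX"
proof (induction Ps)
  case (Cons P Ps)
  have "P \<in> monic_irreducibles" "set Ps \<subseteq> monic_irreducibles" using Cons(2) by (simp_all del: UN_iff)
  then show ?case unfolding poly_prod_simps using Cons(1) irreduciblesD(1) RX.m_closed by blast
qed (simp add: poly_prod_simps)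

lemma poly_prod_append:
  "set Ps \<subseteq> monic_irreducibles \<Longrightarrow> set Qs \<subseteq> monic_irreducibles \<Longrightarrow>
   poly_prod (Ps @ Qs) = poly_prod Ps \<otimes>\<^bsub>RX\<^esub> poly_prod Qs"
proof (induction Ps)
  case Nil
  then show ?case using RX.l_one[OF poly_prod_closed[OF Nil(2)]] by (simp add: poly_prod_simps)
next
  case (Cons P Ps)
  have P: "P \<in> monic_irreducibles" "set Ps \<subseteq> monic_irreducibles" using Cons(2) by (simp_all del: UN_iff)
  show ?case using Cons(1)[OF P(2) Cons(3)] RX.m_assoc[OF irreduciblesD(1)[OF P(1)] poly_prod_closed[OF P(2)] poly_prod_closed[OF Cons(3)]]
    by (simp add: poly_prod_simps)
qed

lemma poly_prod_remove1:
  "set Ps \<subseteq> monic_irreducibles \<Longrightarrow> P \<in> set Ps \<Longrightarrow> poly_prod Ps = P \<otimes>\<^bsub>RX\<^esub> poly_prod (remove1 P Ps)"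
proof (induction Ps)
  case (Cons S Ps)
  have S: "S \<in> monic_irreducibles" "set Ps \<subseteq> monic_irreducibles" using Cons(2) by (simp_all del: UN_iff)
  show ?case
  proof (cases "P = S")
    case True then show ?thesis by (simp add: poly_prod_simps)
  next
    case False
    then have P: "P \<in> set Ps" using Cons(3) by simp
    have r: "set (remove1 P Ps) \<subseteq> monic_irreducibles" using set_remove1_subset S(2) by (rule subset_trans)
    have Pm: "P \<in> monic_irreducibles" using P S(2) by blast
    show ?thesis
      using Cons(1)[OF S(2) P] False RX.m_lcomm[OF irreduciblesD(1)[OF S(1)] irreduciblesD(1)[OF Pm] poly_prod_closed[OF r]]
      by (simp add: poly_prod_simps)
  qed
qed simp

lemma poly_prod_degree:
  "set Ps \<subseteq> monic_irreducibles \<Longrightarrow> poly_prod Ps \<noteq> [] \<and> degree (poly_prod Ps) = (\<Sum>P\<leftarrow>Ps. degree P)"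
proof (induction Ps)
  case (Cons P Ps)
  have P: "P \<in> monic_irreducibles" "set Ps \<subseteq> monic_irreducibles" using Cons(2) by (simp_all del: UN_iff)
  note I = irreduciblesD[OF P(1)] and c = poly_prod_closed[OF P(2)]
  have IH: "poly_prod Ps \<noteq> []" "degree (poly_prod Ps) = (\<Sum>P\<leftarrow>Ps. degree P)" using Cons(1)[OF P(2)] by auto
  show ?case unfolding poly_prod_simps
    using RX_mult_Nil[OF I(1) c] RX_degree_mult[OF I(1) c I(4) IH(1)] I(4) IH by simp
qed (simp add: poly_prod_simps univ_poly_one)

lemma monic_scale:
  assumes f: "f \<in> carrier RX" "f \<noteq> []"
  shows "\<exists>u\<in>Units RX. \<exists>P\<in>carrier RX. P \<noteq> [] \<and> lead_coeff P = \<one>\<^bsub>R\<^esub> \<and> degree P = degree f \<and> f = u \<otimes>\<^bsub>RX\<^esub> P"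
proof -
  note fn = f(2)
  define c where "c = lead_coeff f"
  have c: "c \<in> carrier R" "c \<noteq> \<zero>\<^bsub>R\<^esub>" using f(1) fn by (auto simp: c_def univ_poly_carrier[symmetric] polynomial_def)
  then have "c \<in> nonzero R" by (simp add: nonzero_def)
  note ci = R.nonzero_inv[OF this]
  have ic: "inv\<^bsub>R\<^esub> c \<in> carrier R" "inv\<^bsub>R\<^esub> c \<noteq> \<zero>\<^bsub>R\<^esub>" using ci(1) by (auto simp: nonzero_def)
  define u where "u = [c]"
  define w where "w = [inv\<^bsub>R\<^esub> c]"
  have uw: "u \<in> Units RX" "w \<in> Units RX"
    unfolding u_def w_def RX_units using c ic by (auto simp: univ_poly_carrier[symmetric] polynomial_def)
  have uc: "u \<in> carrier RX" "w \<in> carrier RX" "u \<noteq> []" "w \<noteq> []" using uw RX_units by auto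
  have "u \<otimes>\<^bsub>RX\<^esub> w = \<one>\<^bsub>RX\<^esub>"
    using c ic ci(2) R.poly_mult.simps by (simp add: u_def w_def univ_poly_mult univ_poly_one)
  define P where "P = w \<otimes>\<^bsub>RX\<^esub> f"
  have P: "P \<in> carrier RX" "P \<noteq> []" using uc f(1) fn RX_mult_Nil[OF uc(2) f(1)] by (auto simp: P_def)
  have fP: "f = u \<otimes>\<^bsub>RX\<^esub> P"
    unfolding P_def using RX.m_assoc[OF uc(1,2) f(1)] \<open>u \<otimes>\<^bsub>RX\<^esub> w = \<one>\<^bsub>RX\<^esub>\<close> f(1) by simp
  have du: "degree u = 0" "degree w = 0" by (simp_all add: u_def w_def)
  have dP: "degree P = degree f" unfolding P_def using RX_degree_mult[OF uc(2) f(1) uc(4) fn(1)] du by simp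
  have "lead_coeff P = inv\<^bsub>R\<^esub> c \<otimes>\<^bsub>R\<^esub> c"
    using R.poly_mult_lead_coeff[OF R.carrier_is_subring, of w f] uc f(1) fn(1)
    by (simp add: P_def w_def c_def univ_poly_carrier univ_poly_mult)
  then have lP: "lead_coeff P = \<one>\<^bsub>R\<^esub>" using ci(3) by simp
  show ?thesis using uw(1) P lP dP fP by blast
qed

lemma monic_associate:
  assumes f: "f \<in> carrier RX" "ring_irreducible\<^bsub>RX\<^esub> f"
  shows "\<exists>u\<in>Units RX. \<exists>P\<in>monic_irreducibles. f = u \<otimes>\<^bsub>RX\<^esub> P"
proof -
  have fn: "f \<noteq> []" "f \<notin> Units RX" using R.pirreducibleE(1,2)[OF R.carrier_is_subring f] by auto
  obtain u P where uw: "u \<in> Units RX" and P: "P \<in> carrier RX" "P \<noteq> []"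
    and lP: "lead_coeff P = \<one>\<^bsub>R\<^esub>" and dP: "degree P = degree f" and fP: "f = u \<otimes>\<^bsub>RX\<^esub> P"
    using monic_scale[OF f(1) fn(1)] by blast
  have uc: "u \<in> carrier RX" "u \<noteq> []" and du: "degree u = 0" using uw RX_units[of u] by simp_all
  have "ring_irreducible\<^bsub>RX\<^esub> P"
  proof (rule R.pirreducibleI[OF R.carrier_is_subring P])
    show "P \<notin> Units RX" using dP fn RX_units[of P] RX_units[of f] f(1) by simp
    fix q r assume qr: "q \<in> carrier RX" "r \<in> carrier RX" "P = q \<otimes>\<^bsub>RX\<^esub> r"
    have ne: "q \<noteq> []" using P(2) qr(3) RX_mult_Nil[OF qr(1,2)] by auto
    have "f = (u \<otimes>\<^bsub>RX\<^esub> q) \<otimes>\<^bsub>RX\<^esub> r" using fP qr RX.m_assoc[OF uc(1) qr(1,2)] by simp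
    then have "u \<otimes>\<^bsub>RX\<^esub> q \<in> Units RX \<or> r \<in> Units RX"
      using R.pirreducibleE(3)[OF R.carrier_is_subring f RX.m_closed[OF uc(1) qr(1)] qr(2)] by blast
    then show "q \<in> Units RX \<or> r \<in> Units RX"
      using RX_degree_mult[OF uc(1) qr(1) uc(2) ne] du RX_units[of q] RX_units[of "u \<otimes>\<^bsub>RX\<^esub> q"] qr(1) ne by auto
  qed
  then have "P \<in> irreducibles (degree P)" using P(1) lP by (simp add: irreducibles_def)
  then show ?thesis using uw fP by blast
qed

lemma irreducible_factorization:
  assumes "f \<in> carrier RX" "f \<noteq> []"
  shows "\<exists>u\<in>Units RX. \<exists>Ps. set Ps \<subseteq> monic_irreducibles \<and> f = u \<otimes>\<^bsub>RX\<^esub> poly_prod Ps"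
  using assms
proof (induction "degree f" arbitrary: f rule: less_induct)
  case less
  note f = less(2,3)
  show ?case
  proof (cases "f \<in> Units RX")
    case True
    then show ?thesis using f(1) by (intro bexI[of _ f] exI[of _ "[]"]) (simp_all add: poly_prod_simps)
  next
    case nu: False
    show ?thesis
    proof (cases "ring_irreducible\<^bsub>RX\<^esub> f")
      case True
      then obtain u P where uP: "u \<in> Units RX" "P \<in> monic_irreducibles" "f = u \<otimes>\<^bsub>RX\<^esub> P" using monic_associate[OF f(1)] by blast
      have "poly_prod [P] = P" using RX.r_one[OF irreduciblesD(1)[OF uP(2)]] by (simp add: poly_prod_simps)
      then show ?thesis using uP by (intro bexI[of _ u] exI[of _ "[P]"]) simp_all
    next
      case False
      then obtain q r where qr: "q \<in> carrier RX" "r \<in> carrier RX" "f = q \<otimes>\<^bsub>RX\<^esub> r" "q \<notin> Units RX" "r \<notin> Units RX"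
        using R.pirreducibleI[OF R.carrier_is_subring f nu] by blast
      have ne: "q \<noteq> []" "r \<noteq> []" using f(2) qr(3) RX_mult_Nil[OF qr(1,2)] by auto
      have d: "degree q \<noteq> 0" "degree r \<noteq> 0" using qr RX_units ne by auto
      have df: "degree f = degree q + degree r" using RX_degree_mult[OF qr(1,2) ne] qr(3) by simp
      have lt: "degree q < degree f" "degree r < degree f" using df d by linarith+
      obtain u Ps where u: "u \<in> Units RX" "set Ps \<subseteq> monic_irreducibles" "q = u \<otimes>\<^bsub>RX\<^esub> poly_prod Ps"
        using less(1)[OF lt(1) qr(1) ne(1)] by blast
      obtain w Qs where w: "w \<in> Units RX" "set Qs \<subseteq> monic_irreducibles" "r = w \<otimes>\<^bsub>RX\<^esub> poly_prod Qs"
        using less(1)[OF lt(2) qr(2) ne(2)] by blast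
      have "f = (u \<otimes>\<^bsub>RX\<^esub> w) \<otimes>\<^bsub>RX\<^esub> (poly_prod Ps \<otimes>\<^bsub>RX\<^esub> poly_prod Qs)"
        unfolding qr(3) u(3) w(3) using RX.Units_closed[OF u(1)] RX.Units_closed[OF w(1)] poly_prod_closed[OF u(2)] poly_prod_closed[OF w(2)]
        by (simp add: RX.m_ac)
      also have "poly_prod Ps \<otimes>\<^bsub>RX\<^esub> poly_prod Qs = poly_prod (Ps @ Qs)" using poly_prod_append[OF u(2) w(2)] by simp
      finally have e: "f = (u \<otimes>\<^bsub>RX\<^esub> w) \<otimes>\<^bsub>RX\<^esub> poly_prod (Ps @ Qs)" .
      have "set (Ps @ Qs) \<subseteq> monic_irreducibles" using Un_least[OF u(2) w(2)] by simp
      then show ?thesis using e RX.Units_m_closed[OF u(1) w(1)] by blast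
    qed
  qed
qed

text \<open>
  Products of \<open>r\<close> monic irreducibles of total degree \<open>d\<close>, with a factor of maximal degree first;
  that factor has degree at least \<open>d / r\<close>.
\<close>

primrec products :: "nat \<Rightarrow> nat \<Rightarrow> 'r list set" where
  "products 0 d = (if d = 0 then {\<one>\<^bsub>RX\<^esub>} else {})"
| "products (Suc r) d = (\<Union>n\<in>{n \<in> {1..d}. d \<le> Suc r * n}. (\<lambda>(P, h). P \<otimes>\<^bsub>RX\<^esub> h) ` (irreducibles n \<times> products r (d - n)))"

lemma poly_prod_products:
  "set Ps \<subseteq> monic_irreducibles \<Longrightarrow> poly_prod Ps \<in> products (length Ps) (\<Sum>P\<leftarrow>Ps. degree P)"
proof (induction "length Ps" arbitrary: Ps)
  case 0
  then show ?case by (simp add: poly_prod_simps)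
next
  case (Suc r)
  have ne: "set Ps \<noteq> {}" using Suc(2) by auto
  define M where "M = Max (degree ` set Ps)"
  have "M \<in> degree ` set Ps" unfolding M_def using ne by (intro Max_in) auto
  then obtain P where P: "P \<in> set Ps" "degree P = M" by blast
  have le: "degree S \<le> M" if "S \<in> set Ps" for S unfolding M_def using that by (intro Max_ge) auto
  have Pm: "P \<in> monic_irreducibles" using P Suc(3) by blast
  let ?d = "\<Sum>P\<leftarrow>Ps. degree P"
  have s: "?d = degree P + (\<Sum>P\<leftarrow>remove1 P Ps. degree P)" using sum_list_map_remove1[OF P(1), of degree] .
  have "?d \<le> (\<Sum>P\<leftarrow>Ps. M)" using le by (intro sum_list_mono) auto
  also have "\<dots> = Suc r * M" using Suc(2) by (simp add: sum_list_triv)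
  finally have dM: "?d \<le> Suc r * M" .
  have r: "set (remove1 P Ps) \<subseteq> monic_irreducibles" using set_remove1_subset Suc(3) by (rule subset_trans)
  have lr: "r = length (remove1 P Ps)" using Suc(2) P(1) by (simp add: length_remove1)
  have "poly_prod (remove1 P Ps) \<in> products r (?d - M)" using Suc(1)[OF lr r] s P(2) lr by simp
  moreover have "P \<in> irreducibles M" using irreduciblesD(3)[OF Pm] P(2) by simp
  moreover have "M \<in> {n \<in> {1..?d}. ?d \<le> Suc r * n}" using dM s P(2) irreduciblesD(5)[OF Pm] by simp
  ultimately have "P \<otimes>\<^bsub>RX\<^esub> poly_prod (remove1 P Ps) \<in> products (Suc r) ?d"
    unfolding products.simps by (intro UN_I[of M]) (auto intro!: image_eqI[of _ _ "(P, poly_prod (remove1 P Ps))"])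
  then show ?case using poly_prod_remove1[OF Suc(3) P(1)] Suc(2) by simp
qed

end

text \<open>The recursion satisfied by a bound, relative to \<open>Q^d\<close>, for the number of
  elements of \<open>products r d\<close>. The factor \<open>(r + 1)/d\<close> bounds
  \<open>1/n\<close> for the maximal degree \<open>n\<close>. For \<open>d = 0\<close> and positive
  \<open>r\<close> the value is \<open>0\<close> by division by zero, in agreement with the empty
  set of products.\<close>

primrec product_bound :: "nat \<Rightarrow> nat \<Rightarrow> real" where
  "product_bound 0 d = (if d = 0 then 1 else 0)"
| "product_bound (Suc r) d = real (Suc r) * ((\<Sum>m<d. product_bound r m) / real d)"

lemma product_bound_nonneg: "product_bound r d \<ge> 0"
  by (induction r arbitrary: d) (auto intro!: mult_nonneg_nonneg divide_nonneg_nonneg sum_nonneg)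

lemma cesaro_zero:
  fixes a :: "nat \<Rightarrow> real"
  assumes nn: "\<And>n. a n \<ge> 0" and lim: "a \<longlonglongrightarrow> 0"
  shows "(\<lambda>n. (\<Sum>m<n. a m) / real n) \<longlonglongrightarrow> 0"
proof (rule metric_LIMSEQ_I)
  fix e :: real assume e: "e > 0"
  obtain N where N: "\<And>n. n \<ge> N \<Longrightarrow> \<bar>a n\<bar> < e / 2"
    using metric_LIMSEQ_D[OF lim, of "e / 2"] e by (auto simp: dist_real_def)
  define S where "S = (\<Sum>m<N. a m)"
  \<comment> \<open>Beyond \<open>L\<close> the fixed initial sum \<open>S\<close> contributes less
    than \<open>e/2\<close> to the mean.\<close>
  obtain L :: nat where L: "real L > 2 * S / e" using reals_Archimedean2 by blast
  show "\<exists>no. \<forall>n\<ge>no. dist ((\<Sum>m<n. a m) / real n) 0 < e"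
  proof (intro exI allI impI)
    fix n assume n: "n \<ge> max (Suc L) N"
    have "(\<Sum>m<n. a m) = S + (\<Sum>m=N..<n. a m)"
      unfolding S_def using n by (metis atLeast0LessThan le0 max.boundedE sum.atLeastLessThan_concat)
    also have "(\<Sum>m=N..<n. a m) \<le> (\<Sum>m=N..<n. e / 2)" using N by (intro sum_mono) (meson abs_ge_self atLeastLessThan_iff le_less_trans less_imp_le)
    also have "\<dots> \<le> real n * (e / 2)" using e by (simp add: mult_right_mono)
    finally have 1: "(\<Sum>m<n. a m) \<le> S + real n * (e / 2)" by simp
    have n0: "real n > 0" using n by simp
    have "2 * S / e < real n" using L n by linarith
    then have "S < real n * (e / 2)" using e by (simp add: field_simps)
    then have "(\<Sum>m<n. a m) < real n * e" using 1 by simp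
    then have "(\<Sum>m<n. a m) / real n < e" using n0 by (simp add: field_simps)
    moreover have "(\<Sum>m<n. a m) / real n \<ge> 0" using nn by (simp add: sum_nonneg)
    ultimately show "dist ((\<Sum>m<n. a m) / real n) 0 < e" by (simp add: dist_real_def)
  qed
qed

lemma product_bound_tendsto: "product_bound r \<longlonglongrightarrow> 0"
proof (induction r)
  case 0
  have "eventually (\<lambda>d. product_bound 0 d = 0) sequentially" using eventually_gt_at_top[of 0] by eventually_elim simp
  then show ?case by (rule tendsto_eventually)
next
  case (Suc r)
  have "(\<lambda>d. real (Suc r) * ((\<Sum>m<d. product_bound r m) / real d)) \<longlonglongrightarrow> real (Suc r) * 0"
    by (intro tendsto_mult tendsto_const cesaro_zero product_bound_nonneg Suc)
  then show ?case by simp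
qed

context finite_field_closure begin

lemma finite_products: "finite (products r d)"
proof (induction r arbitrary: d)
  case (Suc r)
  show ?case unfolding products.simps
    by (intro finite_UN_I finite_imageI finite_cartesian_product finite_irreducibles Suc) simp
qed simp

text \<open>For each degree \<open>n\<close> of the leading factor,
  \<open>card (irreducibles n)\<close> is at most \<open>Q^n/n\<close>; the powers of
  \<open>Q\<close> then combine to \<open>Q^d\<close>, which leaves a sum of proportions for
  \<open>r\<close>.\<close>

lemma card_products: "real (card (products r d)) \<le> product_bound r d * real Q ^ d"
proof (induction r arbitrary: d)
  case (Suc r)
  have Q0: "real Q > 0" using Q_ge_2 by simp
  let ?N = "{n \<in> {1..d}. d \<le> Suc r * n}"
  show ?case
  proof (cases "d = 0")
    case True then show ?thesis by simp
  next
    case False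
    then have d: "real d > 0" by simp
    have "card (products (Suc r) d) \<le> (\<Sum>n\<in>?N. card (irreducibles n) * card (products r (d - n)))"
    proof -
      have "card (products (Suc r) d) \<le> (\<Sum>n\<in>?N. card ((\<lambda>(P, h). P \<otimes>\<^bsub>RX\<^esub> h) ` (irreducibles n \<times> products r (d - n))))"
        unfolding products.simps by (rule card_UN_le) simp
      also have "\<dots> \<le> (\<Sum>n\<in>?N. card (irreducibles n \<times> products r (d - n)))"
        by (intro sum_mono card_image_le finite_cartesian_product finite_irreducibles finite_products)
      finally show ?thesis by (simp only: card_cartesian_product)
    qed
    then have "real (card (products (Suc r) d)) \<le> (\<Sum>n\<in>?N. real (card (irreducibles n)) * real (card (products r (d - n))))"
      by (metis (mono_tags, lifting) of_nat_le_iff of_nat_mult of_nat_sum sum.cong)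
    also have "\<dots> \<le> (\<Sum>n\<in>?N. (real (Suc r) / real d) * real Q ^ d * product_bound r (d - n))"
    proof (rule sum_mono)
      fix n assume n: "n \<in> ?N"
      \<comment> \<open>A factor of maximal degree has \<open>d \<le> Suc r * n\<close>, which
        replaces the weight \<open>1/n\<close> by a multiple of \<open>1/d\<close> not depending on
        \<open>n\<close>.\<close>
      have "real d * real (card (irreducibles n)) \<le> real (Suc r) * real Q ^ n"
      proof -
        have "d * card (irreducibles n) \<le> (Suc r * n) * card (irreducibles n)" using n by (intro mult_right_mono) simp_all
        also have "\<dots> \<le> Suc r * Q ^ n" using card_irreducibles[of n] by (metis mult.assoc mult_le_mono2)
        finally show ?thesis by (metis of_nat_le_iff of_nat_mult of_nat_power)
      qed
      then have I: "real (card (irreducibles n)) \<le> (real (Suc r) / real d) * real Q ^ n" using d by (simp add: field_simps)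
      have "real (card (irreducibles n)) * real (card (products r (d - n)))
          \<le> ((real (Suc r) / real d) * real Q ^ n) * (product_bound r (d - n) * real Q ^ (d - n))"
        using I Suc[of "d - n"] Q0 by (intro mult_mono) simp_all
      also have "\<dots> = (real (Suc r) / real d) * (real Q ^ n * real Q ^ (d - n)) * product_bound r (d - n)" by simp
      also have "real Q ^ n * real Q ^ (d - n) = real Q ^ d" using n by (simp flip: power_add)
      finally show "real (card (irreducibles n)) * real (card (products r (d - n)))
          \<le> (real (Suc r) / real d) * real Q ^ d * product_bound r (d - n)" .
    qed
    also have "\<dots> \<le> (\<Sum>n\<in>{1..d}. (real (Suc r) / real d) * real Q ^ d * product_bound r (d - n))"
      using d Q0 by (intro sum_mono2) (auto simp: product_bound_nonneg)
    also have "\<dots> = (real (Suc r) / real d) * real Q ^ d * (\<Sum>n\<in>{1..d}. product_bound r (d - n))"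
      by (simp add: sum_distrib_left)
    also have "(\<Sum>n\<in>{1..d}. product_bound r (d - n)) = (\<Sum>m<d. product_bound r m)"
      by (rule sum.reindex_bij_witness[of _ "\<lambda>m. d - m" "\<lambda>n. d - n"]) auto
    finally show ?thesis by (simp add: mult_ac)
  qed
qed simp

section \<open>The proportion of squarefree polynomials\<close>

definition square_free_polys :: "nat \<Rightarrow> 'r list set" where
  "square_free_polys d = {f. square_free f \<and> length f = Suc d}"

lemma finite_square_free_polys: "finite (square_free_polys d)"
proof (rule finite_subset[OF _ R.card_polys(3)[OF R_finite, of "Suc d"]])
  show "square_free_polys d \<subseteq> {p \<in> carrier RX. length p \<le> Suc d}"
    by (simp add: square_free_polys_def square_free_def subset_iff)
qed

lemma card_units: "card (Units RX) \<le> Q - 1" and finite_units: "finite (Units RX)"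
proof -
  have s: "Units RX \<subseteq> {p \<in> carrier RX. length p = Suc 0}"
  proof
    fix p assume "p \<in> Units RX"
    then have "p \<in> carrier RX" "p \<noteq> []" "degree p = 0" using RX_units by auto
    then show "p \<in> {p \<in> carrier RX. length p = Suc 0}" by (cases p) simp_all
  qed
  have fin: "finite {p \<in> carrier RX. length p = Suc 0}"
    by (rule finite_subset[OF _ R.card_polys(3)[OF R_finite, of "Suc 0"]]) (simp add: subset_iff)
  show "card (Units RX) \<le> Q - 1" using card_mono[OF fin s] R.card_polys(1)[OF R_finite, of 0] by simp
  show "finite (Units RX)" using finite_subset[OF s fin] .
qed

lemma card_monic: "card {p \<in> carrier RX. length p = Suc n \<and> lead_coeff p = \<one>\<^bsub>R\<^esub>} \<le> Q ^ n"
  and finite_monic: "finite {p \<in> carrier RX. length p = Suc n \<and> lead_coeff p = \<one>\<^bsub>R\<^esub>}"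
proof -
  let ?L = "{l. set l \<subseteq> carrier R \<and> length l = n}"
  have s: "{p \<in> carrier RX. length p = Suc n \<and> lead_coeff p = \<one>\<^bsub>R\<^esub>} \<subseteq> (\<lambda>l. \<one>\<^bsub>R\<^esub> # l) ` ?L"
  proof
    fix p assume p: "p \<in> {p \<in> carrier RX. length p = Suc n \<and> lead_coeff p = \<one>\<^bsub>R\<^esub>}"
    then obtain l where "p = \<one>\<^bsub>R\<^esub> # l" by (cases p) auto
    moreover have "set p \<subseteq> carrier R" using p by (auto simp: univ_poly_carrier[symmetric] polynomial_def)
    ultimately show "p \<in> (\<lambda>l. \<one>\<^bsub>R\<^esub> # l) ` ?L" using p by auto
  qed
  have fin: "finite ((\<lambda>l. \<one>\<^bsub>R\<^esub> # l) ` ?L)" by (rule finite_imageI[OF finite_lists_length_eq[OF R_finite]])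
  have "card ((\<lambda>l. \<one>\<^bsub>R\<^esub> # l) ` ?L) \<le> Q ^ n"
    using card_image_le[OF finite_lists_length_eq[OF R_finite, of n]] card_lists_length_eq[OF R_finite, of n] by metis
  then show "card {p \<in> carrier RX. length p = Suc n \<and> lead_coeff p = \<one>\<^bsub>R\<^esub>} \<le> Q ^ n" using card_mono[OF fin s] by simp
  show "finite {p \<in> carrier RX. length p = Suc n \<and> lead_coeff p = \<one>\<^bsub>R\<^esub>}" using finite_subset[OF s fin] .
qed

end

context finite_field_closure begin

text \<open>A polynomial that is not squarefree is \<open>P^2 v\<close> with \<open>P\<close> monic
  of some degree \<open>j \<ge> 1\<close>. For fixed \<open>j\<close> there are at most
  \<open>(Q - 1) Q^(d-j)\<close> such products, and the geometric sum over \<open>j\<close> is at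
  most \<open>Q^d\<close>.\<close>

lemma card_square_multiples:
  "card {f \<in> carrier RX. length f = Suc d \<and> \<not> square_free f} \<le> Q ^ d"
proof -
  let ?S = "\<lambda>j. {p \<in> carrier RX. length p = Suc j \<and> lead_coeff p = \<one>\<^bsub>R\<^esub>}"
  let ?T = "\<lambda>m. {p \<in> carrier RX. length p = Suc m}"
  let ?J = "{j \<in> {1..d}. 2 * j \<le> d}"
  let ?M = "\<lambda>j. (\<lambda>(h, u). (h \<otimes>\<^bsub>RX\<^esub> h) \<otimes>\<^bsub>RX\<^esub> u) ` (?S j \<times> ?T (d - 2 * j))"
  have finT: "finite (?T m)" for m
    by (rule finite_subset[OF _ R.card_polys(3)[OF R_finite, of "Suc m"]]) (simp add: subset_iff)
  have finM: "finite (?M j)" for j by (intro finite_imageI finite_cartesian_product finite_monic finT)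
  have s: "{f \<in> carrier RX. length f = Suc d \<and> \<not> square_free f} \<subseteq> (\<Union>j\<in>?J. ?M j)"
  proof
    fix f assume "f \<in> {f \<in> carrier RX. length f = Suc d \<and> \<not> square_free f}"
    then have f: "f \<in> carrier RX" "length f = Suc d" "\<not> square_free f" by simp_all
    have fn: "f \<noteq> []" using f(2) by auto
    obtain h where h: "h \<in> carrier RX" "(h \<otimes>\<^bsub>RX\<^esub> h) pdivides\<^bsub>R\<^esub> f" "h \<notin> Units RX"
      using f(1,3) fn unfolding square_free_def by blast
    obtain u where u: "u \<in> carrier RX" "f = (h \<otimes>\<^bsub>RX\<^esub> h) \<otimes>\<^bsub>RX\<^esub> u"
      using h(2) unfolding pdivides_def factor_def by blast
    have hn: "h \<noteq> []" using fn u(2) RX_mult_Nil[OF RX.m_closed[OF h(1) h(1)] u(1)] RX_mult_Nil[OF h(1) h(1)] by simp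
    obtain w P where w: "w \<in> Units RX" and P: "P \<in> carrier RX" "P \<noteq> []"
      and P': "lead_coeff P = \<one>\<^bsub>R\<^esub>" "degree P = degree h" "h = w \<otimes>\<^bsub>RX\<^esub> P"
      using monic_scale[OF h(1) hn] by blast
    have wc: "w \<in> carrier RX" using w RX_units[of w] by simp
    \<comment> \<open>The square of the unit \<open>w\<close> is absorbed in the cofactor. Counting
      only monic \<open>P\<close> saves a factor \<open>Q - 1\<close>.\<close>
    define v where "v = (w \<otimes>\<^bsub>RX\<^esub> w) \<otimes>\<^bsub>RX\<^esub> u"
    have v: "v \<in> carrier RX" unfolding v_def by (intro RX.m_closed wc u(1))
    have PP: "P \<otimes>\<^bsub>RX\<^esub> P \<in> carrier RX" "P \<otimes>\<^bsub>RX\<^esub> P \<noteq> []"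
      using RX.m_closed[OF P(1) P(1)] RX_mult_Nil[OF P(1) P(1)] P(2) by simp_all
    have fv: "f = (P \<otimes>\<^bsub>RX\<^esub> P) \<otimes>\<^bsub>RX\<^esub> v" unfolding u(2) v_def P'(3) using wc P(1) u(1) by (simp add: RX.m_ac)
    have vn: "v \<noteq> []" using fn fv RX_mult_Nil[OF PP(1) v] by simp
    have "degree f = degree P + degree P + degree v"
      using RX_degree_mult[OF PP(1) v PP(2) vn] RX_degree_mult[OF P(1) P(1) P(2) P(2)] fv by simp
    then have d: "d = 2 * degree P + degree v" using f(2) by simp
    have "degree P \<ge> 1" using h(1,3) hn RX_units[of h] P'(2) by simp
    then have J: "degree P \<in> ?J" using d by simp
    have "v \<in> ?T (d - 2 * degree P)" using v d vn by (cases v) simp_all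
    moreover have "P \<in> ?S (degree P)" using P P'(1) by (cases P) simp_all
    ultimately have "(P, v) \<in> ?S (degree P) \<times> ?T (d - 2 * degree P)" by (rule SigmaI[rotated])
    then have "f \<in> ?M (degree P)" by (rule image_eqI[rotated]) (simp add: fv)
    then show "f \<in> (\<Union>j\<in>?J. ?M j)" using J by (rule UN_I[rotated])
  qed
  have cM: "card (?M j) \<le> (Q - 1) * Q ^ (d - j)" if j: "j \<in> ?J" for j
  proof -
    have "card (?M j) \<le> card (?S j \<times> ?T (d - 2 * j))"
      by (intro card_image_le finite_cartesian_product finite_monic finT)
    also have "\<dots> \<le> Q ^ j * ((Q - 1) * Q ^ (d - 2 * j))"
      unfolding card_cartesian_product R.card_polys(1)[OF R_finite] by (intro mult_right_mono card_monic) simp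
    also have "\<dots> = (Q - 1) * (Q ^ j * Q ^ (d - 2 * j))" by simp
    also have "Q ^ j * Q ^ (d - 2 * j) = Q ^ (d - j)" using j by (simp flip: power_add)
    finally show ?thesis .
  qed
  have "card {f \<in> carrier RX. length f = Suc d \<and> \<not> square_free f} \<le> card (\<Union>j\<in>?J. ?M j)"
    by (intro card_mono[OF _ s] finite_UN_I finM) simp
  also have "\<dots> \<le> (\<Sum>j\<in>?J. card (?M j))" by (rule card_UN_le) simp
  also have "\<dots> \<le> (\<Sum>j\<in>?J. (Q - 1) * Q ^ (d - j))" using cM by (rule sum_mono)
  also have "\<dots> \<le> (\<Sum>j\<in>{1..d}. (Q - 1) * Q ^ (d - j))" by (rule sum_mono2) auto
  also have "\<dots> = (\<Sum>m<d. (Q - 1) * Q ^ m)"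
    by (rule sum.reindex_bij_witness[of _ "\<lambda>m. d - m" "\<lambda>j. d - j"]) auto
  also have "\<dots> \<le> Q ^ d"
  proof (induction d)
    case (Suc d)
    have "(Q - 1) * Q ^ d + Q ^ d = (Q - 1 + 1) * Q ^ d" by (simp only: distrib_right mult_1)
    also have "\<dots> = Q ^ Suc d" using Q_ge_2 by simp
    finally show ?case using Suc by simp
  qed simp
  finally show ?thesis .
qed

text \<open>Of the \<open>(Q - 1) Q^d\<close> polynomials of degree \<open>d\<close> at most
  \<open>Q^d\<close> are not squarefree. The additive form avoids subtraction of natural
  numbers.\<close>

lemma card_square_free_polys: "(Q - 1) * Q ^ d \<le> card (square_free_polys d) + Q ^ d"
proof -
  let ?N = "{f \<in> carrier RX. length f = Suc d \<and> \<not> square_free f}"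
  have "{p \<in> carrier RX. length p = Suc d} \<subseteq> square_free_polys d \<union> ?N"
    unfolding square_free_polys_def by blast
  then have "card {p \<in> carrier RX. length p = Suc d} \<le> card (square_free_polys d \<union> ?N)"
  proof (rule card_mono[rotated])
    have "finite ?N"
      by (rule finite_subset[OF _ R.card_polys(3)[OF R_finite, of "Suc d"]]) (simp add: subset_iff)
    then show "finite (square_free_polys d \<union> ?N)" using finite_square_free_polys by (rule finite_UnI[rotated])
  qed
  also have "\<dots> \<le> card (square_free_polys d) + card ?N" by (rule card_Un_le)
  finally have "card {p \<in> carrier RX. length p = Suc d} \<le> card (square_free_polys d) + card ?N" .
  then show ?thesis using card_square_multiples[of d] unfolding R.card_polys(1)[OF R_finite] by linarith
qed

text \<open>With four or more irreducible factors, the unit and everything from the fourth factor on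
  are merged into one nonconstant factor, to which \<open>four_factors_not_cyclic\<close>
  applies.\<close>

lemma cyclic_factors:
  assumes two: "\<one>\<^bsub>k\<^esub> \<oplus>\<^bsub>k\<^esub> \<one>\<^bsub>k\<^esub> \<noteq> \<zero>\<^bsub>k\<^esub>"
    and f: "square_free f" "length f = 2 * g + 3"
    and cyc: "cyclic_group (jacobian_points k (i ` carrier R) (map i f))"
    and u: "u \<in> Units RX" and Ps: "set Ps \<subseteq> monic_irreducibles" "f = u \<otimes>\<^bsub>RX\<^esub> poly_prod Ps"
  shows "length Ps < 4"
proof (rule ccontr)
  assume "\<not> length Ps < 4"
  then have "Suc (Suc (Suc (Suc 0))) \<le> length Ps" by simp
  then obtain A B D E Qs where e: "Ps = A # B # D # E # Qs" unfolding Suc_le_length_iff by blast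
  have m: "A \<in> monic_irreducibles" "B \<in> monic_irreducibles" "D \<in> monic_irreducibles" "E \<in> monic_irreducibles"
    "set (E # Qs) \<subseteq> monic_irreducibles"
    using Ps(1) unfolding e by (simp_all del: UN_iff)
  note c = irreduciblesD(1)[OF m(1)] irreduciblesD(1)[OF m(2)] irreduciblesD(1)[OF m(3)]
  have uc: "u \<in> carrier RX" "u \<noteq> []" using u RX_units[of u] by simp_all
  note pc = poly_prod_closed[OF m(5)] and pd = poly_prod_degree[OF m(5)]
  note ec = RX.m_closed[OF uc(1) pc]
  have fe: "f = A \<otimes>\<^bsub>RX\<^esub> (B \<otimes>\<^bsub>RX\<^esub> (D \<otimes>\<^bsub>RX\<^esub> (u \<otimes>\<^bsub>RX\<^esub> poly_prod (E # Qs))))"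
    unfolding Ps(2) e poly_prod_simps(2)[of A] poly_prod_simps(2)[of B] poly_prod_simps(2)[of D] using c uc(1) pc by (simp add: RX.m_ac)
  have "degree (u \<otimes>\<^bsub>RX\<^esub> poly_prod (E # Qs)) > 0"
    using RX_degree_mult[OF uc(1) pc uc(2)] pd irreduciblesD(5)[OF m(4)] by simp
  moreover have "degree A > 0" "degree B > 0" "degree D > 0"
    using irreduciblesD(5)[OF m(1)] irreduciblesD(5)[OF m(2)] irreduciblesD(5)[OF m(3)] by linarith+
  ultimately have "\<not> cyclic_group (jacobian_points k (i ` carrier R) (map i f))"
    by (intro four_factors_not_cyclic[OF two f c ec fe])
  then show False using cyc by contradiction
qed

lemma card_cyclic:
  assumes two: "\<one>\<^bsub>k\<^esub> \<oplus>\<^bsub>k\<^esub> \<one>\<^bsub>k\<^esub> \<noteq> \<zero>\<^bsub>k\<^esub>"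
  shows "card {f \<in> square_free_polys (2 * g + 2). cyclic_group (jacobian_points k (i ` carrier R) (map i f))}
    \<le> (Q - 1) * (\<Sum>r<4. card (products r (2 * g + 2)))" (is "card ?cyc \<le> _")
proof -
  let ?d = "2 * g + 2"
  let ?M = "\<lambda>r. (\<lambda>(u, h). u \<otimes>\<^bsub>RX\<^esub> h) ` (Units RX \<times> products r ?d)"
  have finM: "finite (?M r)" for r by (intro finite_imageI finite_cartesian_product finite_units finite_products)
  have s: "?cyc \<subseteq> (\<Union>r<4. ?M r)"
  proof
    fix f assume "f \<in> ?cyc"
    then have f: "square_free f" "length f = 2 * g + 3" "cyclic_group (jacobian_points k (i ` carrier R) (map i f))"
      by (simp_all add: square_free_polys_def)
    have fc: "f \<in> carrier RX" "f \<noteq> []" using f(1) by (simp_all add: square_free_def)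
    obtain u Ps where u: "u \<in> Units RX" and Ps: "set Ps \<subseteq> monic_irreducibles" "f = u \<otimes>\<^bsub>RX\<^esub> poly_prod Ps"
      using irreducible_factorization[OF fc] by blast
    have r: "length Ps \<in> {..<4}" using cyclic_factors[OF two f u Ps] by simp
    have uc: "u \<in> carrier RX" "u \<noteq> []" "degree u = 0" using u RX_units[of u] by simp_all
    have "degree f = (\<Sum>P\<leftarrow>Ps. degree P)"
      using RX_degree_mult[OF uc(1) poly_prod_closed[OF Ps(1)] uc(2)] poly_prod_degree[OF Ps(1)] uc(3) Ps(2) by simp
    then have "poly_prod Ps \<in> products (length Ps) ?d" using poly_prod_products[OF Ps(1)] f(2) by simp
    with u have "(u, poly_prod Ps) \<in> Units RX \<times> products (length Ps) ?d" by (rule SigmaI)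
    then have "f \<in> ?M (length Ps)" by (rule image_eqI[rotated]) (simp add: Ps(2))
    then show "f \<in> (\<Union>r<4. ?M r)" using r by (rule UN_I[rotated])
  qed
  have "card ?cyc \<le> card (\<Union>r<4. ?M r)" by (intro card_mono[OF _ s] finite_UN_I finM) simp
  also have "\<dots> \<le> (\<Sum>r<4. card (?M r))" by (rule card_UN_le) simp
  also have "\<dots> \<le> (\<Sum>r<4. (Q - 1) * card (products r ?d))"
  proof (rule sum_mono)
    fix r :: nat
    have "card (?M r) \<le> card (Units RX \<times> products r ?d)"
      by (intro card_image_le finite_cartesian_product finite_units finite_products)
    also have "\<dots> \<le> (Q - 1) * card (products r ?d)"
      unfolding card_cartesian_product by (intro mult_right_mono card_units) simp
    finally show "card (?M r) \<le> (Q - 1) * card (products r ?d)" .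
  qed
  finally show ?thesis by (simp only: sum_distrib_left)
qed

text \<open>The ratio compares \<open>(q - 1) q^d\<close> times a proportion with at least
  \<open>(q - 2) q^d\<close> squarefree polynomials. The factor \<open>2\<close> is a bound for
  \<open>(q - 1)/(q - 2)\<close> when \<open>q \<ge> 3\<close>.\<close>

theorem cyclic_ratio:
  assumes two: "\<one>\<^bsub>k\<^esub> \<oplus>\<^bsub>k\<^esub> \<one>\<^bsub>k\<^esub> \<noteq> \<zero>\<^bsub>k\<^esub>" and Q: "Q \<ge> 3"
  shows "square_free_polys (2 * g + 2) \<noteq> {}"
    and "real (card {f \<in> square_free_polys (2 * g + 2). cyclic_group (jacobian_points k (i ` carrier R) (map i f))})
      / real (card (square_free_polys (2 * g + 2))) \<le> 2 * (\<Sum>r<4. product_bound r (2 * g + 2))"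
proof -
  let ?d = "2 * g + 2"
  let ?SF = "card (square_free_polys ?d)"
  let ?cyc = "card {f \<in> square_free_polys ?d. cyclic_group (jacobian_points k (i ` carrier R) (map i f))}"
  define q where "q = real Q"
  define b where "b = (\<Sum>r<4. product_bound r ?d)"
  have q: "q \<ge> 3" using Q by (simp add: q_def)
  have q1: "real (Q - 1) = q - 1" using Q by (simp add: q_def)
  have b: "b \<ge> 0" unfolding b_def by (intro sum_nonneg product_bound_nonneg)
  have "real ((Q - 1) * Q ^ ?d) \<le> real (?SF + Q ^ ?d)" using card_square_free_polys[of ?d] by (rule of_nat_mono)
  then have "(q - 1) * q ^ ?d \<le> real ?SF + q ^ ?d" unfolding of_nat_mult of_nat_add of_nat_power q1 q_def[symmetric] .
  then have SF: "(q - 2) * q ^ ?d \<le> real ?SF" by (simp add: left_diff_distrib)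
  have "(q - 2) * q ^ ?d > 0" using q by simp
  then have pos: "real ?SF > 0" using SF by linarith
  then have "?SF \<noteq> 0" by simp
  then show "square_free_polys ?d \<noteq> {}" using card.empty by metis
  have "real ?cyc \<le> real ((Q - 1) * (\<Sum>r<4. card (products r ?d)))" using card_cyclic[OF two] by (rule of_nat_mono)
  also have "\<dots> = (q - 1) * (\<Sum>r<4. real (card (products r ?d)))" unfolding of_nat_mult of_nat_sum q1 ..
  also have "\<dots> \<le> (q - 1) * (\<Sum>r<4. product_bound r ?d * q ^ ?d)"
    unfolding q_def[symmetric] using q card_products[of _ ?d, folded q_def] by (intro mult_left_mono sum_mono) simp_all
  also have "\<dots> = (q - 1) * (b * q ^ ?d)" unfolding b_def sum_distrib_right ..
  also have "\<dots> \<le> (2 * (q - 2)) * (b * q ^ ?d)" using q b by (intro mult_right_mono mult_nonneg_nonneg) simp_all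
  also have "\<dots> = 2 * b * ((q - 2) * q ^ ?d)" by simp
  also have "\<dots> \<le> 2 * b * real ?SF" using SF b by (intro mult_left_mono) simp_all
  finally have "real ?cyc \<le> 2 * b * real ?SF" .
  then show "real ?cyc / real ?SF \<le> 2 * (\<Sum>r<4. product_bound r ?d)"
    using pos by (simp only: pos_divide_le_eq b_def)
qed

end

section \<open>Odd prime fields and the limit\<close>

lemma prime_field_closure:
  assumes p: "normalization_semidom_class.prime p" "p > 2"
  shows "finite_field_closure (prime_field p) (field.alg_closure (prime_field p)) (ring.indexed_const (prime_field p))"
    and "card (carrier (prime_field p)) = p"
    and "\<one>\<^bsub>field.alg_closure (prime_field p)\<^esub> \<oplus>\<^bsub>field.alg_closure (prime_field p)\<^esub> \<one>\<^bsub>field.alg_closure (prime_field p)\<^esub>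
      \<noteq> \<zero>\<^bsub>field.alg_closure (prime_field p)\<^esub>"
proof -
  let ?R = "prime_field p" and ?k = "field.alg_closure (prime_field p)"
  interpret r: residues_prime p ?R using p(1) by unfold_locales simp_all
  interpret a: algebraic_closure ?k "ring.indexed_const ?R ` carrier ?R" by (rule r.alg_closureE(1))
  show c: "finite_field_closure ?R ?k (ring.indexed_const ?R)"
    by (intro finite_field_closure.intro finite_field_closure_axioms.intro r.field_axioms a.algebraically_closed_axioms r.alg_closureE(2) r.finite)
  interpret c: finite_field_closure ?R ?k "ring.indexed_const ?R" by (rule c)
  show "card (carrier ?R) = p" using p(2) by (simp add: r.res_carrier_eq)
  have 1: "\<one>\<^bsub>?R\<^esub> \<in> carrier ?R" by (rule r.one_closed)
  \<comment> \<open>The embedding is injective, so it is enough that \<open>1 + 1\<close> is nonzero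
    modulo \<open>p\<close>, which is the condition \<open>p > 2\<close>.\<close>
  have "ring.indexed_const ?R (\<one>\<^bsub>?R\<^esub> \<oplus>\<^bsub>?R\<^esub> \<one>\<^bsub>?R\<^esub>) = \<one>\<^bsub>?k\<^esub> \<oplus>\<^bsub>?k\<^esub> \<one>\<^bsub>?k\<^esub>"
    using ring_hom_add[OF r.alg_closureE(2) 1 1] ring_hom_one[OF r.alg_closureE(2)] by simp
  moreover have "\<one>\<^bsub>?R\<^esub> \<oplus>\<^bsub>?R\<^esub> \<one>\<^bsub>?R\<^esub> \<noteq> \<zero>\<^bsub>?R\<^esub>"
    using p(2) unfolding r.res_add_eq r.res_one_eq r.res_zero_eq by simp
  ultimately show "\<one>\<^bsub>?k\<^esub> \<oplus>\<^bsub>?k\<^esub> \<one>\<^bsub>?k\<^esub> \<noteq> \<zero>\<^bsub>?k\<^esub>"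
    using c.i_zero[OF r.add.m_closed[OF 1 1]] by simp
qed

lemma cyclic_probability_bound:
  assumes p: "normalization_semidom_class.prime p" "p > 2"
  shows "cyclic_probability p g \<le> 2 * (\<Sum>r<4. product_bound r (2 * g + 2))"
proof -
  interpret c: finite_field_closure "prime_field p" "field.alg_closure (prime_field p)" "ring.indexed_const (prime_field p)"
    by (rule prime_field_closure(1)[OF p])
  \<comment> \<open>For a nonzero coefficient list the length is one more than the degree.\<close>
  have e: "squarefree_polys p (2 * g + 2) = c.square_free_polys (2 * g + 2)"
    unfolding squarefree_polys_def c.square_free_polys_def c.square_free_def univ_poly_zero
    by (intro Collect_cong) (auto simp: Suc_diff_Suc)
  have Q: "card (carrier (prime_field p)) \<ge> 3" using prime_field_closure(2)[OF p] p(2) by simp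
  note r = c.cyclic_ratio[OF prime_field_closure(3)[OF p] Q, of g]
  have "c.square_free_polys (2 * g + 2) \<inter> {f. cyclic_group (jacobian_Fp p f)} =
    {f \<in> c.square_free_polys (2 * g + 2). cyclic_group (jacobian_points (field.alg_closure (prime_field p))
      (ring.indexed_const (prime_field p) ` carrier (prime_field p)) (map (ring.indexed_const (prime_field p)) f))}"
    unfolding jacobian_Fp_def by (simp only: Int_def mem_Collect_eq)
  then show ?thesis
    using r(2) unfolding cyclic_probability_def e measure_pmf_of_set[OF r(1) c.finite_square_free_polys] by (simp only:)
qed

theorem theorem1p13:
  shows "((\<lambda>(p, g). cyclic_probability p g) \<longlongrightarrow> 0)
    (inf at_top (principal {p :: nat. normalization_semidom_class.prime p \<and> p > 2}) \<times>\<^sub>F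
     inf at_top (principal {g :: nat. g \<ge> 1}))" (is "(_ \<longlongrightarrow> _) (?P \<times>\<^sub>F ?G)")
proof (rule tendsto_sandwich)
  \<comment> \<open>A function of \<open>g\<close> alone, so its limit along the product filter is
    the limit in the second coordinate.\<close>
  let ?b = "\<lambda>g::nat. 2 * (\<Sum>r<4. product_bound r (2 * g + 2))"
  show "\<forall>\<^sub>F x in ?P \<times>\<^sub>F ?G. 0 \<le> (case x of (p, g) \<Rightarrow> cyclic_probability p g)"
    by (rule always_eventually) (simp add: cyclic_probability_def split: prod.split)
  have "eventually (\<lambda>p. normalization_semidom_class.prime p \<and> p > 2) ?P"
    unfolding eventually_inf_principal by (rule always_eventually) simp
  then have "\<forall>\<^sub>F x in ?P \<times>\<^sub>F ?G. normalization_semidom_class.prime (fst x) \<and> fst x > 2"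
    by (rule eventually_compose_filterlim[OF _ filterlim_fst])
  then show "\<forall>\<^sub>F x in ?P \<times>\<^sub>F ?G. (case x of (p, g) \<Rightarrow> cyclic_probability p g) \<le> ?b (snd x)"
  proof eventually_elim
    case (elim x)
    then show ?case using cyclic_probability_bound[of "fst x" "snd x"] unfolding case_prod_beta by blast
  qed
  show "((\<lambda>x. 0) \<longlongrightarrow> (0::real)) (?P \<times>\<^sub>F ?G)" by (rule tendsto_const)
  have "strict_mono (\<lambda>g::nat. 2 * g + 2)" by (rule strict_monoI) simp
  then have "(\<lambda>g. product_bound r (2 * g + 2)) \<longlonglongrightarrow> 0" for r
    using LIMSEQ_subseq_LIMSEQ[OF product_bound_tendsto[of r]] by (simp add: comp_def)
  then have "?b \<longlonglongrightarrow> 2 * (\<Sum>r<4::nat. 0)" by (intro tendsto_mult tendsto_const tendsto_sum)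
  then have "(?b \<longlongrightarrow> 0) ?G" by (intro tendsto_mono[OF inf_le1]) simp
  then show "((\<lambda>x. ?b (snd x)) \<longlongrightarrow> 0) (?P \<times>\<^sub>F ?G)"
    by (rule filterlim_compose[OF _ filterlim_snd])
qed

end
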